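(* For an unoriented link diagram $L$ with $n\ge1$ components, let $$\Psi[Q](L) = i^{wr(L)}\left(\frac{z}{w}\right)^{n-1}\sum_{k=1}^n \gamma^{k-1}\,\widehat{E}_k \sum_{\pi} i^{-wr(\pi L)}\,Q(\pi L),$$ where $i^2=-1$, the second summation is over all partitions $\pi$ of the set of components of $L$ into $k$ (unordered, non-empty) subsets, $Q(\pi L)$ denotes the product of the polynomials $Q$ of the $k$ sublinks of $L$ defined by $\pi$, $wr(L)$ is the writhe of $L$ for some choice of orientation of $L$, $wr(\pi L)$ is the sum of the writhes of the parts of the partitioned link $\pi L$ (with the same orientation), $\gamma=\frac{a+a^{-1}}{w}-1$, $\widehat{E}=\frac{z}{w}E$, $\widehat{E}_1=1$ and $\widehat{E}_k=(\widehat{E}^{-1}-1)(\widehat{E}^{-1}-2)\cdots(\widehat{E}^{-1}-k+1)$. Then $\Psi[Q]$ is a well-defined regular isotopy invariant of unoriented links, and $\Psi[Q]$ coincides with $K[Q]$.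
   Context: $z,w,a,E$ are indeterminates. Regular isotopy is the equivalence relation on planar link diagrams generated by planar isotopy and Reidemeister moves II and III; a regular isotopy invariant is a function on diagrams constant on regular isotopy classes. The writhe of an oriented diagram is the sum of the signs of all its crossings. For a crossing, swinging the overcrossing arc counterclockwise sweeps two of the four local regions; joining these two regions is the $A$-smoothing, joining the other two is the $B$-smoothing. A crossing (drawn in the plane as an X) is of positive type if its $A$-smoothing is horizontal (one arc on top and one arc at the bottom) and of negative type if its $A$-smoothing is vertical. An unoriented Conway quadruple $L_+,L_-,L_0,L_\infty$ consists of four unoriented diagrams identical except near one specified crossing, which is of positive type in $L_+$, switched in $L_-$, and replaced in $L_0$ and $L_\infty$ by, respectively, the $A$-smoothing (horizontal) and the $B$-smoothing (vertical) of the crossing of $L_+$. A union of $r$ unlinked knots $\mathcal{K}^r=\sqcup_{i=1}^r K_i$ is an $r$-component link diagram representing a split link whose $r$ split components are (possibly non-trivial) knots $K_1,\dots,K_r$. $Q=Q(w,a)$, the (known) regular isotopy version of the Kauffman polynomial, is the regular isotopy invariant of unoriented links determined by: $Q(L_+)+Q(L_-)=w\,(Q(L_0)+Q(L_\infty))$ for every unoriented Conway quadruple (any crossing); $Q(\text{diagram with a positive curl})=a\,Q(\text{diagram without the curl})$ and $Q(\text{diagram with a negative curl})=a^{-1}Q(\text{diagram without the curl})$ (a curl is a Reidemeister I kink, its sign being the sign of its crossing for either orientation of the strand); $Q=1$ on the standard crossingless unknot diagram. It follows that $Q(\mathcal{K}^r)=\gamma^{r-1}\prod_{i=1}^r Q(K_i)$.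 $K[Q]$ is the unique regular isotopy invariant of unoriented links, with values in Laurent polynomials in $z,w,a,E$, such that: (1) $K[Q](L_+)+K[Q](L_-)=z\,\big(K[Q](L_0)+K[Q](L_\infty)\big)$ for every unoriented Conway quadruple whose specified crossing involves two different components; (2) $K[Q](\mathcal{K}^r)=E^{1-r}Q(\mathcal{K}^r)$ for every union $\mathcal{K}^r$ of $r\geq1$ unlinked knots. *)

theory Defs
  imports Complex_Main "HOL-Library.Poly_Mapping" "HOL-Library.Product_Plus"
    "HOL-Library.Disjoint_Sets"
begin

section \<open>Laurent polynomials in z, w, a, E\<close>

text \<open>The group ring of the free abelian group on four generators; the exponents are listed
  in the order z, w, a, E. The coefficients are complex because the state sum below uses powers
  of the imaginary unit.\<close>

type_synonym laurent = "(int \<times> int \<times> int \<times> int) \<Rightarrow>\<^sub>0 complex"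

definition const :: "complex \<Rightarrow> laurent" where
  "const c = Poly_Mapping.single 0 c"

definition z_pow :: "int \<Rightarrow> laurent" where
  "z_pow n = Poly_Mapping.single (n, 0, 0, 0) 1"

definition w_pow :: "int \<Rightarrow> laurent" where
  "w_pow n = Poly_Mapping.single (0, n, 0, 0) 1"

definition a_pow :: "int \<Rightarrow> laurent" where
  "a_pow n = Poly_Mapping.single (0, 0, n, 0) 1"

definition E_pow :: "int \<Rightarrow> laurent" where
  "E_pow n = Poly_Mapping.single (0, 0, 0, n) 1"

definition gamma :: laurent where
  "gamma = (a_pow 1 + a_pow (-1)) * w_pow (-1) - 1"

text \<open>The inverse of \<open>(z/w) E\<close>.\<close>

definition Ehat_inv :: laurent where
  "Ehat_inv = w_pow 1 * z_pow (-1) * E_pow (-1)"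

definition Ehat :: "nat \<Rightarrow> laurent" where
  "Ehat k = (\<Prod>j = 1..<k. Ehat_inv - of_nat j)"


section \<open>Planar link diagrams\<close>

text \<open>A planar link diagram in general position with respect to the height function is cut by
  horizontal lines into slices, each containing exactly one local minimum (\<open>Cup\<close>), local
  maximum (\<open>Cap\<close>) or crossing, next to vertical strands. A diagram is the list of its slices
  read from bottom to top; \<open>(g, i)\<close> is the slice with \<open>i\<close> vertical strands to the left of
  \<open>g\<close>. Every planar diagram is planar isotopic to one of this form.

  At a crossing \<open>Pos\<close> the overcrossing arc runs from bottom right to top left. Turning it
  counterclockwise sweeps the left and the right region, so its A-smoothing is the horizontal
  one: the crossing is of positive type. \<open>Neg\<close> is the switched crossing.\<close>

datatype piece = Cup | Cap | Pos | Neg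

type_synonym diagram = "(piece \<times> nat) list"

fun n_in :: "piece \<Rightarrow> nat" where
  "n_in Cup = 0"
| "n_in Cap = 2"
| "n_in Pos = 2"
| "n_in Neg = 2"

fun n_out :: "piece \<Rightarrow> nat" where
  "n_out Cup = 2"
| "n_out Cap = 0"
| "n_out Pos = 2"
| "n_out Neg = 2"

text \<open>Number of strands at the top of a stack of slices that starts with no strands.\<close>

definition width :: "diagram \<Rightarrow> nat" where
  "width L = fold (\<lambda>(g, i) m. m - n_in g + n_out g) L 0"

text \<open>The empty diagram is excluded, so a link diagram has at least one component.\<close>

definition link_diagram :: "diagram \<Rightarrow> bool" where
  "link_diagram L \<longleftrightarrow> L \<noteq> [] \<and> width L = 0 \<and>
     (\<forall>h < length L. case L ! h of (g, i) \<Rightarrow> i + n_in g \<le> width (take h L))"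


subsection \<open>Components\<close>

text \<open>The strands are cut at the levels \<open>0, \<dots>, length L\<close>; the point \<open>(h, p)\<close> is the
  \<open>p\<close>-th strand from the left (counted from 0) at level \<open>h\<close>, just below the slice
  \<open>L ! h\<close>.\<close>

type_synonym point = "nat \<times> nat"

definition points :: "diagram \<Rightarrow> point set" where
  "points L = {(h, p). h \<le> length L \<and> p < width (take h L)}"

text \<open>\<open>ascends (g, i) p q\<close>: a strand leads through the slice monotonically from position
  \<open>p\<close> below to position \<open>q\<close> above.\<close>

fun ascends :: "piece \<times> nat \<Rightarrow> nat \<Rightarrow> nat \<Rightarrow> bool" where
  "ascends (g, i) p q \<longleftrightarrow>
     p < i \<and> q = p \<or>
     i + n_in g \<le> p \<and> q = p - n_in g + n_out g \<or>
     g \<in> {Pos, Neg} \<and> (p = i \<and> q = i + 1 \<or> p = i + 1 \<and> q = i)"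

definition through :: "diagram \<Rightarrow> (point \<times> point) set" where
  "through L = {((h, p), (Suc h, q)) | h p q.
     h < length L \<and> p < width (take h L) \<and> ascends (L ! h) p q}"

text \<open>The two points adjacent to the extremum or the crossing of a slice: its end points for an
  extremum, the two strands entering it from below for a crossing.\<close>

definition site_left :: "diagram \<Rightarrow> nat \<Rightarrow> point" where
  "site_left L h = (case L ! h of (g, i) \<Rightarrow> (if g = Cup then Suc h else h, i))"

definition site_right :: "diagram \<Rightarrow> nat \<Rightarrow> point" where
  "site_right L h = (case L ! h of (g, i) \<Rightarrow> (if g = Cup then Suc h else h, i + 1))"

definition turns :: "diagram \<Rightarrow> (point \<times> point) set" where
  "turns L = {(site_left L h, site_right L h) | h.
     h < length L \<and> fst (L ! h) \<in> {Cup, Cap}}"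

definition connected_points :: "diagram \<Rightarrow> (point \<times> point) set" where
  "connected_points L =
     (through L \<union> turns L \<union> (through L \<union> turns L)\<inverse>)\<^sup>* \<inter> points L \<times> points L"

definition components :: "diagram \<Rightarrow> point set set" where
  "components L = points L // connected_points L"

definition n_components :: "diagram \<Rightarrow> nat" where
  "n_components L = card (components L)"

definition knot_diagram :: "diagram \<Rightarrow> bool" where
  "knot_diagram L \<longleftrightarrow> link_diagram L \<and> n_components L = 1"

text \<open>The sublink diagram formed by the strands in \<open>S\<close>, a union of components. The other
  strands are erased, and a slice survives if both strands at its site do.\<close>

definition restrict_slice :: "diagram \<Rightarrow> point set \<Rightarrow> nat \<Rightarrow> diagram" where
  "restrict_slice L S h = (case L ! h of (g, i) \<Rightarrow>
     if site_left L h \<in> S \<and> site_right L h \<in> S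
     then [(g, card {p. p < i \<and> (h, p) \<in> S})] else [])"

definition sublink :: "diagram \<Rightarrow> point set \<Rightarrow> diagram" where
  "sublink L S = concat (map (restrict_slice L S) [0..<length L])"


subsection \<open>Orientations and writhe\<close>

text \<open>An orientation tells for every point whether the strand is directed upwards there.
  Values outside \<open>points L\<close> are irrelevant.\<close>

definition orientation :: "diagram \<Rightarrow> (point \<Rightarrow> bool) \<Rightarrow> bool" where
  "orientation L up \<longleftrightarrow>
     (\<forall>(x, y) \<in> through L. up x = up y) \<and> (\<forall>(x, y) \<in> turns L. up x \<noteq> up y)"

text \<open>With both strands directed upwards, \<open>Neg\<close> (overcrossing arc from bottom left to top
  right) is the positive crossing; reversing one of the strands changes the sign.\<close>

definition crossing_sign :: "diagram \<Rightarrow> (point \<Rightarrow> bool) \<Rightarrow> nat \<Rightarrow> int" where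
  "crossing_sign L up h =
     (let parallel = (up (site_left L h) = up (site_right L h)) in
      case fst (L ! h) of
        Pos \<Rightarrow> if parallel then -1 else 1
      | Neg \<Rightarrow> if parallel then 1 else -1
      | _ \<Rightarrow> 0)"

text \<open>The writhe of the sublink formed by the strands in \<open>S\<close>: the crossings of the sublink are
  the crossings of \<open>L\<close> between two strands in \<open>S\<close>.\<close>

definition sub_writhe :: "diagram \<Rightarrow> (point \<Rightarrow> bool) \<Rightarrow> point set \<Rightarrow> int" where
  "sub_writhe L up S = (\<Sum>h < length L.
     if site_left L h \<in> S \<and> site_right L h \<in> S then crossing_sign L up h else 0)"

definition writhe :: "diagram \<Rightarrow> (point \<Rightarrow> bool) \<Rightarrow> int" where
  "writhe L up = (\<Sum>h < length L. crossing_sign L up h)"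


section \<open>Regular isotopy\<close>

text \<open>Planar isotopy of sliced diagrams is generated by exchanging the heights of two distant
  slices, cancelling a minimum against an adjacent maximum, and moving an extremum of one strand
  through a crossing with another strand. In the last case the crossing gets turned by a quarter,
  which interchanges \<open>Pos\<close> and \<open>Neg\<close>.\<close>

inductive planar_move :: "diagram \<Rightarrow> diagram \<Rightarrow> bool" where
  exchange: "planar_move [(g, i), (g', i + n_out g + d)] [(g', i + n_in g + d), (g, i)]"
| zigzag_left: "planar_move [(Cup, i), (Cap, i + 1)] []"
| zigzag_right: "planar_move [(Cup, i + 1), (Cap, i)] []"
| cup_over: "planar_move [(Cup, i), (Neg, i + 1)] [(Cup, i + 1), (Pos, i)]"
| cup_under: "planar_move [(Cup, i), (Pos, i + 1)] [(Cup, i + 1), (Neg, i)]"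
| cap_over: "planar_move [(Pos, i + 1), (Cap, i)] [(Neg, i), (Cap, i + 1)]"
| cap_under: "planar_move [(Neg, i + 1), (Cap, i)] [(Pos, i), (Cap, i + 1)]"

inductive reidemeister2 :: "diagram \<Rightarrow> diagram \<Rightarrow> bool" where
  "reidemeister2 [(Pos, i), (Neg, i)] []"
| "reidemeister2 [(Neg, i), (Pos, i)] []"

text \<open>\<open>x\<close>, \<open>y\<close>, \<open>z\<close> are the crossings of the first and second, first and third, second
  and third of the three strands. The side condition says that one strand lies above and
  another one below the other two, i.e. that the over-under relation is not cyclic.\<close>

inductive reidemeister3 :: "diagram \<Rightarrow> diagram \<Rightarrow> bool" where
  "\<lbrakk>x \<in> {Pos, Neg}; y \<in> {Pos, Neg}; z \<in> {Pos, Neg}; y = x \<or> y = z\<rbrakk> \<Longrightarrow>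
   reidemeister3 [(x, i), (y, i + 1), (z, i)] [(z, i + 1), (y, i), (x, i + 1)]"

text \<open>\<open>curl s l\<close>: the slices \<open>l\<close> form a curl of sign \<open>s\<close> on the strand at position
  \<open>i\<close>. The curl lies to the right or to the left of the strand; the strand passes the crossing
  twice in the same vertical direction. Up to planar isotopy every curl has one of these forms.\<close>

inductive curl :: "int \<Rightarrow> diagram \<Rightarrow> bool" where
  "curl 1 [(Cup, i + 1), (Neg, i), (Cap, i + 1)]"
| "curl 1 [(Cup, i), (Neg, i + 1), (Cap, i)]"
| "curl (-1) [(Cup, i + 1), (Pos, i), (Cap, i + 1)]"
| "curl (-1) [(Cup, i), (Pos, i + 1), (Cap, i)]"

definition local_move :: "(diagram \<Rightarrow> diagram \<Rightarrow> bool) \<Rightarrow> diagram \<Rightarrow> diagram \<Rightarrow> bool" where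
  "local_move M L L' \<longleftrightarrow> link_diagram L \<and> link_diagram L' \<and>
     (\<exists>u v l l'. M l l' \<and> L = u @ l @ v \<and> L' = u @ l' @ v)"

definition regular_isotopic :: "diagram \<Rightarrow> diagram \<Rightarrow> bool" where
  "regular_isotopic = equivclp (local_move (\<lambda>l l'.
     planar_move l l' \<or> reidemeister2 l l' \<or> reidemeister3 l l'))"

definition regular_isotopy_invariant :: "(diagram \<Rightarrow> 'r) \<Rightarrow> bool" where
  "regular_isotopy_invariant F \<longleftrightarrow> (\<forall>L L'. regular_isotopic L L' \<longrightarrow> F L = F L')"

text \<open>Two diagrams represent the same link in space iff they are related by all three
  Reidemeister moves.\<close>

definition same_link :: "diagram \<Rightarrow> diagram \<Rightarrow> bool" where
  "same_link = equivclp (local_move (\<lambda>l l'.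
     planar_move l l' \<or> reidemeister2 l l' \<or> reidemeister3 l l' \<or>
     (\<exists>s. curl s l) \<and> l' = []))"

text \<open>\<open>concat Ks\<close> is the disjoint union of the diagrams \<open>Ks\<close>, placed above each other.\<close>

definition union_of_unlinked_knots :: "nat \<Rightarrow> diagram \<Rightarrow> bool" where
  "union_of_unlinked_knots r L \<longleftrightarrow> r \<ge> 1 \<and> link_diagram L \<and> n_components L = r \<and>
     (\<exists>Ks. length Ks = r \<and> (\<forall>K \<in> set Ks. knot_diagram K) \<and> same_link L (concat Ks))"


section \<open>Skein invariants\<close>

text \<open>\<open>h\<close> is the slice of the specified crossing.\<close>

definition conway_quadruple ::
  "nat \<Rightarrow> diagram \<Rightarrow> diagram \<Rightarrow> diagram \<Rightarrow> diagram \<Rightarrow> bool" where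
  "conway_quadruple h Lp Lm L0 Linf \<longleftrightarrow> link_diagram Lp \<and>
     (\<exists>u i v. length u = h \<and>
        Lp = u @ [(Pos, i)] @ v \<and>
        Lm = u @ [(Neg, i)] @ v \<and>
        L0 = u @ [(Cap, i), (Cup, i)] @ v \<and>
        Linf = u @ v)"

definition mixed_crossing :: "diagram \<Rightarrow> nat \<Rightarrow> bool" where
  "mixed_crossing L h \<longleftrightarrow> (site_left L h, site_right L h) \<notin> connected_points L"

text \<open>\<open>Q\<close> satisfies the axioms of the regular isotopy version of the Kauffman polynomial. That
  only w and a occur in its values need not be required, as the axioms determine \<open>Q\<close> on link
  diagrams.\<close>

definition kauffman_polynomial :: "(diagram \<Rightarrow> laurent) \<Rightarrow> bool" where
  "kauffman_polynomial Q \<longleftrightarrow>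
     regular_isotopy_invariant Q \<and>
     (\<forall>h Lp Lm L0 Linf. conway_quadruple h Lp Lm L0 Linf \<longrightarrow>
        Q Lp + Q Lm = w_pow 1 * (Q L0 + Q Linf)) \<and>
     (\<forall>s u l v. curl s l \<and> link_diagram (u @ l @ v) \<longrightarrow>
        Q (u @ l @ v) = a_pow s * Q (u @ v)) \<and>
     Q [(Cup, 0), (Cap, 0)] = 1"

text \<open>\<open>F\<close> has the two properties that characterize the invariant \<open>K[Q]\<close>.\<close>

definition is_K :: "(diagram \<Rightarrow> laurent) \<Rightarrow> (diagram \<Rightarrow> laurent) \<Rightarrow> bool" where
  "is_K Q F \<longleftrightarrow>
     regular_isotopy_invariant F \<and>
     (\<forall>h Lp Lm L0 Linf. conway_quadruple h Lp Lm L0 Linf \<and> mixed_crossing Lp h \<longrightarrow>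
        F Lp + F Lm = z_pow 1 * (F L0 + F Linf)) \<and>
     (\<forall>r L. union_of_unlinked_knots r L \<longrightarrow> F L = E_pow (1 - int r) * Q L)"

text \<open>A part \<open>S\<close> of a partition is a set of components, and the set of strands of the
  corresponding sublink is \<open>\<Union>S\<close>.\<close>

definition Psi_oriented :: "(diagram \<Rightarrow> laurent) \<Rightarrow> diagram \<Rightarrow> (point \<Rightarrow> bool) \<Rightarrow> laurent" where
  "Psi_oriented Q L up =
     const (\<i> powi writhe L up) * (z_pow 1 * w_pow (-1)) ^ (n_components L - 1) *
     (\<Sum>k = 1..n_components L. gamma ^ (k - 1) * Ehat k *
        (\<Sum>\<pi> | partition_on (components L) \<pi> \<and> card \<pi> = k.
           const (\<i> powi (- (\<Sum>S \<in> \<pi>. sub_writhe L up (\<Union>S)))) *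
           (\<Prod>S \<in> \<pi>. Q (sublink L (\<Union>S)))))"

definition Psi :: "(diagram \<Rightarrow> laurent) \<Rightarrow> diagram \<Rightarrow> laurent" where
  "Psi Q L = Psi_oriented Q L (SOME up. orientation L up)"

end

theory Submission
  imports Defs "HOL-Combinatorics.Multiset_Permutations" "HOL-Combinatorics.Stirling"
begin

text \<open>Up to the factor \<open>k!\<close>, the inner sum of \<open>\<Psi>[Q]\<close> runs over the colourings of the components by
  exactly \<open>k\<close> colours. A colouring contributes the product of the values of \<open>Q\<close> on the
  monochromatic sublinks and a phase, namely the power of \<open>\<i>\<close> whose exponent is the sum of the signs
  of the crossings of different colours. This exponent changes by a multiple of 4 when a component is
  reversed, because two classes of components cross an even number of times.

  Colourings and orientations are labelings of the strands, and every move induces a bijection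
  between the labelings before and after it that preserves phases and moves the sublinks
  accordingly; hence \<open>\<Psi>[Q]\<close> is a regular isotopy invariant. In the skein relation at a
  crossing of two components, the colourings that distinguish its strands cancel, since
  switching the crossing negates their phases. The other ones are the colourings of both
  smoothings, and they satisfy the skein relation of \<open>Q\<close>; as the smoothings have one component
  less, the coefficient \<open>w\<close> becomes \<open>z\<close>. For a union of \<open>r\<close> knots all phases are 1 and \<open>Q\<close> is
  multiplicative up to powers of \<open>\<gamma>\<close>, so that the value of \<open>\<Psi>[Q]\<close> comes down to the
  expansion of a power in falling factorials, whose coefficients are Stirling numbers.

  For uniqueness, order the components and switch the crossings of different components until
  every component lies above the later ones. The strands of such a diagram can be sorted, which
  shows that it is a union of unlinked knots. By the skein relation, each switch changes the value
  of an invariant by values on diagrams with fewer components.\<close>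

section \<open>Tangles and their isotopies\<close>

text \<open>Components are equivalence classes of points and are awkward to follow through a move.
  Labelings by words are local: a move has to be checked only at position 0, on the few strands it
  touches, and global data are recovered by counting. In particular, a diagram with n components has
  2^n labelings by truth values, which is how numbers of components are compared. The phase uses an
  orientation, but the two smoothings of a mixed crossing inherit orientations of different kinds,
  one from parallel strands and the other from antiparallel ones. Independence of the orientation
  modulo 4 is what allows both to be used. Multiplicativity of Q under disjoint union is not among
  the axioms. It follows from a uniqueness statement for skein invariants, which requires unknotting
  by crossing changes with control of the curls. The same sorting braid \<open>sigma\<close> serves
  there with real heights as labels and, for the uniqueness of K[Q], with components as labels;
  hence it has to admit equal labels.\<close>

fun fits :: "nat \<Rightarrow> diagram \<Rightarrow> bool" where
  "fits m [] \<longleftrightarrow> True"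
| "fits m ((g, i) # l) \<longleftrightarrow> i + n_in g \<le> m \<and> fits (m - n_in g + n_out g) l"

lemma Suc_Suc_diff_2 [simp]: "2 \<le> m \<Longrightarrow> Suc (Suc (m - 2)) = m"
  by simp

text \<open>The subtraction is truncated, so \<open>wd m l\<close> is meaningful only together with
  \<open>fits m l\<close>. An arbitrary \<open>m\<close> is needed because moves act on slices in
  the middle of a diagram.\<close>

fun wd :: "nat \<Rightarrow> diagram \<Rightarrow> nat" where
  "wd m [] = m"
| "wd m ((g, i) # l) = wd (m - n_in g + n_out g) l"

lemma fits_append [simp]: "fits m (l @ l') \<longleftrightarrow> fits m l \<and> fits (wd m l) l'"
  by (induction m l rule: fits.induct) auto

lemma wd_append [simp]: "wd m (l @ l') = wd (wd m l) l'"
  by (induction m l rule: wd.induct) auto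

lemma wd_eq_fold: "wd m l = fold (\<lambda>(g, i) m. m - n_in g + n_out g) l m"
  by (induction m l rule: wd.induct) auto

lemma width_eq_wd: "width L = wd 0 L"
  by (simp add: width_def wd_eq_fold)

lemma fits_iff_nth:
  "fits m l \<longleftrightarrow> (\<forall>h < length l. case l ! h of (g, i) \<Rightarrow> i + n_in g \<le> wd m (take h l))"
proof (induction m l rule: fits.induct)
  case (2 m g i l)
  have *: "(\<forall>h < length ((g, i) # l). P h) \<longleftrightarrow> P 0 \<and> (\<forall>h < length l. P (Suc h))" for P
    by (simp add: All_less_Suc2)
  show ?case unfolding * using 2 by simp
qed simp

lemma link_diagram_iff: "link_diagram L \<longleftrightarrow> L \<noteq> [] \<and> fits 0 L \<and> wd 0 L = 0"
  by (simp add: link_diagram_def fits_iff_nth width_eq_wd conj_ac)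

definition shift :: "nat \<Rightarrow> diagram \<Rightarrow> diagram" where
  "shift k = map (\<lambda>(g, i). (g, i + k))"

lemma shift_simps [simp]:
  "shift k [] = []" "shift k ((g, i) # l) = (g, i + k) # shift k l"
  "shift k (l @ l') = shift k l @ shift k l'"
  "shift k (shift j l) = shift (k + j) l" "shift 0 l = l"
  by (auto simp: shift_def algebra_simps)

lemma shift_eq_Nil [simp]: "shift k l = [] \<longleftrightarrow> l = []"
  by (simp add: shift_def)

lemma fits_wd_shift_aux:
  "fits m l \<Longrightarrow> fits (m + k) (shift k l) \<and> wd (m + k) (shift k l) = wd m l + k"
proof (induction m l rule: fits.induct)
  case (2 m g i l)
  then have eq: "m + k - n_in g + n_out g = m - n_in g + n_out g + k" by simp
  have i: "i + n_in g \<le> m" and f: "fits (m - n_in g + n_out g) l" using 2(2) by (simp_all only: fits.simps)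
  show ?case unfolding shift_simps fits.simps wd.simps eq using i 2(1)[OF f] by simp
qed simp

lemmas fits_wd_shift = fits_wd_shift_aux [THEN conjunct1] fits_wd_shift_aux [THEN conjunct2]

lemma fits_wd_mono_aux: "fits m l \<Longrightarrow> fits (m + k) l \<and> wd (m + k) l = wd m l + k"
proof (induction m l rule: fits.induct)
  case (2 m g i l)
  then have eq: "m + k - n_in g + n_out g = m - n_in g + n_out g + k" by simp
  have i: "i + n_in g \<le> m" and f: "fits (m - n_in g + n_out g) l" using 2(2) by (simp_all only: fits.simps)
  show ?case unfolding shift_simps fits.simps wd.simps eq using i 2(1)[OF f] by simp
qed simp

lemmas fits_wd_mono = fits_wd_mono_aux [THEN conjunct1] fits_wd_mono_aux [THEN conjunct2]

section \<open>Isotopy moves and curls on open tangles\<close>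

definition isotopy_move :: "diagram \<Rightarrow> diagram \<Rightarrow> bool" where
  "isotopy_move l l' \<longleftrightarrow> planar_move l l' \<or> reidemeister2 l l' \<or> reidemeister3 l l'"

lemma isotopy_move_cases [consumes 1, case_names exchange zigzag_left zigzag_right cup_over
    cup_under cap_over cap_under r2_pos r2_neg r3]:
  assumes "isotopy_move l l'"
    "\<And>g i g' d. l = [(g, i), (g', i + n_out g + d)] \<Longrightarrow> l' = [(g', i + n_in g + d), (g, i)] \<Longrightarrow> P"
    "\<And>i. l = [(Cup, i), (Cap, Suc i)] \<Longrightarrow> l' = [] \<Longrightarrow> P"
    "\<And>i. l = [(Cup, Suc i), (Cap, i)] \<Longrightarrow> l' = [] \<Longrightarrow> P"
    "\<And>i. l = [(Cup, i), (Neg, Suc i)] \<Longrightarrow> l' = [(Cup, Suc i), (Pos, i)] \<Longrightarrow> P"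
    "\<And>i. l = [(Cup, i), (Pos, Suc i)] \<Longrightarrow> l' = [(Cup, Suc i), (Neg, i)] \<Longrightarrow> P"
    "\<And>i. l = [(Pos, Suc i), (Cap, i)] \<Longrightarrow> l' = [(Neg, i), (Cap, Suc i)] \<Longrightarrow> P"
    "\<And>i. l = [(Neg, Suc i), (Cap, i)] \<Longrightarrow> l' = [(Pos, i), (Cap, Suc i)] \<Longrightarrow> P"
    "\<And>i. l = [(Pos, i), (Neg, i)] \<Longrightarrow> l' = [] \<Longrightarrow> P"
    "\<And>i. l = [(Neg, i), (Pos, i)] \<Longrightarrow> l' = [] \<Longrightarrow> P"
    "\<And>x y z i. {x, y, z} \<subseteq> {Pos, Neg} \<Longrightarrow> y = x \<or> y = z \<Longrightarrow> l = [(x, i), (y, Suc i), (z, i)] \<Longrightarrow>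
       l' = [(z, Suc i), (y, i), (x, Suc i)] \<Longrightarrow> P"
  shows P
proof -
  consider "planar_move l l'" | "reidemeister2 l l'" | "reidemeister3 l l'"
    using assms(1) unfolding isotopy_move_def by blast
  then show P
  proof cases
    case 1
    then show P by cases (rule assms(2-8); simp)+
  next
    case 2
    then show P by cases (rule assms(9-10); simp)+
  next
    case 3
    then show P by cases (rule assms(11); auto)
  qed
qed

lemma isotopy_moves:
  "isotopy_move [(g, i), (g', i + n_out g + d)] [(g', i + n_in g + d), (g, i)]"
  "isotopy_move [(Cup, i), (Cap, Suc i)] []"
  "isotopy_move [(Cup, Suc i), (Cap, i)] []"
  "isotopy_move [(Cup, i), (Neg, Suc i)] [(Cup, Suc i), (Pos, i)]"
  "isotopy_move [(Cup, i), (Pos, Suc i)] [(Cup, Suc i), (Neg, i)]"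
  "isotopy_move [(Pos, Suc i), (Cap, i)] [(Neg, i), (Cap, Suc i)]"
  "isotopy_move [(Neg, Suc i), (Cap, i)] [(Pos, i), (Cap, Suc i)]"
  "isotopy_move [(Pos, i), (Neg, i)] []"
  "isotopy_move [(Neg, i), (Pos, i)] []"
  "{x, y, z} \<subseteq> {Pos, Neg} \<Longrightarrow> y = x \<or> y = z \<Longrightarrow>
     isotopy_move [(x, i), (y, Suc i), (z, i)] [(z, Suc i), (y, i), (x, Suc i)]"
  unfolding isotopy_move_def
  using planar_move.intros(2-)[of i] planar_move.intros(1)[of g i g' d] reidemeister2.intros[of i]
    reidemeister3.intros[of x y z i] by simp_all

lemma n_in_crossing [simp]: "x \<in> {Pos, Neg} \<Longrightarrow> n_in x = 2" "x \<in> {Pos, Neg} \<Longrightarrow> n_out x = 2"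
  by auto

lemma wd_isotopy_move:
  assumes "isotopy_move l l'" "fits m l"
  shows "wd m l = wd m l'"
  using assms by (cases rule: isotopy_move_cases) auto

lemma isotopy_move_shift:
  assumes "isotopy_move l l'"
  shows "isotopy_move (shift k l) (shift k l')"
  using assms
proof (cases rule: isotopy_move_cases)
  case (exchange g i g' d)
  then show ?thesis using isotopy_moves(1)[of g "i + k" g' d] by (simp add: algebra_simps)
next
  case (r3 x y z i)
  then show ?thesis using isotopy_moves(10)[of x y z "i + k"] by simp
qed (simp_all add: isotopy_moves)

lemma curl_cases [consumes 1]:
  assumes "curl s l"
    "\<And>i. s = 1 \<Longrightarrow> l = [(Cup, Suc i), (Neg, i), (Cap, Suc i)] \<Longrightarrow> P"
    "\<And>i. s = 1 \<Longrightarrow> l = [(Cup, i), (Neg, Suc i), (Cap, i)] \<Longrightarrow> P"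
    "\<And>i. s = -1 \<Longrightarrow> l = [(Cup, Suc i), (Pos, i), (Cap, Suc i)] \<Longrightarrow> P"
    "\<And>i. s = -1 \<Longrightarrow> l = [(Cup, i), (Pos, Suc i), (Cap, i)] \<Longrightarrow> P"
  shows P
  using assms(1) by cases (use assms(2-) in auto)

lemma curls:
  "curl 1 [(Cup, Suc i), (Neg, i), (Cap, Suc i)]"
  "curl 1 [(Cup, i), (Neg, Suc i), (Cap, i)]"
  "curl (-1) [(Cup, Suc i), (Pos, i), (Cap, Suc i)]"
  "curl (-1) [(Cup, i), (Pos, Suc i), (Cap, i)]"
  using curl.intros[of i] by auto

lemma curl_shift: "curl s l \<Longrightarrow> curl s (shift k l)"
  by (erule curl_cases) (auto simp: curls)

lemma wd_curl: "curl s l \<Longrightarrow> fits m l \<Longrightarrow> wd m l = m"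
  by (erule curl_cases) auto

text \<open>\<open>tiso m k l l'\<close>: with \<open>m\<close> strands entering from below, \<open>l\<close> becomes \<open>l'\<close> by a regular
  isotopy and the removal of curls whose signs add up to \<open>k\<close>.\<close>

inductive tiso :: "nat \<Rightarrow> int \<Rightarrow> diagram \<Rightarrow> diagram \<Rightarrow> bool" where
  refl: "fits m l \<Longrightarrow> tiso m 0 l l"
| move: "isotopy_move l l' \<Longrightarrow> fits m (u @ l @ v) \<Longrightarrow> fits m (u @ l' @ v) \<Longrightarrow>
    tiso m 0 (u @ l @ v) (u @ l' @ v)"
| curl: "curl s l \<Longrightarrow> fits m (u @ l @ v) \<Longrightarrow> tiso m s (u @ l @ v) (u @ v)"
| sym: "tiso m k l l' \<Longrightarrow> tiso m (- k) l' l"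
| trans: "tiso m j l l' \<Longrightarrow> tiso m k l' l'' \<Longrightarrow> tiso m (j + k) l l''"

lemma tiso_fits_wd: "tiso m k l l' \<Longrightarrow> fits m l \<and> fits m l' \<and> wd m l = wd m l'"
  by (induction rule: tiso.induct) (auto simp: wd_isotopy_move wd_curl)

lemma tiso_context:
  assumes "tiso m k l l'" "fits n u" "wd n u = m" "fits (wd m l) v"
  shows "tiso n k (u @ l @ v) (u @ l' @ v)"
  using assms
proof (induction rule: tiso.induct)
  case (move l l' m u' v')
  then show ?case
    using tiso.move[of l l' n "u @ u'" "v' @ v"] wd_isotopy_move[OF move(1)] by auto
next
  case (curl s l m u' v')
  then show ?case using tiso.curl[of s l n "u @ u'" "v' @ v"] by auto
next
  case (sym m k l l')
  then show ?case using tiso.sym tiso_fits_wd by metis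
next
  case (trans m j l l' k l'')
  then show ?case using tiso.trans tiso_fits_wd by metis
qed (auto intro: tiso.refl)

lemma tiso_right: "tiso m k l l' \<Longrightarrow> fits (wd m l) v \<Longrightarrow> tiso m k (l @ v) (l' @ v)"
  using tiso_context[of m k l l' m "[]" v] by simp

lemma tiso_left: "tiso m k l l' \<Longrightarrow> fits n u \<Longrightarrow> wd n u = m \<Longrightarrow> tiso n k (u @ l) (u @ l')"
  using tiso_context[of m k l l' n u "[]"] by simp

lemma tiso_shift:
  assumes "tiso m k l l'"
  shows "tiso (m + j) k (shift j l) (shift j l')"
  using assms
proof (induction rule: tiso.induct)
  case (refl m l)
  then show ?case by (simp add: tiso.refl fits_wd_shift)
next
  case (move l l' m u v)
  then show ?case
    using tiso.move[OF isotopy_move_shift[OF move(1)], of "m + j" "shift j u" j "shift j v"]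
      fits_wd_shift(1)[OF move(2), of j] fits_wd_shift(1)[OF move(3), of j] by simp
next
  case (curl s l m u v)
  then show ?case
    using tiso.curl[OF curl_shift[OF curl(1)], of "m + j" "shift j u" j "shift j v"]
      fits_wd_shift(1)[OF curl(2), of j] by simp
qed (auto intro: tiso.intros)

text \<open>The sign sum 0 also admits isotopies that remove and create curls of cancelling signs.
  This is harmless: a framed invariant sees only the sum, as the exponent of a.\<close>

abbreviation riso :: "diagram \<Rightarrow> nat \<Rightarrow> diagram \<Rightarrow> bool" ("(_ \<simeq>[_] _)" [51, 0, 51] 50) where
  "l \<simeq>[m] l' \<equiv> tiso m 0 l l'"

lemma riso_sym: "l \<simeq>[m] l' \<Longrightarrow> l' \<simeq>[m] l"
  using tiso.sym by fastforce

lemma riso_trans [trans]: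
  "l \<simeq>[m] l' \<Longrightarrow> l' \<simeq>[m] l'' \<Longrightarrow> l \<simeq>[m] l''"
  "l \<simeq>[m] l' \<Longrightarrow> tiso m k l' l'' \<Longrightarrow> tiso m k l l''"
  "tiso m k l l' \<Longrightarrow> l' \<simeq>[m] l'' \<Longrightarrow> tiso m k l l''"
  using tiso.trans by fastforce+

lemma riso_moveI:
  assumes "isotopy_move l l'" "L = u @ l @ v" "L' = u @ l' @ v" "fits m L" "fits m L'"
  shows "L \<simeq>[m] L'" "L' \<simeq>[m] L"
  using tiso.move[OF assms(1), of m u v] riso_sym assms(2-) by auto

text \<open>\<open>l\<close> uses the \<open>c\<close> strands on the left and \<open>l'\<close> the
  \<open>m\<close> strands to their right, so the two tangles can be built in either order. A single
  slice is carried past the whole right tangle, and \<open>l\<close> is moved slice by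
  slice.\<close>

lemma riso_exchange:
  assumes "fits c l" "fits m l'"
  shows "l @ shift (wd c l) l' \<simeq>[c + m] shift c l' @ l"
proof -
  have slice: "[(g, i)] @ shift (c - n_in g + n_out g) l \<simeq>[c + m] shift c l @ [(g, i)]"
    if "i + n_in g \<le> c" "fits m l" for g i c m l
    using that
  proof (induction l arbitrary: m)
    case Nil
    then show ?case by (auto intro: tiso.refl)
  next
    case (Cons s l)
    obtain h j where s: "s = (h, j)" by force
    let ?c' = "c - n_in g + n_out g" and ?m = "m - n_in h + n_out h"
    have fl: "fits ?m l" and j: "j + n_in h \<le> m" using Cons(3) s by auto
    have w: "c + m - n_in h + n_out h = c + ?m" "?c' + m - n_in h + n_out h = ?c' + ?m"
      "c + m - n_in g + n_out g = ?c' + m"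
      using j Cons(2) by auto
    note f = fits_wd_shift[OF fl, of ?c'] fits_wd_shift[OF fl, of c]
    \<comment> \<open>The offset in the exchange move is the number of strands between the two
      slices, counted below them.\<close>
    have eq: "i + n_out g + (j + c - n_in g - i) = j + ?c'" "i + n_in g + (j + c - n_in g - i) = j + c"
      using Cons(2) by auto
    have "[(g, i)] @ shift ?c' (s # l) \<simeq>[c + m] [(h, j + c), (g, i)] @ shift ?c' l"
    proof (rule riso_moveI(1)[where u = "[]" and v = "shift ?c' l"])
      show "isotopy_move [(g, i), (h, j + ?c')] [(h, j + c), (g, i)]"
        using isotopy_moves(1)[of g i h "j + c - n_in g - i"] unfolding eq .
    qed (use s Cons(2) j w f in \<open>auto simp: algebra_simps\<close>)
    also have "\<dots> \<simeq>[c + m] [(h, j + c)] @ shift c l @ [(g, i)]"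
      using tiso_left[OF Cons.IH[OF Cons(2) fl], of "c + m" "[(h, j + c)]"] j w by simp
    finally show ?case using s by simp
  qed
  show ?thesis
    using assms(1)
  proof (induction l arbitrary: c)
    case Nil
    then show ?case
      using tiso.refl[OF fits_wd_shift(1)[OF assms(2), of c]] by (simp add: add.commute)
  next
    case (Cons s l)
    obtain g i where s: "s = (g, i)" by force
    let ?c = "c - n_in g + n_out g"
    have i: "i + n_in g \<le> c" and fl: "fits ?c l" using Cons s by auto
    have w: "c + m - n_in g + n_out g = ?c + m" using i by auto
    have "(s # l) @ shift (wd c (s # l)) l' = [s] @ (l @ shift (wd ?c l) l')" using s by simp
    also have "\<dots> \<simeq>[c + m] [s] @ (shift ?c l' @ l)"
      by (rule tiso_left[OF Cons.IH[OF fl]]) (use s i w in auto)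
    also have "\<dots> \<simeq>[c + m] (shift c l' @ [s]) @ l"
      using tiso_right[OF slice[OF i assms(2)], of l] fits_wd_shift[OF assms(2), of ?c]
        fits_wd_mono[OF fl, of "wd m l'"] s w by (simp add: add.commute[of ?c])
    finally show ?case by simp
  qed
qed

section \<open>Sorting the strands of a tangle\<close>

text \<open>One strand enters at position \<open>p\<close>, passes below the \<open>p\<close>
  strands on its left and leaves at position 0. It is the lower one because \<open>Neg\<close> puts
  the strand going to the right on top.\<close>

fun line :: "nat \<Rightarrow> diagram" where
  "line 0 = []"
| "line (Suc p) = (Neg, p) # line p"

lemma fits_wd_line: "p < m \<Longrightarrow> fits m (line p) \<and> wd m (line p) = m"
  by (induction p) auto

lemma fits_line [simp]: "p < m \<Longrightarrow> fits m (line p)"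
  and wd_line [simp]: "p < m \<Longrightarrow> wd m (line p) = m"
  using fits_wd_line by auto

lemma line_exchange_right:
  assumes "p \<le> j" "Suc j + n_in g \<le> m"
  shows "line p @ [(g, Suc j)] \<simeq>[m] [(g, Suc j)] @ line p"
  using riso_exchange[of "Suc p" "line p" "m - Suc p" "[(g, j - p)]"] assms by simp

lemma slices_exchange:
  assumes "j + n_in g \<le> i" "i + n_in h \<le> m" "i' + n_in g = i + n_out g"
  shows "[(h, i), (g, j)] \<simeq>[m] [(g, j), (h, i')]"
proof -
  have *: "i' = j + n_out g + (i - (j + n_in g))" "i = j + n_in g + (i - (j + n_in g))"
    using assms by linarith+
  have "isotopy_move [(g, j), (h, i')] [(h, i), (g, j)]"
    using isotopy_moves(1)[of g j h "i - (j + n_in g)"] * by metis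
  then show ?thesis
    by (rule riso_moveI(2)[where u = "[]" and v = "[]"]) (use assms in auto)
qed

text \<open>The strand of the line lies below everything it meets, so a slice to its left can be
  pulled through it: an extremum by a cup or cap move and Reidemeister II, a crossing by
  Reidemeister III. Since the strand ends up at position 0, it adds one to the position of the
  slice. The induction starts with the line that just reaches across the slice and adds further
  crossings by exchange.\<close>

lemma line_slide_left:
  assumes "j + n_in g \<le> p" "p < m"
  shows "line p @ [(g, Suc j)] \<simeq>[m] [(g, j)] @ line (p - n_in g + n_out g)"
  using assms
proof (induction p rule: nat_induct_at_least)
  case base
  have ex: "line j @ [(g, Suc j)] \<simeq>[m] [(g, Suc j)] @ line j"
    by (rule line_exchange_right) (use base in auto)
  show ?case
  proof (cases g)
    case Cup
    have "[(Cup, Suc j)] \<simeq>[m] [(Cup, Suc j), (Pos, j), (Neg, j)]"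
      by (rule riso_moveI(2)[OF isotopy_moves(8), where u = "[(Cup, Suc j)]" and v = "[]"])
        (use base Cup in auto)
    also have "\<dots> \<simeq>[m] [(Cup, j), (Neg, Suc j), (Neg, j)]"
      by (rule riso_moveI(2)[OF isotopy_moves(4), where u = "[]" and v = "[(Neg, j)]"])
        (use base Cup in auto)
    finally have "[(Cup, Suc j)] @ line j \<simeq>[m] [(Cup, j), (Neg, Suc j), (Neg, j)] @ line j"
      by (rule tiso_right) (use base Cup in auto)
    with ex show ?thesis using Cup riso_trans(1) by auto
  next
    case Cap
    have "[(Neg, Suc j), (Neg, j), (Cap, Suc j)] \<simeq>[m] [(Neg, Suc j), (Pos, Suc j), (Cap, j)]"
      by (rule riso_moveI(2)[OF isotopy_moves(6), where u = "[(Neg, Suc j)]" and v = "[]"])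
        (use base Cap in auto)
    also have "\<dots> \<simeq>[m] [(Cap, j)]"
      by (rule riso_moveI(1)[OF isotopy_moves(9), where u = "[]" and v = "[(Cap, j)]"])
        (use base Cap in auto)
    finally have "[(Neg, Suc j), (Neg, j), (Cap, Suc j)] @ line j \<simeq>[m] [(Cap, j)] @ line j"
      by (rule tiso_right) (use base Cap in auto)
    moreover have "[(Neg, Suc j), (Neg, j)] @ line j @ [(g, Suc j)]
        \<simeq>[m] [(Neg, Suc j), (Neg, j)] @ [(g, Suc j)] @ line j"
      by (rule tiso_left[OF ex]) (use base Cap in auto)
    ultimately show ?thesis using Cap riso_trans(1) by (auto simp: numeral_2_eq_2)
  next
    case Pos
    have "[(Neg, Suc j), (Neg, j), (Pos, Suc j)] \<simeq>[m] [(Pos, j), (Neg, Suc j), (Neg, j)]"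
      by (rule riso_moveI(2)[OF isotopy_moves(10)[of Pos Neg Neg], where u = "[]" and v = "[]"])
        (use base Pos in auto)
    then have "[(Neg, Suc j), (Neg, j), (Pos, Suc j)] @ line j
        \<simeq>[m] [(Pos, j), (Neg, Suc j), (Neg, j)] @ line j"
      by (rule tiso_right) (use base Pos in auto)
    moreover have "[(Neg, Suc j), (Neg, j)] @ line j @ [(g, Suc j)]
        \<simeq>[m] [(Neg, Suc j), (Neg, j)] @ [(g, Suc j)] @ line j"
      by (rule tiso_left[OF ex]) (use base Pos in auto)
    ultimately show ?thesis using Pos riso_trans(1) by (auto simp: numeral_2_eq_2)
  next
    case Neg
    have "[(Neg, Suc j), (Neg, j), (Neg, Suc j)] \<simeq>[m] [(Neg, j), (Neg, Suc j), (Neg, j)]"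
      by (rule riso_moveI(2)[OF isotopy_moves(10)[of Neg Neg Neg], where u = "[]" and v = "[]"])
        (use base Neg in auto)
    then have "[(Neg, Suc j), (Neg, j), (Neg, Suc j)] @ line j
        \<simeq>[m] [(Neg, j), (Neg, Suc j), (Neg, j)] @ line j"
      by (rule tiso_right) (use base Neg in auto)
    moreover have "[(Neg, Suc j), (Neg, j)] @ line j @ [(g, Suc j)]
        \<simeq>[m] [(Neg, Suc j), (Neg, j)] @ [(g, Suc j)] @ line j"
      by (rule tiso_left[OF ex]) (use base Neg in auto)
    ultimately show ?thesis using Neg riso_trans(1) by (auto simp: numeral_2_eq_2)
  qed
next
  case (Suc p)
  let ?q = "p - n_in g + n_out g"
  have q: "Suc p - n_in g + n_out g = Suc ?q" using Suc by auto
  have w: "m - n_in g + n_out g > Suc ?q" using Suc by auto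
  have "[(Neg, p)] @ line p @ [(g, Suc j)] \<simeq>[m] [(Neg, p)] @ [(g, j)] @ line ?q"
    by (rule tiso_left) (use Suc in auto)
  also have "[(Neg, p)] @ [(g, j)] @ line ?q \<simeq>[m] [(g, j), (Neg, ?q)] @ line ?q"
    using tiso_right[OF slices_exchange[of j g p Neg m ?q], of "line ?q"] Suc w by auto
  finally show ?case using q by simp
qed

text \<open>Two parallel strands travel from positions \<open>p\<close> and \<open>p + 1\<close> to
  0 and 1, below all others and without crossing each other.\<close>

definition lines2 :: "nat \<Rightarrow> diagram" where
  "lines2 p = line p @ shift 1 (line p)"

lemma fits_wd_shift_line: "p + k < m \<Longrightarrow> fits m (shift k (line p)) \<and> wd m (shift k (line p)) = m"
  using fits_wd_shift[of "m - k" "line p" k] by simp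

lemma fits_lines2 [simp]: "p + 2 \<le> m \<Longrightarrow> fits m (lines2 p)"
  and wd_lines2 [simp]: "p + 2 \<le> m \<Longrightarrow> wd m (lines2 p) = m"
  using fits_wd_shift_line[of p 1 m] by (auto simp: lines2_def)

lemma lines2_Suc:
  assumes "p + 3 \<le> m"
  shows "lines2 (Suc p) \<simeq>[m] [(Neg, p), (Neg, Suc p)] @ lines2 p"
  unfolding lines2_def
  using tiso_context[OF line_exchange_right[of p p Neg m], of m "[(Neg, p)]" "shift 1 (line p)"]
    fits_wd_shift_line[of p 1 m] assms by simp

text \<open>The number \<open>n\<close> is always that of the strands entering or leaving a slice,
  hence 0 or 2; the case distinction lets extrema and crossings share one statement.\<close>

definition strands :: "nat \<Rightarrow> nat \<Rightarrow> diagram" where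
  "strands n p = (if n = 0 then [] else lines2 p)"

lemma fits_strands [simp]: "n = 0 \<or> p + 2 \<le> m \<Longrightarrow> fits m (strands n p)"
  and wd_strands [simp]: "n = 0 \<or> p + 2 \<le> m \<Longrightarrow> wd m (strands n p) = m"
  by (auto simp: strands_def)

text \<open>The slice at position 0 is formed by two strands that travel together below all others,
  so it can also be formed at position \<open>p\<close>. Each unit of the distance takes
  Reidemeister II and a cup or cap move for an extremum, and Reidemeister III for a
  crossing.\<close>

lemma strands_slide:
  assumes "p + n_in g \<le> m"
  shows "strands (n_in g) p @ [(g, 0)] \<simeq>[m] [(g, p)] @ strands (n_out g) p"
  using assms
proof (induction p)
  case 0
  then show ?case by (auto simp: strands_def lines2_def intro: tiso.refl)
next
  case (Suc p)
  let ?s = "\<lambda>n. if n = 0 then [] else [(Neg, p), (Neg, Suc p)]"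
  have unroll: "strands n (Suc p) \<simeq>[k] ?s n @ strands n p" if "n = 0 \<or> p + 3 \<le> k" for n k
    using that lines2_Suc[of p k] by (auto simp: strands_def intro: tiso.refl)
  have "[(Neg, p), (Neg, Suc p), (Cap, p)] \<simeq>[m] [(Neg, p), (Pos, p), (Cap, Suc p)]" if "g = Cap"
    by (rule riso_moveI(1)[OF isotopy_moves(7), where u = "[(Neg, p)]" and v = "[]"])
      (use that Suc in auto)
  also have "[(Neg, p), (Pos, p), (Cap, Suc p)] \<simeq>[m] [(Cap, Suc p)]" if "g = Cap"
    by (rule riso_moveI(1)[OF isotopy_moves(9), where u = "[]" and v = "[(Cap, Suc p)]"])
      (use that Suc in auto)
  finally have cap: "[(Neg, p), (Neg, Suc p), (Cap, p)] \<simeq>[m] [(Cap, Suc p)]" if "g = Cap"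
    using that by simp
  have "[(Cup, Suc p), (Neg, p), (Neg, Suc p)] \<simeq>[m] [(Cup, p), (Pos, Suc p), (Neg, Suc p)]" if "g = Cup"
    by (rule riso_moveI(2)[OF isotopy_moves(5), where u = "[]" and v = "[(Neg, Suc p)]"])
      (use that Suc in auto)
  also have "[(Cup, p), (Pos, Suc p), (Neg, Suc p)] \<simeq>[m] [(Cup, p)]" if "g = Cup"
    by (rule riso_moveI(1)[OF isotopy_moves(8), where u = "[(Cup, p)]" and v = "[]"])
      (use that Suc in auto)
  finally have cup: "[(Cup, Suc p), (Neg, p), (Neg, Suc p)] \<simeq>[m] [(Cup, p)]" if "g = Cup"
    using that by simp
  have cross: "[(Neg, p), (Neg, Suc p), (g, p)] \<simeq>[m] [(g, Suc p), (Neg, p), (Neg, Suc p)]"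
    if "g \<in> {Pos, Neg}"
    by (rule riso_moveI(1)[OF isotopy_moves(10)[of Neg Neg g], where u = "[]" and v = "[]"])
      (use that Suc in auto)
  have local: "?s (n_in g) @ [(g, p)] \<simeq>[m] [(g, Suc p)] @ ?s (n_out g)"
    using cap riso_sym[OF cup] cross by (cases g) auto
  have "strands (n_in g) (Suc p) @ [(g, 0)] \<simeq>[m] (?s (n_in g) @ strands (n_in g) p) @ [(g, 0)]"
    by (rule tiso_right[OF unroll]) (use Suc in \<open>cases g; auto\<close>)+
  also have "\<dots> \<simeq>[m] ?s (n_in g) @ ([(g, p)] @ strands (n_out g) p)"
    using tiso_left[OF Suc.IH, of m "?s (n_in g)"] Suc(2) by (cases g) auto
  also have "\<dots> \<simeq>[m] ([(g, Suc p)] @ ?s (n_out g)) @ strands (n_out g) p"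
    using tiso_right[OF local, of "strands (n_out g) p"] Suc(2) by (cases g) auto
  also have "\<dots> \<simeq>[m] [(g, Suc p)] @ strands (n_out g) (Suc p)"
    using tiso_left[OF riso_sym[OF unroll[of "n_out g" "m - n_in g + n_out g"]], of m "[(g, Suc p)]"] Suc(2)
    by (cases g) auto
  finally show ?case .
qed

lemma strands_slide_tail:
  assumes "p \<le> length_B" "fits length_B s"
  shows "(strands (n_in g) p @ shift (n_in g) s) @ [(g, 0)]
    \<simeq>[n_in g + length_B] (g, p) # strands (n_out g) p @ shift (n_out g) s"
proof -
  let ?m = "n_in g + length_B"
  have "shift (n_in g) s @ [(g, 0)] \<simeq>[?m] [(g, 0)] @ shift (n_out g) s"
    using riso_sym[OF riso_exchange[of "n_in g" "[(g, 0)]" length_B s]] assms by simp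
  then have "strands (n_in g) p @ shift (n_in g) s @ [(g, 0)]
      \<simeq>[?m] strands (n_in g) p @ [(g, 0)] @ shift (n_out g) s"
    by (rule tiso_left) (use assms in \<open>cases g; auto\<close>)+
  also have "\<dots> = (strands (n_in g) p @ [(g, 0)]) @ shift (n_out g) s" by simp
  also have "\<dots> \<simeq>[?m] ([(g, p)] @ strands (n_out g) p) @ shift (n_out g) s"
    by (rule tiso_right[OF strands_slide])
      (use assms fits_wd_shift[OF assms(2), of "n_out g"] in \<open>cases g; auto simp: add.commute\<close>)+
  finally show ?thesis by simp
qed

text \<open>A crossing of the two ends of a minimum is a curl, but not in one of the listed forms.
  An extra zigzag brings it there and turns the crossing by a quarter, so that \<open>Pos\<close>
  yields the sign 1 although the listed curls of sign 1 contain \<open>Neg\<close>. The second claim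
  is the first one undone by Reidemeister II.\<close>

lemma cup_twist:
  assumes "q \<le> m"
  shows "tiso m 1 [(Cup, q), (Pos, q)] [(Cup, q)]" "tiso m (-1) [(Cup, q), (Neg, q)] [(Cup, q)]"
proof -
  have "[(Cup, q), (Pos, q)] \<simeq>[m] [(Cup, q), (Pos, q), (Cup, q), (Cap, Suc q)]"
    by (rule riso_moveI(2)[OF isotopy_moves(2), where u = "[(Cup, q), (Pos, q)]" and v = "[]"])
      (use assms in auto)
  also have "\<dots> \<simeq>[m] [(Cup, q), (Cup, q), (Pos, Suc (Suc q)), (Cap, Suc q)]"
    using assms
    by (intro riso_moveI(2)[where u = "[(Cup, q)]" and v = "[(Cap, Suc q)]",
          OF isotopy_moves(1)[of Cup q Pos 0]]) auto
  also have "\<dots> \<simeq>[m] [(Cup, q), (Cup, Suc (Suc q)), (Pos, Suc (Suc q)), (Cap, Suc q)]"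
    using assms
    by (intro riso_moveI(2)[where u = "[]" and v = "[(Pos, Suc (Suc q)), (Cap, Suc q)]",
          OF isotopy_moves(1)[of Cup q Cup 0]]) auto
  also have "\<dots> \<simeq>[m] [(Cup, q), (Cup, Suc (Suc q)), (Neg, Suc q), (Cap, Suc (Suc q))]"
    using assms
    by (intro riso_moveI(1)[where u = "[(Cup, q), (Cup, Suc (Suc q))]" and v = "[]",
          OF isotopy_moves(6)]) auto
  also have "tiso m 1 \<dots> [(Cup, q)]"
    using tiso.curl[OF curls(1)[of "Suc q"], of m "[(Cup, q)]" "[]"] assms by simp
  finally show pos: "tiso m 1 [(Cup, q), (Pos, q)] [(Cup, q)]" by simp
  have "[(Cup, q), (Pos, q), (Neg, q)] \<simeq>[m] [(Cup, q)]"
    by (rule riso_moveI(1)[OF isotopy_moves(8), where u = "[(Cup, q)]" and v = "[]"])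
      (use assms in auto)
  moreover have "tiso m (-1) ([(Cup, q)] @ [(Neg, q)]) ([(Cup, q), (Pos, q)] @ [(Neg, q)])"
    by (rule tiso_right[OF tiso.sym[OF pos]]) (use assms in auto)
  ultimately show "tiso m (-1) [(Cup, q), (Neg, q)] [(Cup, q)]" using riso_trans(3) by simp
qed

lemma cap_twist:
  assumes "q + 2 \<le> m"
  shows "tiso m 1 [(Pos, q), (Cap, q)] [(Cap, q)]" "tiso m (-1) [(Neg, q), (Cap, q)] [(Cap, q)]"
proof -
  have "[(Pos, q), (Cap, q)] \<simeq>[m] [(Cup, Suc q), (Cap, q), (Pos, q), (Cap, q)]"
    by (rule riso_moveI(2)[OF isotopy_moves(3), where u = "[]" and v = "[(Pos, q), (Cap, q)]"])
      (use assms in auto)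
  also have "\<dots> \<simeq>[m] [(Cup, Suc q), (Pos, Suc (Suc q)), (Cap, q), (Cap, q)]"
    using assms
    by (intro riso_moveI(1)[where u = "[(Cup, Suc q)]" and v = "[(Cap, q)]",
          OF isotopy_moves(1)[of Cap q Pos 0]]) auto
  also have "\<dots> \<simeq>[m] [(Cup, Suc q), (Pos, Suc (Suc q)), (Cap, Suc (Suc q)), (Cap, q)]"
    using assms
    by (intro riso_moveI(1)[where u = "[(Cup, Suc q), (Pos, Suc (Suc q))]" and v = "[]",
          OF isotopy_moves(1)[of Cap q Cap 0]]) auto
  also have "\<dots> \<simeq>[m] [(Cup, Suc (Suc q)), (Neg, Suc q), (Cap, Suc (Suc q)), (Cap, q)]"
    using assms
    by (intro riso_moveI(1)[where u = "[]" and v = "[(Cap, Suc (Suc q)), (Cap, q)]",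
          OF isotopy_moves(5)]) auto
  also have "tiso m 1 \<dots> [(Cap, q)]"
    using tiso.curl[OF curls(1)[of "Suc q"], of m "[]" "[(Cap, q)]"] assms by simp
  finally show pos: "tiso m 1 [(Pos, q), (Cap, q)] [(Cap, q)]" by simp
  have "[(Neg, q), (Pos, q), (Cap, q)] \<simeq>[m] [(Cap, q)]"
    by (rule riso_moveI(1)[OF isotopy_moves(9), where u = "[]" and v = "[(Cap, q)]"])
      (use assms in auto)
  moreover have "tiso m (-1) ([(Neg, q)] @ [(Cap, q)]) ([(Neg, q)] @ [(Pos, q), (Cap, q)])"
    by (rule tiso_left[OF tiso.sym[OF pos]]) (use assms in auto)
  ultimately show "tiso m (-1) [(Neg, q), (Cap, q)] [(Cap, q)]" using riso_trans(3) by simp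
qed

text \<open>\<open>sigma w\<close> carries the strands from the order sorted by label to the order of the word \<open>w\<close>;
  at each of its crossings the strand with the smaller label is on top.\<close>

fun sigma :: "'a :: linorder list \<Rightarrow> diagram" where
  "sigma [] = []"
| "sigma (x # w) = line (length (filter (\<lambda>y. y < x) w)) @ shift 1 (sigma w)"

declare sigma.simps(2) [simp del]

lemma length_filter_less [simp]: "length (filter P w) < Suc (length w)"
  by (simp add: le_imp_less_Suc)

lemma fits_wd_sigma: "fits (length w) (sigma w) \<and> wd (length w) (sigma w) = length w"
proof (induction w)
  case (Cons x w)
  then show ?case using fits_wd_shift[of "length w" "sigma w" 1] by (simp add: sigma.simps(2))
qed simp

lemma fits_sigma [simp]: "m = length w \<Longrightarrow> fits m (sigma w)"
  and wd_sigma [simp]: "m = length w \<Longrightarrow> wd m (sigma w) = m"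
  using fits_wd_sigma by auto

lemma fits_wd_shift_sigma [simp]:
  "m = length w + k \<Longrightarrow> fits m (shift k (sigma w))"
  "m = length w + k \<Longrightarrow> wd m (shift k (sigma w)) = m"
  using fits_wd_shift[of "length w" "sigma w" k] by auto

text \<open>The position in the sorted order of a slice between strands with label \<open>l\<close>.\<close>

definition sorted_pos :: "'a :: linorder \<Rightarrow> 'a list \<Rightarrow> 'a list \<Rightarrow> nat" where
  "sorted_pos l A B = length (filter (\<lambda>y. y < l) (A @ B)) + length (filter (\<lambda>y. y = l) A)"

lemma sorted_pos_Nil [simp]: "sorted_pos l [] B = length (filter (\<lambda>y. y < l) B)"
  by (simp add: sorted_pos_def)

lemma sorted_pos_Cons:
  "sorted_pos l (x # A) B = (if x \<le> l then Suc (sorted_pos l A B) else sorted_pos l A B)"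
  by (auto simp: sorted_pos_def)

lemma length_filter_less_le_sorted_pos:
  assumes "x \<le> l"
  shows "length (filter (\<lambda>y. y < x) (A @ B)) \<le> sorted_pos l A B"
proof -
  have "length (filter (\<lambda>y. y < x) w) \<le> length (filter (\<lambda>y. y < l) w)" for w :: "'a list"
    using assms by (induction w) auto
  then show ?thesis unfolding sorted_pos_def using trans_le_add1 by blast
qed

lemma sorted_pos_le_length_filter:
  assumes "l < x"
  shows "sorted_pos l A B \<le> length (filter (\<lambda>y. y < x) (A @ B))"
proof -
  have "length (filter (\<lambda>y. y < l) B) \<le> length (filter (\<lambda>y. y < x) B)"
    using assms by (induction B) auto
  moreover have "length (filter (\<lambda>y. y < l) A) + length (filter (\<lambda>y. y = l) A) \<le> length (filter (\<lambda>y. y < x) A)"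
    using assms by (induction A) auto
  ultimately show ?thesis by (simp add: sorted_pos_def)
qed

text \<open>A new label \<open>x\<close> in front of the word adds one line at the bottom of
  \<open>sigma\<close>. The hypothesis on \<open>A\<close> excludes that \<open>x\<close> separates
  the labels at the slice: either all of them are smaller, and the slice slides through the line, or
  none is, and the slice lies to the right of the line. So it suffices to treat a slice at position
  0.\<close>

lemma sigma_slice_lift:
  assumes "tiso (length (X @ B)) k (sigma (X @ B) @ [(g, 0)]) ((g, sorted_pos l [] B) # sigma (Y @ B))"
    and XY: "length X = n_in g" "length Y = n_out g"
    and "\<And>x. x \<in> set A \<Longrightarrow> l < x \<and> (\<forall>y \<in> set (X @ Y). y < x) \<or> x \<le> l \<and> (\<forall>y \<in> set (X @ Y). \<not> y < x)"
  shows "tiso (length (A @ X @ B)) k (sigma (A @ X @ B) @ [(g, length A)])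
    ((g, sorted_pos l A B) # sigma (A @ Y @ B))"
  using assms(4)
proof (induction A)
  case Nil
  then show ?case using assms(1) by simp
next
  case (Cons x A)
  define w w' where "w = A @ X @ B" and "w' = A @ Y @ B"
  define p p' where "p = length (filter (\<lambda>y. y < x) w)" and "p' = length (filter (\<lambda>y. y < x) w')"
  define j where "j = sorted_pos l A B"
  let ?c = "length (filter (\<lambda>y. y < x) (A @ B))" and ?j' = "sorted_pos l (x # A) B"
  have IH: "tiso (length w) k (sigma w @ [(g, length A)]) ((g, j) # sigma w')"
    using Cons by (simp add: w_def w'_def j_def)
  have fit: "j + n_in g \<le> length w" using tiso_fits_wd[OF IH] by auto
  have len: "length w' = length w - n_in g + n_out g" "n_in g \<le> length w"
    using XY by (auto simp: w_def w'_def)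
  have p_le: "p \<le> length w" "p' \<le> length w'" by (auto simp: p_def p'_def)
  have sig: "sigma (x # w) = line p @ shift 1 (sigma w)" "sigma (x # w') = line p' @ shift 1 (sigma w')"
    by (simp_all add: p_def p'_def sigma.simps(2))
  have "tiso (Suc (length w)) k (line p @ shift 1 (sigma w @ [(g, length A)]))
      (line p @ shift 1 ((g, j) # sigma w'))"
    using tiso_left[OF tiso_shift[OF IH, of 1], of "Suc (length w)" "line p"] p_le by simp
  moreover have "line p @ [(g, Suc j)] \<simeq>[Suc (length w)] [(g, ?j')] @ line p'"
  proof (cases "x \<le> l")
    case True
    then have *: "\<forall>y \<in> set (X @ Y). \<not> y < x" using Cons(2)[of x] by auto
    then have "filter (\<lambda>y. y < x) X = []" "filter (\<lambda>y. y < x) Y = []"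
      by (auto simp: filter_empty_conv)
    then have "p = ?c" "p' = p" by (simp_all add: p_def p'_def w_def w'_def)
    then have "p \<le> j" "p' = p"
      using length_filter_less_le_sorted_pos[OF True, of A B] by (simp_all add: j_def)
    then show ?thesis using True line_exchange_right[of p j g "Suc (length w)"] fit
      by (simp add: sorted_pos_Cons j_def)
  next
    case False
    then have *: "\<forall>y \<in> set (X @ Y). y < x" using Cons(2)[of x] by auto
    then have "filter (\<lambda>y. y < x) X = X" "filter (\<lambda>y. y < x) Y = Y"
      by (auto simp: filter_id_conv)
    then have "p = ?c + n_in g" "p' = ?c + n_out g" using XY by (simp_all add: p_def p'_def w_def w'_def)
    moreover have "j \<le> ?c"
      using sorted_pos_le_length_filter[of l x A B] False by (simp add: j_def)
    ultimately have "j + n_in g \<le> p" "p' = p - n_in g + n_out g" by linarith+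
    then show ?thesis using False line_slide_left[of j g p "Suc (length w)"] p_le
      by (simp add: sorted_pos_Cons j_def)
  qed
  then have "(line p @ [(g, Suc j)]) @ shift 1 (sigma w')
      \<simeq>[Suc (length w)] ([(g, ?j')] @ line p') @ shift 1 (sigma w')"
    by (rule tiso_right) (use fit len p_le in auto)
  ultimately have "tiso (Suc (length w)) k (line p @ shift 1 (sigma w @ [(g, length A)]))
      ([(g, ?j')] @ line p' @ shift 1 (sigma w'))"
    using riso_trans(3) by fastforce
  then show ?case using sig by (simp add: w_def w'_def)
qed

text \<open>If no label of \<open>B\<close> lies in between, the strands \<open>a\<close> and
  \<open>b\<close> are neighbours in the sorted order and run in parallel. In the reverse order they
  cross once more, right at the start.\<close>

lemma sigma_Cons2:
  fixes a b :: "'a :: linorder"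
  assumes "a \<le> b" "filter (\<lambda>y. y < b) B = filter (\<lambda>y. y < a) B"
  shows "sigma (a # b # B) = lines2 (length (filter (\<lambda>y. y < a) B)) @ shift 2 (sigma B)"
    "a < b \<Longrightarrow> sigma (b # a # B) =
      (Neg, length (filter (\<lambda>y. y < a) B)) # lines2 (length (filter (\<lambda>y. y < a) B)) @ shift 2 (sigma B)"
  using assms by (auto simp: lines2_def numeral_2_eq_2 sigma.simps(2))

lemma sigma_straight_slice:
  assumes "X = [] \<or> (\<exists>a b. X = [a, b] \<and> a \<le> b \<and> l = a \<and> filter (\<lambda>y. y < b) B = filter (\<lambda>y. y < a) B)"
    and "Y = [] \<or> (\<exists>a b. Y = [a, b] \<and> a \<le> b \<and> l = a \<and> filter (\<lambda>y. y < b) B = filter (\<lambda>y. y < a) B)"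
    and XY: "length X = n_in g" "length Y = n_out g"
  shows "sigma (X @ B) @ [(g, 0)] \<simeq>[length (X @ B)] (g, sorted_pos l [] B) # sigma (Y @ B)"
proof -
  have *: "sigma (X @ B) = strands (length X) (sorted_pos l [] B) @ shift (length X) (sigma B)"
    if "X = [] \<or> (\<exists>a b. X = [a, b] \<and> a \<le> b \<and> l = a \<and> filter (\<lambda>y. y < b) B = filter (\<lambda>y. y < a) B)"
    for X
    using that
  proof (elim disjE exE conjE)
    fix a b
    assume "X = [a, b]" "a \<le> b" "l = a" "filter (\<lambda>y. y < b) B = filter (\<lambda>y. y < a) B"
    then show ?thesis using sigma_Cons2(1)[of a b B]
      by (simp add: strands_def numeral_2_eq_2)
  qed (simp add: strands_def)
  show ?thesis
    using strands_slide_tail[of "sorted_pos l [] B" "length B" "sigma B" g]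
    unfolding *[OF assms(1)] *[OF assms(2)] XY length_append by simp
qed

text \<open>With the labels in decreasing order, the extra crossing of the two neighbours meets the
  extremum and forms a curl. This is the only source of curls in the sorting.\<close>

lemma sigma_twisted_slice:
  fixes a b :: "'a :: linorder"
  assumes "a < b" "filter (\<lambda>y. y < b) B = filter (\<lambda>y. y < a) B"
    and "(X, g, Y) = ([], Cup, [b, a]) \<or> (X, g, Y) = ([b, a], Cap, [])"
  shows "\<exists>k. tiso (length (X @ B)) k (sigma (X @ B) @ [(g, 0)]) ((g, sorted_pos a [] B) # sigma (Y @ B))"
proof -
  let ?p = "sorted_pos a [] B"
  have ba: "sigma (b # a # B) = (Neg, ?p) # sigma (a # b # B)"
    using sigma_Cons2[of a b B] assms by simp
  have p: "?p \<le> length B" by simp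
  from assms(3) show ?thesis
  proof
    assume "(X, g, Y) = ([], Cup, [b, a])"
    then have XY: "X = []" "g = Cup" "Y = [b, a]" by auto
    have "sigma B @ [(Cup, 0)] \<simeq>[length B] (Cup, ?p) # sigma (a # b # B)"
      using sigma_straight_slice[of "[]" a B "[a, b]" Cup] assms by simp
    also have "\<dots> = [(Cup, ?p)] @ sigma (a # b # B)" by simp
    also have "tiso (length B) (- (-1)) ([(Cup, ?p)] @ sigma (a # b # B))
        ([(Cup, ?p), (Neg, ?p)] @ sigma (a # b # B))"
      by (rule tiso_right[OF tiso.sym[OF cup_twist(2)[OF p]]]) simp
    finally show ?thesis using XY ba by auto
  next
    assume "(X, g, Y) = ([b, a], Cap, [])"
    then have XY: "X = [b, a]" "g = Cap" "Y = []" by auto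
    let ?m = "Suc (Suc (length B))"
    have "sigma (a # b # B) @ [(Cap, 0)] \<simeq>[?m] (Cap, ?p) # sigma B"
      using sigma_straight_slice[of "[a, b]" a B "[]" Cap] assms by simp
    then have "[(Neg, ?p)] @ sigma (a # b # B) @ [(Cap, 0)] \<simeq>[?m] [(Neg, ?p)] @ (Cap, ?p) # sigma B"
      by (rule tiso_left) (use p in auto)
    also have "\<dots> = [(Neg, ?p), (Cap, ?p)] @ sigma B" by simp
    also have "tiso ?m (-1) \<dots> ([(Cap, ?p)] @ sigma B)"
      by (rule tiso_right[OF cap_twist(2)]) (use p in auto)
    finally show ?thesis using XY ba by auto
  qed
qed

lemma filter_less_adjacent:
  fixes a b :: "'a :: linorder"
  assumes "\<And>z. z \<in> set B \<Longrightarrow> \<not> (a \<le> z \<and> z < b)" "a \<le> b"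
  shows "filter (\<lambda>y. y < b) B = filter (\<lambda>y. y < a) B"
  using assms by (intro filter_cong) fastforce+

text \<open>The two alternatives belong to the two uses of sorting: equal labels to strands coloured
  by components, neighbouring labels to heights of arcs.\<close>

definition adjacent_labels :: "'a :: linorder \<Rightarrow> 'a \<Rightarrow> 'a list \<Rightarrow> bool" where
  "adjacent_labels a b w \<longleftrightarrow> a = b \<or> (\<forall>z \<in> set w. \<not> (min a b \<le> z \<and> z \<le> max a b))"

lemma sigma_extremum:
  fixes a b :: "'a :: linorder"
  assumes "adjacent_labels a b (A @ B)"
    and "(X, g, Y) = ([], Cup, [a, b]) \<or> (X, g, Y) = ([a, b], Cap, [])"
  shows "\<exists>k. (a = b \<longrightarrow> k = 0) \<and> tiso (length (A @ X @ B)) k (sigma (A @ X @ B) @ [(g, length A)])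
    ((g, sorted_pos (min a b) A B) # sigma (A @ Y @ B))"
proof -
  let ?l = "min a b"
  have fil: "filter (\<lambda>y. y < max a b) B = filter (\<lambda>y. y < min a b) B"
  proof (rule filter_less_adjacent)
    show "min a b \<le> max a b" by (metis max.cobounded1 min.cobounded1 order_trans)
  qed (use assms(1) in \<open>auto simp: adjacent_labels_def\<close>)
  have XY: "length X = n_in g" "length Y = n_out g" "set (X @ Y) = {a, b}" using assms(2) by auto
  have "\<exists>k. (a = b \<longrightarrow> k = 0) \<and>
    tiso (length (X @ B)) k (sigma (X @ B) @ [(g, 0)]) ((g, sorted_pos ?l [] B) # sigma (Y @ B))"
  proof (cases "a \<le> b")
    case True
    then have "sigma (X @ B) @ [(g, 0)] \<simeq>[length (X @ B)] (g, sorted_pos ?l [] B) # sigma (Y @ B)"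
      using assms(2) fil by (intro sigma_straight_slice) auto
    then show ?thesis by blast
  next
    case False
    then have "b < a" "a \<noteq> b" "min a b = b" "max a b = a" by auto
    then show ?thesis using sigma_twisted_slice[of b a B X g Y] assms(2) fil by auto
  qed
  then obtain k where "a = b \<longrightarrow> k = 0"
    "tiso (length (X @ B)) k (sigma (X @ B) @ [(g, 0)]) ((g, sorted_pos ?l [] B) # sigma (Y @ B))"
    by blast
  moreover have "?l < x \<and> (\<forall>y \<in> set (X @ Y). y < x) \<or> x \<le> ?l \<and> (\<forall>y \<in> set (X @ Y). \<not> y < x)"
    if x: "x \<in> set A" for x
  proof -
    consider "a = b" | "x < min a b" | "max a b < x"
      using x assms(1) unfolding adjacent_labels_def by (metis UnCI not_le set_append)
    then show ?thesis
    proof cases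
      case 1
      then show ?thesis unfolding XY(3) by auto
    qed (unfold XY(3), auto simp: min_less_iff_disj)
  qed
  ultimately show ?thesis using sigma_slice_lift[OF _ XY(1,2), of B k ?l A] by blast
qed

lemma sigma_crossing_same:
  assumes "g \<in> {Pos, Neg}"
  shows "sigma (A @ [a, a] @ B) @ [(g, length A)] \<simeq>[length (A @ [a, a] @ B)]
    (g, sorted_pos a A B) # sigma (A @ [a, a] @ B)"
proof (rule sigma_slice_lift)
  show "sigma ([a, a] @ B) @ [(g, 0)] \<simeq>[length ([a, a] @ B)] (g, sorted_pos a [] B) # sigma ([a, a] @ B)"
    using assms by (intro sigma_straight_slice) auto
qed (use assms in auto)

text \<open>The second line runs below all strands it meets, so the crossings of the first one slide
  through it one at a time.\<close>

lemma line_line: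
  "p \<le> q \<Longrightarrow> Suc q < m \<Longrightarrow> line p @ line (Suc q) \<simeq>[m] line (Suc q) @ shift 1 (line p)"
proof (induction p)
  case 0
  then show ?case by (auto intro: tiso.refl)
next
  case (Suc p)
  have "[(Neg, p)] @ line p @ line (Suc q) \<simeq>[m] [(Neg, p)] @ line (Suc q) @ shift 1 (line p)"
    by (rule tiso_left) (use Suc in auto)
  also have "\<dots> = ([(Neg, p)] @ line (Suc q)) @ shift 1 (line p)" by simp
  also have "\<dots> \<simeq>[m] (line (Suc q) @ [(Neg, Suc p)]) @ shift 1 (line p)"
    using riso_sym[OF line_slide_left[of p Neg "Suc q" m]] Suc fits_wd_shift_line[of p 1 m]
    by (intro tiso_right) auto
  finally show ?case by simp
qed

text \<open>A crossing with the smaller label on top is of the kind that \<open>sigma\<close>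
  consists of, so the sorting absorbs it. For \<open>b < a\<close> it undoes the crossing of the
  other order by Reidemeister II.\<close>

lemma sigma_crossing_distinct:
  fixes a b :: "'a :: linorder"
  assumes "a \<noteq> b"
  shows "sigma (A @ [a, b] @ B) @ [(if a < b then Neg else Pos, length A)] \<simeq>[length (A @ [a, b] @ B)]
    sigma (A @ [b, a] @ B)"
proof (induction A)
  case Nil
  have less: "sigma (a # b # B) @ [(Neg, 0)] \<simeq>[length B + 2] sigma (b # a # B)" if "a < b" for a b :: 'a
  proof -
    define p q where "p = length (filter (\<lambda>y. y < a) B)" and "q = length (filter (\<lambda>y. y < b) B)"
    let ?m = "length B + 2"
    have "p \<le> q" unfolding p_def q_def using that by (induction B) auto
    then have pq: "p \<le> q" "p \<le> length B" "q \<le> length B" by (simp_all add: p_def q_def)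
    \<comment> \<open>The shifted line stops at position 1, and the additional crossing carries its
      strand on to position 0.\<close>
    have swap: "shift 1 (line q) @ [(Neg, 0)] = line (Suc q)" for q by (induction q) auto
    have sh: "fits ?m (shift 1 (line r))" "wd ?m (shift 1 (line r)) = ?m" if "r \<le> length B" for r
      using fits_wd_shift_line[of r 1 ?m] that by auto
    have "shift 2 (sigma B) @ [(Neg, 0)] \<simeq>[?m] [(Neg, 0)] @ shift 2 (sigma B)"
      using riso_sym[OF riso_exchange[of 2 "[(Neg, 0)]" "length B" "sigma B"]]
      by (simp add: numeral_2_eq_2)
    then have "(line p @ shift 1 (line q)) @ shift 2 (sigma B) @ [(Neg, 0)]
        \<simeq>[?m] (line p @ shift 1 (line q)) @ [(Neg, 0)] @ shift 2 (sigma B)"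
      by (rule tiso_left) (use pq sh in auto)
    also have "\<dots> = (line p @ line (Suc q)) @ shift 2 (sigma B)"
      unfolding swap[symmetric] by simp
    also have "\<dots> \<simeq>[?m] (line (Suc q) @ shift 1 (line p)) @ shift 2 (sigma B)"
      by (rule tiso_right[OF line_line]) (use pq in auto)
    finally show ?thesis using that by (simp add: numeral_2_eq_2 sigma.simps(2) less_not_sym p_def q_def)
  qed
  show ?case
  proof (cases "a < b")
    case True
    then show ?thesis using less[of a b] by simp
  next
    case False
    let ?m = "length B + 2"
    have "(sigma (b # a # B) @ [(Neg, 0)]) @ [(Pos, 0)] \<simeq>[?m] sigma (a # b # B) @ [(Pos, 0)]"
      using less[of b a] False assms by (intro tiso_right) auto
    then have "sigma (a # b # B) @ [(Pos, 0)] \<simeq>[?m] sigma (b # a # B) @ [(Neg, 0), (Pos, 0)]"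
      using riso_sym by simp
    also have "\<dots> \<simeq>[?m] sigma (b # a # B)"
      by (rule riso_moveI(1)[OF isotopy_moves(9), where u = "sigma (b # a # B)" and v = "[]"])
        auto
    finally show ?thesis using False by simp
  qed
next
  case (Cons x A)
  define w w' where "w = A @ [a, b] @ B" and "w' = A @ [b, a] @ B"
  define p where "p = length (filter (\<lambda>y. y < x) w)"
  have "p \<le> length w" unfolding p_def by (rule length_filter_le)
  have "p = length (filter (\<lambda>y. y < x) w')" "length w' = length w"
    by (simp_all add: p_def w_def w'_def)
  then have "sigma (x # w) = line p @ shift 1 (sigma w)" "sigma (x # w') = line p @ shift 1 (sigma w')"
    by (simp_all add: p_def sigma.simps(2))
  moreover have "line p @ shift 1 (sigma w @ [(if a < b then Neg else Pos, length A)])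
      \<simeq>[Suc (length w)] line p @ shift 1 (sigma w')"
    using tiso_left[OF tiso_shift[OF Cons, of 1], of "Suc (length w)" "line p"] \<open>p \<le> length w\<close>
    unfolding w_def w'_def by simp
  ultimately show ?case by (simp add: w_def w'_def)
qed

section \<open>Unknotting by crossing changes\<close>

definition switched :: "diagram \<Rightarrow> diagram \<Rightarrow> bool" where
  "switched = list_all2 (\<lambda>(g, i) (g', i'). i = i' \<and> (g = g' \<or> {g, g'} \<subseteq> {Pos, Neg}))"

lemma switched_refl [simp]: "switched u u"
  unfolding switched_def by (rule list_all2_refl) auto

lemma switched_append: "switched u u' \<Longrightarrow> switched v v' \<Longrightarrow> switched (u @ v) (u' @ v')"
  unfolding switched_def by (rule list_all2_appendI)

lemma switched_crossing: "g \<in> {Pos, Neg} \<Longrightarrow> h \<in> {Pos, Neg} \<Longrightarrow> switched [(g, i)] [(h, i)]"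
  by (auto simp: switched_def)

lemma fits_wd_switched: "switched u u' \<Longrightarrow> fits m u' = fits m u \<and> wd m u' = wd m u"
  unfolding switched_def
proof (induction arbitrary: m rule: list_all2_induct)
  case (Cons s u s' u')
  obtain g i h j where "s = (g, i)" "s' = (h, j)" by force
  then have "i = j" "n_in h = n_in g" "n_out h = n_out g" using Cons(1) by auto
  then show ?case using Cons \<open>s = _\<close> \<open>s' = _\<close> by simp
qed simp

definition crossings :: "diagram \<Rightarrow> nat" where
  "crossings l = length (filter (\<lambda>s. fst s \<in> {Pos, Neg}) l)"

lemma crossings_simps [simp]:
  "crossings [] = 0"
  "crossings ((g, i) # l) = (if g \<in> {Pos, Neg} then Suc (crossings l) else crossings l)"
  "crossings (l @ l') = crossings l + crossings l'"
  by (simp_all add: crossings_def)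

text \<open>An arc \<open>n\<close> of a tangle \<open>u\<close> without strands at the bottom has two ends \<open>Head n\<close> and
  \<open>Tail n\<close> at the top; \<open>ends u k\<close> says that \<open>k\<close> is the word of the ends at the top.\<close>

datatype arc_end = Head (arc: nat) | Tail (arc: nat)

fun flip :: "arc_end \<Rightarrow> arc_end" where
  "flip (Head n) = Tail n"
| "flip (Tail n) = Head n"

lemma flip_flip [simp]: "flip (flip e) = e"
  by (cases e) simp_all

lemma flip_neq [simp]: "flip e \<noteq> e" "e \<noteq> flip e"
  by (cases e; simp)+

lemma flip_eq_iff [simp]: "flip x = flip y \<longleftrightarrow> x = y"
  by (metis flip_flip)

inductive ends :: "diagram \<Rightarrow> arc_end list \<Rightarrow> bool" where
  Nil: "ends [] []"
| Cup: "ends u (A @ B) \<Longrightarrow> n \<notin> arc ` set (A @ B) \<Longrightarrow>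
    ends (u @ [(Cup, length A)]) (A @ [Head n, Tail n] @ B)"
| Cross: "ends u (A @ [e, e'] @ B) \<Longrightarrow> g \<in> {Pos, Neg} \<Longrightarrow>
    ends (u @ [(g, length A)]) (A @ [e', e] @ B)"
| Close: "ends u (A @ [e, flip e] @ B) \<Longrightarrow> ends (u @ [(Cap, length A)]) (A @ B)"
| Join: "ends u (A @ [e, e'] @ B) \<Longrightarrow> e' \<noteq> flip e \<Longrightarrow>
    ends (u @ [(Cap, length A)]) (map (id(flip e' := e)) (A @ B))"

text \<open>When two different arcs are joined, the outer end \<open>flip e'\<close> takes over the
  name \<open>e\<close>, which has just become free. The surviving ends \<open>flip e\<close> and
  \<open>e\<close> are partners again, so the word stays closed under \<open>flip\<close>.\<close>

lemma ends_closed: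
  assumes "ends u k"
  shows "distinct k \<and> flip ` set k \<subseteq> set k \<and> fits 0 u \<and> wd 0 u = length k"
  using assms
proof (induction rule: ends.induct)
  case (Cup u A B n)
  then show ?case by (auto simp: image_iff Bex_def)
next
  case (Cross u A e e' B g)
  then show ?case by auto
next
  case (Close u A e B)
  then have d: "distinct (A @ [e, flip e] @ B)" and c: "\<And>x. x \<in> set (A @ [e, flip e] @ B) \<Longrightarrow> flip x \<in> set (A @ [e, flip e] @ B)"
    by auto
  have "flip x \<in> set (A @ B)" if "x \<in> set (A @ B)" for x
    using c[of x] d that by auto
  then show ?case using Close d by auto
next
  case (Join u A e e' B)
  then have d: "distinct (A @ [e, e'] @ B)" and c: "\<And>x. x \<in> set (A @ [e, e'] @ B) \<Longrightarrow> flip x \<in> set (A @ [e, e'] @ B)"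
    by auto
  let ?r = "id(flip e' := e)"
  have "inj_on ?r (set (A @ B))" using d by (auto simp: inj_on_def)
  then have 1: "distinct (map ?r (A @ B))" using d by (simp only: distinct_map) auto
  have fe: "flip e' \<in> set (A @ B)" "flip e \<in> set (A @ B)"
    using c[of e'] c[of e] Join(2) by auto
  have "flip (?r x) \<in> ?r ` set (A @ B)" if x: "x \<in> set (A @ B)" for x
  proof (cases "x = flip e'")
    case True
    moreover have "flip e = ?r (flip e)" using d by auto
    ultimately show ?thesis using fe by auto
  next
    case False
    show ?thesis
    proof (cases "x = flip e")
      case True
      then show ?thesis using False fe(1) by (auto intro!: image_eqI[of _ _ "flip e'"])
    next
      case xe: False
      have "flip x \<noteq> e" "flip x \<noteq> e'" using False xe by auto
      then have "flip x \<in> set (A @ B)" using c[of x] x by auto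
      moreover have "flip x \<noteq> flip e'" using x d by auto
      ultimately show ?thesis using False by (auto intro!: image_eqI[of _ _ "flip x"])
    qed
  qed
  then have 2: "flip ` set (map ?r (A @ B)) \<subseteq> set (map ?r (A @ B))" by (auto simp only: set_map)
  then show ?case using Join 1 by auto
qed (auto)

lemma split_word:
  assumes "i + n \<le> length k"
  obtains A X B where "k = A @ X @ B" "length A = i" "length X = n"
proof
  show "k = take i k @ take n (drop i k) @ drop n (drop i k)" by (simp only: append_take_drop_id)
qed (use assms in auto)

lemma ends_exists: "fits 0 u \<Longrightarrow> \<exists>k. ends u k"
proof (induction u rule: rev_induct)
  case Nil
  then show ?case using ends.Nil by blast
next
  case (snoc s u)
  obtain g i where s: "s = (g, i)" by force
  obtain k where k: "ends u k" using snoc by auto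
  have "i + n_in g \<le> length k" using snoc(2) ends_closed[OF k] s by simp
  then obtain A X B where AXB: "k = A @ X @ B" "length A = i" "length X = n_in g"
    by (rule split_word)
  show ?case
  proof (cases g)
    case Cup
    obtain n where "n \<notin> arc ` set k"
      using ex_new_if_finite[of "arc ` set k"] infinite_UNIV_nat by auto
    then show ?thesis using ends.Cup[of u A B n] k AXB s Cup by auto
  next
    case Cap
    then obtain e e' where X: "X = [e, e']" using AXB(3)
      by (auto simp: numeral_2_eq_2 length_Suc_conv)
    then show ?thesis using ends.Close[of u A e B] ends.Join[of u A e e' B] k AXB s Cap
      by (cases "e' = flip e") auto
  next
    case Pos
    then obtain e e' where X: "X = [e, e']" using AXB(3)
      by (auto simp: numeral_2_eq_2 length_Suc_conv)
    then show ?thesis using ends.Cross[of u A e e' B Pos] k AXB s Pos by auto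
  next
    case Neg
    then obtain e e' where X: "X = [e, e']" using AXB(3)
      by (auto simp: numeral_2_eq_2 length_Suc_conv)
    then show ?thesis using ends.Cross[of u A e e' B Neg] k AXB s Neg by auto
  qed
qed

text \<open>The heights of the two ends of an arc bound an interval that contains no other height.
  Writing out the case \<open>f e < f (flip e)\<close> suffices, since the words of ends are closed
  under \<open>flip\<close>.\<close>

definition separated :: "(arc_end \<Rightarrow> real) \<Rightarrow> arc_end set \<Rightarrow> bool" where
  "separated f K \<longleftrightarrow> inj_on f K \<and> (\<forall>e \<in> K. \<forall>x \<in> K. \<not> (f e < f x \<and> f x < f (flip e)))"

text \<open>Heights are extended downwards through a cap, from the word above it to the word below.
  A component that closes here is unrelated to the other arcs and is placed above all of
  them.\<close>

lemma separated_close: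
  assumes "separated f (set (A @ B))" "distinct (A @ [e, flip e] @ B)"
    "flip ` set (A @ B) \<subseteq> set (A @ B)"
  obtains f' where "separated f' (set (A @ [e, flip e] @ B))" "map f' (A @ B) = map f (A @ B)"
proof -
  obtain M where M: "\<And>x. x \<in> set (A @ B) \<Longrightarrow> f x < M"
    using finite_imageI[of "set (A @ B)" f] by (metis finite_set bdd_above_finite bdd_above_def image_eqI le_less_trans lt_ex gt_ex)
  define f' where "f' = f(e := M + 1, flip e := M + 2)"
  have same: "f' x = f x" if "x \<in> set (A @ B)" for x using that assms(2) by (auto simp: f'_def)
  have new: "f' e = M + 1" "f' (flip e) = M + 2" by (auto simp: f'_def)
  have "separated f' (set (A @ B) \<union> {e, flip e})"
    unfolding separated_def
  proof (intro conjI ballI)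
    show "inj_on f' (set (A @ B) \<union> {e, flip e})"
    proof (rule inj_onI)
      fix x y
      assume "x \<in> set (A @ B) \<union> {e, flip e}" "y \<in> set (A @ B) \<union> {e, flip e}" "f' x = f' y"
      moreover have "inj_on f (set (A @ B))" using assms(1) by (simp add: separated_def)
      ultimately show "x = y" using same[of x] same[of y] M[of x] M[of y] new by (auto dest: inj_onD)
    qed
    fix x y
    assume x: "x \<in> set (A @ B) \<union> {e, flip e}" and y: "y \<in> set (A @ B) \<union> {e, flip e}"
    consider "x \<in> set (A @ B)" "flip x \<in> set (A @ B)" | "x = e" | "x = flip e"
      using x assms(3) by auto
    then show "\<not> (f' x < f' y \<and> f' y < f' (flip x))"
    proof cases
      case 1
      then show ?thesis using same[of x] same[of "flip x"] same[of y] M[of "flip x"] y new assms(1)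
        unfolding separated_def by auto
    next
      case 2
      then show ?thesis using y new M[of y] same[of y] by auto
    next
      case 3
      then show ?thesis using y new M[of y] same[of y] by auto
    qed
  qed
  moreover have "set (A @ [e, flip e] @ B) = set (A @ B) \<union> {e, flip e}" by auto
  ultimately show thesis using that[of f'] same by auto
qed

text \<open>The joined arc occupies the interval between \<open>f (flip e)\<close> and
  \<open>f e\<close>. Dividing it into thirds gives the outer thirds to the two arcs below the cap
  and leaves the middle third free, so that the two ends meeting at the cap have neighbouring
  heights.\<close>

lemma separated_join:
  assumes "separated f (set (map (id(flip e' := e)) (A @ B)))" "distinct (A @ [e, e'] @ B)"
    "flip ` set (A @ [e, e'] @ B) \<subseteq> set (A @ [e, e'] @ B)" "e' \<noteq> flip e"
  obtains f' where "separated f' (set (A @ [e, e'] @ B))"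
    "map f' (A @ B) = map f (map (id(flip e' := e)) (A @ B))"
    "\<And>x. x \<in> set (A @ B) \<Longrightarrow> \<not> (f' e < f' x \<and> f' x < f' e') \<and> \<not> (f' e' < f' x \<and> f' x < f' e)"
proof -
  let ?K = "set (map (id(flip e' := e)) (A @ B))"
  define D where "D = set (A @ B) - {flip e, flip e'}"
  have fl: "flip e \<in> set (A @ B)" "flip e' \<in> set (A @ B)" "flip e \<noteq> flip e'" "e \<noteq> e'"
    using assms(2,3,4) by auto
  have K: "?K = D \<union> {flip e, e}" using fl assms(2) by (auto simp: D_def)
  have S: "set (A @ [e, e'] @ B) = D \<union> {flip e, e, flip e', e'}" using fl by (auto simp: D_def)
  have notin: "e \<notin> D" "e' \<notin> D" "flip e \<notin> D" "flip e' \<notin> D" using assms(2) by (auto simp: D_def)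
  have Dflip: "flip x \<in> D" if "x \<in> D" for x
  proof -
    have "flip x \<in> D \<union> {flip e, e, flip e', e'}" using assms(3) that unfolding S by blast
    then show ?thesis using that notin by auto
  qed
  define s t where "s = f (flip e)" and "t = f e"
  define f' where "f' = f(flip e' := t, e := (2 * s + t) / 3, e' := (s + 2 * t) / 3)"
  have f': "f' e = (2 * s + t) / 3" "f' e' = (s + 2 * t) / 3" "f' (flip e) = s" "f' (flip e') = t"
    using fl assms(4) by (auto simp: f'_def s_def)
  have f'D: "f' x = f x" if "x \<in> D" for x using that notin by (auto simp: f'_def)
  have inj: "inj_on f (D \<union> {flip e, e})" and sep: "\<And>x y. x \<in> D \<union> {flip e, e} \<Longrightarrow> y \<in> D \<union> {flip e, e} \<Longrightarrow> \<not> (f x < f y \<and> f y < f (flip x))"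
    using assms(1) unfolding K separated_def by auto
  have "s \<noteq> t" using inj unfolding s_def t_def inj_on_def by auto
  \<comment> \<open>No other height lies inside the interval of the joined arc, so each of them is
    on one side of all four new values.\<close>
  have out: "f x < s \<and> f x < t \<or> s < f x \<and> t < f x" if "x \<in> D" for x
  proof -
    have "f x \<noteq> s" "f x \<noteq> t" using inj that notin unfolding s_def t_def inj_on_def by blast+
    moreover have "\<not> (s < f x \<and> f x < t)" "\<not> (t < f x \<and> f x < s)"
      using sep[of "flip e" x] sep[of e x] that unfolding s_def t_def by auto
    ultimately show ?thesis by linarith
  qed
  have "separated f' (D \<union> {flip e, e, flip e', e'})"
    unfolding separated_def
  proof (intro conjI ballI)
    show "inj_on f' (D \<union> {flip e, e, flip e', e'})"
    proof (rule inj_onI)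
      fix x y
      assume xy: "x \<in> D \<union> {flip e, e, flip e', e'}" "y \<in> D \<union> {flip e, e, flip e', e'}" "f' x = f' y"
      consider "x \<in> D" "y \<in> D" | "x \<in> D" "y \<notin> D" | "x \<notin> D" "y \<in> D" | "x \<notin> D" "y \<notin> D" by auto
      then show "x = y"
      proof cases
        case 1
        then show ?thesis using xy(3) f'D inj by (auto dest: inj_onD)
      next
        case 2
        then show ?thesis using xy f' f'D[of x] out[of x] \<open>s \<noteq> t\<close> by (auto simp: field_simps)
      next
        case 3
        then show ?thesis using xy f' f'D[of y] out[of y] \<open>s \<noteq> t\<close> by (auto simp: field_simps)
      next
        case 4
        then show ?thesis using xy f' \<open>s \<noteq> t\<close> by (auto simp: field_simps)
      qed
    qed
    fix x y
    assume x: "x \<in> D \<union> {flip e, e, flip e', e'}" and y: "y \<in> D \<union> {flip e, e, flip e', e'}"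
    show "\<not> (f' x < f' y \<and> f' y < f' (flip x))"
    proof (cases "x \<in> D")
      case True
      then have fx: "f' x = f x" "f' (flip x) = f (flip x)" using f'D Dflip by auto
      have se: "\<not> (f x < s \<and> s < f (flip x))" "\<not> (f x < t \<and> t < f (flip x))"
        using sep[of x "flip e"] sep[of x e] True unfolding s_def t_def by auto
      show ?thesis
      proof (cases "y \<in> D")
        case True
        then show ?thesis using f'D[of y] fx sep[of x y] \<open>x \<in> D\<close> by auto
      next
        case False
        then have "f' y \<in> {s, t, (2 * s + t) / 3, (s + 2 * t) / 3}" using y f' by auto
        then show ?thesis
          using fx se out[OF True] out[OF Dflip[OF True]] by (auto simp: field_simps)
      qed
    next
      case False
      then have "(f' x, f' (flip x)) \<in> {(s, (2 * s + t) / 3), ((2 * s + t) / 3, s), (t, (s + 2 * t) / 3), ((s + 2 * t) / 3, t)}"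
        using x f' by auto
      moreover have "f' y \<in> {s, t, (2 * s + t) / 3, (s + 2 * t) / 3} \<or> f' y < s \<and> f' y < t \<or> s < f' y \<and> t < f' y"
        using y f' f'D[of y] out[of y] by auto
      ultimately show ?thesis by (auto simp: field_simps)
    qed
  qed
  then have "separated f' (set (A @ [e, e'] @ B))" unfolding S .
  moreover have "f' x = f ((id(flip e' := e)) x)" if "x \<in> set (A @ B)" for x
    using that f' f'D[of x] assms(2) unfolding t_def s_def D_def by auto
  moreover have "\<not> (f' e < f' x \<and> f' x < f' e') \<and> \<not> (f' e' < f' x \<and> f' x < f' e)"
    if "x \<in> set (A @ B)" for x
  proof -
    have "f' x \<in> {s, t} \<or> f' x < s \<and> f' x < t \<or> s < f' x \<and> t < f' x"
    proof (cases "x \<in> D")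
      case True
      then show ?thesis using f'D[OF True] out[OF True] by simp
    next
      case False
      then have "x = flip e \<or> x = flip e'" using that by (auto simp: D_def)
      then show ?thesis using f' by auto
    qed
    then show ?thesis using f' by (auto simp: field_simps)
  qed
  ultimately show thesis using that[of f'] by simp
qed

lemma adjacent_labels_separated:
  assumes "separated f (set (A @ [e, e'] @ B))" "distinct (A @ [e, e'] @ B)"
    and "\<And>x. x \<in> set (A @ B) \<Longrightarrow> \<not> (f e < f x \<and> f x < f e') \<and> \<not> (f e' < f x \<and> f x < f e)"
  shows "adjacent_labels (f e) (f e') (map f A @ map f B)"
  unfolding adjacent_labels_def
proof (intro disjI2 ballI)
  fix z assume "z \<in> set (map f A @ map f B)"
  then obtain x where x: "x \<in> set (A @ B)" "z = f x" by auto
  then have "f x \<noteq> f e" "f x \<noteq> f e'" using assms(1,2) unfolding separated_def inj_on_def by auto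
  then show "\<not> (min (f e) (f e') \<le> z \<and> z \<le> max (f e) (f e'))"
    using assms(3)[OF x(1)] x(2) by (auto simp: min_def max_def split: if_splits)
qed

text \<open>Up to crossing changes and curls, all extrema can be moved below the crossings:
  \<open>b\<close> collects them, and \<open>sigma w\<close> carries the ends to their
  places.\<close>

definition sortable :: "diagram \<Rightarrow> 'a :: linorder list \<Rightarrow> bool" where
  "sortable u w \<longleftrightarrow> (\<exists>u' b k. switched u u' \<and> crossings b = 0 \<and> wd 0 b = length w \<and>
     tiso 0 k u' (b @ sigma w))"

lemma sortable_step:
  assumes "sortable u w" "switched [s] [s']" "tiso (length w) k (sigma w @ [s']) (l @ sigma w')"
    "crossings l = 0" "wd (length w) l = length w'"
  shows "sortable (u @ [s]) w'"
proof -
  obtain u' b j where u': "switched u u'" "crossings b = 0" "wd 0 b = length w"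
    "tiso 0 j u' (b @ sigma w)"
    using assms(1) unfolding sortable_def by blast
  have b: "fits 0 b" "wd 0 u' = length w" "fits (length w) [s']"
    using tiso_fits_wd[OF u'(4)] tiso_fits_wd[OF assms(3)] u'(3) by auto
  have "tiso 0 j (u' @ [s']) ((b @ sigma w) @ [s'])"
    by (rule tiso_right[OF u'(4)]) (use b in simp)
  moreover have "tiso 0 k (b @ (sigma w @ [s'])) (b @ (l @ sigma w'))"
    by (rule tiso_left[OF assms(3)]) (use u' b in auto)
  ultimately have "tiso 0 (j + k) (u' @ [s']) ((b @ l) @ sigma w')"
    using tiso.trans[of 0 j "u' @ [s']" "b @ sigma w @ [s']" k] by simp
  moreover have "switched (u @ [s]) (u' @ [s'])" using switched_append u'(1) assms(2) by blast
  moreover have "crossings (b @ l) = 0" "wd 0 (b @ l) = length w'" using u' assms(4,5) by simp_all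
  ultimately show ?thesis unfolding sortable_def by blast
qed

lemma sortable_extremum:
  fixes a b :: "'a :: linorder"
  assumes "sortable u (A @ X @ B)" "adjacent_labels a b (A @ B)"
    and "(X, g, Y) = ([], Cup, [a, b]) \<or> (X, g, Y) = ([a, b], Cap, [])"
  shows "sortable (u @ [(g, length A)]) (A @ Y @ B)"
proof -
  let ?l = "[(g, sorted_pos (min a b) A B)]"
  obtain k where "tiso (length (A @ X @ B)) k (sigma (A @ X @ B) @ [(g, length A)]) (?l @ sigma (A @ Y @ B))"
    using sigma_extremum[OF assms(2,3)] by auto
  then show ?thesis
    by (rule sortable_step[OF assms(1) switched_refl]) (use assms(3) in auto)
qed

text \<open>The labels are heights on a descending tangle: different arcs occupy disjoint intervals of
  heights.\<close>

lemma sortable_ends: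
  assumes "ends u k" "separated f (set k)"
  shows "sortable u (map f k)"
  using assms
proof (induction arbitrary: f rule: ends.induct)
  case Nil
  show ?case unfolding sortable_def
    by (intro exI[of _ "[]"] exI[of _ 0]) (auto intro: tiso.refl)
next
  case (Cup u A B n)
  have d: "distinct (A @ [Head n, Tail n] @ B)" using ends_closed[OF ends.Cup[OF Cup(1,2)]] by simp
  have "separated f (set (A @ B))" using Cup(4) unfolding separated_def by (auto simp: inj_on_def)
  then have "sortable u (map f A @ [] @ map f B)" using Cup.IH by simp
  moreover have "adjacent_labels (f (Head n)) (f (Tail n)) (map f A @ map f B)"
  proof (rule adjacent_labels_separated[OF Cup(4) d])
    fix x assume "x \<in> set (A @ B)"
    then show "\<not> (f (Head n) < f x \<and> f x < f (Tail n)) \<and> \<not> (f (Tail n) < f x \<and> f x < f (Head n))"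
      using Cup(4) unfolding separated_def by (auto dest: bspec[of _ _ "Head n"] bspec[of _ _ "Tail n"])
  qed
  ultimately show ?case using sortable_extremum[of u "map f A" "[]" "map f B" "f (Head n)" "f (Tail n)" Cup] by simp
next
  case (Cross u A e e' B g)
  have d: "distinct (A @ [e, e'] @ B)" using ends_closed[OF Cross(1)] by simp
  have s: "separated f (set (A @ [e, e'] @ B))" using Cross(4) by (simp add: insert_commute)
  then have ne: "f e \<noteq> f e'" using d unfolding separated_def inj_on_def by auto
  \<comment> \<open>The heights dictate the type of the crossing; a switch makes up for the
    difference from \<open>g\<close>.\<close>
  have step: "tiso (length (map f (A @ [e, e'] @ B))) 0
      (sigma (map f (A @ [e, e'] @ B)) @ [(if f e < f e' then Neg else Pos, length A)])
      ([] @ sigma (map f (A @ [e', e] @ B)))"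
    using sigma_crossing_distinct[OF ne, of "map f A" "map f B"] by simp
  show ?case
    by (rule sortable_step[OF Cross.IH[OF s] switched_crossing[OF Cross(2)] step]) auto
next
  case (Close u A e B)
  have d: "distinct (A @ [e, flip e] @ B)" using ends_closed[OF Close(1)] by simp
  have "flip ` set (A @ B) \<subseteq> set (A @ B)" using ends_closed[OF ends.Close[OF Close(1)]] by simp
  then obtain f' where f': "separated f' (set (A @ [e, flip e] @ B))" "map f' (A @ B) = map f (A @ B)"
    using separated_close[OF Close(3) d] by blast
  have "adjacent_labels (f' e) (f' (flip e)) (map f' A @ map f' B)"
  proof (rule adjacent_labels_separated[OF f'(1) d])
    fix x assume "x \<in> set (A @ B)"
    then show "\<not> (f' e < f' x \<and> f' x < f' (flip e)) \<and> \<not> (f' (flip e) < f' x \<and> f' x < f' e)"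
      using f'(1) unfolding separated_def by (auto dest: bspec[of _ _ e] bspec[of _ _ "flip e"])
  qed
  then have "sortable (u @ [(Cap, length (map f' A))]) (map f' A @ [] @ map f' B)"
    using Close.IH[OF f'(1)] by (intro sortable_extremum) auto
  then show ?case unfolding f'(2)[symmetric] by simp
next
  case (Join u A e e' B)
  have d: "distinct (A @ [e, e'] @ B)" and c: "flip ` set (A @ [e, e'] @ B) \<subseteq> set (A @ [e, e'] @ B)"
    using ends_closed[OF Join(1)] by auto
  obtain f' where f': "separated f' (set (A @ [e, e'] @ B))"
    "map f' (A @ B) = map f (map (id(flip e' := e)) (A @ B))"
    "\<And>x. x \<in> set (A @ B) \<Longrightarrow> \<not> (f' e < f' x \<and> f' x < f' e') \<and> \<not> (f' e' < f' x \<and> f' x < f' e)"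
    using separated_join[OF Join(4) d c Join(2)] by blast
  have "adjacent_labels (f' e) (f' e') (map f' A @ map f' B)"
    by (rule adjacent_labels_separated[OF f'(1) d f'(3)])
  then have "sortable (u @ [(Cap, length (map f' A))]) (map f' A @ [] @ map f' B)"
    using Join.IH[OF f'(1)] by (intro sortable_extremum) auto
  then show ?case unfolding f'(2)[symmetric] by simp
qed

section \<open>Framed invariants and skein invariants\<close>

definition framed_invariant :: "(diagram \<Rightarrow> laurent) \<Rightarrow> bool" where
  "framed_invariant G \<longleftrightarrow> (\<forall>L L'. local_move isotopy_move L L' \<longrightarrow> G L = G L') \<and>
     (\<forall>s u l v. curl s l \<and> link_diagram (u @ l @ v) \<longrightarrow> G (u @ l @ v) = a_pow s * G (u @ v))"

text \<open>These are the axioms of the Kauffman polynomial without the normalization. They are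
  linear, so that a difference of two solutions is again a solution.\<close>

definition skein_invariant :: "(diagram \<Rightarrow> laurent) \<Rightarrow> bool" where
  "skein_invariant G \<longleftrightarrow> framed_invariant G \<and>
     (\<forall>h Lp Lm L0 Linf. conway_quadruple h Lp Lm L0 Linf \<longrightarrow>
        G Lp + G Lm = w_pow 1 * (G L0 + G Linf))"

lemma pow_mult:
  "z_pow m * z_pow n = z_pow (m + n)" "w_pow m * w_pow n = w_pow (m + n)"
  "a_pow m * a_pow n = a_pow (m + n)" "E_pow m * E_pow n = E_pow (m + n)"
  by (simp_all add: z_pow_def w_pow_def a_pow_def E_pow_def mult_single)

lemma pow_0 [simp]: "z_pow 0 = 1" "w_pow 0 = 1" "a_pow 0 = 1" "E_pow 0 = 1"
  by (simp_all add: z_pow_def w_pow_def a_pow_def E_pow_def zero_prod_def[symmetric])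

lemma regular_isotopic_eq: "regular_isotopic = equivclp (local_move isotopy_move)"
proof -
  have "isotopy_move = (\<lambda>l l'. planar_move l l' \<or> reidemeister2 l l' \<or> reidemeister3 l l')"
    by (intro ext) (simp add: isotopy_move_def)
  then show ?thesis unfolding regular_isotopic_def by simp
qed

lemma regular_isotopy_invariant_iff:
  "regular_isotopy_invariant F \<longleftrightarrow> (\<forall>L L'. local_move isotopy_move L L' \<longrightarrow> F L = F L')"
proof
  assume F: "\<forall>L L'. local_move isotopy_move L L' \<longrightarrow> F L = F L'"
  have "F L = F L'" if "equivclp (local_move isotopy_move) L L'" for L L'
    using that
  proof (induction rule: equivclp_induct)
    case (step y z)
    then have "F y = F z" using F by metis
    then show ?case using step(3) by simp
  qed simp
  then show "regular_isotopy_invariant F"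
    unfolding regular_isotopy_invariant_def regular_isotopic_eq by simp
next
  assume "regular_isotopy_invariant F"
  then show "\<forall>L L'. local_move isotopy_move L L' \<longrightarrow> F L = F L'"
    unfolding regular_isotopy_invariant_def regular_isotopic_eq by (simp add: r_into_equivclp)
qed

lemma kauffman_polynomial_iff:
  "kauffman_polynomial Q \<longleftrightarrow> skein_invariant Q \<and> Q [(Cup, 0), (Cap, 0)] = 1"
  unfolding kauffman_polynomial_def skein_invariant_def framed_invariant_def regular_isotopy_invariant_iff
  by (rule iffI; elim conjE; intro conjI; assumption)

text \<open>The empty list is not a link diagram, so no move may produce it. Every move that erases
  all of its slices needs a strand entering from below.\<close>

lemma tiso_nonempty: "tiso m k l l' \<Longrightarrow> m = 0 \<Longrightarrow> l = [] \<longleftrightarrow> l' = []"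
proof (induction rule: tiso.induct)
  case (move l l' m u v)
  then show ?case by (cases rule: isotopy_move_cases) auto
next
  case (curl s l m u v)
  then show ?case by (elim curl_cases) auto
qed auto

lemma tiso_link_diagram:
  assumes "tiso 0 k L L'"
  shows "link_diagram L \<longleftrightarrow> link_diagram L'"
  using tiso_nonempty[OF assms] tiso_fits_wd[OF assms] by (auto simp: link_diagram_iff)

lemma framed_invariant_tiso:
  assumes "framed_invariant G" "tiso 0 k L L'" "link_diagram L"
  shows "G L = a_pow k * G L'"
proof -
  have "G l = a_pow k * G l'" if "tiso m k l l'" "m = 0" "link_diagram l" for m l l'
    using that
  proof (induction rule: tiso.induct)
    case (move l l' m u v)
    then have "link_diagram (u @ l' @ v)" using tiso_link_diagram[OF tiso.move[of l l' 0 u v]] by simp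
    then have "local_move isotopy_move (u @ l @ v) (u @ l' @ v)"
      using move unfolding local_move_def by blast
    then show ?case using assms(1) by (simp add: framed_invariant_def)
  next
    case (curl s l m u v)
    then show ?case using assms(1) by (simp add: framed_invariant_def)
  next
    case (sym m k l l')
    then have "G l = a_pow k * G l'" using tiso_link_diagram by blast
    then show ?case by (simp add: pow_mult mult.assoc[symmetric])
  next
    case (trans m j l l' k l'')
    then have "G l = a_pow j * G l'" "G l' = a_pow k * G l''" using tiso_link_diagram by blast+
    then show ?case by (simp add: pow_mult mult.assoc[symmetric])
  qed simp
  then show ?thesis using assms by blast
qed

lemma skein_invariant_skein:
  assumes "skein_invariant G" "link_diagram (u @ (g, i) # v)" "{g, h} = {Pos, Neg}"
  shows "G (u @ (g, i) # v) + G (u @ (h, i) # v) =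
    w_pow 1 * (G (u @ (Cap, i) # (Cup, i) # v) + G (u @ v))"
proof -
  have *: "g = Pos \<and> h = Neg \<or> g = Neg \<and> h = Pos" using assms(3) by (auto simp: doubleton_eq_iff)
  then have "link_diagram (u @ [(Pos, i)] @ v)" using assms(2) by (auto simp: link_diagram_iff)
  then have "conway_quadruple (length u) (u @ [(Pos, i)] @ v) (u @ [(Neg, i)] @ v)
      (u @ [(Cap, i), (Cup, i)] @ v) (u @ v)"
    unfolding conway_quadruple_def by blast
  then have "G (u @ [(Pos, i)] @ v) + G (u @ [(Neg, i)] @ v) =
      w_pow 1 * (G (u @ [(Cap, i), (Cup, i)] @ v) + G (u @ v))"
    using assms(1) unfolding skein_invariant_def by blast
  then show ?thesis using * by (auto simp: add.commute)
qed

lemma w_pow_cancel: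
  fixes x y :: laurent
  assumes "x = w_pow 1 * y"
  shows "y = w_pow (-1) * x"
  using assms by (simp add: pow_mult mult.assoc[symmetric])

text \<open>The two smoothings of the crossing of a curl are the strand itself and the strand with a
  circle next to it.\<close>

lemma skein_invariant_circle:
  assumes G: "skein_invariant G" and uv: "link_diagram (u @ v)" "0 < wd 0 u" "i \<le> wd 0 u"
  shows "G (u @ (Cup, i) # (Cap, i) # v) = gamma * G (u @ v)"
proof -
  \<comment> \<open>The circle is made to cross a neighbouring strand: the one on its right if the
    circle is leftmost, otherwise the one on its left.\<close>
  obtain k where jk: "k = Suc i \<or> i = Suc k" and k: "k + 2 \<le> Suc (Suc (wd 0 u))"
    and curls: "curl 1 [(Cup, i), (Neg, k), (Cap, i)]" "curl (-1) [(Cup, i), (Pos, k), (Cap, i)]"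
  proof (cases i)
    case 0
    then show thesis using that[of "Suc i"] curls[of 0] uv(2) by simp
  next
    case (Suc j)
    then show thesis using that[of j] curls[of j] uv(3) by simp
  qed
  have fit: "fits 0 u" "fits (wd 0 u) v" "wd (wd 0 u) v = 0" using uv by (auto simp: link_diagram_iff)
  have link: "link_diagram (u @ [(Cup, i), (g, k), (Cap, i)] @ v)" if "g \<in> {Pos, Neg}" for g
    using that fit uv(3) k by (auto simp: link_diagram_iff)
  have fr: "G (u @ l @ v) = a_pow s * G (u @ v)" if "curl s l" "link_diagram (u @ l @ v)" for s l
    using G that unfolding skein_invariant_def framed_invariant_def by simp
  have "G (u @ [(Cup, i), (Neg, k), (Cap, i)] @ v) = a_pow 1 * G (u @ v)"
    "G (u @ [(Cup, i), (Pos, k), (Cap, i)] @ v) = a_pow (-1) * G (u @ v)"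
    using fr[OF curls(1)] fr[OF curls(2)] link by simp_all
  moreover have "G ((u @ [(Cup, i)]) @ (Neg, k) # (Cap, i) # v) + G ((u @ [(Cup, i)]) @ (Pos, k) # (Cap, i) # v)
      = w_pow 1 * (G ((u @ [(Cup, i)]) @ (Cap, k) # (Cup, k) # (Cap, i) # v) + G ((u @ [(Cup, i)]) @ (Cap, i) # v))"
    by (rule skein_invariant_skein[OF G]) (use link[of Neg] in auto)
  moreover have "G (u @ [(Cup, i), (Cap, k), (Cup, k), (Cap, i)] @ v) = G (u @ v)"
  proof -
    have zz: "isotopy_move [(Cup, i), (Cap, k)] []" "isotopy_move [(Cup, k), (Cap, i)] []"
      using jk isotopy_moves(2,3) by auto
    have "u @ [(Cup, i), (Cap, k)] @ ([(Cup, k), (Cap, i)] @ v) \<simeq>[0] u @ [] @ ([(Cup, k), (Cap, i)] @ v)"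
      by (rule tiso.move[OF zz(1)]) (use fit uv(3) k jk in auto)
    also have "u @ [] @ ([(Cup, k), (Cap, i)] @ v) = u @ [(Cup, k), (Cap, i)] @ v" by simp
    also have "\<dots> \<simeq>[0] u @ [] @ v"
      by (rule tiso.move[OF zz(2)]) (use fit uv(3) k jk in auto)
    finally have *: "u @ [(Cup, i), (Cap, k), (Cup, k), (Cap, i)] @ v \<simeq>[0] u @ v" by simp
    show ?thesis
      using framed_invariant_tiso[OF _ *] G tiso_link_diagram[OF *] uv(1)
      unfolding skein_invariant_def by simp
  qed
  \<comment> \<open>Adding the two curls gives (a + 1/a) G = w (G + circle). Solving for the value
    with the circle produces \<open>gamma\<close>.\<close>
  ultimately have "(a_pow 1 + a_pow (-1)) * G (u @ v) = w_pow 1 * (G (u @ v) + G (u @ (Cup, i) # (Cap, i) # v))"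
    by (simp add: algebra_simps)
  from w_pow_cancel[OF this] show ?thesis
    unfolding gamma_def by (simp add: algebra_simps)
qed

lemma link_diagram_first:
  assumes "link_diagram L"
  obtains v where "L = (Cup, 0) # v"
proof -
  obtain g i v where L: "L = (g, i) # v" using assms by (cases L) (auto simp: link_diagram_iff)
  then have "n_in g = 0" "i = 0" using assms by (auto simp: link_diagram_iff)
  then show thesis using that[of v] L by (cases g) auto
qed

text \<open>At the bottom of the diagram there is no strand that the circle could be joined to by a
  crossing. It is therefore moved past the first minimum.\<close>

lemma skein_invariant_circle_below:
  assumes G: "skein_invariant G" and L: "link_diagram L"
  shows "G ((Cup, 0) # (Cap, 0) # L) = gamma * G L"
proof -
  obtain v where v: "L = (Cup, 0) # v" using L by (rule link_diagram_first)
  have fit: "fits 2 v" "wd 2 v = 0" using L v by (auto simp: link_diagram_iff numeral_2_eq_2)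
  have "[(Cup, 0)] @ [(Cap, 0), (Cup, 0)] @ v \<simeq>[0] [(Cup, 0)] @ [(Cup, 2), (Cap, 0)] @ v"
    by (rule tiso.move) (use isotopy_moves(1)[of Cap 0 Cup 0] fit in \<open>auto simp: numeral_2_eq_2\<close>)
  also have "[(Cup, 0)] @ [(Cup, 2), (Cap, 0)] @ v = [] @ [(Cup, 0), (Cup, 2)] @ ([(Cap, 0)] @ v)" by simp
  also have "\<dots> \<simeq>[0] [] @ [(Cup, 0), (Cup, 0)] @ ([(Cap, 0)] @ v)"
    by (rule tiso.move) (use isotopy_moves(1)[of Cup 0 Cup 0] fit in \<open>auto simp: numeral_2_eq_2\<close>)
  finally have *: "(Cup, 0) # (Cap, 0) # L \<simeq>[0] [(Cup, 0)] @ (Cup, 0) # (Cap, 0) # v" using v by simp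
  have "link_diagram ((Cup, 0) # (Cap, 0) # L)" using L by (auto simp: link_diagram_iff)
  then have "G ((Cup, 0) # (Cap, 0) # L) = G ([(Cup, 0)] @ (Cup, 0) # (Cap, 0) # v)"
    using framed_invariant_tiso[OF _ *] G unfolding skein_invariant_def by simp
  also have "\<dots> = gamma * G ([(Cup, 0)] @ v)"
    by (rule skein_invariant_circle[OF G]) (use L v in auto)
  finally show ?thesis using v by simp
qed

lemma wd_cups: "fst ` set c \<subseteq> {Cup} \<Longrightarrow> m \<le> wd m c"
proof (induction c arbitrary: m)
  case (Cons a c)
  then have "Suc (Suc m) \<le> wd (Suc (Suc m)) c" by simp
  then show ?case using Cons(2) by (cases a) auto
qed simp

text \<open>Consider the first maximum and the minimum directly below it in the list. They form a
  circle or a zigzag, which shortens the diagram, or they are distant and can be exchanged, which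
  moves the first maximum further down.\<close>

lemma skein_invariant_crossingless:
  assumes G: "skein_invariant G" "G [(Cup, 0), (Cap, 0)] = 0"
  shows "link_diagram L \<Longrightarrow> crossings L = 0 \<Longrightarrow> G L = 0"
proof (induction "length L" arbitrary: L rule: less_induct)
  case less
  have step: "G L = 0" if "L = c @ (Cap, j) # v" "fst ` set c \<subseteq> {Cup}" "link_diagram L" "crossings L = 0"
    "length L = n" and IH: "\<And>L'. length L' < n \<Longrightarrow> link_diagram L' \<Longrightarrow> crossings L' = 0 \<Longrightarrow> G L' = 0"
    for L c j v n
    using that(1-5)
  proof (induction c arbitrary: L j v rule: rev_induct)
    case Nil
    then show ?case by (simp add: link_diagram_iff)
  next
    case (snoc s c)
    obtain i where s: "s = (Cup, i)" using snoc(3) by (cases s) auto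
    have L: "L = c @ (Cup, i) # (Cap, j) # v" using snoc(2) s by simp
    have fit: "fits 0 c" "i \<le> wd 0 c" "j \<le> wd 0 c" "fits (wd 0 c) v" "wd (wd 0 c) v = 0"
      using snoc(4) L by (auto simp: link_diagram_iff)
    have cr: "crossings c = 0" "crossings v = 0" using snoc(5) L by auto
    have GL: "G L = G L'" if "L \<simeq>[0] L'" for L'
      using framed_invariant_tiso[OF _ that snoc(4)] G unfolding skein_invariant_def by simp
    consider "i = j" | "j = Suc i \<or> i = Suc j" | "j + 2 \<le> i" | "i + 2 \<le> j" by linarith
    then show ?case
    proof cases
      case 1
      show ?thesis
      proof (cases "c = []")
        case True
        then have i: "i = 0" using fit by simp
        show ?thesis
        proof (cases "v = []")
          case True
          then show ?thesis using \<open>c = []\<close> i 1 L G by simp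
        next
          case False
          then have v: "link_diagram v" using fit \<open>c = []\<close> by (simp add: link_diagram_iff)
          then have "G v = 0" using IH[of v] snoc(6) L cr by simp
          then show ?thesis
            using skein_invariant_circle_below[OF G(1) v] \<open>c = []\<close> i 1 L by simp
        qed
      next
        case False
        obtain i' c' where c': "c = (Cup, i') # c'" using snoc(3) False by (cases c) auto
        have "0 < wd 0 c" using snoc(3) c' wd_cups[of c' "Suc (Suc 0)"] by simp
        moreover have uv: "link_diagram (c @ v)" using fit c' by (simp add: link_diagram_iff)
        ultimately have "G L = gamma * G (c @ v)"
          using skein_invariant_circle[OF G(1) uv _ fit(2)] L 1 by simp
        moreover have "G (c @ v) = 0" by (rule IH) (use snoc(6) L uv cr in auto)
        ultimately show ?thesis by simp
      qed
    next
      case 2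
      have "isotopy_move [(Cup, i), (Cap, j)] []" using 2 isotopy_moves(2,3) by auto
      then have "c @ [(Cup, i), (Cap, j)] @ v \<simeq>[0] c @ [] @ v"
        by (rule tiso.move) (use fit 2 in auto)
      then have iso: "L \<simeq>[0] c @ v" using L by simp
      then have "link_diagram (c @ v)" using tiso_link_diagram snoc(4) by blast
      then have "G (c @ v) = 0" using IH[of "c @ v"] snoc(6) L cr by simp
      then show ?thesis using GL[OF iso] by simp
    next
      case 3
      let ?L = "c @ (Cap, j) # (Cup, i - 2) # v"
      have "c @ [(Cup, i), (Cap, j)] @ v \<simeq>[0] c @ [(Cap, j), (Cup, i - 2)] @ v"
        by (rule tiso_context[OF slices_exchange[where m = "wd 0 c"]]) (use fit 3 in auto)
      then have iso: "L \<simeq>[0] ?L" using L by simp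
      then have "link_diagram ?L" using tiso_link_diagram snoc(4) by blast
      then have "G ?L = 0" by (intro snoc(1)[OF HOL.refl]) (use snoc(3,6) L cr in auto)
      then show ?thesis using GL[OF iso] by simp
    next
      case 4
      let ?L = "c @ (Cap, j - 2) # (Cup, i) # v"
      have "isotopy_move [(Cup, i), (Cap, j)] [(Cap, j - 2), (Cup, i)]"
        using isotopy_moves(1)[of Cup i Cap "j - 2 - i"] 4 by simp
      then have "c @ [(Cup, i), (Cap, j)] @ v \<simeq>[0] c @ [(Cap, j - 2), (Cup, i)] @ v"
        by (rule tiso.move) (use fit 4 in auto)
      then have iso: "L \<simeq>[0] ?L" using L by simp
      then have "link_diagram ?L" using tiso_link_diagram snoc(4) by blast
      then have "G ?L = 0" by (intro snoc(1)[OF HOL.refl]) (use snoc(3,6) L cr in auto)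
      then show ?thesis using GL[OF iso] by simp
    qed
  qed
  have "\<exists>s \<in> set L. fst s \<noteq> Cup"
  proof (rule ccontr)
    assume *: "\<not> ?thesis"
    obtain v where v: "L = (Cup, 0) # v" using less(2) by (rule link_diagram_first)
    then have "Suc (Suc 0) \<le> wd 0 L" using * wd_cups[of v "Suc (Suc 0)"] by auto
    then show False using less(2) by (simp add: link_diagram_iff)
  qed
  from split_list_first_prop[OF this]
  obtain c s v where L: "L = c @ s # v" "fst s \<noteq> Cup" "\<forall>s \<in> set c. fst s = Cup" by auto
  then have "fst s \<notin> {Pos, Neg}" using less(3) by (auto simp: crossings_def filter_empty_conv)
  with L(2) obtain j where "s = (Cap, j)" by (cases s; cases "fst s") auto
  with L(1) have "L = c @ (Cap, j) # v" by simp
  then show ?case by (rule step[OF _ _ less(2,3) HOL.refl less(1)]) (use L(3) in auto)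
qed

text \<open>The smoothings have fewer crossings, so the skein relation degenerates to a change of
  sign, and vanishing is unaffected by any number of switches.\<close>

lemma skein_invariant_switched:
  assumes G: "skein_invariant G"
    and fewer: "\<And>L. link_diagram L \<Longrightarrow> crossings L < n \<Longrightarrow> G L = 0"
    and "switched L L'" "link_diagram (u @ L)" "crossings (u @ L) = n"
  shows "G (u @ L) = 0 \<longleftrightarrow> G (u @ L') = 0"
  using assms(3-5) unfolding switched_def
proof (induction arbitrary: u rule: list_all2_induct)
  case (Cons s L s' L')
  obtain g h i where s: "s = (g, i)" "s' = (h, i)" "g = h \<or> {g, h} \<subseteq> {Pos, Neg}"
    using Cons(1) by (cases s; cases s') auto
  have next_link: "link_diagram ((u @ [s']) @ L)" "crossings ((u @ [s']) @ L) = n"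
    using Cons(4,5) s by (auto simp: link_diagram_iff)
  have "G (u @ s # L) = 0 \<longleftrightarrow> G (u @ s' # L) = 0"
  proof (cases "g = h")
    case False
    then have gh: "{g, h} = {Pos, Neg}" using s(3) by auto
    have "G (u @ (Cap, i) # (Cup, i) # L) = 0" "G (u @ L) = 0"
      using Cons(4,5) s gh by (auto intro!: fewer simp: link_diagram_iff doubleton_eq_iff)
    then have "G (u @ s # L) + G (u @ s' # L) = 0"
      using skein_invariant_skein[OF G _ gh, of u i L] Cons(4) s by simp
    then show ?thesis by (auto simp: add_eq_0_iff)
  qed (use s in simp)
  also have "\<dots> \<longleftrightarrow> G (u @ s' # L') = 0"
    using Cons.IH[OF next_link] by simp
  finally show ?case .
qed simp

text \<open>A skein invariant is determined by its value on the circle: modulo diagrams with fewer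
  crossings, crossing changes only affect the sign, and they turn every diagram into an unlink.\<close>

theorem skein_invariant_vanishes:
  assumes G: "skein_invariant G" "G [(Cup, 0), (Cap, 0)] = 0"
  shows "link_diagram L \<Longrightarrow> G L = 0"
proof (induction "crossings L" arbitrary: L rule: less_induct)
  case less
  have fit: "fits 0 L" "wd 0 L = 0" using less(2) by (auto simp: link_diagram_iff)
  obtain k where k: "ends L k" using ends_exists[OF fit(1)] by blast
  then have "k = []" using ends_closed[OF k] fit by simp
  then have "sortable L ([] :: real list)"
    using sortable_ends[OF k, of "\<lambda>_. 0"] by (simp add: separated_def)
  then obtain L' b j where L': "switched L L'" "crossings b = 0" "tiso 0 j L' b"
    unfolding sortable_def by auto
  have "link_diagram L'" using less(2) L'(1) fits_wd_switched[OF L'(1), of 0]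
    by (auto simp: link_diagram_iff switched_def)
  then have "link_diagram b" and "G L' = a_pow j * G b"
    using framed_invariant_tiso[OF _ L'(3)] tiso_link_diagram[OF L'(3)] G unfolding skein_invariant_def by auto
  then have "G L' = 0" using skein_invariant_crossingless[OF G] L'(2) by simp
  moreover have "G ([] @ L) = 0 \<longleftrightarrow> G ([] @ L') = 0"
    by (rule skein_invariant_switched[OF G(1) _ L'(1)]) (use less in auto)
  ultimately show ?case by simp
qed

section \<open>Multiplicativity of the Kauffman polynomial\<close>

lemma link_diagram_append: "link_diagram A \<Longrightarrow> link_diagram B \<Longrightarrow> link_diagram (A @ B)"
  by (simp add: link_diagram_iff)

text \<open>As a function of \<open>A\<close>, the difference of the two sides satisfies the skein
  axioms. It vanishes on the circle, because a circle added to \<open>B\<close> multiplies the value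
  by \<open>gamma\<close>. Hence it is zero.\<close>

lemma kauffman_polynomial_union:
  assumes Q: "kauffman_polynomial Q" and A: "link_diagram A" and B: "link_diagram B"
  shows "Q (A @ B) = gamma * Q A * Q B"
proof -
  have Q': "skein_invariant Q" "Q [(Cup, 0), (Cap, 0)] = 1" using Q by (auto simp: kauffman_polynomial_iff)
  define G where "G = (\<lambda>A. Q (A @ B) - gamma * Q A * Q B)"
  have "local_move isotopy_move (L @ B) (L' @ B)" if "local_move isotopy_move L L'" for L L'
    using that B unfolding local_move_def by (metis append.assoc link_diagram_append)
  moreover have "G (u @ l @ v) = a_pow s * G (u @ v)" if "curl s l" "link_diagram (u @ l @ v)" for s l u v
  proof -
    have "Q (u @ l @ v @ B) = a_pow s * Q (u @ v @ B)" "Q (u @ l @ v) = a_pow s * Q (u @ v)"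
      using Q'(1) that link_diagram_append[OF that(2) B] unfolding skein_invariant_def framed_invariant_def
      by simp_all
    then show ?thesis by (simp add: G_def algebra_simps)
  qed
  ultimately have "framed_invariant G"
    using Q' unfolding skein_invariant_def framed_invariant_def by (auto simp: G_def)
  moreover have "G Lp + G Lm = w_pow 1 * (G L0 + G Linf)" if c: "conway_quadruple h Lp Lm L0 Linf" for h Lp Lm L0 Linf
  proof -
    have "conway_quadruple h (Lp @ B) (Lm @ B) (L0 @ B) (Linf @ B)"
      using c B link_diagram_append unfolding conway_quadruple_def by fastforce
    then have "Q (Lp @ B) + Q (Lm @ B) = w_pow 1 * (Q (L0 @ B) + Q (Linf @ B))"
      "Q Lp + Q Lm = w_pow 1 * (Q L0 + Q Linf)"
      using Q' c unfolding skein_invariant_def by blast+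
    moreover have "gamma * Q Lp * Q B + gamma * Q Lm * Q B = gamma * Q B * (Q Lp + Q Lm)"
      by (simp add: algebra_simps)
    ultimately show ?thesis by (simp add: G_def algebra_simps)
  qed
  ultimately have "skein_invariant G" unfolding skein_invariant_def by blast
  moreover have "G [(Cup, 0), (Cap, 0)] = 0"
    using skein_invariant_circle_below[OF Q'(1) B] Q'(2) by (simp add: G_def)
  ultimately have "G A = 0" using skein_invariant_vanishes A by blast
  then show ?thesis by (simp add: G_def)
qed

lemma link_diagram_concat:
  "Ks \<noteq> [] \<Longrightarrow> (\<And>K. K \<in> set Ks \<Longrightarrow> link_diagram K) \<Longrightarrow> link_diagram (concat Ks)"
  by (induction Ks rule: list_nonempty_induct) (auto intro: link_diagram_append)

lemma kauffman_polynomial_concat: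
  assumes Q: "kauffman_polynomial Q" and "Ks \<noteq> []" "\<And>K. K \<in> set Ks \<Longrightarrow> link_diagram K"
  shows "Q (concat Ks) = gamma ^ (length Ks - 1) * prod_list (map Q Ks)"
  using assms(2,3)
proof (induction Ks rule: list_nonempty_induct)
  case (cons K Ks)
  then have "Q (concat (K # Ks)) = gamma * Q K * Q (concat Ks)"
    using kauffman_polynomial_union[OF Q, of K "concat Ks"] link_diagram_concat[of Ks] by simp
  moreover obtain n where n: "length Ks = Suc n" using cons(1) by (cases Ks) auto
  then have "gamma * Q K * Q (concat Ks) = gamma ^ (length (K # Ks) - 1) * prod_list (map Q (K # Ks))"
    using cons by (simp add: mult.left_commute mult.assoc)
  ultimately show ?case by simp
qed simp

section \<open>Labelings\<close>

text \<open>A labeling attaches a word of labels to every level of a tangle. Labels are constant along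
  strands, except that they are changed by the involution \<open>\<iota>\<close> at minima and maxima: colours
  have \<open>\<iota> = id\<close>, orientations have \<open>\<iota> = Not\<close>.\<close>

fun step :: "('c \<Rightarrow> 'c) \<Rightarrow> piece \<times> nat \<Rightarrow> 'c list \<Rightarrow> 'c list \<Rightarrow> bool" where
  "step \<iota> (g, Suc i) w w' \<longleftrightarrow> (\<exists>x v v'. w = x # v \<and> w' = x # v' \<and> step \<iota> (g, i) v v')"
| "step \<iota> (Cup, 0) w w' \<longleftrightarrow> (\<exists>c. w' = c # \<iota> c # w)"
| "step \<iota> (Cap, 0) w w' \<longleftrightarrow> (\<exists>c. w = c # \<iota> c # w')"
| "step \<iota> (Pos, 0) w w' \<longleftrightarrow> (\<exists>a b v. w = a # b # v \<and> w' = b # a # v)"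
| "step \<iota> (Neg, 0) w w' \<longleftrightarrow> (\<exists>a b v. w = a # b # v \<and> w' = b # a # v)"

text \<open>\<open>ws\<close> lists the words above the successive slices; the word \<open>w\<close>
  at the bottom is kept apart.\<close>

fun lab :: "('c \<Rightarrow> 'c) \<Rightarrow> diagram \<Rightarrow> 'c list \<Rightarrow> 'c list list \<Rightarrow> 'c list \<Rightarrow> bool" where
  "lab \<iota> [] w ws w' \<longleftrightarrow> ws = [] \<and> w' = w"
| "lab \<iota> (s # l) w ws w' \<longleftrightarrow> (\<exists>x xs. ws = x # xs \<and> step \<iota> s w x \<and> lab \<iota> l x xs w')"

definition sub1 :: "('c \<Rightarrow> bool) \<Rightarrow> piece \<times> nat \<Rightarrow> 'c list \<Rightarrow> 'c list \<Rightarrow> diagram" where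
  "sub1 P = (\<lambda>(g, i) w w'. let v = (if g = Cup then w' else w) in
     if P (v ! i) \<and> P (v ! Suc i) then [(g, length (filter P (take i w)))] else [])"

text \<open>The diagram formed by the strands with a label in \<open>P\<close>.\<close>

fun sub :: "('c \<Rightarrow> bool) \<Rightarrow> diagram \<Rightarrow> 'c list \<Rightarrow> 'c list list \<Rightarrow> diagram" where
  "sub P (s # l) w (x # ws) = sub1 P s w x @ sub P l x ws"
| "sub P _ w _ = []"

text \<open>The weight \<omega> of a crossing is left open, because signs, parities and differences
  of signs are summed in the same way.\<close>

definition wr1 :: "(piece \<Rightarrow> 'c \<Rightarrow> 'c \<Rightarrow> int) \<Rightarrow> piece \<times> nat \<Rightarrow> 'c list \<Rightarrow> int" where
  "wr1 \<omega> = (\<lambda>(g, i) w. if g \<in> {Pos, Neg} then \<omega> g (w ! i) (w ! Suc i) else 0)"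

fun wr :: "(piece \<Rightarrow> 'c \<Rightarrow> 'c \<Rightarrow> int) \<Rightarrow> diagram \<Rightarrow> 'c list \<Rightarrow> 'c list list \<Rightarrow> int" where
  "wr \<omega> (s # l) w (x # ws) = wr1 \<omega> s w + wr \<omega> l x ws"
| "wr \<omega> _ w _ = 0"

definition labels :: "'c list \<Rightarrow> 'c list list \<Rightarrow> 'c set" where
  "labels w ws = set w \<union> (\<Union>x \<in> set ws. set x)"

lemma step_fits:
  "step \<iota> (g, i) w w' \<Longrightarrow> i + n_in g \<le> length w \<and> length w' = length w - n_in g + n_out g"
proof (induction i arbitrary: w w')
  case 0
  then show ?case by (cases g) auto
next
  case (Suc i)
  then obtain x v v' where "w = x # v" "w' = x # v'" "step \<iota> (g, i) v v'" by auto
  then show ?case using Suc.IH[of v v'] by (auto simp: Suc_diff_le)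
qed

lemma lab_fits:
  "lab \<iota> l w ws w' \<Longrightarrow> fits (length w) l \<and> wd (length w) l = length w' \<and> length ws = length l"
proof (induction l arbitrary: w ws)
  case (Cons s l)
  obtain g i where "s = (g, i)" by force
  then show ?case using Cons step_fits[of \<iota> g i w] by fastforce
qed auto

lemma lab_append:
  "lab \<iota> (l @ l') w ws w' \<longleftrightarrow> (\<exists>x xs xs'. ws = xs @ xs' \<and> lab \<iota> l w xs x \<and> lab \<iota> l' x xs' w')"
proof (induction l arbitrary: w ws)
  case (Cons s l)
  show ?case
  proof
    assume "lab \<iota> ((s # l) @ l') w ws w'"
    then obtain y ys x xs xs' where "ws = y # ys" "step \<iota> s w y" "ys = xs @ xs'" "lab \<iota> l y xs x"
      "lab \<iota> l' x xs' w'" using Cons by auto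
    then show "\<exists>x xs xs'. ws = xs @ xs' \<and> lab \<iota> (s # l) w xs x \<and> lab \<iota> l' x xs' w'"
      by (intro exI[of _ x] exI[of _ "y # xs"] exI[of _ xs']) auto
  next
    assume "\<exists>x xs xs'. ws = xs @ xs' \<and> lab \<iota> (s # l) w xs x \<and> lab \<iota> l' x xs' w'"
    then obtain x y ys xs' where "ws = (y # ys) @ xs'" "step \<iota> s w y" "lab \<iota> l y ys x"
      "lab \<iota> l' x xs' w'" by auto
    then show "lab \<iota> ((s # l) @ l') w ws w'" using Cons[of y "ys @ xs'"] by auto
  qed
qed auto

lemma sub_append:
  "lab \<iota> l w ws x \<Longrightarrow> sub P (l @ l') w (ws @ ws') = sub P l w ws @ sub P l' x ws'"
  by (induction l arbitrary: w ws) auto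

lemma wr_append:
  "lab \<iota> l w ws x \<Longrightarrow> wr \<omega> (l @ l') w (ws @ ws') = wr \<omega> l w ws + wr \<omega> l' x ws'"
  by (induction l arbitrary: w ws) auto

lemma labels_append:
  "lab \<iota> l w ws x \<Longrightarrow> labels w (ws @ ws') = labels w ws \<union> labels x ws'"
proof -
  have "lab \<iota> l w ws x \<Longrightarrow> set x \<subseteq> labels w ws" for w ws
    by (induction l arbitrary: w ws) (fastforce simp: labels_def)+
  then show "lab \<iota> l w ws x \<Longrightarrow> labels w (ws @ ws') = labels w ws \<union> labels x ws'"
    by (auto simp: labels_def)
qed

section \<open>Locality of labelings, their images and pairs\<close>

lemma step_prefix:
  "step \<iota> (g, length A + i) (A @ w) w' \<longleftrightarrow> (\<exists>v. w' = A @ v \<and> step \<iota> (g, i) w v)"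
  by (induction A arbitrary: w') auto

lemma lab_prefix:
  "lab \<iota> (shift (length A) l) (A @ w) ws w' \<longleftrightarrow>
    (\<exists>vs v. ws = map ((@) A) vs \<and> w' = A @ v \<and> lab \<iota> l w vs v)"
proof (induction l arbitrary: w ws)
  case (Cons s l)
  obtain g i where s: "s = (g, i)" by force
  have *: "step \<iota> (g, i + length A) (A @ w) x \<longleftrightarrow> (\<exists>v. x = A @ v \<and> step \<iota> (g, i) w v)" for x
    using step_prefix[of \<iota> g A i w x] by (simp add: add.commute)
  show ?case
  proof
    assume "lab \<iota> (shift (length A) (s # l)) (A @ w) ws w'"
    then obtain x xs where x: "ws = x # xs" "step \<iota> (g, i + length A) (A @ w) x"
      "lab \<iota> (shift (length A) l) x xs w'" using s by auto
    then obtain v vs v' where v: "x = A @ v" "step \<iota> (g, i) w v" "xs = map ((@) A) vs" "w' = A @ v'" "lab \<iota> l v vs v'"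
      using * Cons by auto
    then show "\<exists>vs v. ws = map ((@) A) vs \<and> w' = A @ v \<and> lab \<iota> (s # l) w vs v"
      using x s by (intro exI[of _ "v # vs"] exI[of _ v']) auto
  next
    assume "\<exists>vs v. ws = map ((@) A) vs \<and> w' = A @ v \<and> lab \<iota> (s # l) w vs v"
    then obtain v vs v' where "ws = (A @ v) # map ((@) A) vs" "w' = A @ v'" "step \<iota> (g, i) w v" "lab \<iota> l v vs v'"
      using s by auto
    then show "lab \<iota> (shift (length A) (s # l)) (A @ w) ws w'"
      using s * Cons by auto
  qed
qed auto

lemma sub1_prefix:
  assumes "step \<iota> (g, i) w w'"
  shows "sub1 P (g, length A + i) (A @ w) (A @ w') = shift (length (filter P A)) (sub1 P (g, i) w w')"
  using step_fits[OF assms] by (cases g) (auto simp: sub1_def nth_append)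

lemma sub_prefix:
  assumes "lab \<iota> l w ws w'"
  shows "sub P (shift (length A) l) (A @ w) (map ((@) A) ws) = shift (length (filter P A)) (sub P l w ws)"
  using assms
proof (induction l arbitrary: w ws)
  case (Cons s l)
  obtain g i where s: "s = (g, i)" by force
  obtain x xs where "ws = x # xs" "step \<iota> (g, i) w x" "lab \<iota> l x xs w'" using Cons.prems s by auto
  then show ?case using Cons.IH[of x xs] sub1_prefix[of \<iota> g i w x P A] s by (simp add: add.commute)
qed auto

lemma wr_prefix:
  assumes "lab \<iota> l w ws w'"
  shows "wr \<omega> (shift (length A) l) (A @ w) (map ((@) A) ws) = wr \<omega> l w ws"
  using assms
proof (induction l arbitrary: w ws)
  case (Cons s l)
  obtain g i where s: "s = (g, i)" by force
  obtain x xs where x: "ws = x # xs" "lab \<iota> l x xs w'" using Cons.prems by auto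
  have "wr1 \<omega> (g, i + length A) (A @ w) = wr1 \<omega> (g, i) w"
    by (simp add: wr1_def nth_append add.commute)
  then show ?case
    unfolding s x(1) shift_simps list.map wr.simps Cons.IH[OF x(2)] by (rule arg_cong)
qed auto

lemma labels_prefix: "labels (A @ w) (map ((@) A) ws) = set A \<union> labels w ws"
  by (auto simp: labels_def)

lemma step_sub1:
  assumes "step \<iota> (g, i) w w'" "\<And>c. P (\<iota> c) = P c"
  shows "fits (length (filter P w)) (sub1 P (g, i) w w') \<and>
    wd (length (filter P w)) (sub1 P (g, i) w w') = length (filter P w')"
  using assms(1)
proof (induction i arbitrary: w w')
  case 0
  show ?case
  proof (cases g)
    case Cup
    then obtain c where "w' = c # \<iota> c # w" using 0 by auto
    then show ?thesis using assms(2)[of c] Cup by (simp add: sub1_def)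
  next
    case Cap
    then obtain c where "w = c # \<iota> c # w'" using 0 by auto
    then show ?thesis using assms(2)[of c] Cap by (simp add: sub1_def)
  qed (use 0 in \<open>auto simp: sub1_def\<close>)
next
  case (Suc i)
  then obtain x v v' where x: "w = x # v" "w' = x # v'" "step \<iota> (g, i) v v'" by auto
  have "sub1 P (g, Suc i) w w' = shift (length (filter P [x])) (sub1 P (g, i) v v')"
    using sub1_prefix[OF x(3), of P "[x]"] x by simp
  moreover have "length (filter P w) = length (filter P v) + length (filter P [x])"
    "length (filter P w') = length (filter P v') + length (filter P [x])" using x by simp_all
  ultimately show ?case
    using Suc.IH[OF x(3)] fits_wd_shift[of "length (filter P v)" "sub1 P (g, i) v v'" "length (filter P [x])"]
    by metis
qed

lemma lab_sub:
  assumes "lab \<iota> l w ws w'" "\<And>c. P (\<iota> c) = P c"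
  shows "fits (length (filter P w)) (sub P l w ws) \<and> wd (length (filter P w)) (sub P l w ws) = length (filter P w')"
  using assms(1)
proof (induction l arbitrary: w ws)
  case (Cons s l)
  obtain g i where s: "s = (g, i)" by force
  obtain x xs where "ws = x # xs" "step \<iota> (g, i) w x" "lab \<iota> l x xs w'" using Cons.prems s by auto
  then show ?case using Cons.IH[of x xs] step_sub1[of \<iota> g i w x P] assms(2) s by simp
qed auto

lemma lab_sub_link_diagram:
  assumes "lab id L [] ws []" "sub P L [] ws \<noteq> []"
  shows "link_diagram (sub P L [] ws)"
  using lab_sub[of id L "[]" ws "[]" P] assms by (simp add: link_diagram_iff)

text \<open>A colour that is absent at the bottom but used somewhere enters at a slice that changes
  the number of its strands, and this slice survives in the sublink. As the empty list is not a link
  diagram, this is what makes the sublink of a used colour a link diagram.\<close>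

lemma lab_sub_nonempty:
  assumes "lab id l w ws w'" "c \<in> labels w ws" "c \<notin> set w"
  shows "sub ((=) c) l w ws \<noteq> []"
  using assms
proof (induction l arbitrary: w ws)
  case (Cons s l)
  obtain g i where s: "s = (g, i)" by force
  obtain x xs where x: "ws = x # xs" "step id (g, i) w x" "lab id l x xs w'"
    using Cons(2) unfolding s lab.simps by blast
  have e: "filter ((=) c) v = [] \<longleftrightarrow> c \<notin> set v" for v by (auto simp: filter_empty_conv)
  show ?case
  proof (cases "c \<in> set x")
    case True
    then have "length (filter ((=) c) w) \<noteq> length (filter ((=) c) x)" using Cons(4) e[of w] e[of x] by auto
    then have "sub1 ((=) c) (g, i) w x \<noteq> []" using step_sub1[OF x(2), of "(=) c"] by auto
    then show ?thesis using x s by simp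
  next
    case False
    then have "c \<in> labels x xs" using Cons(3,4) x by (auto simp: labels_def)
    then show ?thesis using Cons.IH[OF x(3) _ False] x by simp
  qed
qed (auto simp: labels_def)

lemma step_map:
  assumes "\<And>c. h (\<iota> c) = \<iota>' (h c)"
  shows "step \<iota> (g, i) w w' \<Longrightarrow> step \<iota>' (g, i) (map h w) (map h w')"
proof (induction i arbitrary: w w')
  case 0
  then show ?case by (cases g) (auto simp: assms)
qed auto

lemma lab_map:
  assumes "\<And>c. h (\<iota> c) = \<iota>' (h c)"
  shows "lab \<iota> l w ws w' \<Longrightarrow> lab \<iota>' l (map h w) (map (map h) ws) (map h w')"
proof (induction l arbitrary: w ws)
  case (Cons s l)
  obtain g i where s: "s = (g, i)" by force
  then show ?case using Cons step_map[of h \<iota> \<iota>' g i w, OF assms] by auto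
qed auto

lemma wr1_map:
  assumes "step \<iota> (g, i) w w'"
  shows "wr1 \<omega> (g, i) (map h w) = wr1 (\<lambda>g a b. \<omega> g (h a) (h b)) (g, i) w"
  using step_fits[OF assms] by (cases g) (auto simp: wr1_def)

lemma wr_map:
  "lab \<iota> l w ws w' \<Longrightarrow> wr \<omega> l (map h w) (map (map h) ws) = wr (\<lambda>g a b. \<omega> g (h a) (h b)) l w ws"
proof (induction l arbitrary: w ws)
  case (Cons s l)
  obtain g i where s: "s = (g, i)" by force
  obtain x xs where "ws = x # xs" "step \<iota> (g, i) w x" "lab \<iota> l x xs w'" using Cons.prems s by auto
  then show ?case using Cons.IH[of x xs] wr1_map[of \<iota> g i w x \<omega> h] s by simp
qed auto

lemma step_zip:
  "step \<iota> (g, i) w w' \<Longrightarrow> step \<iota>' (g, i) v v' \<Longrightarrow> length w = length v \<Longrightarrow>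
    step (map_prod \<iota> \<iota>') (g, i) (zip w v) (zip w' v')"
proof (induction i arbitrary: w w' v v')
  case 0
  then show ?case by (cases g) auto
qed auto

lemma lab_zip:
  "lab \<iota> l w ws w' \<Longrightarrow> lab \<iota>' l v vs v' \<Longrightarrow> length w = length v \<Longrightarrow>
    lab (map_prod \<iota> \<iota>') l (zip w v) (map2 zip ws vs) (zip w' v')"
proof (induction l arbitrary: w ws v vs)
  case (Cons s l)
  obtain g i where s: "s = (g, i)" by force
  obtain x xs y ys where x: "ws = x # xs" "step \<iota> (g, i) w x" "lab \<iota> l x xs w'"
    "vs = y # ys" "step \<iota>' (g, i) v y" "lab \<iota>' l y ys v'" using Cons.prems s by auto
  have "length x = length y" using step_fits[OF x(2)] step_fits[OF x(5)] Cons(4) by simp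
  then show ?case using Cons.IH[OF x(3,6)] step_zip[OF x(2,5) Cons(4)] x s by auto
qed auto

lemma lab_length:
  "lab \<iota> l w ws w' \<Longrightarrow> lab \<iota>' l v vs v' \<Longrightarrow> length w = length v \<Longrightarrow>
    length ws = length vs \<and> list_all2 (\<lambda>x y. length x = length y) ws vs \<and> length w' = length v'"
proof (induction l arbitrary: w ws v vs)
  case (Cons s l)
  obtain g i where s: "s = (g, i)" by force
  obtain x xs y ys where x: "ws = x # xs" "step \<iota> (g, i) w x" "lab \<iota> l x xs w'"
    "vs = y # ys" "step \<iota>' (g, i) v y" "lab \<iota>' l y ys v'" using Cons.prems s by auto
  have "length x = length y" using step_fits[OF x(2)] step_fits[OF x(5)] Cons(4) by simp
  then show ?case using Cons.IH[OF x(3,6)] x by auto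
qed auto

text \<open>The words at the bottom and at the top are shared, so the labeling of the rest of the
  diagram remains valid. In between, existence and uniqueness in both directions yield a
  bijection.\<close>

definition unique_transfer :: "('c \<Rightarrow> 'c) \<Rightarrow> diagram \<Rightarrow> diagram \<Rightarrow> 'c list \<Rightarrow> bool" where
  "unique_transfer \<iota> l l' w \<longleftrightarrow> (\<forall>w' ws. lab \<iota> l w ws w' \<longrightarrow> (\<exists>!ws'. lab \<iota> l' w ws' w')) \<and>
     (\<forall>w' ws'. lab \<iota> l' w ws' w' \<longrightarrow> (\<exists>!ws. lab \<iota> l w ws w'))"

text \<open>The behaviour of crossing weights under rotation by a quarter, as needed for the moves of an
  extremum through a crossing.\<close>

definition rotatable :: "('c \<Rightarrow> 'c) \<Rightarrow> (piece \<Rightarrow> 'c \<Rightarrow> 'c \<Rightarrow> int) \<Rightarrow> bool" where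
  "rotatable \<iota> \<omega> \<longleftrightarrow> (\<forall>a b. \<omega> Pos a b + \<omega> Neg b a = 0 \<and>
     \<omega> Neg (\<iota> a) b = \<omega> Pos b a \<and> \<omega> Pos (\<iota> a) b = \<omega> Neg b a \<and>
     \<omega> Pos b (\<iota> a) = \<omega> Neg a b \<and> \<omega> Neg b (\<iota> a) = \<omega> Pos a b)"

text \<open>The label sets are compared for colours only: a zigzag on a strand labelled
  \<open>c\<close> also shows \<open>\<iota> c\<close>. If a sublink misses some of the strands, the
  move may become trivial on it, hence the disjunction.\<close>

definition labelings_match :: "('c \<Rightarrow> 'c) \<Rightarrow> diagram \<Rightarrow> diagram \<Rightarrow> 'c list \<Rightarrow> 'c list list \<Rightarrow> 'c list list \<Rightarrow> bool" where
  "labelings_match \<iota> l l' w ws ws' \<longleftrightarrow> (\<iota> = id \<longrightarrow> labels w ws = labels w ws') \<and>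
     (\<forall>P. (\<forall>c. P (\<iota> c) = P c) \<longrightarrow> sub P l w ws = sub P l' w ws' \<or> isotopy_move (sub P l w ws) (sub P l' w ws')) \<and>
     (\<forall>\<omega>. rotatable \<iota> \<omega> \<longrightarrow> wr \<omega> l w ws = wr \<omega> l' w ws')"

definition moves_labelings :: "('c \<Rightarrow> 'c) \<Rightarrow> diagram \<Rightarrow> diagram \<Rightarrow> 'c list \<Rightarrow> bool" where
  "moves_labelings \<iota> l l' w \<longleftrightarrow> unique_transfer \<iota> l l' w \<and>
     (\<forall>w' ws ws'. lab \<iota> l w ws w' \<longrightarrow> lab \<iota> l' w ws' w' \<longrightarrow> labelings_match \<iota> l l' w ws ws')"

lemma unique_transfer_prefix:
  assumes "unique_transfer \<iota> l l' w"
  shows "unique_transfer \<iota> (shift (length A) l) (shift (length A) l') (A @ w)"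
proof -
  have inj: "map ((@) A) vs = map ((@) A) vs' \<longleftrightarrow> vs = vs'" for vs vs' :: "'a list list"
    by (intro inj_map_eq_map) (auto intro: injI)
  have *: "\<exists>!ws'. lab \<iota> (shift (length A) m') (A @ w) ws' w'"
    if m: "\<And>w' ws. lab \<iota> m w ws w' \<Longrightarrow> \<exists>!ws'. lab \<iota> m' w ws' w'" and l: "lab \<iota> (shift (length A) m) (A @ w) ws w'"
    for m m' ws w'
  proof -
    obtain vs v where v: "w' = A @ v" "lab \<iota> m w vs v" using l unfolding lab_prefix by blast
    obtain vs' where vs': "lab \<iota> m' w vs' v" "\<And>ws'. lab \<iota> m' w ws' v \<Longrightarrow> ws' = vs'" using m[OF v(2)] by blast
    show ?thesis
    proof (rule ex1I)
      show "lab \<iota> (shift (length A) m') (A @ w) (map ((@) A) vs') w'"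
        unfolding lab_prefix using v vs' by blast
      fix ws' assume "lab \<iota> (shift (length A) m') (A @ w) ws' w'"
      then obtain us u where "ws' = map ((@) A) us" "w' = A @ u" "lab \<iota> m' w us u"
        unfolding lab_prefix by blast
      moreover from this have "u = v" using v(1) by simp
      ultimately show "ws' = map ((@) A) vs'" using vs'(2)[of us] by simp
    qed
  qed
  have 1: "\<exists>!ws'. lab \<iota> l' w ws' w'" if "lab \<iota> l w ws w'" for ws w'
    using assms[unfolded unique_transfer_def, THEN conjunct1, rule_format, OF that] .
  have 2: "\<exists>!ws'. lab \<iota> l w ws' w'" if "lab \<iota> l' w ws w'" for ws w'
    using assms[unfolded unique_transfer_def, THEN conjunct2, rule_format, OF that] .
  show ?thesis
    unfolding unique_transfer_def
  proof (intro conjI allI impI)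
    fix w' ws
    assume "lab \<iota> (shift (length A) l) (A @ w) ws w'"
    then show "\<exists>!ws'. lab \<iota> (shift (length A) l') (A @ w) ws' w'" by (rule *[rotated]) (rule 1)
  next
    fix w' ws
    assume "lab \<iota> (shift (length A) l') (A @ w) ws w'"
    then show "\<exists>!ws. lab \<iota> (shift (length A) l) (A @ w) ws w'" by (rule *[rotated]) (rule 2)
  qed
qed

lemma labelings_matchI:
  assumes "\<iota> = id \<Longrightarrow> labels w ws = labels w ws'"
    and "\<And>P. (\<And>c. P (\<iota> c) = P c) \<Longrightarrow> sub P l w ws = sub P l' w ws' \<or> isotopy_move (sub P l w ws) (sub P l' w ws')"
    and "\<And>\<omega>. rotatable \<iota> \<omega> \<Longrightarrow> wr \<omega> l w ws = wr \<omega> l' w ws'"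
  shows "labelings_match \<iota> l l' w ws ws'"
  using assms unfolding labelings_match_def by blast

lemma moves_labelings_prefix:
  assumes "moves_labelings \<iota> l l' w"
  shows "moves_labelings \<iota> (shift (length A) l) (shift (length A) l') (A @ w)"
  unfolding moves_labelings_def
proof (intro conjI allI impI)
  show "unique_transfer \<iota> (shift (length A) l) (shift (length A) l') (A @ w)"
    using assms unique_transfer_prefix unfolding moves_labelings_def by blast
  fix w' ws ws'
  assume "lab \<iota> (shift (length A) l) (A @ w) ws w'" "lab \<iota> (shift (length A) l') (A @ w) ws' w'"
  then obtain vs vs' v where v: "ws = map ((@) A) vs" "ws' = map ((@) A) vs'" "lab \<iota> l w vs v" "lab \<iota> l' w vs' v"
    unfolding lab_prefix by auto
  then have m: "labelings_match \<iota> l l' w vs vs'" using assms unfolding moves_labelings_def by blast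
  show "labelings_match \<iota> (shift (length A) l) (shift (length A) l') (A @ w) ws ws'"
    unfolding v(1,2)
  proof (rule labelings_matchI)
    fix P :: "'a \<Rightarrow> bool"
    assume "\<And>c. P (\<iota> c) = P c"
    then have "sub P l w vs = sub P l' w vs' \<or> isotopy_move (sub P l w vs) (sub P l' w vs')"
      using m unfolding labelings_match_def by blast
    then show "sub P (shift (length A) l) (A @ w) (map ((@) A) vs) = sub P (shift (length A) l') (A @ w) (map ((@) A) vs') \<or>
      isotopy_move (sub P (shift (length A) l) (A @ w) (map ((@) A) vs)) (sub P (shift (length A) l') (A @ w) (map ((@) A) vs'))"
      unfolding sub_prefix[OF v(3)] sub_prefix[OF v(4)] using isotopy_move_shift by auto
  next
    assume "\<iota> = id"
    then show "labels (A @ w) (map ((@) A) vs) = labels (A @ w) (map ((@) A) vs')"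
      using m unfolding labels_prefix labelings_match_def by simp
  next
    fix \<omega> :: "piece \<Rightarrow> 'a \<Rightarrow> 'a \<Rightarrow> int"
    assume "rotatable \<iota> \<omega>"
    then show "wr \<omega> (shift (length A) l) (A @ w) (map ((@) A) vs) = wr \<omega> (shift (length A) l') (A @ w) (map ((@) A) vs')"
      using m unfolding wr_prefix[OF v(3)] wr_prefix[OF v(4)] labelings_match_def by simp
  qed
qed

text \<open>The labelings of both sides are parametrized by the same \<open>a\<close>, which the
  common top word \<open>G a\<close> determines. For each move it remains to list the
  labelings.\<close>

lemma moves_labelingsI:
  assumes "\<And>ws w'. lab \<iota> l w ws w' \<longleftrightarrow> (\<exists>a \<in> S. ws = F a \<and> w' = G a)"
    and "\<And>ws w'. lab \<iota> l' w ws w' \<longleftrightarrow> (\<exists>a \<in> S. ws = F' a \<and> w' = G a)"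
    and "inj_on G S" "\<And>a. a \<in> S \<Longrightarrow> labelings_match \<iota> l l' w (F a) (F' a)"
  shows "moves_labelings \<iota> l l' w"
proof -
  have eq: "G a = G b \<longleftrightarrow> a = b" if "a \<in> S" "b \<in> S" for a b
    using inj_onD[OF assms(3)] that by blast
  show ?thesis
    unfolding moves_labelings_def unique_transfer_def assms(1,2) using assms(4) by (auto simp: eq)
qed

lemma rotatableD:
  assumes "rotatable \<iota> \<omega>"
  shows "\<omega> Pos a b + \<omega> Neg b a = 0" "\<omega> Neg (\<iota> a) b = \<omega> Pos b a" "\<omega> Pos (\<iota> a) b = \<omega> Neg b a"
    "\<omega> Pos b (\<iota> a) = \<omega> Neg a b" "\<omega> Neg b (\<iota> a) = \<omega> Pos a b"
  using assms unfolding rotatable_def by blast+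

lemma labelings_match_r2:
  assumes "{x, y} = {Pos, Neg}"
  shows "labelings_match \<iota> [(x, 0), (y, 0)] [] (a # b # B) [b # a # B, a # b # B] []"
proof (rule labelings_matchI)
  have xy: "x = Pos \<and> y = Neg \<or> x = Neg \<and> y = Pos" using assms by (auto simp: doubleton_eq_iff)
  fix P :: "'a \<Rightarrow> bool"
  show "sub P [(x, 0), (y, 0)] (a # b # B) [b # a # B, a # b # B] = sub P [] (a # b # B) [] \<or>
    isotopy_move (sub P [(x, 0), (y, 0)] (a # b # B) [b # a # B, a # b # B]) (sub P [] (a # b # B) [])"
    using xy isotopy_moves(8,9)[of 0] by (auto simp: sub1_def)
  fix \<omega> :: "piece \<Rightarrow> 'a \<Rightarrow> 'a \<Rightarrow> int"
  assume "rotatable \<iota> \<omega>"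
  from rotatableD(1)[OF this, of a b] rotatableD(1)[OF this, of b a]
  show "wr \<omega> [(x, 0), (y, 0)] (a # b # B) [b # a # B, a # b # B] = wr \<omega> [] (a # b # B) []"
    using xy by (auto simp: wr1_def)
qed (auto simp: labels_def)

lemma moves_labelings_r2:
  assumes "{x, y} = {Pos, Neg}"
  shows "moves_labelings \<iota> [(x, 0), (y, 0)] [] (a # b # B)"
proof (rule moves_labelingsI[where S = "{()}" and F = "\<lambda>_. [b # a # B, a # b # B]" and F' = "\<lambda>_. []" and G = "\<lambda>_. a # b # B"])
  have xy: "x = Pos \<and> y = Neg \<or> x = Neg \<and> y = Pos" using assms by (auto simp: doubleton_eq_iff)
  show "lab \<iota> [(x, 0), (y, 0)] (a # b # B) ws w' \<longleftrightarrow> (\<exists>u \<in> {()}. ws = [b # a # B, a # b # B] \<and> w' = a # b # B)" for ws w'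
    using xy by auto
qed (auto intro: labelings_match_r2[OF assms])

lemma labelings_match_zigzag:
  assumes \<iota>: "\<And>c. \<iota> (\<iota> c) = c" and x: "{x, y} = {0, Suc 0}"
  shows "labelings_match \<iota> [(Cup, x), (Cap, y)] [] (c # B) [c # \<iota> c # c # B, c # B] []"
proof (rule labelings_matchI)
  have xy: "x = 0 \<and> y = Suc 0 \<or> x = Suc 0 \<and> y = 0" using x by (auto simp: doubleton_eq_iff)
  fix P :: "'a \<Rightarrow> bool"
  assume P: "\<And>c. P (\<iota> c) = P c"
  show "sub P [(Cup, x), (Cap, y)] (c # B) [c # \<iota> c # c # B, c # B] = sub P [] (c # B) [] \<or>
    isotopy_move (sub P [(Cup, x), (Cap, y)] (c # B) [c # \<iota> c # c # B, c # B]) (sub P [] (c # B) [])"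
    using xy isotopy_moves(2,3)[of 0] P[of c] by (auto simp: sub1_def)
qed (auto simp: labels_def wr1_def)

lemma moves_labelings_zigzag:
  assumes \<iota>: "\<And>c. \<iota> (\<iota> c) = c" and x: "{x, y} = {0, Suc 0}"
  shows "moves_labelings \<iota> [(Cup, x), (Cap, y)] [] (c # B)"
proof (rule moves_labelingsI[where S = "{()}" and F = "\<lambda>_. [c # \<iota> c # c # B, c # B]" and F' = "\<lambda>_. []" and G = "\<lambda>_. c # B"])
  have xy: "x = 0 \<and> y = Suc 0 \<or> x = Suc 0 \<and> y = 0" using x by (auto simp: doubleton_eq_iff)
  show "lab \<iota> [(Cup, x), (Cap, y)] (c # B) ws w' \<longleftrightarrow> (\<exists>u \<in> {()}. ws = [c # \<iota> c # c # B, c # B] \<and> w' = c # B)" for ws w'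
    using xy
  proof
    assume "x = 0 \<and> y = Suc 0"
    then show ?thesis using \<iota> by auto
  next
    assume "x = Suc 0 \<and> y = 0"
    then show ?thesis using \<iota> by auto
  qed
qed (auto intro: labelings_match_zigzag[OF assms])

lemma moves_labelings_cup:
  assumes \<iota>: "\<And>c. \<iota> (\<iota> c) = c" and x: "{x, y} = {Pos, Neg}"
  shows "moves_labelings \<iota> [(Cup, 0), (x, Suc 0)] [(Cup, Suc 0), (y, 0)] (c # B)"
proof (rule moves_labelingsI[where S = UNIV and F = "\<lambda>a. [a # \<iota> a # c # B, a # c # \<iota> a # B]"
      and F' = "\<lambda>a. [c # a # \<iota> a # B, a # c # \<iota> a # B]" and G = "\<lambda>a. a # c # \<iota> a # B"])
  have xy: "x = Pos \<and> y = Neg \<or> x = Neg \<and> y = Pos" using x by (auto simp: doubleton_eq_iff)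
  show "lab \<iota> [(Cup, 0), (x, Suc 0)] (c # B) ws w' \<longleftrightarrow>
      (\<exists>a \<in> UNIV. ws = [a # \<iota> a # c # B, a # c # \<iota> a # B] \<and> w' = a # c # \<iota> a # B)" for ws w'
    using xy by auto
  show "lab \<iota> [(Cup, Suc 0), (y, 0)] (c # B) ws w' \<longleftrightarrow>
      (\<exists>a \<in> UNIV. ws = [c # a # \<iota> a # B, a # c # \<iota> a # B] \<and> w' = a # c # \<iota> a # B)" for ws w'
    using xy by auto
  show "labelings_match \<iota> [(Cup, 0), (x, Suc 0)] [(Cup, Suc 0), (y, 0)] (c # B)
    [a # \<iota> a # c # B, a # c # \<iota> a # B] [c # a # \<iota> a # B, a # c # \<iota> a # B]" for a
  proof (rule labelings_matchI)
    fix P :: "'a \<Rightarrow> bool"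
    assume P: "\<And>c. P (\<iota> c) = P c"
    show "sub P [(Cup, 0), (x, Suc 0)] (c # B) [a # \<iota> a # c # B, a # c # \<iota> a # B] =
      sub P [(Cup, Suc 0), (y, 0)] (c # B) [c # a # \<iota> a # B, a # c # \<iota> a # B] \<or>
      isotopy_move (sub P [(Cup, 0), (x, Suc 0)] (c # B) [a # \<iota> a # c # B, a # c # \<iota> a # B])
      (sub P [(Cup, Suc 0), (y, 0)] (c # B) [c # a # \<iota> a # B, a # c # \<iota> a # B])"
      using xy isotopy_moves(4,5)[of 0] P[of a] by (auto simp: sub1_def)
  next
    fix \<omega> :: "piece \<Rightarrow> 'a \<Rightarrow> 'a \<Rightarrow> int"
    assume "rotatable \<iota> \<omega>"
    from rotatableD(2,3)[OF this, of a c]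
    show "wr \<omega> [(Cup, 0), (x, Suc 0)] (c # B) [a # \<iota> a # c # B, a # c # \<iota> a # B] =
      wr \<omega> [(Cup, Suc 0), (y, 0)] (c # B) [c # a # \<iota> a # B, a # c # \<iota> a # B]"
      using xy by (auto simp: wr1_def)
  qed (auto simp: labels_def)
qed (auto simp: inj_on_def)

lemma moves_labelings_cap:
  assumes \<iota>: "\<And>c. \<iota> (\<iota> c) = c" and x: "{x, y} = {Pos, Neg}"
  shows "moves_labelings \<iota> [(x, Suc 0), (Cap, 0)] [(y, 0), (Cap, Suc 0)] (a # b # c # B)"
\<comment> \<open>The cap accepts \<open>a\<close> and \<open>c\<close> only if they are related by
  \<iota>; otherwise neither side has a labeling.\<close>
proof (rule moves_labelingsI[where S = "if c = \<iota> a then {()} else {}" and F = "\<lambda>_. [a # c # b # B, b # B]"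
      and F' = "\<lambda>_. [b # a # c # B, b # B]" and G = "\<lambda>_. b # B"])
  have xy: "x = Pos \<and> y = Neg \<or> x = Neg \<and> y = Pos" using x by (auto simp: doubleton_eq_iff)
  show "lab \<iota> [(x, Suc 0), (Cap, 0)] (a # b # c # B) ws w' \<longleftrightarrow>
      (\<exists>u \<in> (if c = \<iota> a then {()} else {}). ws = [a # c # b # B, b # B] \<and> w' = b # B)" for ws w'
    using xy by auto
  show "lab \<iota> [(y, 0), (Cap, Suc 0)] (a # b # c # B) ws w' \<longleftrightarrow>
      (\<exists>u \<in> (if c = \<iota> a then {()} else {}). ws = [b # a # c # B, b # B] \<and> w' = b # B)" for ws w'
    using xy by auto
  show "labelings_match \<iota> [(x, Suc 0), (Cap, 0)] [(y, 0), (Cap, Suc 0)] (a # b # c # B)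
    [a # c # b # B, b # B] [b # a # c # B, b # B]" if "u \<in> (if c = \<iota> a then {()} else {})" for u
  proof (rule labelings_matchI)
    have c: "c = \<iota> a" using that by (auto split: if_splits)
    fix P :: "'a \<Rightarrow> bool"
    assume P: "\<And>c. P (\<iota> c) = P c"
    show "sub P [(x, Suc 0), (Cap, 0)] (a # b # c # B) [a # c # b # B, b # B] =
      sub P [(y, 0), (Cap, Suc 0)] (a # b # c # B) [b # a # c # B, b # B] \<or>
      isotopy_move (sub P [(x, Suc 0), (Cap, 0)] (a # b # c # B) [a # c # b # B, b # B])
      (sub P [(y, 0), (Cap, Suc 0)] (a # b # c # B) [b # a # c # B, b # B])"
      using xy isotopy_moves(6,7)[of 0] P[of a] c by (auto simp: sub1_def)
  next
    have c: "c = \<iota> a" using that by (auto split: if_splits)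
    fix \<omega> :: "piece \<Rightarrow> 'a \<Rightarrow> 'a \<Rightarrow> int"
    assume "rotatable \<iota> \<omega>"
    from rotatableD(4,5)[OF this, of b a]
    show "wr \<omega> [(x, Suc 0), (Cap, 0)] (a # b # c # B) [a # c # b # B, b # B] =
      wr \<omega> [(y, 0), (Cap, Suc 0)] (a # b # c # B) [b # a # c # B, b # B]"
      using xy c by (auto simp: wr1_def)
  qed (auto simp: labels_def)
qed (auto simp: inj_on_def)

text \<open>If one of the three strands is erased, the same single crossing of the other two remains
  on both sides; the move itself survives only with all three strands.\<close>

lemma moves_labelings_r3:
  assumes x: "{x, y, z} \<subseteq> {Pos, Neg}" "y = x \<or> y = z"
  shows "moves_labelings \<iota> [(x, 0), (y, Suc 0), (z, 0)] [(z, Suc 0), (y, 0), (x, Suc 0)] (a # b # c # B)"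
proof (rule moves_labelingsI[where S = "{()}" and F = "\<lambda>_. [b # a # c # B, b # c # a # B, c # b # a # B]"
      and F' = "\<lambda>_. [a # c # b # B, c # a # b # B, c # b # a # B]" and G = "\<lambda>_. c # b # a # B"])
  have st: "step \<iota> (g, 0) (p # q # r) s \<longleftrightarrow> s = q # p # r" if "g \<in> {Pos, Neg}" for g p q r s
    using that by auto
  show "lab \<iota> [(x, 0), (y, Suc 0), (z, 0)] (a # b # c # B) ws w' \<longleftrightarrow>
      (\<exists>u \<in> {()}. ws = [b # a # c # B, b # c # a # B, c # b # a # B] \<and> w' = c # b # a # B)" for ws w'
    using x st by auto
  show "lab \<iota> [(z, Suc 0), (y, 0), (x, Suc 0)] (a # b # c # B) ws w' \<longleftrightarrow>
      (\<exists>u \<in> {()}. ws = [a # c # b # B, c # a # b # B, c # b # a # B] \<and> w' = c # b # a # B)" for ws w'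
    using x st by auto
  have nc: "x \<noteq> Cup" "y \<noteq> Cup" "z \<noteq> Cup" using x by auto
  show "labelings_match \<iota> [(x, 0), (y, Suc 0), (z, 0)] [(z, Suc 0), (y, 0), (x, Suc 0)] (a # b # c # B)
    [b # a # c # B, b # c # a # B, c # b # a # B] [a # c # b # B, c # a # b # B, c # b # a # B]"
  proof (rule labelings_matchI)
    fix P :: "'a \<Rightarrow> bool"
    show "sub P [(x, 0), (y, Suc 0), (z, 0)] (a # b # c # B) [b # a # c # B, b # c # a # B, c # b # a # B] =
        sub P [(z, Suc 0), (y, 0), (x, Suc 0)] (a # b # c # B) [a # c # b # B, c # a # b # B, c # b # a # B] \<or>
      isotopy_move (sub P [(x, 0), (y, Suc 0), (z, 0)] (a # b # c # B) [b # a # c # B, b # c # a # B, c # b # a # B])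
        (sub P [(z, Suc 0), (y, 0), (x, Suc 0)] (a # b # c # B) [a # c # b # B, c # a # b # B, c # b # a # B])"
      using nc isotopy_moves(10)[OF x, of 0]
      by (cases "P a"; cases "P b"; cases "P c") (simp_all add: sub1_def)
  qed (use x in \<open>auto simp: labels_def wr1_def\<close>)
qed (auto simp: inj_on_def)

lemma step_0_append:
  assumes "length X = n_in g"
  shows "step \<iota> (g, 0) (X @ v) y \<longleftrightarrow> (\<exists>X'. y = X' @ v \<and> step \<iota> (g, 0) X X')"
proof (cases "g = Cup")
  case False
  then obtain a b where "X = [a, b]" using assms by (cases g) (auto simp: numeral_2_eq_2 length_Suc_conv)
  then show ?thesis by (cases g) auto
qed (use assms in auto)

lemma moves_labelings_exchange:
  assumes "\<And>c. \<iota> (\<iota> c) = c" and "n_in g \<le> length w"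
  shows "moves_labelings \<iota> [(g, 0), (g', n_out g + d)] [(g', n_in g + d), (g, 0)] w"
proof -
  obtain X v where w: "w = X @ v" "length X = n_in g"
    using assms(2) by (metis append_take_drop_id length_take min.absorb2)
  let ?S = "{(X', v'). step \<iota> (g, 0) X X' \<and> step \<iota> (g', d) v v'}"
  have len: "length X' = n_out g" if "step \<iota> (g, 0) X X'" for X'
    using step_fits[OF that] w by simp
  show ?thesis
  proof (rule moves_labelingsI[where S = ?S and F = "\<lambda>(X', v'). [X' @ v, X' @ v']"
        and F' = "\<lambda>(X', v'). [X @ v', X' @ v']" and G = "\<lambda>(X', v'). X' @ v'"])
    have up: "step \<iota> (g', n_out g + d) (X' @ v) y \<longleftrightarrow> (\<exists>v'. y = X' @ v' \<and> step \<iota> (g', d) v v')"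
      if "step \<iota> (g, 0) X X'" for X' y
      using step_prefix[of \<iota> g' X' d v y] len[OF that] by simp
    have down: "step \<iota> (g', n_in g + d) (X @ v) y \<longleftrightarrow> (\<exists>v'. y = X @ v' \<and> step \<iota> (g', d) v v')" for y
      using step_prefix[of \<iota> g' X d v y] w by simp
    show "lab \<iota> [(g, 0), (g', n_out g + d)] w ws w' \<longleftrightarrow>
      (\<exists>a \<in> ?S. ws = (case a of (X', v') \<Rightarrow> [X' @ v, X' @ v']) \<and> w' = (case a of (X', v') \<Rightarrow> X' @ v'))" for ws w'
    proof
      assume "lab \<iota> [(g, 0), (g', n_out g + d)] w ws w'"
      then obtain y where y: "ws = [y, w']" "step \<iota> (g, 0) (X @ v) y" "step \<iota> (g', n_out g + d) y w'"
        using w by auto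
      then obtain X' where X': "y = X' @ v" "step \<iota> (g, 0) X X'" using step_0_append[OF w(2)] by blast
      then obtain v' where "w' = X' @ v'" "step \<iota> (g', d) v v'" using y(3) up[OF X'(2)] by blast
      then show "\<exists>a \<in> ?S. ws = (case a of (X', v') \<Rightarrow> [X' @ v, X' @ v']) \<and> w' = (case a of (X', v') \<Rightarrow> X' @ v')"
        using X' y by (intro bexI[of _ "(X', v')"]) auto
    next
      assume "\<exists>a \<in> ?S. ws = (case a of (X', v') \<Rightarrow> [X' @ v, X' @ v']) \<and> w' = (case a of (X', v') \<Rightarrow> X' @ v')"
      then obtain X' v' where "step \<iota> (g, 0) X X'" "step \<iota> (g', d) v v'" "ws = [X' @ v, X' @ v']" "w' = X' @ v'"
        by auto
      then show "lab \<iota> [(g, 0), (g', n_out g + d)] w ws w'"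
        using step_0_append[OF w(2), of \<iota> v "X' @ v"] up[of X' "X' @ v'"] w by auto
    qed
    show "lab \<iota> [(g', n_in g + d), (g, 0)] w ws w' \<longleftrightarrow>
      (\<exists>a \<in> ?S. ws = (case a of (X', v') \<Rightarrow> [X @ v', X' @ v']) \<and> w' = (case a of (X', v') \<Rightarrow> X' @ v'))" for ws w'
    proof
      assume "lab \<iota> [(g', n_in g + d), (g, 0)] w ws w'"
      then obtain y where y: "ws = [y, w']" "step \<iota> (g', n_in g + d) (X @ v) y" "step \<iota> (g, 0) y w'"
        using w by auto
      then obtain v' where v': "y = X @ v'" "step \<iota> (g', d) v v'" using down by blast
      then obtain X' where "w' = X' @ v'" "step \<iota> (g, 0) X X'" using y(3) step_0_append[OF w(2)] by blast
      then show "\<exists>a \<in> ?S. ws = (case a of (X', v') \<Rightarrow> [X @ v', X' @ v']) \<and> w' = (case a of (X', v') \<Rightarrow> X' @ v')"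
        using v' y by (intro bexI[of _ "(X', v')"]) auto
    next
      assume "\<exists>a \<in> ?S. ws = (case a of (X', v') \<Rightarrow> [X @ v', X' @ v']) \<and> w' = (case a of (X', v') \<Rightarrow> X' @ v')"
      then obtain X' v' where "step \<iota> (g, 0) X X'" "step \<iota> (g', d) v v'" "ws = [X @ v', X' @ v']" "w' = X' @ v'"
        by auto
      then show "lab \<iota> [(g', n_in g + d), (g, 0)] w ws w'"
        using step_0_append[OF w(2), of \<iota> v' "X' @ v'"] down[of "X @ v'"] w by auto
    qed
    show "inj_on (\<lambda>(X', v'). X' @ v') ?S" using len by (auto simp: inj_on_def)
    show "labelings_match \<iota> [(g, 0), (g', n_out g + d)] [(g', n_in g + d), (g, 0)] w
        (case a of (X', v') \<Rightarrow> [X' @ v, X' @ v']) (case a of (X', v') \<Rightarrow> [X @ v', X' @ v'])" if aS: "a \<in> ?S" for a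
    proof -
      obtain X' v' where a: "a = (X', v')" "step \<iota> (g, 0) X X'" "step \<iota> (g', d) v v'" using aS by auto
      have d: "d + n_in g' \<le> length v" using step_fits[OF a(3)] by simp
      show ?thesis unfolding a prod.case
      proof (rule labelings_matchI)
        show "labels w [X' @ v, X' @ v'] = labels w [X @ v', X' @ v']" by (auto simp: labels_def w)
        fix \<omega> :: "piece \<Rightarrow> 'a \<Rightarrow> 'a \<Rightarrow> int"
        have "wr1 \<omega> (g', n_out g + d) (X' @ v) = wr1 \<omega> (g', d) v"
          "wr1 \<omega> (g', n_in g + d) (X @ v) = wr1 \<omega> (g', d) v"
          using len[OF a(2)] w by (auto simp: wr1_def nth_append)
        moreover have "wr1 \<omega> (g, 0) (X @ v) = wr1 \<omega> (g, 0) (X @ v')"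
          using w(2) by (cases g) (auto simp: wr1_def nth_append)
        ultimately show "wr \<omega> [(g, 0), (g', n_out g + d)] w [X' @ v, X' @ v'] =
            wr \<omega> [(g', n_in g + d), (g, 0)] w [X @ v', X' @ v']" using w by simp
      next
        fix P :: "'a \<Rightarrow> bool"
        assume P: "\<And>c. P (\<iota> c) = P c"
        let ?p = "length (filter P X)" and ?p' = "length (filter P X')"
        have 1: "sub1 P (g', n_out g + d) (X' @ v) (X' @ v') = shift ?p' (sub1 P (g', d) v v')"
          "sub1 P (g', n_in g + d) (X @ v) (X @ v') = shift ?p (sub1 P (g', d) v v')"
          using sub1_prefix[OF a(3), of P X'] sub1_prefix[OF a(3), of P X] len[OF a(2)] w by simp_all
        have 2: "sub1 P (g, 0) (X @ v) (X' @ v) = sub1 P (g, 0) (X @ v') (X' @ v')"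
          using w(2) len[OF a(2)] by (cases g) (auto simp: sub1_def nth_append)
        \<comment> \<open>Either the slice \<open>g\<close> is erased and equally many of its
          strands survive below and above, or it is kept together with all of its strands. In both
          cases the other slice has the positions required by the move.\<close>
        have 3: "sub1 P (g, 0) (X @ v) (X' @ v) = [] \<and> ?p = ?p' \<or>
            sub1 P (g, 0) (X @ v) (X' @ v) = [(g, 0)] \<and> ?p = n_in g \<and> ?p' = n_out g"
        proof (cases g)
          case Cup
          then obtain c where "X = []" "X' = [c, \<iota> c]" using a(2) w(2) by auto
          then show ?thesis using P[of c] Cup by (simp add: sub1_def)
        next
          case Cap
          then obtain c where "X = [c, \<iota> c]" "X' = []" using a(2) w(2) by auto
          then show ?thesis using P[of c] Cap by (simp add: sub1_def)
        qed (use a(2) w(2) in \<open>auto simp: sub1_def\<close>)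
        have 4: "sub1 P (g', d) v v' = [] \<or> (\<exists>j. sub1 P (g', d) v v' = [(g', j)])"
          by (auto simp: sub1_def)
        have "sub P [(g, 0), (g', n_out g + d)] w [X' @ v, X' @ v'] =
            sub1 P (g, 0) (X @ v) (X' @ v) @ shift ?p' (sub1 P (g', d) v v')"
          "sub P [(g', n_in g + d), (g, 0)] w [X @ v', X' @ v'] =
            shift ?p (sub1 P (g', d) v v') @ sub1 P (g, 0) (X @ v) (X' @ v)"
          using 1 2 w by simp_all
        then show "sub P [(g, 0), (g', n_out g + d)] w [X' @ v, X' @ v'] =
            sub P [(g', n_in g + d), (g, 0)] w [X @ v', X' @ v'] \<or>
          isotopy_move (sub P [(g, 0), (g', n_out g + d)] w [X' @ v, X' @ v'])
            (sub P [(g', n_in g + d), (g, 0)] w [X @ v', X' @ v'])"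
          using 3 4 isotopy_moves(1)[of g 0 g'] by (auto simp: add.commute)
      qed
    qed
  qed
qed

lemma moves_labelings_shift:
  "moves_labelings \<iota> l l' v \<Longrightarrow> length A = i \<Longrightarrow> moves_labelings \<iota> (shift i l) (shift i l') (A @ v)"
  using moves_labelings_prefix by blast

lemma split_at:
  assumes "i + n \<le> length w"
  obtains A X B where "w = A @ X @ B" "length A = i" "length X = n"
  using split_word[OF assms] by blast

lemma length_1E: "length X = Suc 0 \<Longrightarrow> (\<And>a. X = [a] \<Longrightarrow> P) \<Longrightarrow> P"
  and length_2E: "length X = Suc (Suc 0) \<Longrightarrow> (\<And>a b. X = [a, b] \<Longrightarrow> P) \<Longrightarrow> P"
  and length_3E: "length X = Suc (Suc (Suc 0)) \<Longrightarrow> (\<And>a b c. X = [a, b, c] \<Longrightarrow> P) \<Longrightarrow> P"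
  by (auto simp: length_Suc_conv)

lemma moves_labelings_move:
  assumes "isotopy_move l l'" "fits (length w) l" "fits (length w) l'" and \<iota>: "\<And>c. \<iota> (\<iota> c) = c"
  shows "moves_labelings \<iota> l l' w"
  using assms(1)
proof (cases rule: isotopy_move_cases)
  case (exchange g i g' d)
  then obtain A v where w: "w = A @ v" "length A = i" "n_in g \<le> length v"
    using assms(2) split_at[of i "n_in g" w] by (metis fits.simps(2) le_add1 length_append)
  have "l = shift i [(g, 0), (g', n_out g + d)]" "l' = shift i [(g', n_in g + d), (g, 0)]"
    using exchange by (simp_all add: add_ac)
  then show ?thesis
    using moves_labelings_shift[OF moves_labelings_exchange[OF \<iota> w(3), of g' d] w(2)] w(1) by metis
next
  case (zigzag_left i)
  then have "i + Suc 0 \<le> length w" using assms(2) by simp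
  then obtain A X B where w: "w = A @ X @ B" "length A = i" "length X = Suc 0" by (rule split_at)
  obtain c where X: "X = [c]" using w(3) by (rule length_1E)
  have "l = shift i [(Cup, 0), (Cap, Suc 0)]" "l' = shift i []" using zigzag_left by simp_all
  then show ?thesis
    using moves_labelings_shift[OF moves_labelings_zigzag[OF \<iota>, of 0 "Suc 0" c B] w(2)] w X by simp
next
  case (zigzag_right i)
  then have "i + Suc 0 \<le> length w" using assms(2) by simp
  then obtain A X B where w: "w = A @ X @ B" "length A = i" "length X = Suc 0" by (rule split_at)
  obtain c where X: "X = [c]" using w(3) by (rule length_1E)
  have "l = shift i [(Cup, Suc 0), (Cap, 0)]" "l' = shift i []" using zigzag_right by simp_all
  then show ?thesis
    using moves_labelings_shift[OF moves_labelings_zigzag[OF \<iota>, of "Suc 0" 0 c B] w(2)] w X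
    by (simp add: insert_commute)
next
  case (cup_over i)
  then have "i + Suc 0 \<le> length w" using assms(2) by simp
  then obtain A X B where w: "w = A @ X @ B" "length A = i" "length X = Suc 0" by (rule split_at)
  obtain c where X: "X = [c]" using w(3) by (rule length_1E)
  have "l = shift i [(Cup, 0), (Neg, Suc 0)]" "l' = shift i [(Cup, Suc 0), (Pos, 0)]" using cup_over by simp_all
  then show ?thesis
    using moves_labelings_shift[OF moves_labelings_cup[OF \<iota>, of Neg Pos c B] w(2)] w X
    by (simp add: insert_commute)
next
  case (cup_under i)
  then have "i + Suc 0 \<le> length w" using assms(2) by simp
  then obtain A X B where w: "w = A @ X @ B" "length A = i" "length X = Suc 0" by (rule split_at)
  obtain c where X: "X = [c]" using w(3) by (rule length_1E)
  have "l = shift i [(Cup, 0), (Pos, Suc 0)]" "l' = shift i [(Cup, Suc 0), (Neg, 0)]" using cup_under by simp_all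
  then show ?thesis
    using moves_labelings_shift[OF moves_labelings_cup[OF \<iota>, of Pos Neg c B] w(2)] w X by simp
next
  case (cap_over i)
  then have "i + Suc (Suc (Suc 0)) \<le> length w" using assms(2) by simp
  then obtain A X B where w: "w = A @ X @ B" "length A = i" "length X = Suc (Suc (Suc 0))" by (rule split_at)
  obtain a b c where X: "X = [a, b, c]" using w(3) by (rule length_3E)
  have "l = shift i [(Pos, Suc 0), (Cap, 0)]" "l' = shift i [(Neg, 0), (Cap, Suc 0)]" using cap_over by simp_all
  then show ?thesis
    using moves_labelings_shift[OF moves_labelings_cap[OF \<iota>, of Pos Neg a b c B] w(2)] w X by simp
next
  case (cap_under i)
  then have "i + Suc (Suc (Suc 0)) \<le> length w" using assms(2) by simp
  then obtain A X B where w: "w = A @ X @ B" "length A = i" "length X = Suc (Suc (Suc 0))" by (rule split_at)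
  obtain a b c where X: "X = [a, b, c]" using w(3) by (rule length_3E)
  have "l = shift i [(Neg, Suc 0), (Cap, 0)]" "l' = shift i [(Pos, 0), (Cap, Suc 0)]" using cap_under by simp_all
  then show ?thesis
    using moves_labelings_shift[OF moves_labelings_cap[OF \<iota>, of Neg Pos a b c B] w(2)] w X
    by (simp add: insert_commute)
next
  case (r2_pos i)
  then have "i + Suc (Suc 0) \<le> length w" using assms(2) by simp
  then obtain A X B where w: "w = A @ X @ B" "length A = i" "length X = Suc (Suc 0)" by (rule split_at)
  obtain a b where X: "X = [a, b]" using w(3) by (rule length_2E)
  have "l = shift i [(Pos, 0), (Neg, 0)]" "l' = shift i []" using r2_pos by simp_all
  then show ?thesis
    using moves_labelings_shift[OF moves_labelings_r2[of Pos Neg \<iota> a b B] w(2)] w X by simp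
next
  case (r2_neg i)
  then have "i + Suc (Suc 0) \<le> length w" using assms(2) by simp
  then obtain A X B where w: "w = A @ X @ B" "length A = i" "length X = Suc (Suc 0)" by (rule split_at)
  obtain a b where X: "X = [a, b]" using w(3) by (rule length_2E)
  have "l = shift i [(Neg, 0), (Pos, 0)]" "l' = shift i []" using r2_neg by simp_all
  then show ?thesis
    using moves_labelings_shift[OF moves_labelings_r2[of Neg Pos \<iota> a b B] w(2)] w X
    by (simp add: insert_commute)
next
  case (r3 x y z i)
  then have "i + Suc (Suc (Suc 0)) \<le> length w" using assms(2) by auto
  then obtain A X B where w: "w = A @ X @ B" "length A = i" "length X = Suc (Suc (Suc 0))" by (rule split_at)
  obtain a b c where X: "X = [a, b, c]" using w(3) by (rule length_3E)
  have "l = shift i [(x, 0), (y, Suc 0), (z, 0)]" "l' = shift i [(z, Suc 0), (y, 0), (x, Suc 0)]"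
    using r3 by simp_all
  then show ?thesis
    using moves_labelings_shift[OF moves_labelings_r3[OF r3(1,2), of \<iota> a b c B] w(2)] w X by simp
qed

text \<open>A curl involves a single strand, with label \<open>c\<close>, and its labeling is
  forced. A sublink thus contains the whole curl or nothing of it. Both passages through the
  crossing carry \<open>c\<close>, even for orientations, since they go in the same vertical
  direction; so a weight that vanishes on equal labels does not see the curl.\<close>

definition curl_labeling :: "('c \<Rightarrow> 'c) \<Rightarrow> int \<Rightarrow> diagram \<Rightarrow> 'c list \<Rightarrow> 'c list list \<Rightarrow> 'c \<Rightarrow> bool" where
  "curl_labeling \<iota> s l w ws c \<longleftrightarrow> c \<in> set w \<and> (\<forall>ws' w'. lab \<iota> l w ws' w' \<longleftrightarrow> ws' = ws \<and> w' = w) \<and>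
     (\<iota> = id \<longrightarrow> labels w ws = set w) \<and>
     (\<forall>P. (\<forall>c. P (\<iota> c) = P c) \<longrightarrow> (if P c then curl s (sub P l w ws) else sub P l w ws = [])) \<and>
     (\<forall>\<omega>. (\<forall>g. \<omega> g c c = 0) \<longrightarrow> wr \<omega> l w ws = 0)"

lemma curl_labeling_base:
  assumes \<iota>: "\<And>c. \<iota> (\<iota> c) = c" and x: "x \<in> {Pos, Neg}"
    and "l = [(Cup, Suc 0), (x, 0), (Cap, Suc 0)] \<and> ws = [c # c # \<iota> c # B, c # c # \<iota> c # B, c # B] \<or>
      l = [(Cup, 0), (x, Suc 0), (Cap, 0)] \<and> ws = [\<iota> c # c # c # B, \<iota> c # c # c # B, c # B]"
    and "curl s l"
  shows "curl_labeling \<iota> s l (c # B) ws c"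
  unfolding curl_labeling_def
proof (intro conjI allI impI)
  have eq: "\<iota> a = \<iota> b \<longleftrightarrow> a = b" "c = \<iota> a \<longleftrightarrow> a = \<iota> c" for a b using \<iota> by metis+
  show "lab \<iota> l (c # B) ws' w' \<longleftrightarrow> ws' = ws \<and> w' = c # B" for ws' w'
    using assms(3)
  proof
    assume "l = [(Cup, Suc 0), (x, 0), (Cap, Suc 0)] \<and> ws = [c # c # \<iota> c # B, c # c # \<iota> c # B, c # B]"
    then show ?thesis using x by (auto simp: eq(1))
  next
    assume "l = [(Cup, 0), (x, Suc 0), (Cap, 0)] \<and> ws = [\<iota> c # c # c # B, \<iota> c # c # c # B, c # B]"
    then show ?thesis using x by (auto simp: eq(2) \<iota>)
  qed
  show "if P c then curl s (sub P l (c # B) ws) else sub P l (c # B) ws = []"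
    if P: "\<forall>c. P (\<iota> c) = P c" for P
    using assms(3,4) spec[OF P, of c] x by (auto simp: sub1_def)
  show "wr \<omega> l (c # B) ws = 0" if "\<forall>g. \<omega> g c c = 0" for \<omega>
    using assms(3) x that by (auto simp: wr1_def)
qed (use assms(3) in \<open>auto simp: labels_def\<close>)

lemma curl_labeling_prefix:
  assumes "curl_labeling \<iota> s l w ws c"
  shows "curl_labeling \<iota> s (shift (length A) l) (A @ w) (map ((@) A) ws) c"
  unfolding curl_labeling_def
proof (intro conjI allI impI)
  have l: "lab \<iota> l w ws' w' \<longleftrightarrow> ws' = ws \<and> w' = w" for ws' w'
    using assms unfolding curl_labeling_def by simp
  then have lw: "lab \<iota> l w ws w" by simp
  show "c \<in> set (A @ w)" using assms unfolding curl_labeling_def by simp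
  show "lab \<iota> (shift (length A) l) (A @ w) ws' w' \<longleftrightarrow> ws' = map ((@) A) ws \<and> w' = A @ w" for ws' w'
    unfolding lab_prefix l by auto
  show "labels (A @ w) (map ((@) A) ws) = set (A @ w)" if "\<iota> = id"
    using assms that unfolding labels_prefix curl_labeling_def by simp
  show "if P c then curl s (sub P (shift (length A) l) (A @ w) (map ((@) A) ws))
      else sub P (shift (length A) l) (A @ w) (map ((@) A) ws) = []" if "\<forall>c. P (\<iota> c) = P c" for P
  proof -
    have "if P c then curl s (sub P l w ws) else sub P l w ws = []"
      using assms that unfolding curl_labeling_def by blast
    then show ?thesis unfolding sub_prefix[OF lw] by (auto simp: curl_shift split: if_splits)
  qed
  show "wr \<omega> (shift (length A) l) (A @ w) (map ((@) A) ws) = 0" if "\<forall>g. \<omega> g c c = 0" for \<omega>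
    using assms that unfolding wr_prefix[OF lw] curl_labeling_def by simp
qed

lemma curl_labeling_exists:
  assumes "curl s l" "fits (length w) l" and \<iota>: "\<And>c. \<iota> (\<iota> c) = c"
  shows "\<exists>ws c. curl_labeling \<iota> s l w ws c"
proof -
  obtain i x l0 where l: "l = shift i l0" "x \<in> {Pos, Neg}" "curl s l0"
    "l0 = [(Cup, Suc 0), (x, 0), (Cap, Suc 0)] \<or> l0 = [(Cup, 0), (x, Suc 0), (Cap, 0)]"
    using assms(1)
  proof (cases rule: curl_cases)
    case (1 i)
    then show thesis using that[of i "[(Cup, Suc 0), (Neg, 0), (Cap, Suc 0)]" Neg] curls(1)[of 0] by simp
  next
    case (2 i)
    then show thesis using that[of i "[(Cup, 0), (Neg, Suc 0), (Cap, 0)]" Neg] curls(2)[of 0] by simp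
  next
    case (3 i)
    then show thesis using that[of i "[(Cup, Suc 0), (Pos, 0), (Cap, Suc 0)]" Pos] curls(3)[of 0] by simp
  next
    case (4 i)
    then show thesis using that[of i "[(Cup, 0), (Pos, Suc 0), (Cap, 0)]" Pos] curls(4)[of 0] by simp
  qed
  then have "i + Suc 0 \<le> length w" using assms(2) by auto
  then obtain A X B where w: "w = A @ X @ B" "length A = i" "length X = Suc 0" by (rule split_at)
  obtain c where X: "X = [c]" using w(3) by (rule length_1E)
  obtain ws where "curl_labeling \<iota> s l0 (c # B) ws c"
    using l(4) curl_labeling_base[OF \<iota> l(2) _ l(3)] by metis
  from curl_labeling_prefix[OF this, of A] show ?thesis using w X l(1) by auto
qed

text \<open>Values prescribed on the ends are propagated downwards. A cap never leads to a conflict: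
  it closes an arc, where any value can be chosen, or it joins two arcs, and the value is passed on
  along the joined arc. In particular, orientations exist.\<close>

lemma ends_labeling:
  assumes "ends u k" "\<And>e. e \<in> set k \<Longrightarrow> f (flip e) = \<iota> (f e)" and \<iota>: "\<And>c. \<iota> (\<iota> c) = c"
  shows "\<exists>ws. lab \<iota> u [] ws (map f k)"
proof -
  have st: "\<exists>ws. lab \<iota> (u @ [(g, length A)]) [] ws (map f A @ Y)"
    if ex: "\<exists>ws. lab \<iota> u [] ws (map f A @ X)" and s: "step \<iota> (g, 0) X Y" for u g X Y A and f :: "arc_end \<Rightarrow> _"
  proof -
    obtain ws where ws: "lab \<iota> u [] ws (map f A @ X)" using ex by blast
    have "step \<iota> (g, length A) (map f A @ X) (map f A @ Y)"
      using step_prefix[of \<iota> g "map f A" 0 X "map f A @ Y"] s by simp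
    then have "lab \<iota> (u @ [(g, length A)]) [] (ws @ [map f A @ Y]) (map f A @ Y)"
      unfolding lab_append using ws by auto
    then show ?thesis by blast
  qed
  show ?thesis
    using assms(1,2)
  proof (induction arbitrary: f rule: ends.induct)
    case (Cup u A B n)
    have fe: "f (Tail n) = \<iota> (f (Head n))" using Cup(4)[of "Head n"] by simp
    have "\<exists>ws. lab \<iota> u [] ws (map f A @ map f B)" using Cup.IH[of f] Cup(4) by simp
    from st[OF this, of Cup "f (Head n) # f (Tail n) # map f B"] fe show ?case by simp
  next
    case (Cross u A e e' B g)
    have "f (flip x) = \<iota> (f x)" if "x \<in> set (A @ [e, e'] @ B)" for x
      by (rule Cross(4)) (use that in auto)
    then have "\<exists>ws. lab \<iota> u [] ws (map f A @ f e # f e' # map f B)" using Cross.IH[of f] by simp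
    from st[OF this, of g "f e' # f e # map f B"] Cross(2) show ?case by auto
  next
    case (Close u A e B)
    have d: "distinct (A @ [e, flip e] @ B)" using ends_closed[OF Close(1)] by simp
    \<comment> \<open>The component that closes here is not constrained from above, so any value
      serves.\<close>
    define f' where "f' = f(e := undefined, flip e := \<iota> undefined)"
    have same: "map f' A = map f A" "map f' B = map f B" using d by (auto simp: f'_def)
    have "f' (flip x) = \<iota> (f' x)" if "x \<in> set (A @ [e, flip e] @ B)" for x
    proof (cases "x = e \<or> x = flip e")
      case True
      then show ?thesis using \<iota> by (auto simp: f'_def)
    next
      case False
      then have "flip x \<noteq> e" "flip x \<noteq> flip e" by auto
      then show ?thesis using False that Close(3)[of x] by (auto simp: f'_def)
    qed
    then have "\<exists>ws. lab \<iota> u [] ws (map f' A @ f' e # f' (flip e) # map f' B)" using Close.IH[of f'] by simp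
    moreover have "f' (flip e) = \<iota> (f' e)" by (simp add: f'_def)
    ultimately show ?case
      unfolding map_append same[symmetric] using st[where f = f' and g = Cap and Y = "map f' B"] by simp
  next
    case (Join u A e e' B)
    let ?k = "map (id(flip e' := e)) (A @ B)"
    have d: "distinct (A @ [e, e'] @ B)" and c: "flip ` set (A @ [e, e'] @ B) \<subseteq> set (A @ [e, e'] @ B)"
      using ends_closed[OF Join(1)] by auto
    have ne: "flip e \<noteq> flip e'" "e \<noteq> e'" "e' \<noteq> flip e" "flip e' \<noteq> e" using d Join(2) by auto
    have fe: "flip e' \<in> set (A @ B)" "flip e \<in> set (A @ B)" using c ne by auto
    have ek: "e \<in> set ?k" using fe(1) by (auto intro!: image_eqI[of _ _ "flip e'"])
    define f' where "f' = f(flip e' := f e, e' := \<iota> (f e))"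
    have new: "f' (flip e') = f e" "f' e' = \<iota> (f e)" "f' e = f e" "f' (flip e) = \<iota> (f e)"
      using ne Join(4)[OF ek] by (auto simp: f'_def)
    have same: "map f' A = map f (map (id(flip e' := e)) A)" "map f' B = map f (map (id(flip e' := e)) B)"
      using d by (auto simp: f'_def)
    have "f' (flip x) = \<iota> (f' x)" if x: "x \<in> set (A @ [e, e'] @ B)" for x
    proof (cases "x \<in> {e, e', flip e, flip e'}")
      case True
      then show ?thesis using new \<iota> by auto
    next
      case False
      then have "flip x \<noteq> e'" "flip x \<noteq> flip e'" by auto
      moreover have "x \<in> set ?k" using False x by (auto intro!: image_eqI[of _ _ x])
      ultimately show ?thesis using False Join(4)[of x] by (simp add: f'_def)
    qed
    then have "\<exists>ws. lab \<iota> u [] ws (map f' A @ f' e # f' e' # map f' B)" using Join.IH[of f'] by simp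
    from st[OF this, of Cap "map f' B"] show ?case using new same by simp
  qed auto
qed

lemma labeling_exists:
  assumes "link_diagram L" "\<And>c. \<iota> (\<iota> c) = c"
  obtains ws where "lab \<iota> L [] ws []"
proof -
  obtain k where k: "ends L k" using ends_exists assms(1) unfolding link_diagram_iff by blast
  then have "k = []" using ends_closed[OF k] assms(1) by (simp add: link_diagram_iff)
  then show thesis using ends_labeling[OF k, of undefined \<iota>] assms(2) that by auto
qed

section \<open>The phase of a colouring\<close>

lemma wr_diff: "wr \<omega> l w ws - wr \<omega>' l w ws = wr (\<lambda>g a b. \<omega> g a b - \<omega>' g a b) l w ws"
  by (induction \<omega> l w ws rule: wr.induct) (auto simp: wr1_def)

lemma wr_cmult: "k * wr \<omega> l w ws = wr (\<lambda>g a b. k * \<omega> g a b) l w ws"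
  by (induction \<omega> l w ws rule: wr.induct) (auto simp: wr1_def algebra_simps)

lemma wr_dvd:
  assumes "\<And>g a b. g \<in> {Pos, Neg} \<Longrightarrow> d dvd \<omega> g a b"
  shows "d dvd wr \<omega> l w ws"
  using assms by (induction \<omega> l w ws rule: wr.induct) (auto simp: wr1_def)

text \<open>This count detects crossings. For irreflexive \<open>r\<close>, an extremum with two
  equal labels changes it by an even number, and a crossing changes its parity exactly if
  \<open>r\<close> relates the two labels in one direction only.\<close>

fun inversions :: "('c \<Rightarrow> 'c \<Rightarrow> bool) \<Rightarrow> 'c list \<Rightarrow> nat" where
  "inversions r [] = 0"
| "inversions r (x # w) = length (filter (r x) w) + inversions r w"

lemma step_filter_parity:
  "step id (g, i) w w' \<Longrightarrow> even (length (filter P w)) = even (length (filter P w'))"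
proof (induction i arbitrary: w w')
  case 0
  then show ?case by (cases g) (auto split: if_splits)
next
  case (Suc i)
  then obtain x v v' where x: "w = x # v" "w' = x # v'" "step id (g, i) v v'"
    unfolding step.simps by blast
  then show ?case using Suc.IH[OF x(3)] by simp
qed

lemma lab_filter_parity:
  "lab id l w ws w' \<Longrightarrow> even (length (filter P w)) = even (length (filter P w'))"
proof (induction l arbitrary: w ws)
  case (Cons s l)
  obtain g i where s: "s = (g, i)" by force
  obtain x xs where x: "step id (g, i) w x" "lab id l x xs w'" using Cons.prems unfolding s lab.simps by blast
  show ?case using Cons.IH[OF x(2)] step_filter_parity[OF x(1), of P] by simp
qed simp

text \<open>Two classes of strands cross an even number of times.\<close>

lemma step_crossing_parity:
  assumes r: "\<And>c. \<not> r c c" and "step id (g, i) w w'"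
  shows "even (wr1 (\<lambda>g a b. of_bool (r a b \<noteq> r b a)) (g, i) w) =
    (even (inversions r w) = even (inversions r w'))"
  using assms(2)
proof (induction i arbitrary: w w')
  case 0
  then show ?case using r by (cases g) (auto simp: wr1_def)
next
  case (Suc i)
  then obtain x v v' where x: "w = x # v" "w' = x # v'" "step id (g, i) v v'"
    unfolding step.simps by blast
  have "wr1 (\<lambda>g a b. of_bool (r a b \<noteq> r b a)) (g, Suc i) w = wr1 (\<lambda>g a b. of_bool (r a b \<noteq> r b a)) (g, i) v"
    using x by (simp add: wr1_def)
  then show ?case using Suc.IH[OF x(3)] step_filter_parity[OF x(3), of "r x"] x(1,2) by auto
qed

lemma lab_crossing_parity:
  assumes r: "\<And>c. \<not> r c c" and "lab id l w ws w'"
  shows "even (wr (\<lambda>g a b. of_bool (r a b \<noteq> r b a)) l w ws) =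
    (even (inversions r w) = even (inversions r w'))"
  using assms(2)
proof (induction l arbitrary: w ws)
  case (Cons s l)
  obtain g i where s: "s = (g, i)" by force
  obtain x xs where x: "ws = x # xs" "step id (g, i) w x" "lab id l x xs w'"
    using Cons.prems unfolding s lab.simps by blast
  show ?case using Cons.IH[OF x(3)] step_crossing_parity[of r, OF r x(2)] x(1) s by auto
qed simp

fun turn_sign :: "piece \<Rightarrow> bool \<Rightarrow> int" where
  "turn_sign Pos p = (if p then -1 else 1)"
| "turn_sign Neg p = (if p then 1 else -1)"
| "turn_sign _ p = 0"

text \<open>A label consists of a colour and a direction.\<close>

fun mixed_sign :: "piece \<Rightarrow> 'c \<times> bool \<Rightarrow> 'c \<times> bool \<Rightarrow> int" where
  "mixed_sign g (c, p) (d, q) = (if c = d then 0 else turn_sign g (p = q))"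

abbreviation lift_Not :: "'c \<times> bool \<Rightarrow> 'c \<times> bool" where
  "lift_Not \<equiv> map_prod id Not"

lemma lift_Not_lift_Not: "lift_Not (lift_Not c) = c"
  by (cases c) simp

lemma rotatable_mixed_sign: "rotatable lift_Not mixed_sign"
  unfolding rotatable_def by auto

lemma i_powi_cong:
  assumes "4 dvd m - n"
  shows "\<i> powi m = \<i> powi n"
proof -
  obtain k where k: "m = n + 4 * k" using assms by (auto simp: dvd_def algebra_simps)
  have "\<i> powi 4 = 1" by (simp add: power_int_def eval_nat_numeral)
  then have "\<i> powi (4 * k) = 1" by (simp only: power_int_mult power_int_1_left)
  then show ?thesis using k by (simp add: power_int_add)
qed

text \<open>Reversing some of the components changes the signs of an even number of crossings between
  different colours.\<close>

lemma mixed_sign_reverse: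
  assumes "lab (map_prod id (map_prod Not Not)) L [] zs []"
  shows "4 dvd wr mixed_sign L [] (map (map (map_prod id fst)) zs) - wr mixed_sign L [] (map (map (map_prod id snd)) zs)"
proof -
  define \<omega> :: "piece \<Rightarrow> 'a \<times> bool \<times> bool \<Rightarrow> 'a \<times> bool \<times> bool \<Rightarrow> int"
    where "\<omega> = (\<lambda>g x y. mixed_sign g (map_prod id fst x) (map_prod id fst y) -
      mixed_sign g (map_prod id snd x) (map_prod id snd y))"
  \<comment> \<open>\<open>p \<noteq> q\<close> marks the strands on which the two orientations
    differ. Both orientations are negated at extrema, so the mark is constant along
    components.\<close>
  define h :: "'a \<times> bool \<times> bool \<Rightarrow> 'a \<times> bool" where "h = (\<lambda>(c, p, q). (c, p \<noteq> q))"
  \<comment> \<open>With this \<open>r\<close>, the crossings that count are those of different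
    colours with exactly one reversed strand. Their signs are the ones that change, and they change
    by 2 modulo 4.\<close>
  define r :: "'a \<times> bool \<Rightarrow> 'a \<times> bool \<Rightarrow> bool" where "r = (\<lambda>(c, p) (d, q). c \<noteq> d \<and> \<not> p \<and> q)"
  let ?t = "\<lambda>(g :: piece) x y. of_bool (r x y \<noteq> r y x) :: int"
  have "lab id L (map h []) (map (map h) zs) (map h [])"
    by (rule lab_map[OF _ assms]) (auto simp: h_def split: prod.splits)
  then have lh: "lab id L [] (map (map h) zs) []" by simp
  have "even (wr ?t L [] (map (map h) zs))"
    using lab_crossing_parity[of r, OF _ lh] by (auto simp: r_def split: prod.splits)
  moreover have "wr ?t L [] (map (map h) zs) = wr (\<lambda>g x y. ?t g (h x) (h y)) L [] zs"
    using wr_map[OF assms, of ?t h] by simp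
  ultimately have "4 dvd 2 * wr (\<lambda>g x y. ?t g (h x) (h y)) L [] zs" by auto
  moreover have "4 dvd wr \<omega> L [] zs - 2 * wr (\<lambda>g x y. ?t g (h x) (h y)) L [] zs"
    unfolding wr_cmult wr_diff
  proof (rule wr_dvd)
    fix g and x y :: "'a \<times> bool \<times> bool"
    assume g: "g \<in> {Pos, Neg}"
    obtain c p q d p' q' where xy: "x = (c, p, q)" "y = (d, p', q')" by (metis prod_cases3)
    show "4 dvd \<omega> g x y - 2 * ?t g (h x) (h y)"
      using g unfolding xy \<omega>_def h_def r_def
      by (cases "c = d"; cases p; cases q; cases p'; cases q') auto
  qed
  ultimately have "4 dvd wr \<omega> L [] zs" by presburger
  then show ?thesis
    using wr_map[OF assms, of mixed_sign "map_prod id fst"] wr_map[OF assms, of mixed_sign "map_prod id snd"]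
    unfolding \<omega>_def wr_diff[symmetric] by simp
qed

definition colour_phase :: "diagram \<Rightarrow> 'c list list \<Rightarrow> complex" where
  "colour_phase L cs = \<i> powi wr mixed_sign L [] (map2 zip cs (SOME os. lab Not L [] os []))"

lemma map_map_prod_zip:
  assumes "length x = length y" "length y = length z"
  shows "map (map_prod id fst) (zip x (zip y z)) = zip x y" "map (map_prod id snd) (zip x (zip y z)) = zip x z"
  using assms by (induction x y z rule: list_induct3) auto

lemma map2_zip_zip:
  assumes "list_all2 (\<lambda>x y. length x = length y) xs ys" "list_all2 (\<lambda>x y. length x = length y) ys zs"
  shows "map (map (map_prod id fst)) (map2 zip xs (map2 zip ys zs)) = map2 zip xs ys"
    "map (map (map_prod id snd)) (map2 zip xs (map2 zip ys zs)) = map2 zip xs zs"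
proof -
  have "length xs = length ys" "length ys = length zs"
    using assms by (auto dest: list_all2_lengthD)
  then show "map (map (map_prod id fst)) (map2 zip xs (map2 zip ys zs)) = map2 zip xs ys"
    "map (map (map_prod id snd)) (map2 zip xs (map2 zip ys zs)) = map2 zip xs zs"
    using assms by (induction xs ys zs rule: list_induct3) (auto simp: map_map_prod_zip)
qed

text \<open>Both orientations are attached to the colouring at once, so that the difference of the
  two exponents is a sum over one labeling by triples. Hence any orientation computes the
  phase.\<close>

lemma colour_phase_eq:
  assumes "lab id L [] cs []" "lab Not L [] os []"
  shows "colour_phase L cs = \<i> powi wr mixed_sign L [] (map2 zip cs os)"
proof -
  define os' where "os' = (SOME os. lab Not L [] os [])"
  have os': "lab Not L [] os' []" unfolding os'_def using assms(2) by (rule someI)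
  have "lab (map_prod Not Not) L [] (map2 zip os' os) []"
    using lab_zip[OF os' assms(2)] by simp
  from lab_zip[OF assms(1) this]
  have "lab (map_prod id (map_prod Not Not)) L [] (map2 zip cs (map2 zip os' os)) []" by simp
  from mixed_sign_reverse[OF this] map2_zip_zip[of cs os' os]
  have "4 dvd wr mixed_sign L [] (map2 zip cs os') - wr mixed_sign L [] (map2 zip cs os)"
    using lab_length[OF assms(1) os'] lab_length[OF os' assms(2)] by simp
  then show ?thesis unfolding colour_phase_def os'_def[symmetric] by (rule i_powi_cong)
qed

lemma orientation_labeling_exists:
  assumes "link_diagram L"
  obtains os where "lab Not L [] os []"
  using labeling_exists[OF assms, of Not] by auto

section \<open>The colour sums and their invariance\<close>

text \<open>All \<open>k\<close> colours have to occur: a partition into \<open>k\<close> parts then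
  comes from exactly \<open>k!\<close> colourings, and no monochromatic sublink is empty.\<close>

definition colourings :: "diagram \<Rightarrow> nat \<Rightarrow> nat list list set" where
  "colourings L k = {cs. lab id L [] cs [] \<and> labels [] cs = {..<k}}"

definition colour_weight :: "(diagram \<Rightarrow> laurent) \<Rightarrow> diagram \<Rightarrow> nat \<Rightarrow> nat list list \<Rightarrow> laurent" where
  "colour_weight Q L k cs = const (colour_phase L cs) * (\<Prod>j<k. Q (sub ((=) j) L [] cs))"

definition colour_sum :: "(diagram \<Rightarrow> laurent) \<Rightarrow> diagram \<Rightarrow> nat \<Rightarrow> laurent" where
  "colour_sum Q L k = (\<Sum>cs \<in> colourings L k. colour_weight Q L k cs)"

text \<open>A labeling by truth values amounts to a set of components. Counting these labelings
  replaces counting components.\<close>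

definition bool_labelings :: "diagram \<Rightarrow> bool list list set" where
  "bool_labelings L = {bs. lab id L [] bs []}"

lemma sum_relates:
  assumes "\<And>x. x \<in> A \<Longrightarrow> \<exists>!y. y \<in> B \<and> R x y" "\<And>y. y \<in> B \<Longrightarrow> \<exists>!x. x \<in> A \<and> R x y"
    and "\<And>x y. x \<in> A \<Longrightarrow> y \<in> B \<Longrightarrow> R x y \<Longrightarrow> f x = g y"
  shows "sum f A = sum g B"
proof -
  define \<phi> where "\<phi> x = (THE y. y \<in> B \<and> R x y)" for x
  define \<psi> where "\<psi> y = (THE x. x \<in> A \<and> R x y)" for y
  have \<phi>: "\<phi> x \<in> B \<and> R x (\<phi> x)" if "x \<in> A" for x
    unfolding \<phi>_def by (rule theI'[OF assms(1)[OF that]])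
  have \<psi>: "\<psi> y \<in> A \<and> R (\<psi> y) y" if "y \<in> B" for y
    unfolding \<psi>_def by (rule theI'[OF assms(2)[OF that]])
  show ?thesis
  proof (rule sum.reindex_bij_witness[of A \<psi> \<phi>])
    fix x assume x: "x \<in> A"
    then show "\<psi> (\<phi> x) = x" using \<phi>[OF x] \<psi>[of "\<phi> x"] assms(2)[of "\<phi> x"] by blast
    show "\<phi> x \<in> B" "g (\<phi> x) = f x" using \<phi>[OF x] assms(3)[OF x, of "\<phi> x"] by auto
  next
    fix y assume y: "y \<in> B"
    then show "\<phi> (\<psi> y) = y" using \<psi>[OF y] \<phi>[of "\<psi> y"] assms(1)[of "\<psi> y"] by blast
    show "\<psi> y \<in> A" using \<psi>[OF y] by auto
  qed
qed

lemma lab_unique: "lab \<iota> l w ws x \<Longrightarrow> lab \<iota> l w ws y \<Longrightarrow> x = y"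
  by (induction l arbitrary: w ws) auto

lemma lab_append3:
  "lab \<iota> (u @ l @ v) w ws w' \<longleftrightarrow> (\<exists>a x b y z. ws = a @ x @ b \<and> lab \<iota> u w a y \<and> lab \<iota> l y x z \<and> lab \<iota> v z b w')"
  unfolding lab_append by blast

definition transferred :: "diagram \<Rightarrow> diagram \<Rightarrow> diagram \<Rightarrow> diagram \<Rightarrow> 'c list list \<Rightarrow> 'c list list \<Rightarrow> bool" where
  "transferred u l l' v ws ws' \<longleftrightarrow> (\<exists>a w x x' w' b. ws = a @ x @ b \<and> ws' = a @ x' @ b \<and>
     lab id u [] a w \<and> lab id l w x w' \<and> lab id l' w x' w' \<and> lab id v w' b [])"

lemma transferred_unique:
  fixes ws :: "'c list list"
  assumes "\<And>w :: 'c list. length w = wd 0 u \<Longrightarrow> unique_transfer id l l' w"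
    and ws: "lab id (u @ l @ v) [] ws []"
  shows "\<exists>!ws'. lab id (u @ l' @ v) [] ws' [] \<and> transferred u l l' v ws ws'"
proof -
  obtain a x b w w' where d: "ws = a @ x @ b" "lab id u [] a w" "lab id l w x w'" "lab id v w' b []"
    using ws unfolding lab_append3 by blast
  have w: "length w = wd 0 u" using lab_fits[OF d(2)] by simp
  then obtain x' where x': "lab id l' w x' w'" "\<And>y. lab id l' w y w' \<Longrightarrow> y = x'"
    using assms(1)[OF w] d(3) unfolding unique_transfer_def by blast
  show ?thesis
  proof (rule ex1I)
    show "lab id (u @ l' @ v) [] (a @ x' @ b) [] \<and> transferred u l l' v ws (a @ x' @ b)"
      unfolding lab_append3 transferred_def using d x' by blast
    fix ws' assume "lab id (u @ l' @ v) [] ws' [] \<and> transferred u l l' v ws ws'"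
    then obtain a2 w2 x2 x2' w2' b2 where e: "ws = a2 @ x2 @ b2" "ws' = a2 @ x2' @ b2"
      "lab id u [] a2 w2" "lab id l w2 x2 w2'" "lab id l' w2 x2' w2'" "lab id v w2' b2 []"
      unfolding transferred_def by blast
    have "length a = length a2" "length x = length x2"
      using lab_fits[OF d(2)] lab_fits[OF e(3)] lab_fits[OF d(3)] lab_fits[OF e(4)] by simp_all
    then have "a2 = a" "x2 = x" "b2 = b" using d(1) e(1) by auto
    moreover have "w2 = w" using lab_unique[OF d(2)] e(3) calculation(1) by blast
    moreover have "w2' = w'" using lab_unique[OF d(3)] e(4) calculation by blast
    ultimately show "ws' = a @ x' @ b" using x'(2) e(2,5) by blast
  qed
qed

lemma transferred_sym: "transferred u l l' v ws ws' \<longleftrightarrow> transferred u l' l v ws' ws"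
  unfolding transferred_def by blast

lemma unique_transfer_sym: "unique_transfer \<iota> l l' w \<longleftrightarrow> unique_transfer \<iota> l' l w"
  unfolding unique_transfer_def by blast

lemma transfer_sum:
  fixes f g :: "'c list list \<Rightarrow> 'r :: comm_monoid_add"
  assumes T: "\<And>w :: 'c list. length w = wd 0 u \<Longrightarrow> unique_transfer id l l' w"
    and S: "\<And>ws ws' :: 'c list list. transferred u l l' v ws ws' \<Longrightarrow> labels [] ws = labels [] ws'"
    and eq: "\<And>ws ws'. transferred u l l' v ws ws' \<Longrightarrow> p (labels [] ws) \<Longrightarrow> f ws = g ws'"
  shows "(\<Sum>ws | lab id (u @ l @ v) [] ws [] \<and> p (labels [] ws). f ws) =
    (\<Sum>ws | lab id (u @ l' @ v) [] ws [] \<and> p (labels [] ws). g ws)"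
proof (rule sum_relates[where R = "transferred u l l' v"])
  fix ws assume ws: "ws \<in> {ws. lab id (u @ l @ v) [] ws [] \<and> p (labels [] ws)}"
  then have "lab id (u @ l @ v) [] ws []" by simp
  note ex1 = transferred_unique[OF T this]
  have "ws' \<in> {ws. lab id (u @ l' @ v) [] ws [] \<and> p (labels [] ws)} \<and> transferred u l l' v ws ws' \<longleftrightarrow>
      lab id (u @ l' @ v) [] ws' [] \<and> transferred u l l' v ws ws'" for ws'
    using S[of ws ws'] ws by auto
  then show "\<exists>!ws'. ws' \<in> {ws. lab id (u @ l' @ v) [] ws [] \<and> p (labels [] ws)} \<and> transferred u l l' v ws ws'"
    using ex1 by presburger
  fix ws' assume "ws' \<in> {ws. lab id (u @ l' @ v) [] ws [] \<and> p (labels [] ws)}" "transferred u l l' v ws ws'"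
  then show "f ws = g ws'" using eq ws by simp
next
  fix ws' assume ws: "ws' \<in> {ws. lab id (u @ l' @ v) [] ws [] \<and> p (labels [] ws)}"
  have T': "unique_transfer id l' l w" if "length w = wd 0 u" for w :: "'c list"
    using T[OF that] unique_transfer_sym by blast
  have "lab id (u @ l' @ v) [] ws' []" using ws by simp
  note ex1 = transferred_unique[OF T' this]
  have "ws \<in> {ws. lab id (u @ l @ v) [] ws [] \<and> p (labels [] ws)} \<and> transferred u l l' v ws ws' \<longleftrightarrow>
      lab id (u @ l @ v) [] ws [] \<and> transferred u l' l v ws' ws" for ws
    using S[of ws ws'] ws transferred_sym[of u l' l v ws' ws] by auto
  then show "\<exists>!ws. ws \<in> {ws. lab id (u @ l @ v) [] ws [] \<and> p (labels [] ws)} \<and> transferred u l l' v ws ws'"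
    using ex1 by presburger
qed

lemma lab_append_zip:
  assumes "lab \<iota> u w a x" "lab \<iota>' u v b y" "length w = length v"
  shows "map2 zip (a @ a') (b @ b') = map2 zip a b @ map2 zip a' b'" "length x = length y"
  using lab_length[OF assms] by simp_all

text \<open>An orientation is transferred along with the colouring.\<close>

lemma colour_phase_transfer:
  fixes a b x x' :: "'c list list" and w w' :: "'c list"
  assumes L: "link_diagram (u @ l @ v)" and cs: "lab id u [] a w" "lab id l w x w'" "lab id l' w x' w'" "lab id v w' b []"
    and T: "\<And>w w' x. length w = wd 0 u \<Longrightarrow> lab Not l w x w' \<Longrightarrow> \<exists>x'. lab Not l' w x' w'"
    and W: "\<And>(w :: ('c \<times> bool) list) w' x x'. length w = wd 0 u \<Longrightarrow> lab lift_Not l w x w' \<Longrightarrow> lab lift_Not l' w x' w' \<Longrightarrow>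
      wr mixed_sign l w x = wr mixed_sign l' w x'"
  shows "colour_phase (u @ l @ v) (a @ x @ b) = colour_phase (u @ l' @ v) (a @ x' @ b)"
proof -
  obtain os where os: "lab Not (u @ l @ v) [] os []" using orientation_labeling_exists[OF L] by blast
  then obtain c y d z z' where o: "os = c @ y @ d" "lab Not u [] c z" "lab Not l z y z'" "lab Not v z' d []"
    unfolding lab_append3 by blast
  have len: "length w = wd 0 u" "length z = wd 0 u" "length w = length z" "length w' = length z'"
    using lab_fits[OF cs(1)] lab_fits[OF o(2)] lab_fits[OF cs(2)] lab_fits[OF o(3)] by simp_all
  have len0: "length ([] :: 'c list) = length ([] :: bool list)" by simp
  obtain y' where y': "lab Not l' z y' z'" using T[OF len(2) o(3)] by blast
  have ul: "lab id (u @ l @ v) [] (a @ x @ b) []" "lab id (u @ l' @ v) [] (a @ x' @ b) []"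
    "lab Not (u @ l' @ v) [] (c @ y' @ d) []"
    using cs o y' unfolding lab_append3 by blast+
  have zu: "lab lift_Not u [] (map2 zip a c) (zip w z)" using lab_zip[OF cs(1) o(2)] by simp
  have zl: "lab lift_Not l (zip w z) (map2 zip x y) (zip w' z')" using lab_zip[OF cs(2) o(3)] len by simp
  have zl': "lab lift_Not l' (zip w z) (map2 zip x' y') (zip w' z')" using lab_zip[OF cs(3) y'] len by simp
  have "wr mixed_sign (u @ l @ v) [] (map2 zip (a @ x @ b) (c @ y @ d)) =
      wr mixed_sign (u @ l' @ v) [] (map2 zip (a @ x' @ b) (c @ y' @ d))"
    unfolding lab_append_zip(1)[OF cs(1) o(2) len0] lab_append_zip(1)[OF cs(2) o(3) len(3)]
      lab_append_zip(1)[OF cs(3) y' len(3)]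
      wr_append[OF zu] wr_append[OF zl] wr_append[OF zl']
    using W[OF _ zl zl'] len by simp
  then show ?thesis
    unfolding colour_phase_eq[OF ul(1) os] colour_phase_eq[OF ul(2,3)] o(1) by simp
qed

lemma labels_append3:
  assumes "lab \<iota> u [] a w" "lab \<iota> l w x w'"
  shows "labels [] (a @ x @ b) = labels [] a \<union> labels w x \<union> labels w' b"
  unfolding labels_append[OF assms(1)] labels_append[OF assms(2)] by blast

lemma sub_append3:
  assumes "lab \<iota> u [] a w" "lab \<iota> l w x w'"
  shows "sub P (u @ l @ v) [] (a @ x @ b) = sub P u [] a @ sub P l w x @ sub P v w' b"
  unfolding sub_append[OF assms(1)] sub_append[OF assms(2)] by simp

lemma used_colour_link_diagram:
  assumes "lab id L [] cs []" "c \<in> labels [] cs"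
  shows "link_diagram (sub ((=) c) L [] cs)"
  using lab_sub_link_diagram[OF assms(1)] lab_sub_nonempty[OF assms] by simp

lemma isotopy_move_moves_labelings:
  assumes "isotopy_move l l'" "link_diagram (u @ l @ v)" "link_diagram (u @ l' @ v)"
    and "\<And>c. \<iota> (\<iota> c) = c" "length w = wd 0 u"
  shows "moves_labelings \<iota> l l' w"
  using assms by (intro moves_labelings_move) (auto simp: link_diagram_iff)

lemma labelings_match_sub:
  assumes "labelings_match \<iota> l l' w ws ws'" "\<And>c. P (\<iota> c) = P c"
  shows "sub P l w ws = sub P l' w ws' \<or> isotopy_move (sub P l w ws) (sub P l' w ws')"
  using assms unfolding labelings_match_def by blast

lemma colour_sum_isotopy:
  assumes Q: "framed_invariant Q" and mv: "isotopy_move l l'"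
    and L: "link_diagram (u @ l @ v)" "link_diagram (u @ l' @ v)"
  shows "colour_sum Q (u @ l @ v) k = colour_sum Q (u @ l' @ v) k"
  unfolding colour_sum_def colourings_def
proof (rule transfer_sum)
  note ml = isotopy_move_moves_labelings[OF mv L]
  show "unique_transfer id l l' w" if "length w = wd 0 u" for w :: "nat list"
    using ml[OF _ that, of id] unfolding moves_labelings_def by simp
  fix cs cs' :: "nat list list"
  assume "transferred u l l' v cs cs'"
  then obtain a w x x' w' b where d: "cs = a @ x @ b" "cs' = a @ x' @ b"
    "lab id u [] a w" "lab id l w x w'" "lab id l' w x' w'" "lab id v w' b []"
    unfolding transferred_def by blast
  have w: "length w = wd 0 u" using lab_fits[OF d(3)] by simp
  have m: "labelings_match id l l' w x x'"
    using ml[OF _ w, of id] d(4,5) unfolding moves_labelings_def by simp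
  show lb: "labels [] cs = labels [] cs'"
    unfolding d(1,2) labels_append3[OF d(3,4)] labels_append3[OF d(3,5)]
    using m unfolding labelings_match_def by simp
  assume k: "labels [] cs = {..<k}"
  have labs: "lab id (u @ l @ v) [] cs []" "lab id (u @ l' @ v) [] cs' []"
    unfolding lab_append3 using d by blast+
  have "Q (sub ((=) j) (u @ l @ v) [] cs) = Q (sub ((=) j) (u @ l' @ v) [] cs')" if "j < k" for j
  proof -
    have j: "j \<in> labels [] cs" "j \<in> labels [] cs'" using that k lb by auto
    \<comment> \<open>Each colour is used, so both sublinks are link diagrams, as
      \<open>local_move\<close> requires.\<close>
    have link: "link_diagram (sub ((=) j) (u @ l @ v) [] cs)" "link_diagram (sub ((=) j) (u @ l' @ v) [] cs')"
      by (rule used_colour_link_diagram[OF labs(1) j(1)], rule used_colour_link_diagram[OF labs(2) j(2)])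
    have "sub ((=) j) l w x = sub ((=) j) l' w x' \<or> isotopy_move (sub ((=) j) l w x) (sub ((=) j) l' w x')"
      by (rule labelings_match_sub[OF m]) simp
    then show ?thesis
    proof
      assume "isotopy_move (sub ((=) j) l w x) (sub ((=) j) l' w x')"
      then have "local_move isotopy_move (sub ((=) j) (u @ l @ v) [] cs) (sub ((=) j) (u @ l' @ v) [] cs')"
        using link unfolding local_move_def d(1,2) sub_append3[OF d(3,4)] sub_append3[OF d(3,5)] by blast
      then show ?thesis using Q unfolding framed_invariant_def by blast
    qed (simp add: d(1,2) sub_append3[OF d(3,4)] sub_append3[OF d(3,5)])
  qed
  moreover have "colour_phase (u @ l @ v) cs = colour_phase (u @ l' @ v) cs'"
    unfolding d(1,2)
  proof (rule colour_phase_transfer[OF L(1) d(3-6)])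
    fix z z' y assume "length z = wd 0 u" "lab Not l z y z'"
    then show "\<exists>y'. lab Not l' z y' z'"
      using ml[of Not z] unfolding moves_labelings_def unique_transfer_def by blast
  next
    fix z z' y y' assume "length z = wd 0 u" "lab lift_Not l z y z'" "lab lift_Not l' z y' z'"
    then have "labelings_match lift_Not l l' z y y'"
      using ml[of lift_Not z, OF lift_Not_lift_Not] unfolding moves_labelings_def by blast
    then show "wr mixed_sign l z y = wr mixed_sign l' z y'"
      using rotatable_mixed_sign unfolding labelings_match_def by blast
  qed
  ultimately show "colour_weight Q (u @ l @ v) k cs = colour_weight Q (u @ l' @ v) k cs'"
    unfolding colour_weight_def by simp
qed

lemma card_bool_labelings_isotopy:
  assumes mv: "isotopy_move l l'" and L: "link_diagram (u @ l @ v)" "link_diagram (u @ l' @ v)"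
  shows "card (bool_labelings (u @ l @ v)) = card (bool_labelings (u @ l' @ v))"
proof -
  note ml = isotopy_move_moves_labelings[OF mv L]
  have "(\<Sum>bs :: bool list list | lab id (u @ l @ v) [] bs [] \<and> True. 1 :: nat) =
    (\<Sum>bs :: bool list list | lab id (u @ l' @ v) [] bs [] \<and> True. 1)"
  proof (rule transfer_sum[where p = "\<lambda>_. True" and f = "\<lambda>_. 1" and g = "\<lambda>_. 1"])
    show "unique_transfer id l l' w" if "length w = wd 0 u" for w :: "bool list"
      using ml[OF _ that, of id] unfolding moves_labelings_def by simp
    fix ws ws' :: "bool list list"
    assume "transferred u l l' v ws ws'"
    then obtain a w x x' w' b where d: "ws = a @ x @ b" "ws' = a @ x' @ b"
      "lab id u [] a w" "lab id l w x w'" "lab id l' w x' w'" "lab id v w' b []"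
      unfolding transferred_def by blast
    have w: "length w = wd 0 u" using lab_fits[OF d(3)] by simp
    then have "labelings_match id l l' w x x'"
      using ml[OF _ w, of id] d(4,5) unfolding moves_labelings_def by simp
    then show "labels [] ws = labels [] ws'"
      unfolding d(1,2) labels_append3[OF d(3,4)] labels_append3[OF d(3,5)] labelings_match_def by simp
  qed simp
  then show ?thesis unfolding bool_labelings_def by simp
qed

lemma mixed_sign_same [simp]: "mixed_sign g c c = 0"
  by (cases c) simp

lemma curl_labelingD:
  assumes "curl_labeling \<iota> s l w ws c"
  shows "c \<in> set w" "lab \<iota> l w ws' w' \<longleftrightarrow> ws' = ws \<and> w' = w" "\<iota> = id \<Longrightarrow> labels w ws = set w"
    "(\<And>c. P (\<iota> c) = P c) \<Longrightarrow> P c \<Longrightarrow> curl s (sub P l w ws)"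
    "(\<And>c. P (\<iota> c) = P c) \<Longrightarrow> \<not> P c \<Longrightarrow> sub P l w ws = []"
    "(\<And>g. \<omega> g c c = 0) \<Longrightarrow> wr \<omega> l w ws = 0"
proof -
  have "(\<forall>c. P (\<iota> c) = P c) \<longrightarrow> (if P c then curl s (sub P l w ws) else sub P l w ws = [])"
    using assms unfolding curl_labeling_def by blast
  then show "(\<And>c. P (\<iota> c) = P c) \<Longrightarrow> P c \<Longrightarrow> curl s (sub P l w ws)"
    "(\<And>c. P (\<iota> c) = P c) \<Longrightarrow> \<not> P c \<Longrightarrow> sub P l w ws = []" by simp_all
qed (use assms in \<open>simp_all add: curl_labeling_def\<close>)

lemma curl_unique_transfer:
  assumes "curl_labeling \<iota> s l w ws c"
  shows "unique_transfer \<iota> l [] w"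
  unfolding unique_transfer_def curl_labelingD(2)[OF assms] by simp

text \<open>The curl lies in the sublink of exactly one colour, so the product of the values of
  \<open>Q\<close> gains the factor \<open>a_pow s\<close> once. The phase is unchanged because the
  crossing of the curl has equal colours.\<close>

lemma colour_sum_curl:
  assumes Q: "framed_invariant Q" and l: "curl s l" and L: "link_diagram (u @ l @ v)"
  shows "colour_sum Q (u @ l @ v) k = a_pow s * colour_sum Q (u @ v) k"
proof -
  have fit: "fits (wd 0 u) l" using L by (simp add: link_diagram_iff)
  have cl: "\<exists>ws c. curl_labeling \<iota> s l w ws c" if "length w = wd 0 u" "\<And>c. \<iota> (\<iota> c) = c"
    for w :: "'c list" and \<iota>
    using curl_labeling_exists[OF l _ that(2)] fit that(1) by simp
  have "(\<Sum>cs | lab id (u @ l @ v) [] cs [] \<and> labels [] cs = {..<k}. colour_weight Q (u @ l @ v) k cs) =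
    (\<Sum>cs | lab id (u @ [] @ v) [] cs [] \<and> labels [] cs = {..<k}. a_pow s * colour_weight Q (u @ [] @ v) k cs)"
  proof (rule transfer_sum)
    fix w :: "nat list"
    assume "length w = wd 0 u"
    then obtain ws c where "curl_labeling id s l w ws c" using cl[of w id] by auto
    then show "unique_transfer id l [] w" by (rule curl_unique_transfer)
  next
    fix cs cs' :: "nat list list"
    assume "transferred u l [] v cs cs'"
    then obtain a w x x' w' b where d0: "cs = a @ x @ b" "cs' = a @ x' @ b"
      "lab id u [] a w" "lab id l w x w'" "lab id [] w x' w'" "lab id v w' b []"
      unfolding transferred_def by blast
    have w: "length w = wd 0 u" using lab_fits[OF d0(3)] by simp
    obtain x0 c where c0: "curl_labeling id s l w x0 c" using cl[OF w, of id] by auto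
    then have "x = x0" using curl_labelingD(2)[OF c0, of x w'] d0(4) by simp
    then have c: "curl_labeling id s l w x c" using c0 by simp
    have "w' = w" "x' = []" using d0(5) by auto
    note d = d0[unfolded this append_Nil]
    have lu: "lab id [] w [] w" by simp
    have "labels w x = labels w []" using curl_labelingD(3)[OF c] by (simp add: labels_def)
    then show lb: "labels [] cs = labels [] cs'"
      unfolding d(1,2) labels_append3[OF d(3,4)] labels_append[OF d(3)] by (auto simp: labels_def)
    assume k: "labels [] cs = {..<k}"
    have labs: "lab id (u @ l @ v) [] cs []" unfolding lab_append3 using d by blast
    have ck: "c < k"
    proof -
      have "c \<in> labels w x" using curl_labelingD(1)[OF c] by (simp add: labels_def)
      then show ?thesis using k unfolding d(1) labels_append3[OF d(3,4)] by blast
    qed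
    have subs: "sub P (u @ l @ v) [] cs = sub P u [] a @ sub P l w x @ sub P v w b"
      "sub P (u @ v) [] cs' = sub P u [] a @ sub P v w b" for P
      unfolding d(1,2) by (rule sub_append3[OF d(3,4)], rule sub_append[OF d(3)])
    have "Q (sub ((=) j) (u @ l @ v) [] cs) = (if j = c then a_pow s else 1) * Q (sub ((=) j) (u @ v) [] cs')"
      if "j < k" for j
    proof (cases "j = c")
      case True
      have "c \<in> labels [] cs" using ck k by simp
      from used_colour_link_diagram[OF labs this]
      have "link_diagram (sub ((=) c) u [] a @ sub ((=) c) l w x @ sub ((=) c) v w b)"
        unfolding subs .
      moreover have "curl s (sub ((=) c) l w x)" using curl_labelingD(4)[OF c, of "(=) c"] by simp
      ultimately show ?thesis
        using Q True unfolding subs framed_invariant_def by simp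
    next
      case False
      then have "sub ((=) j) l w x = []" using curl_labelingD(5)[OF c, of "(=) j"] by simp
      then show ?thesis using False unfolding subs by simp
    qed
    then have "(\<Prod>j<k. Q (sub ((=) j) (u @ l @ v) [] cs)) =
        (\<Prod>j<k. (if j = c then a_pow s else 1) * Q (sub ((=) j) (u @ v) [] cs'))"
      by (intro prod.cong) simp_all
    also have "\<dots> = (\<Prod>j<k. if j = c then a_pow s else 1) * (\<Prod>j<k. Q (sub ((=) j) (u @ v) [] cs'))"
      by (rule prod.distrib)
    also have "(\<Prod>j<k. if j = c then a_pow s else 1) = a_pow s"
      using ck by (simp add: prod.delta)
    finally have prods: "(\<Prod>j<k. Q (sub ((=) j) (u @ l @ v) [] cs)) = a_pow s * (\<Prod>j<k. Q (sub ((=) j) (u @ v) [] cs'))" .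
    have "colour_phase (u @ l @ v) (a @ x @ b) = colour_phase (u @ [] @ v) (a @ [] @ b)"
    proof (rule colour_phase_transfer[OF L d(3,4) lu d(6)])
      fix z z' y assume z: "length z = wd 0 u" "lab Not l z y z'"
      obtain y0 c0 where y0: "curl_labeling Not s l z y0 c0" using cl[OF z(1), of Not] by auto
      then show "\<exists>y'. lab Not [] z y' z'" using curl_labelingD(2)[OF y0, of y z'] z(2) by simp
    next
      fix z :: "(nat \<times> bool) list" and z' y y'
      assume z: "length z = wd 0 u" "lab lift_Not l z y z'" "lab lift_Not [] z y' z'"
      obtain y0 c0 where y0: "curl_labeling lift_Not s l z y0 c0"
        using cl[OF z(1), of lift_Not, OF lift_Not_lift_Not] by blast
      then have "y = y0" using curl_labelingD(2)[OF y0, of y z'] z(2) by simp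
      then show "wr mixed_sign l z y = wr mixed_sign [] z y'"
        using curl_labelingD(6)[OF y0, of mixed_sign] by simp
    qed
    then show "colour_weight Q (u @ l @ v) k cs = a_pow s * colour_weight Q (u @ [] @ v) k cs'"
      unfolding colour_weight_def using prods d(1,2) by (simp add: mult_ac)
  qed
  then show ?thesis unfolding colour_sum_def colourings_def by (simp add: sum_distrib_left)
qed

lemma card_bool_labelings_curl:
  assumes l: "curl s l" and L: "link_diagram (u @ l @ v)"
  shows "card (bool_labelings (u @ l @ v)) = card (bool_labelings (u @ v))"
proof -
  have fit: "fits (wd 0 u) l" using L by (simp add: link_diagram_iff)
  have cl: "\<exists>ws c. curl_labeling id s l w ws c" if "length w = wd 0 u" for w :: "bool list"
    using curl_labeling_exists[OF l, of w id] fit that by simp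
  have "(\<Sum>bs :: bool list list | lab id (u @ l @ v) [] bs [] \<and> True. 1 :: nat) =
    (\<Sum>bs :: bool list list | lab id (u @ [] @ v) [] bs [] \<and> True. 1)"
  proof (rule sum_relates[where R = "transferred u l [] v"])
    have ut: "unique_transfer id l [] w" if w: "length w = wd 0 u" for w :: "bool list"
    proof -
      obtain ws c where "curl_labeling id s l w ws c" using cl[OF w] by blast
      then show ?thesis by (rule curl_unique_transfer)
    qed
    fix ws :: "bool list list"
    show "\<exists>!y. y \<in> {bs. lab id (u @ [] @ v) [] bs [] \<and> True} \<and> transferred u l [] v ws y"
      if "ws \<in> {bs. lab id (u @ l @ v) [] bs [] \<and> True}"
      using transferred_unique[of u l "[]" v ws, OF ut] that by simp
    show "\<exists>!x. x \<in> {bs. lab id (u @ l @ v) [] bs [] \<and> True} \<and> transferred u l [] v x ws"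
      if "ws \<in> {bs. lab id (u @ [] @ v) [] bs [] \<and> True}"
      using transferred_unique[of u "[]" l v ws, OF unique_transfer_sym[THEN iffD1, OF ut]] that
      unfolding transferred_sym[of u "[]" l] by simp
  qed simp
  then show ?thesis unfolding bool_labelings_def by simp
qed

section \<open>The skein relation\<close>

lemma step_crossing:
  assumes "g \<in> {Pos, Neg}"
  shows "step \<iota> (g, i) w w' \<longleftrightarrow> (\<exists>X c d Y. w = X @ [c, d] @ Y \<and> w' = X @ [d, c] @ Y \<and> length X = i)"
proof
  show "step \<iota> (g, i) w w' \<Longrightarrow> \<exists>X c d Y. w = X @ [c, d] @ Y \<and> w' = X @ [d, c] @ Y \<and> length X = i"
  proof (induction i arbitrary: w w')
    case 0
    then show ?case using assms by auto
  next
    case (Suc i)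
    then obtain x v v' where x: "w = x # v" "w' = x # v'" "step \<iota> (g, i) v v'" unfolding step.simps by blast
    obtain X c d Y where "v = X @ [c, d] @ Y" "v' = X @ [d, c] @ Y" "length X = i" using Suc.IH[OF x(3)] by blast
    then show ?case using x by (intro exI[of _ "x # X"] exI[of _ c] exI[of _ d] exI[of _ Y]) simp
  qed
next
  assume "\<exists>X c d Y. w = X @ [c, d] @ Y \<and> w' = X @ [d, c] @ Y \<and> length X = i"
  then obtain X c d Y where "w = X @ [c, d] @ Y" "w' = X @ [d, c] @ Y" "length X = i" by blast
  then show "step \<iota> (g, i) w w'"
    using step_prefix[of \<iota> g X 0 "[c, d] @ Y" w'] assms by auto
qed

lemma step_Cap:
  "step \<iota> (Cap, i) w w' \<longleftrightarrow> (\<exists>X c Y. w = X @ [c, \<iota> c] @ Y \<and> w' = X @ Y \<and> length X = i)"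
proof
  show "step \<iota> (Cap, i) w w' \<Longrightarrow> \<exists>X c Y. w = X @ [c, \<iota> c] @ Y \<and> w' = X @ Y \<and> length X = i"
  proof (induction i arbitrary: w w')
    case 0
    then show ?case by auto
  next
    case (Suc i)
    then obtain x v v' where x: "w = x # v" "w' = x # v'" "step \<iota> (Cap, i) v v'" unfolding step.simps by blast
    obtain X c Y where "v = X @ [c, \<iota> c] @ Y" "v' = X @ Y" "length X = i" using Suc.IH[OF x(3)] by blast
    then show ?case using x by (intro exI[of _ "x # X"] exI[of _ c] exI[of _ Y]) simp
  qed
next
  assume "\<exists>X c Y. w = X @ [c, \<iota> c] @ Y \<and> w' = X @ Y \<and> length X = i"
  then obtain X c Y where "w = X @ [c, \<iota> c] @ Y" "w' = X @ Y" "length X = i" by blast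
  then show "step \<iota> (Cap, i) w w'"
    using step_prefix[of \<iota> Cap X 0 "[c, \<iota> c] @ Y" w'] by auto
qed

lemma step_Cup:
  assumes "length X = i"
  shows "step \<iota> (Cup, i) (X @ Y) w' \<longleftrightarrow> (\<exists>c. w' = X @ [c, \<iota> c] @ Y)"
  using step_prefix[of \<iota> Cup X 0 Y w'] assms by auto

text \<open>The labeling by \<open>bool\<close> separates the component of one strand of the crossing between \<open>u\<close>
  and \<open>v\<close> from the component of the other one.\<close>

definition mixed_site :: "diagram \<Rightarrow> nat \<Rightarrow> diagram \<Rightarrow> bool" where
  "mixed_site u i v \<longleftrightarrow> (\<exists>a A (p :: bool) q B b. length A = i \<and> p \<noteq> q \<and>
     lab id u [] a (A @ [p, q] @ B) \<and> lab id v (A @ [q, p] @ B) b [])"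

text \<open>Outside of a crossing of two components, the strand that leaves it at the bottom left comes
  back at the top right: otherwise some class of strands would have an odd number of end points
  at the site.\<close>

lemma mixed_site_outside:
  fixes c c' d d' :: 'c
  assumes "mixed_site u i v" "lab id u [] a (X @ [c, c'] @ Y)" "lab id v (X @ [d, d'] @ Y) b []" "length X = i"
  shows "d = c' \<and> d' = c"
proof -
  obtain ga A p q B gb where g: "length A = i" "(p :: bool) \<noteq> q" "lab id u [] ga (A @ [p, q] @ B)"
    "lab id v (A @ [q, p] @ B) gb []"
    using assms(1) unfolding mixed_site_def by blast
  have XA: "length X = length A" using g assms by simp
  have YB: "length Y = length B" using lab_fits[OF assms(2)] lab_fits[OF g(3)] XA by simp
  have z: "zip (X @ [s, t] @ Y) (A @ [p', q'] @ B) = zip X A @ [(s, p'), (t, q')] @ zip Y B" for s t p' q'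
    using XA by simp
  have "lab (map_prod id id) u [] (map2 zip a ga) (zip (X @ [c, c'] @ Y) (A @ [p, q] @ B))"
    using lab_zip[OF assms(2) g(3)] by simp
  then have 1: "lab id u [] (map2 zip a ga) (zip X A @ [(c, p), (c', q)] @ zip Y B)"
    unfolding z prod.map_id0 .
  have "lab (map_prod id id) v (zip (X @ [d, d'] @ Y) (A @ [q, p] @ B)) (map2 zip b gb) (zip [] [])"
    using lab_zip[OF assms(3) g(4)] XA YB by simp
  then have 2: "lab id v (zip X A @ [(d, q), (d', p)] @ zip Y B) (map2 zip b gb) (zip [] [])"
    unfolding z prod.map_id0 .
  have par: "even (length (filter P (zip X A @ [(c, p), (c', q)] @ zip Y B))) =
      even (length (filter P (zip X A @ [(d, q), (d', p)] @ zip Y B)))" for P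
    using lab_filter_parity[OF 1, of P] lab_filter_parity[OF 2, of P] by simp
  \<comment> \<open>The labels \<open>(c, p)\<close> and \<open>(c', q)\<close> differ even if
    \<open>c = c'\<close>. Each occurs once at the lower side of the crossing, hence an odd number
    of times at the upper side.\<close>
  have "even (length (filter ((=) (c, p)) [(c, p), (c', q)])) = even (length (filter ((=) (c, p)) [(d, q), (d', p)]))"
    "even (length (filter ((=) (c', q)) [(c, p), (c', q)])) = even (length (filter ((=) (c', q)) [(d, q), (d', p)]))"
    using par[of "(=) (c, p)"] par[of "(=) (c', q)"] unfolding filter_append length_append by (auto simp del: filter.simps)
  then show ?thesis using g(2) by (auto split: if_splits)
qed

text \<open>Applied to an orientation and a labeling by truth values, this reverses the components
  labelled \<open>True\<close>; applied to two sets of components, it is their symmetric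
  difference.\<close>

definition xor_labeling :: "bool list list \<Rightarrow> bool list list \<Rightarrow> bool list list" where
  "xor_labeling xs ys = map (map (\<lambda>(x, y). x \<noteq> y)) (map2 zip xs ys)"

lemma lab_xor:
  assumes "lab \<kappa> l w ws w'" "lab \<iota> l v vs v'" "\<And>x y. (\<kappa> x \<noteq> \<iota> y) = \<iota>' (x \<noteq> y)" "length w = length v"
  shows "lab \<iota>' l (map (\<lambda>(x, y). x \<noteq> y) (zip w v)) (xor_labeling ws vs) (map (\<lambda>(x, y). x \<noteq> y) (zip w' v'))"
  unfolding xor_labeling_def
proof (rule lab_map[OF _ lab_zip[OF assms(1,2,4)]])
  fix z :: "bool \<times> bool"
  show "(\<lambda>(x, y). x \<noteq> y) (map_prod \<kappa> \<iota> z) = \<iota>' ((\<lambda>(x, y). x \<noteq> y) z)"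
    using assms(3)[of "fst z" "snd z"] by (cases z) (simp only: map_prod_simp prod.case fst_conv snd_conv)
qed

text \<open>The two strands belong to different components, one of which can be reversed alone.
  Hence the strands at the crossing can be oriented in parallel as well as antiparallel.\<close>

lemma mixed_site_orientation:
  assumes "mixed_site u i v" "link_diagram (u @ (g, i) # v)" "g \<in> {Pos, Neg}"
  obtains a X c c' Y b where "length X = i" "lab Not u [] a (X @ [c, c'] @ Y)" "lab Not v (X @ [c', c] @ Y) b []" "(c = c') = parallel"
proof -
  obtain os where "lab Not (u @ (g, i) # v) [] os []" using orientation_labeling_exists[OF assms(2)] by blast
  then obtain a w w' b where os: "lab Not u [] a w" "step Not (g, i) w w'" "lab Not v w' b []"
    unfolding lab_append lab.simps by blast
  obtain X c c' Y where X: "w = X @ [c, c'] @ Y" "w' = X @ [c', c] @ Y" "length X = i"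
    using os(2) unfolding step_crossing[OF assms(3)] by blast
  show thesis
  proof (cases "(c = c') = parallel")
    case True
    then show thesis using that[of X a c c' Y b] os X by blast
  next
    case False
    obtain ga A p q B gb where g: "length A = i" "(p :: bool) \<noteq> q" "lab id u [] ga (A @ [p, q] @ B)"
      "lab id v (A @ [q, p] @ B) gb []"
      using assms(1) unfolding mixed_site_def by blast
    have XA: "length X = length A" using g X by simp
    have YB: "length Y = length B" using lab_fits[OF os(1)] lab_fits[OF g(3)] XA X by simp
    let ?f = "\<lambda>(x, y). x \<noteq> (y :: bool)"
    have z: "zip (X @ [s, t] @ Y) (A @ [p', q'] @ B) = zip X A @ [(s, p'), (t, q')] @ zip Y B" for s t p' q'
      using XA by simp
    have 1: "lab Not u [] (xor_labeling a ga) (map ?f (zip X A) @ [c \<noteq> p, c' \<noteq> q] @ map ?f (zip Y B))"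
      using lab_xor[OF os(1) g(3), of Not] unfolding X(1,2) z by simp
    have 2: "lab Not v (map ?f (zip X A) @ [c' \<noteq> q, c \<noteq> p] @ map ?f (zip Y B)) (xor_labeling b gb) []"
      using lab_xor[OF os(3) g(4), of Not] XA YB unfolding X(1,2) z by simp
    show thesis
      by (rule that[OF _ 1 2]) (use X XA g False in auto)
  qed
qed

lemma lab_length_le: "lab \<iota> l w ws w' \<Longrightarrow> x \<in> set ws \<Longrightarrow> length x \<le> length w + 2 * length l"
proof (induction l arbitrary: w ws)
  case (Cons s l)
  obtain g i where s: "s = (g, i)" by force
  obtain y ys where y: "ws = y # ys" "step \<iota> (g, i) w y" "lab \<iota> l y ys w'"
    using Cons.prems(1) unfolding s lab.simps by blast
  have "length y \<le> length w + 2" using step_fits[OF y(2)] by (cases g) auto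
  then show ?case using Cons.IH[OF y(3)] Cons.prems(2) y(1) by fastforce
qed simp

lemma finite_labelings:
  assumes "finite S"
  shows "finite {ws. lab \<iota> L [] ws [] \<and> labels [] ws \<subseteq> S}"
proof (rule finite_subset)
  let ?W = "{w. set w \<subseteq> S \<and> length w \<le> 2 * length L}"
  show "{ws. lab \<iota> L [] ws [] \<and> labels [] ws \<subseteq> S} \<subseteq> {ws. set ws \<subseteq> ?W \<and> length ws = length L}"
    using lab_length_le[of \<iota> L "[]" _ "[]"] lab_fits[of \<iota> L "[]" _ "[]"] by (fastforce simp: labels_def)
  show "finite {ws. set ws \<subseteq> ?W \<and> length ws = length L}"
    by (intro finite_lists_length_eq finite_lists_length_le assms)
qed

lemma finite_colourings [simp]: "finite (colourings L k)"
  by (rule finite_subset[OF _ finite_labelings[of "{..<k}" id L]]) (auto simp: colourings_def)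

lemma finite_bool_labelings [simp]: "finite (bool_labelings L)"
  using finite_labelings[of "UNIV :: bool set" id L] by (simp add: bool_labelings_def)

text \<open>This is the common part of the labelings of the crossing with equal labels and of the
  labelings of both smoothings. They differ only in the words that the slices at the site insert
  between \<open>a\<close> and \<open>b\<close>.\<close>

definition site_core :: "diagram \<Rightarrow> nat \<Rightarrow> diagram \<Rightarrow> ('c list list \<times> 'c list \<times> 'c list list) set" where
  "site_core u i v = {(a, w, b). lab id u [] a w \<and> lab id v w b [] \<and> w ! i = w ! Suc i}"

lemma lab_crossing:
  assumes "g \<in> {Pos, Neg}"
  shows "lab \<iota> (u @ (g, i) # v) [] ws [] \<longleftrightarrow> (\<exists>a X c c' Y b. ws = a @ [X @ [c', c] @ Y] @ b \<and> length X = i \<and>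
    lab \<iota> u [] a (X @ [c, c'] @ Y) \<and> lab \<iota> v (X @ [c', c] @ Y) b [])"
  unfolding lab_append lab.simps step_crossing[OF assms] by fastforce

lemma lab_crossingI:
  assumes "g \<in> {Pos, Neg}" "length X = i" "lab \<iota> u [] a (X @ [c, c'] @ Y)" "lab \<iota> v (X @ [c', c] @ Y) b []"
  shows "lab \<iota> (u @ (g, i) # v) [] (a @ [X @ [c', c] @ Y] @ b) []"
  unfolding lab_crossing[OF assms(1)] by (intro exI conjI, rule HOL.refl, rule assms(2), rule assms(3), rule assms(4))

lemma lab_appendI: "lab \<iota> u w a x \<Longrightarrow> lab \<iota> v x b w' \<Longrightarrow> lab \<iota> (u @ v) w (a @ b) w'"
  unfolding lab_append by (intro exI conjI, rule HOL.refl)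

lemma split2:
  assumes "i + 2 \<le> length w"
  obtains X c c' Y where "w = X @ [c, c'] @ Y" "length X = i"
proof -
  obtain X Z Y where "w = X @ Z @ Y" "length X = i" "length Z = Suc (Suc 0)"
    using split_at[of i "Suc (Suc 0)" w] assms by auto
  then show thesis using length_2E[of Z thesis] that by auto
qed

lemma nth_site [simp]:
  "length X = i \<Longrightarrow> (X @ c # w) ! i = c" "length X = i \<Longrightarrow> (X @ c # d # w) ! Suc i = d"
  by (auto simp: nth_append)

definition mono_at :: "nat \<Rightarrow> nat \<Rightarrow> 'c list list \<Rightarrow> bool" where
  "mono_at n i ws \<longleftrightarrow> ws ! n ! i = ws ! n ! Suc i"

lemma mono_labelings:
  assumes g: "g \<in> {Pos, Neg}" and L: "link_diagram (u @ (g, i) # v)"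
  shows "{ws. lab id (u @ (g, i) # v) [] ws [] \<and> mono_at (length u) i ws} = (\<lambda>(a, w, b). a @ [w] @ b) ` site_core u i v"
proof (intro equalityI subsetI)
  fix ws assume "ws \<in> {ws. lab id (u @ (g, i) # v) [] ws [] \<and> mono_at (length u) i ws}"
  then obtain a X c c' Y b where d: "ws = a @ [X @ [c', c] @ Y] @ b" "length X = i"
    "lab id u [] a (X @ [c, c'] @ Y)" "lab id v (X @ [c', c] @ Y) b []" "mono_at (length u) i ws"
    unfolding lab_crossing[OF g] by blast
  have "length a = length u" using lab_fits[OF d(3)] by simp
  then have "c = c'" using d(1,2,5) by (auto simp: mono_at_def nth_append)
  then show "ws \<in> (\<lambda>(a, w, b). a @ [w] @ b) ` site_core u i v"
    using d by (intro image_eqI[of _ _ "(a, X @ [c, c] @ Y, b)"]) (auto simp: site_core_def)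
next
  fix ws assume "ws \<in> (\<lambda>(a, w, b). a @ [w] @ b) ` site_core u i v"
  then obtain a w b where d: "ws = a @ [w] @ b" "lab id u [] a w" "lab id v w b []" "w ! i = w ! Suc i"
    unfolding site_core_def by (elim imageE) auto
  have "i + 2 \<le> length w" using L g lab_fits[OF d(2)] by (auto simp: link_diagram_iff)
  then obtain X c c' Y where w: "w = X @ [c, c'] @ Y" "length X = i" by (rule split2)
  then have "c = c'" using d(4) by auto
  then have "lab id (u @ (g, i) # v) [] ws []" unfolding lab_crossing[OF g] using d w by blast
  moreover have "length a = length u" using lab_fits[OF d(2)] by simp
  ultimately show "ws \<in> {ws. lab id (u @ (g, i) # v) [] ws [] \<and> mono_at (length u) i ws}"
    using d by (auto simp: mono_at_def nth_append)
qed

text \<open>By \<open>mixed_site_outside\<close>, the outer part connects the ends at the site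
  crosswise, so the smoothing forces the two labels there to be equal: the two components have
  merged.\<close>

lemma Linf_labelings:
  assumes m: "mixed_site u i v" and L: "link_diagram (u @ (g, i) # v)" and g: "g \<in> {Pos, Neg}"
  shows "{ws. lab id (u @ v) [] ws []} = (\<lambda>(a, w, b). a @ b) ` site_core u i v"
proof (intro equalityI subsetI)
  fix ws assume "ws \<in> {ws. lab id (u @ v) [] ws []}"
  then obtain a w b where d: "ws = a @ b" "lab id u [] a w" "lab id v w b []" unfolding lab_append by blast
  have "i + 2 \<le> length w" using L g lab_fits[OF d(2)] by (auto simp: link_diagram_iff)
  then obtain X c c' Y where w: "w = X @ [c, c'] @ Y" "length X = i" by (rule split2)
  have "c = c'"
    by (rule mixed_site_outside[OF m d(2)[unfolded w(1)] d(3)[unfolded w(1)] w(2), THEN conjunct1])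
  then have "w ! i = w ! Suc i" using w by simp
  then show "ws \<in> (\<lambda>(a, w, b). a @ b) ` site_core u i v"
    using d by (intro image_eqI[of _ _ "(a, w, b)"]) (auto simp: site_core_def)
next
  fix ws assume "ws \<in> (\<lambda>(a, w, b). a @ b) ` site_core u i v"
  then obtain a w b where "ws = a @ b" "lab id u [] a w" "lab id v w b []"
    unfolding site_core_def by (elim imageE) auto
  then show "ws \<in> {ws. lab id (u @ v) [] ws []}" unfolding lab_append by blast
qed

lemma L0_labelings:
  assumes m: "mixed_site u i v" and L: "link_diagram (u @ (g, i) # v)" and g: "g \<in> {Pos, Neg}"
  shows "{ws. lab id (u @ (Cap, i) # (Cup, i) # v) [] ws []} =
    (\<lambda>(a, w, b). a @ [take i w @ drop (i + 2) w, w] @ b) ` site_core u i v"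
proof (intro equalityI subsetI)
  fix ws assume "ws \<in> {ws. lab id (u @ (Cap, i) # (Cup, i) # v) [] ws []}"
  then obtain a w x y b where d: "ws = a @ [x, y] @ b" "lab id u [] a w" "step id (Cap, i) w x" "step id (Cup, i) x y" "lab id v y b []"
    unfolding lab_append lab.simps mem_Collect_eq by force
  obtain X c Y where x: "w = X @ [c, c] @ Y" "x = X @ Y" "length X = i"
    using d(3) unfolding step_Cap by auto
  obtain e where y: "y = X @ [e, e] @ Y" using d(4) unfolding x(2) step_Cup[OF x(3)] by auto
  have "e = c \<and> e = c"
    by (rule mixed_site_outside[OF m d(2)[unfolded x(1)] d(5)[unfolded y] x(3)])
  then show "ws \<in> (\<lambda>(a, w, b). a @ [take i w @ drop (i + 2) w, w] @ b) ` site_core u i v"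
    using d x y by (intro image_eqI[of _ _ "(a, w, b)"]) (auto simp: site_core_def)
next
  fix ws assume "ws \<in> (\<lambda>(a, w, b). a @ [take i w @ drop (i + 2) w, w] @ b) ` site_core u i v"
  then obtain a w b where d: "ws = a @ [take i w @ drop (i + 2) w, w] @ b" "lab id u [] a w" "lab id v w b []" "w ! i = w ! Suc i"
    unfolding site_core_def by (elim imageE) auto
  have "i + 2 \<le> length w" using L g lab_fits[OF d(2)] by (auto simp: link_diagram_iff)
  then obtain X c c' Y where w: "w = X @ [c, c'] @ Y" "length X = i" by (rule split2)
  then have c: "c = c'" using d(4) by auto
  have t: "take i w @ drop (i + 2) w = X @ Y" using w by simp
  have "step id (Cap, i) w (X @ Y)" unfolding step_Cap using w c by auto
  moreover have "step id (Cup, i) (X @ Y) w" unfolding step_Cup[OF w(2)] using w c by auto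
  ultimately have "lab id ((Cap, i) # (Cup, i) # v) w ([X @ Y, w] @ b) []" using d(3) by auto
  then show "ws \<in> {ws. lab id (u @ (Cap, i) # (Cup, i) # v) [] ws []}"
    unfolding lab_append d(1) t using d(2) by blast
qed

text \<open>\<open>K w\<close> stands for the words produced at the site. The list \<open>a\<close>
  has the length of \<open>u\<close>, so it can be read off the result, and it determines
  \<open>w\<close>.\<close>

lemma inj_on_site_core:
  assumes "\<And>w. length (K w) = n"
  shows "inj_on (\<lambda>(a, w, b). a @ K w @ b) (site_core u i v)"
proof (rule inj_onI)
  fix s t assume st: "s \<in> site_core u i v" "t \<in> site_core u i v"
    "(case s of (a, w, b) \<Rightarrow> a @ K w @ b) = (case t of (a, w, b) \<Rightarrow> a @ K w @ b)"
  obtain a w b a' w' b' where s: "s = (a, w, b)" "t = (a', w', b')" by (metis prod_cases3)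
  have l: "lab id u [] a w" "lab id u [] a' w'" "a @ K w @ b = a' @ K w' @ b'"
    using st unfolding s site_core_def by auto
  have "length a = length a'" using lab_fits[OF l(1)] lab_fits[OF l(2)] by simp
  then have a: "a = a'" "K w @ b = K w' @ b'" using l(3) by auto
  then have "w = w'" using lab_unique[OF l(1)] l(2) by simp
  then show "s = t" using s a by simp
qed

lemma site_core_word:
  assumes "(a, w, b) \<in> site_core u i v" "link_diagram (u @ (g, i) # v)" "g \<in> {Pos, Neg}"
  obtains X c Y where "w = X @ [c, c] @ Y" "length X = i" "lab id u [] a w" "lab id v w b []"
proof -
  have d: "lab id u [] a w" "lab id v w b []" "w ! i = w ! Suc i"
    using assms(1) unfolding site_core_def by auto
  have "i + 2 \<le> length w" using assms lab_fits[OF d(1)] by (auto simp: link_diagram_iff)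
  then obtain X c c' Y where w: "w = X @ [c, c'] @ Y" "length X = i" by (rule split2)
  then have "c = c'" using d(3) by auto
  then show thesis using that w d by blast
qed

lemma site_core_labels:
  assumes "(a, w, b) \<in> site_core u i v"
  shows "labels [] (a @ [w] @ b) = labels [] a \<union> labels w b" "labels [] (a @ b) = labels [] a \<union> labels w b"
    "labels [] (a @ [take i w @ drop (i + 2) w, w] @ b) = labels [] a \<union> labels w b"
proof -
  have l: "lab id u [] a w" using assms unfolding site_core_def by auto
  show "labels [] (a @ [w] @ b) = labels [] a \<union> labels w b" "labels [] (a @ b) = labels [] a \<union> labels w b"
    "labels [] (a @ [take i w @ drop (i + 2) w, w] @ b) = labels [] a \<union> labels w b"
    unfolding labels_append[OF l] using set_take_subset[of i w] set_drop_subset[of "i + 2" w]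
    by (auto simp: labels_def)
qed

lemma site_core_sub:
  assumes "(a, w, b) \<in> site_core u i v" "link_diagram (u @ (g, i) # v)" "g \<in> {Pos, Neg}"
  shows "sub P (u @ (g, i) # v) [] (a @ [w] @ b) =
      sub P u [] a @ (if P (w ! i) then [(g, length (filter P (take i w)))] else []) @ sub P v w b"
    "sub P (u @ v) [] (a @ b) = sub P u [] a @ sub P v w b"
    "sub P (u @ (Cap, i) # (Cup, i) # v) [] (a @ [take i w @ drop (i + 2) w, w] @ b) =
      sub P u [] a @ (if P (w ! i) then [(Cap, length (filter P (take i w))), (Cup, length (filter P (take i w)))] else []) @ sub P v w b"
proof -
  obtain X c Y where w: "w = X @ [c, c] @ Y" "length X = i" "lab id u [] a w" "lab id v w b []"
    by (rule site_core_word[OF assms])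
  show "sub P (u @ (g, i) # v) [] (a @ [w] @ b) =
      sub P u [] a @ (if P (w ! i) then [(g, length (filter P (take i w)))] else []) @ sub P v w b"
    unfolding sub_append[OF w(3)] using assms(3) w(1,2) by (auto simp: sub1_def)
  show "sub P (u @ v) [] (a @ b) = sub P u [] a @ sub P v w b" by (rule sub_append[OF w(3)])
  show "sub P (u @ (Cap, i) # (Cup, i) # v) [] (a @ [take i w @ drop (i + 2) w, w] @ b) =
      sub P u [] a @ (if P (w ! i) then [(Cap, length (filter P (take i w))), (Cup, length (filter P (take i w)))] else []) @ sub P v w b"
    unfolding sub_append[OF w(3)] using w(1,2) by (auto simp: sub1_def)
qed

lemma wr_zip_site:
  assumes "lab id u [] a w" "lab Not u [] oa ow"
  shows "wr mixed_sign (u @ s # v) [] (map2 zip (a @ x # b) (oa @ ox # ob)) =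
      wr mixed_sign u [] (map2 zip a oa) + wr1 mixed_sign s (zip w ow) + wr mixed_sign v (zip x ox) (map2 zip b ob)"
    "wr mixed_sign (u @ v) [] (map2 zip (a @ b) (oa @ ob)) =
      wr mixed_sign u [] (map2 zip a oa) + wr mixed_sign v (zip w ow) (map2 zip b ob)"
proof -
  have z: "lab lift_Not u [] (map2 zip a oa) (zip w ow)" using lab_zip[OF assms] by simp
  have l: "length a = length oa" using lab_length[OF assms] by simp
  show "wr mixed_sign (u @ s # v) [] (map2 zip (a @ x # b) (oa @ ox # ob)) =
      wr mixed_sign u [] (map2 zip a oa) + wr1 mixed_sign s (zip w ow) + wr mixed_sign v (zip x ox) (map2 zip b ob)"
    using wr_append[OF z, of mixed_sign "s # v" "zip x ox # map2 zip b ob"] l by simp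
  show "wr mixed_sign (u @ v) [] (map2 zip (a @ b) (oa @ ob)) =
      wr mixed_sign u [] (map2 zip a oa) + wr mixed_sign v (zip w ow) (map2 zip b ob)"
    using wr_append[OF z, of mixed_sign v "map2 zip b ob"] l by simp
qed

lemma wr1_mixed_sign_same:
  assumes "w = X @ [c, c] @ Y" "length X = i" "length ow = length w"
  shows "wr1 mixed_sign (g, i) (zip w ow) = 0"
  using assms by (simp add: wr1_def nth_append)

text \<open>The crossing itself has equal colours and contributes nothing. An orientation with
  parallel strands restricts to the smoothing \<open>u @ v\<close>, one with antiparallel strands to
  the smoothing by \<open>Cap\<close> and \<open>Cup\<close>. Since any orientation computes the
  phase, all three phases agree.\<close>

lemma colour_phase_smoothings:
  assumes c: "(a, w, b) \<in> site_core u i v" and m: "mixed_site u i v" and L: "link_diagram (u @ (g, i) # v)" and g: "g \<in> {Pos, Neg}"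
  shows "colour_phase (u @ (g, i) # v) (a @ [w] @ b) = colour_phase (u @ v) (a @ b)"
    "colour_phase (u @ (Cap, i) # (Cup, i) # v) (a @ [take i w @ drop (i + 2) w, w] @ b) = colour_phase (u @ v) (a @ b)"
proof -
  obtain X e Y where w: "w = X @ [e, e] @ Y" "length X = i" "lab id u [] a w" "lab id v w b []"
    by (rule site_core_word[OF c L g])
  have "a @ [w] @ b \<in> (\<lambda>(a, w, b). a @ [w] @ b) ` site_core u i v"
    "a @ b \<in> (\<lambda>(a, w, b). a @ b) ` site_core u i v"
    "a @ [take i w @ drop (i + 2) w, w] @ b \<in> (\<lambda>(a, w, b). a @ [take i w @ drop (i + 2) w, w] @ b) ` site_core u i v"
    by (rule image_eqI[OF _ c], simp only: prod.case)+
  then have lp: "lab id (u @ (g, i) # v) [] (a @ [w] @ b) []" and linf: "lab id (u @ v) [] (a @ b) []"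
    and l0: "lab id (u @ (Cap, i) # (Cup, i) # v) [] (a @ [take i w @ drop (i + 2) w, w] @ b) []"
    unfolding mono_labelings[OF g L, symmetric] Linf_labelings[OF m L g, symmetric] L0_labelings[OF m L g, symmetric]
    by (simp_all only: mem_Collect_eq)
  have sides: "wr mixed_sign (u @ (g, i) # v) [] (map2 zip (a @ [w] @ b) (oa @ [ow'] @ ob)) =
      wr mixed_sign u [] (map2 zip a oa) + wr mixed_sign v (zip w ow') (map2 zip b ob)"
    if "lab Not u [] oa ow" for oa ow ow' ob
    using wr_zip_site(1)[OF w(3) that, of "(g, i)" v w b ow' ob]
      wr1_mixed_sign_same[OF w(1,2), of ow g] lab_length[OF w(3) that] by simp
  obtain oa X1 o1 o1' Y1 ob where par: "length X1 = i" "lab Not u [] oa (X1 @ [o1, o1'] @ Y1)"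
    "lab Not v (X1 @ [o1', o1] @ Y1) ob []" "(o1 = o1') = True"
    by (rule mixed_site_orientation[OF m L g])
  have o1: "o1' = o1" using par(4) by simp
  note ph = colour_phase_eq[OF lp lab_crossingI[OF g par(1-3), unfolded o1]]
    colour_phase_eq[OF linf lab_appendI[OF par(2,3)[unfolded o1]]]
  show 1: "colour_phase (u @ (g, i) # v) (a @ [w] @ b) = colour_phase (u @ v) (a @ b)"
    using sides[OF par(2), of "X1 @ [o1, o1] @ Y1" ob] wr_zip_site(2)[OF w(3) par(2), of v b ob] unfolding ph o1 by simp
  obtain pa X2 o2 o2' Y2 pb where anti: "length X2 = i" "lab Not u [] pa (X2 @ [o2, o2'] @ Y2)"
    "lab Not v (X2 @ [o2', o2] @ Y2) pb []" "(o2 = o2') = False"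
    by (rule mixed_site_orientation[OF m L g])
  have o2: "o2' = (\<not> o2)" using anti(4) by auto
  have op: "lab Not (u @ (g, i) # v) [] (pa @ [X2 @ [\<not> o2, o2] @ Y2] @ pb) []"
    by (rule lab_crossingI[OF g anti(1-3)[unfolded o2]])
  have st: "step Not (Cap, i) (X2 @ [o2, \<not> o2] @ Y2) (X2 @ Y2)" "step Not (Cup, i) (X2 @ Y2) (X2 @ [\<not> o2, o2] @ Y2)"
    unfolding step_Cap step_Cup[OF anti(1)] using anti(1) by (blast, intro exI[of _ "\<not> o2"], simp)
  have "lab Not ((Cap, i) # (Cup, i) # v) (X2 @ [o2, \<not> o2] @ Y2) ([X2 @ Y2, X2 @ [\<not> o2, o2] @ Y2] @ pb) []"
    using st anti(3) unfolding o2 by auto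
  then have o0: "lab Not (u @ (Cap, i) # (Cup, i) # v) [] (pa @ [X2 @ Y2, X2 @ [\<not> o2, o2] @ Y2] @ pb) []"
    using lab_appendI[OF anti(2)[unfolded o2]] by simp
  have "wr mixed_sign (u @ (Cap, i) # (Cup, i) # v) [] (map2 zip (a @ [take i w @ drop (i + 2) w, w] @ b) (pa @ [X2 @ Y2, X2 @ [\<not> o2, o2] @ Y2] @ pb)) =
      wr mixed_sign u [] (map2 zip a pa) + wr mixed_sign v (zip w (X2 @ [\<not> o2, o2] @ Y2)) (map2 zip b pb)"
    using wr_zip_site(1)[OF w(3) anti(2), of "(Cap, i)" "(Cup, i) # v" "take i w @ drop (i + 2) w" "w # b" "X2 @ Y2" "(X2 @ [\<not> o2, o2] @ Y2) # pb"]
    by (simp add: wr1_def)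
  then show "colour_phase (u @ (Cap, i) # (Cup, i) # v) (a @ [take i w @ drop (i + 2) w, w] @ b) = colour_phase (u @ v) (a @ b)"
    unfolding 1[symmetric] colour_phase_eq[OF lp op] colour_phase_eq[OF l0 o0] sides[OF anti(2)] by simp
qed

lemma colour_weight_cancel:
  assumes L: "link_diagram (u @ (Pos, i) # v)" and cs: "lab id (u @ (Pos, i) # v) [] cs []" and nm: "\<not> mono_at (length u) i cs"
  shows "colour_weight Q (u @ (Pos, i) # v) k cs + colour_weight Q (u @ (Neg, i) # v) k cs = 0"
proof -
  obtain a X c c' Y b where d: "cs = a @ [X @ [c', c] @ Y] @ b" "length X = i"
    "lab id u [] a (X @ [c, c'] @ Y)" "lab id v (X @ [c', c] @ Y) b []"
    using cs lab_crossing[of Pos id u i v cs] by blast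
  have "length a = length u" using lab_fits[OF d(3)] by simp
  then have ne: "c \<noteq> c'" using d(1,2) nm by (auto simp: mono_at_def nth_append)
  have cs': "lab id (u @ (Neg, i) # v) [] cs []" using d lab_crossing[of Neg id u i v cs] by blast
  obtain os where "lab Not (u @ (Pos, i) # v) [] os []" using orientation_labeling_exists[OF L] by blast
  moreover from this obtain oa X1 o1 o1' Y1 ob where o: "os = oa @ [X1 @ [o1', o1] @ Y1] @ ob" "length X1 = i"
    "lab Not u [] oa (X1 @ [o1, o1'] @ Y1)" "lab Not v (X1 @ [o1', o1] @ Y1) ob []"
    using lab_crossing[of Pos Not u i v os] by blast
  moreover have "lab Not (u @ (Neg, i) # v) [] os []" using o lab_crossing[of Neg Not u i v os] by blast
  ultimately have ph: "colour_phase (u @ (Pos, i) # v) cs = \<i> powi wr mixed_sign (u @ (Pos, i) # v) [] (map2 zip cs os)"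
    "colour_phase (u @ (Neg, i) # v) cs = \<i> powi wr mixed_sign (u @ (Neg, i) # v) [] (map2 zip cs os)"
    using colour_phase_eq[OF cs] colour_phase_eq[OF cs'] by simp_all
  let ?z = "zip (X @ [c, c'] @ Y) (X1 @ [o1, o1'] @ Y1)"
  define n where "n = wr mixed_sign u [] (map2 zip a oa) + wr mixed_sign v (zip (X @ [c', c] @ Y) (X1 @ [o1', o1] @ Y1)) (map2 zip b ob)"
  have n: "wr mixed_sign (u @ (g, i) # v) [] (map2 zip cs os) = n + wr1 mixed_sign (g, i) ?z" for g
    using wr_zip_site(1)[OF d(3) o(3), of "(g, i)" v "X @ [c', c] @ Y" b "X1 @ [o1', o1] @ Y1" ob]
    unfolding n_def d(1) o(1) by simp
  have "?z = zip X X1 @ [(c, o1), (c', o1')] @ zip Y Y1" using d(2) o(2) by simp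
  then have "wr1 mixed_sign (Pos, i) ?z = 1 \<and> wr1 mixed_sign (Neg, i) ?z = -1 \<or>
      wr1 mixed_sign (Pos, i) ?z = -1 \<and> wr1 mixed_sign (Neg, i) ?z = 1"
    using ne d(2) o(2) by (auto simp: wr1_def nth_append)
  \<comment> \<open>The sum is i^(n-1) times i^2 + 1.\<close>
  moreover have "\<i> powi (n + 1) + \<i> powi (n - 1) = 0"
    by (simp add: power_int_add power_int_diff)
  ultimately have sum: "colour_phase (u @ (Pos, i) # v) cs + colour_phase (u @ (Neg, i) # v) cs = 0"
    unfolding ph n by (auto simp: add.commute)
  have "sub ((=) j) (u @ (g, i) # v) [] cs = sub ((=) j) u [] a @ sub ((=) j) v (X @ [c', c] @ Y) b"
    if "g \<in> {Pos, Neg}" for j g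
    unfolding d(1) sub_append[OF d(3)] using that ne d(2) by (auto simp: sub1_def nth_append)
  then have "sub ((=) j) (u @ (Pos, i) # v) [] cs = sub ((=) j) (u @ (Neg, i) # v) [] cs" for j by simp
  then have "colour_weight Q (u @ (Pos, i) # v) k cs + colour_weight Q (u @ (Neg, i) # v) k cs =
      const (colour_phase (u @ (Pos, i) # v) cs + colour_phase (u @ (Neg, i) # v) cs) * (\<Prod>j<k. Q (sub ((=) j) (u @ (Neg, i) # v) [] cs))"
    unfolding colour_weight_def by (simp add: const_def single_add algebra_simps)
  then show ?thesis unfolding sum by (simp add: const_def)
qed

text \<open>Only the sublink with the colour of the crossing changes. The skein relation of
  \<open>Q\<close> applies to it, with the common phase and the product over the other colours as
  coefficient.\<close>

lemma colour_weight_skein: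
  assumes Q: "skein_invariant Q" and c: "(a, w, b) \<in> site_core u i v" and m: "mixed_site u i v"
    and L: "link_diagram (u @ (Pos, i) # v)" and k: "labels [] (a @ [w] @ b) = {..<k}"
  shows "colour_weight Q (u @ (Pos, i) # v) k (a @ [w] @ b) + colour_weight Q (u @ (Neg, i) # v) k (a @ [w] @ b) =
    w_pow 1 * (colour_weight Q (u @ (Cap, i) # (Cup, i) # v) k (a @ [take i w @ drop (i + 2) w, w] @ b) +
      colour_weight Q (u @ v) k (a @ b))"
proof -
  have L': "link_diagram (u @ (Neg, i) # v)" using L by (auto simp: link_diagram_iff)
  have PN: "Pos \<in> {Pos, Neg}" "Neg \<in> {Pos, Neg}" by auto
  obtain X e Y where w: "w = X @ [e, e] @ Y" "length X = i" "lab id u [] a w" "lab id v w b []"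
    by (rule site_core_word[OF c L PN(1)])
  have we: "w ! i = e" using w by simp
  have e: "e < k"
  proof -
    have "e \<in> labels [] (a @ [w] @ b)" using w(1) by (auto simp: labels_def)
    then show ?thesis using k by simp
  qed
  define U V n where "U j = sub ((=) j) u [] a" and "V j = sub ((=) j) v w b" and "n = length (filter ((=) e) (take i w))" for j
  define R where "R = (\<Prod>j \<in> {..<k} - {e}. Q (U j @ V j))"
  have split: "(\<Prod>j<k. Q (F j)) = Q (F e) * R" if "\<And>j. j \<noteq> e \<Longrightarrow> F j = U j @ V j" for F
  proof -
    have "(\<Prod>j<k. Q (F j)) = Q (F e) * (\<Prod>j \<in> {..<k} - {e}. Q (F j))" using e by (simp add: prod.remove)
    also have "(\<Prod>j \<in> {..<k} - {e}. Q (F j)) = R" unfolding R_def by (rule prod.cong) (use that in auto)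
    finally show ?thesis .
  qed
  note subs = site_core_sub[OF c L PN(1)] site_core_sub(1)[OF c L' PN(2)]
  have prods: "(\<Prod>j<k. Q (sub ((=) j) (u @ (Pos, i) # v) [] (a @ [w] @ b))) = Q (U e @ (Pos, n) # V e) * R"
    "(\<Prod>j<k. Q (sub ((=) j) (u @ (Neg, i) # v) [] (a @ [w] @ b))) = Q (U e @ (Neg, n) # V e) * R"
    "(\<Prod>j<k. Q (sub ((=) j) (u @ v) [] (a @ b))) = Q (U e @ V e) * R"
    "(\<Prod>j<k. Q (sub ((=) j) (u @ (Cap, i) # (Cup, i) # v) [] (a @ [take i w @ drop (i + 2) w, w] @ b))) =
      Q (U e @ (Cap, n) # (Cup, n) # V e) * R"
    unfolding subs we by (subst split; simp add: U_def V_def n_def)+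
  have "e \<in> labels [] (a @ [w] @ b)" using e k by simp
  moreover have "lab id (u @ (Pos, i) # v) [] (a @ [w] @ b) []"
    using lab_crossing[of Pos id u i v "a @ [w] @ b"] w by blast
  ultimately have "link_diagram (sub ((=) e) (u @ (Pos, i) # v) [] (a @ [w] @ b))"
    by (rule used_colour_link_diagram[rotated])
  then have "link_diagram (U e @ (Pos, n) # V e)" unfolding subs we by (simp add: U_def V_def n_def)
  then have sk: "Q (U e @ (Pos, n) # V e) + Q (U e @ (Neg, n) # V e) =
      w_pow 1 * (Q (U e @ (Cap, n) # (Cup, n) # V e) + Q (U e @ V e))"
    by (rule skein_invariant_skein[OF Q]) simp
  note ph = colour_phase_smoothings[OF c m L PN(1)] colour_phase_smoothings(1)[OF c m L' PN(2)]
  let ?p = "const (colour_phase (u @ v) (a @ b))"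
  have "?p * (Q (U e @ (Pos, n) # V e) * R) + ?p * (Q (U e @ (Neg, n) # V e) * R) =
      ?p * R * (Q (U e @ (Pos, n) # V e) + Q (U e @ (Neg, n) # V e))"
    by (simp add: algebra_simps)
  then show ?thesis
    unfolding colour_weight_def prods ph sk by (simp add: algebra_simps)
qed

theorem colour_sum_skein:
  assumes Q: "skein_invariant Q" and m: "mixed_site u i v" and L: "link_diagram (u @ (Pos, i) # v)"
  shows "colour_sum Q (u @ (Pos, i) # v) k + colour_sum Q (u @ (Neg, i) # v) k =
    w_pow 1 * (colour_sum Q (u @ (Cap, i) # (Cup, i) # v) k + colour_sum Q (u @ v) k)"
proof -
  let ?p = "u @ (Pos, i) # v" and ?n = "u @ (Neg, i) # v" and ?o = "u @ (Cap, i) # (Cup, i) # v"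
  let ?W = "\<lambda>cs. colour_weight Q ?p k cs + colour_weight Q ?n k cs"
  define S where "S = {s \<in> site_core u i v. (case s of (a, w, b) \<Rightarrow> labels [] (a @ [w] @ b) = {..<k})}"
  have PN: "Pos \<in> {Pos, Neg}" "Neg \<in> {Pos, Neg}" by auto
  have "lab id ?n [] cs [] \<longleftrightarrow> lab id ?p [] cs []" for cs :: "nat list list"
    unfolding lab_crossing[OF PN(1)] lab_crossing[OF PN(2)] by (rule HOL.refl)
  then have np: "colourings ?n k = colourings ?p k" unfolding colourings_def by simp
  define M where "M = {cs \<in> colourings ?p k. mono_at (length u) i cs}"
  let ?R = "{ws :: nat list list. labels [] ws = {..<k}}"
  have restrict: "A \<inter> ?R = f ` S"
    if "A = f ` site_core u i v" "\<And>a w b. (a, w, b) \<in> site_core u i v \<Longrightarrow> labels [] (f (a, w, b)) = labels [] (a @ [w] @ b)"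
    for A and f :: "nat list list \<times> nat list \<times> nat list list \<Rightarrow> nat list list"
  proof -
    have "A \<inter> ?R = f ` {s \<in> site_core u i v. f s \<in> ?R}" unfolding that(1) by blast
    also have "{s \<in> site_core u i v. f s \<in> ?R} = S" unfolding S_def using that(2) by auto
    finally show ?thesis .
  qed
  have M: "M = (\<lambda>(a, w, b). a @ [w] @ b) ` S"
    using restrict[OF mono_labelings[OF PN(1) L]] unfolding M_def colourings_def by (simp add: Int_def conj_ac)
  have o: "colourings ?o k = (\<lambda>(a, w, b). a @ [take i w @ drop (i + 2) w, w] @ b) ` S"
    unfolding colourings_def Collect_conj_eq by (rule restrict[OF L0_labelings[OF m L PN(1)]]) (simp only: prod.case site_core_labels)
  have inf: "colourings (u @ v) k = (\<lambda>(a, w, b). a @ b) ` S"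
    unfolding colourings_def Collect_conj_eq by (rule restrict[OF Linf_labelings[OF m L PN(1)]]) (simp only: prod.case site_core_labels)
  have sum_S: "sum f ((\<lambda>(a, w, b). a @ K w @ b) ` S) = (\<Sum>(a, w, b) \<in> S. f (a @ K w @ b))"
    if "\<And>w. length (K w) = n" for K :: "nat list \<Rightarrow> nat list list" and n and f :: "nat list list \<Rightarrow> laurent"
  proof -
    have "inj_on (\<lambda>(a, w, b). a @ K w @ b) S"
      by (rule inj_on_subset[OF inj_on_site_core[OF that]]) (auto simp: S_def)
    then have "sum f ((\<lambda>(a, w, b). a @ K w @ b) ` S) = sum (f \<circ> (\<lambda>(a, w, b). a @ K w @ b)) S" by (rule sum.reindex)
    also have "\<dots> = (\<Sum>(a, w, b) \<in> S. f (a @ K w @ b))" by (rule sum.cong) auto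
    finally show ?thesis .
  qed
  have "colour_sum Q ?p k + colour_sum Q ?n k = (\<Sum>cs \<in> colourings ?p k. ?W cs)"
    unfolding colour_sum_def np by (simp add: sum.distrib)
  also have "\<dots> = (\<Sum>cs \<in> M. ?W cs)"
  proof (rule sum.mono_neutral_right)
    show "\<forall>cs \<in> colourings ?p k - M. ?W cs = 0"
      by (intro ballI colour_weight_cancel[OF L]) (auto simp: M_def colourings_def)
  qed (auto simp: M_def)
  also have "\<dots> = (\<Sum>(a, w, b) \<in> S. ?W (a @ [w] @ b))"
    unfolding M by (rule sum_S[of "\<lambda>w. [w]" 1]) simp
  also have "\<dots> = (\<Sum>(a, w, b) \<in> S. w_pow 1 * (colour_weight Q ?o k (a @ [take i w @ drop (i + 2) w, w] @ b) +
      colour_weight Q (u @ v) k (a @ b)))"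
  proof (intro sum.cong[OF HOL.refl])
    fix s assume "s \<in> S"
    then obtain a w b where s: "s = (a, w, b)" "(a, w, b) \<in> site_core u i v" "labels [] (a @ [w] @ b) = {..<k}"
      unfolding S_def by (cases s) auto
    show "(case s of (a, w, b) \<Rightarrow> ?W (a @ [w] @ b)) = (case s of (a, w, b) \<Rightarrow> w_pow 1 *
        (colour_weight Q ?o k (a @ [take i w @ drop (i + 2) w, w] @ b) + colour_weight Q (u @ v) k (a @ b)))"
      unfolding s(1) prod.case by (rule colour_weight_skein[OF Q s(2) m L s(3)])
  qed
  also have "\<dots> = w_pow 1 * ((\<Sum>(a, w, b) \<in> S. colour_weight Q ?o k (a @ [take i w @ drop (i + 2) w, w] @ b)) +
      (\<Sum>(a, w, b) \<in> S. colour_weight Q (u @ v) k (a @ b)))"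
    by (simp add: sum_distrib_left distrib_left sum.distrib case_prod_beta)
  also have "(\<Sum>(a, w, b) \<in> S. colour_weight Q ?o k (a @ [take i w @ drop (i + 2) w, w] @ b)) = colour_sum Q ?o k"
    unfolding colour_sum_def o by (rule sum_S[of "\<lambda>w. [take i w @ drop (i + 2) w, w]" 2, symmetric]) simp
  also have "(\<Sum>(a, w, b) \<in> S. colour_weight Q (u @ v) k (a @ b)) = colour_sum Q (u @ v) k"
    unfolding colour_sum_def inf using sum_S[of "\<lambda>w. []" 0 "colour_weight Q (u @ v) k"] by simp
  finally show ?thesis .
qed

section \<open>Counting labelings at a crossing of two components\<close>

lemma lab_same_shape:
  assumes "lab \<iota> l w ws w'" "lab \<kappa> l v vs v'" "length w = length v"
  shows "list_all2 (\<lambda>x y. length x = length y) ws vs"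
  using assms
proof (induction l arbitrary: w ws v vs)
  case (Cons s l)
  obtain g i where s: "s = (g, i)" by force
  obtain y ys where y: "ws = y # ys" "step \<iota> (g, i) w y" "lab \<iota> l y ys w'"
    using Cons.prems(1) unfolding s lab.simps by blast
  obtain z zs where z: "vs = z # zs" "step \<kappa> (g, i) v z" "lab \<kappa> l z zs v'"
    using Cons.prems(2) unfolding s lab.simps by blast
  have "length y = length z" using step_fits[OF y(2)] step_fits[OF z(2)] Cons.prems(3) by simp
  then show ?case using Cons.IH[OF y(3) z(3)] y(1) z(1) by simp
qed simp

lemma xor_xor_word:
  "length x = length y \<Longrightarrow> map (\<lambda>(x, y). x \<noteq> y) (zip (map (\<lambda>(x, y). x \<noteq> y) (zip x y)) y) = x"
  by (induction x y rule: list_induct2) auto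

lemma xor_xor_labeling:
  assumes "list_all2 (\<lambda>x y. length x = length y) ws gs"
  shows "xor_labeling (xor_labeling ws gs) gs = ws"
  using assms
proof (induction rule: list_all2_induct)
  case (Cons x xs y ys)
  have "xor_labeling (xor_labeling (x # xs) (y # ys)) (y # ys) =
      map (\<lambda>(x, y). x \<noteq> y) (zip (map (\<lambda>(x, y). x \<noteq> y) (zip x y)) y) # xor_labeling (xor_labeling xs ys) ys"
    by (simp add: xor_labeling_def)
  then show ?case unfolding Cons.IH xor_xor_word[OF Cons(1)] .
qed (simp add: xor_labeling_def)

lemma card_site_core:
  fixes K :: "'c list \<Rightarrow> 'c list list"
  assumes "\<And>w. length (K w) = n" and "A = (\<lambda>(a, w, b). a @ K w @ b) ` site_core u i v"
  shows "card A = card (site_core u i v :: ('c list list \<times> 'c list \<times> 'c list list) set)"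
  unfolding assms(2) by (intro card_image inj_on_site_core[of K n] assms(1))

text \<open>Exclusive or with a labeling that separates the two strands is an involution that
  toggles equality of the labels at the crossing. So half of the labelings are equal there, and
  these correspond to the labelings of either smoothing: smoothing removes one component.\<close>

lemma card_bool_labelings_site:
  assumes m: "mixed_site u i v" and L: "link_diagram (u @ (g, i) # v)" and g: "g \<in> {Pos, Neg}"
  shows "card (bool_labelings (u @ (g, i) # v)) = 2 * card (bool_labelings (u @ v))"
    "card (bool_labelings (u @ (Cap, i) # (Cup, i) # v)) = card (bool_labelings (u @ v))"
proof -
  let ?n = "length u"
  define B where "B = bool_labelings (u @ (g, i) # v)"
  define M where "M = {ws \<in> B. mono_at ?n i ws}"
  have inf: "card (bool_labelings (u @ v)) = card (site_core u i v :: (bool list list \<times> _ \<times> _) set)"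
    using card_site_core[of "\<lambda>w. []" 0] Linf_labelings[OF m L g] unfolding bool_labelings_def by simp
  have "M = (\<lambda>(a, w, b). a @ [w] @ b) ` site_core u i v"
    using mono_labelings[OF g L] unfolding M_def B_def bool_labelings_def by simp
  then have M: "card M = card (bool_labelings (u @ v))"
    unfolding inf by (rule card_site_core[of "\<lambda>w. [w]" 1, rotated]) simp
  show "card (bool_labelings (u @ (Cap, i) # (Cup, i) # v)) = card (bool_labelings (u @ v))"
    unfolding inf using L0_labelings[OF m L g] unfolding bool_labelings_def
    by (rule card_site_core[of "\<lambda>w. [take i w @ drop (i + 2) w, w]" 2, rotated]) simp
  obtain ga A p q B' gb where gl: "length A = i" "(p :: bool) \<noteq> q" "lab id u [] ga (A @ [p, q] @ B')"
      "lab id v (A @ [q, p] @ B') gb []"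
    using m unfolding mixed_site_def by blast
  define gs where "gs = ga @ [A @ [q, p] @ B'] @ gb"
  have gs: "lab id (u @ (g, i) # v) [] gs []" unfolding gs_def by (rule lab_crossingI[OF g gl(1,3,4)])
  define f where "f ws = xor_labeling ws gs" for ws
  have fB: "f ws \<in> B" if "ws \<in> B" for ws
    using lab_xor[OF _ gs, of id "[]" ws "[]" id] that unfolding B_def bool_labelings_def f_def by simp
  have ff: "f (f ws) = ws" if "ws \<in> B" for ws
    unfolding f_def by (rule xor_xor_labeling[OF lab_same_shape[OF _ gs]]) (use that in \<open>auto simp: B_def bool_labelings_def\<close>)
  have tog: "mono_at ?n i (f ws) \<longleftrightarrow> \<not> mono_at ?n i ws" if ws: "ws \<in> B" for ws
  proof -
    have "lab id (u @ (g, i) # v) [] ws []" using ws unfolding B_def bool_labelings_def by simp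
    then obtain a X c c' Y b where d: "ws = a @ [X @ [c', c] @ Y] @ b" "length X = i" "lab id u [] a (X @ [c, c'] @ Y)"
      unfolding lab_crossing[OF g] by blast
    have l: "length a = length ga" "length a = ?n" using lab_fits[OF d(3)] lab_fits[OF gl(3)] by simp_all
    have "f ws ! ?n = map (\<lambda>(x, y). x \<noteq> y) (zip X A) @ [c' \<noteq> q, c \<noteq> p] @ map (\<lambda>(x, y). x \<noteq> y) (zip Y B')"
      unfolding f_def xor_labeling_def gs_def d(1) using l d(2) gl(1) by (simp add: nth_append)
    moreover have "ws ! ?n = X @ [c', c] @ Y" unfolding d(1) using l(2) by (simp add: nth_append)
    ultimately show ?thesis unfolding mono_at_def using d(2) gl(1,2) by auto
  qed
  have fin: "finite B" unfolding B_def by simp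
  have "card M = card (B - M)"
  proof (rule card_bij_eq[of f M "B - M" f])
    show "inj_on f M" by (rule inj_on_inverseI[of _ f]) (simp add: M_def ff)
    show "inj_on f (B - M)" by (rule inj_on_inverseI[of _ f]) (simp add: ff)
  qed (use fB tog fin in \<open>auto simp: M_def\<close>)
  moreover have "card B = card M + card (B - M)"
    using fin by (subst card_Un_disjoint[symmetric]) (auto simp: M_def intro!: arg_cong[of _ _ card])
  ultimately show "card (bool_labelings (u @ (g, i) # v)) = 2 * card (bool_labelings (u @ v))"
    unfolding M B_def by simp
qed

section \<open>Labelings of the points of a diagram\<close>

lemma lab_iff_nth:
  "lab \<iota> l w ws w' \<longleftrightarrow> length ws = length l \<and> (\<forall>h < length l. step \<iota> (l ! h) ((w # ws) ! h) (ws ! h)) \<and> last (w # ws) = w'"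
proof (induction l arbitrary: w ws)
  case (Cons s l)
  have *: "(\<forall>h < length (s # l). P h) \<longleftrightarrow> P 0 \<and> (\<forall>h < length l. P (Suc h))" for P
    by (simp add: All_less_Suc2)
  show ?case
  proof (cases ws)
    case (Cons x xs)
    then show ?thesis using Cons.IH[of x xs] unfolding * by auto
  qed simp
qed auto

lemma sub_eq_concat:
  "length ws = length l \<Longrightarrow> sub P l w ws = concat (map (\<lambda>h. sub1 P (l ! h) ((w # ws) ! h) (ws ! h)) [0..<length l])"
proof (induction l arbitrary: w ws)
  case (Cons s l)
  then obtain x xs where "ws = x # xs" "length xs = length l" by (cases ws) auto
  then show ?case using Cons.IH[of xs x] upt_conv_Cons[of 0 "length (s # l)"]
    by (simp add: map_Suc_upt[symmetric] o_def del: upt_Suc)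
qed simp

lemma wr_eq_sum:
  "length ws = length l \<Longrightarrow> wr \<omega> l w ws = (\<Sum>h < length l. wr1 \<omega> (l ! h) ((w # ws) ! h))"
proof (induction l arbitrary: w ws)
  case (Cons s l)
  then obtain x xs where "ws = x # xs" "length xs = length l" by (cases ws) auto
  then show ?case using Cons.IH[of xs x] by (simp add: sum.lessThan_Suc_shift del: sum.lessThan_Suc)
qed simp

text \<open>The recursion of \<open>step\<close> on the position agrees with the explicit
  description by \<open>ascends\<close>. This connects labelings with the points in terms of which
  components and orientations are defined.\<close>

lemma step_iff_ascends:
  "step \<iota> (g, i) w w' \<longleftrightarrow> i + n_in g \<le> length w \<and> length w' = length w - n_in g + n_out g \<and>
    (\<forall>p < length w. \<forall>q. ascends (g, i) p q \<longrightarrow> w ! p = w' ! q) \<and>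
    (g = Cup \<longrightarrow> w' ! Suc i = \<iota> (w' ! i)) \<and> (g = Cap \<longrightarrow> w ! Suc i = \<iota> (w ! i))"
  (is "_ \<longleftrightarrow> ?A i w w'")
proof (induction i arbitrary: w w')
  case 0
  show ?case
  proof
    assume "step \<iota> (g, 0) w w'"
    then show "?A 0 w w'" by (cases g) (auto simp: nth_Cons' less_Suc_eq_0_disj)
  next
    assume A: "?A 0 w w'"
    show "step \<iota> (g, 0) w w'"
    proof (cases g)
      case Cup
      then obtain c d v where v: "w' = c # d # v" using A by (auto simp: length_Suc_conv)
      then have "v = w" using A Cup by (intro nth_equalityI) auto
      then show ?thesis using A Cup v by simp
    next
      case Cap
      then obtain c d v where v: "w = c # d # v" using A by (auto simp: neq_Nil_conv Suc_le_length_iff numeral_2_eq_2)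
      have "v ! p = w' ! p" if "p < length v" for p
        using A that unfolding Cap v by (auto dest: spec[of _ "Suc (Suc p)"])
      then have "v = w'" using A unfolding Cap v by (intro nth_equalityI) auto
      then show ?thesis using A Cap v by simp
    next
      case Pos
      then obtain c d v where v: "w = c # d # v" using A by (auto simp: neq_Nil_conv Suc_le_length_iff numeral_2_eq_2)
      obtain c' d' v' where v': "w' = c' # d' # v'" using A unfolding Pos v by (auto simp: length_Suc_conv)
      have asc: "w ! p = w' ! q" if "p < length w" "ascends (g, 0) p q" for p q using A that by blast
      have "c = d'" "d = c'" using asc[of 0 1] asc[of 1 0] unfolding v v' Pos by simp_all
      moreover have "v ! p = v' ! p" if "p < length v" for p
        using asc[of "Suc (Suc p)" "Suc (Suc p)"] that unfolding Pos v v' by simp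
      then have "v = v'" using A unfolding Pos v v' by (intro nth_equalityI) auto
      ultimately show ?thesis using Pos v v' by simp
    next
      case Neg
      then obtain c d v where v: "w = c # d # v" using A by (auto simp: neq_Nil_conv Suc_le_length_iff numeral_2_eq_2)
      obtain c' d' v' where v': "w' = c' # d' # v'" using A unfolding Neg v by (auto simp: length_Suc_conv)
      have asc: "w ! p = w' ! q" if "p < length w" "ascends (g, 0) p q" for p q using A that by blast
      have "c = d'" "d = c'" using asc[of 0 1] asc[of 1 0] unfolding v v' Neg by simp_all
      moreover have "v ! p = v' ! p" if "p < length v" for p
        using asc[of "Suc (Suc p)" "Suc (Suc p)"] that unfolding Neg v v' by simp
      then have "v = v'" using A unfolding Neg v v' by (intro nth_equalityI) auto
      ultimately show ?thesis using Neg v v' by simp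
    qed
  qed
next
  case (Suc i)
  show ?case
  proof
    assume "step \<iota> (g, Suc i) w w'"
    then obtain x v v' where v: "w = x # v" "w' = x # v'" "step \<iota> (g, i) v v'" by auto
    then have A: "?A i v v'" using Suc.IH by blast
    have "w ! p = w' ! q" if p: "p < length w" "ascends (g, Suc i) p q" for p q
    proof (cases p)
      case 0
      then show ?thesis using p v by auto
    next
      case (Suc p')
      moreover obtain q' where "q = Suc q'" using p Suc A v by (cases q) (auto simp: Suc_diff_le)
      moreover have "ascends (g, i) p' q'" using p(2) unfolding \<open>p = _\<close> \<open>q = _\<close> by (auto simp: Suc_diff_le)
      ultimately show ?thesis using A p(1) v by (simp del: ascends.simps)
    qed
    then show "?A (Suc i) w w'" using A v by (auto simp: Suc_diff_le)
  next
    assume A: "?A (Suc i) w w'"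
    obtain x v where w: "w = x # v" using A by (cases w) auto
    obtain x' v' where w': "w' = x' # v'" using A by (cases w') (auto simp: w Suc_diff_le)
    have "x = x'" using A unfolding w w' by (auto dest: spec[of _ 0])
    moreover have "v ! p = v' ! q" if "p < length v" "ascends (g, i) p q" for p q
    proof -
      have "ascends (g, Suc i) (Suc p) (Suc q)" using that(2) by (auto simp: Suc_diff_le)
      then have "(x # v) ! Suc p = (x' # v') ! Suc q" using A that(1) unfolding w w' by (metis Suc_less_eq length_Cons)
      then show ?thesis by simp
    qed
    then have "?A i v v'" using A unfolding w w' by (auto simp: Suc_diff_le)
    then have "step \<iota> (g, i) v v'" using Suc.IH by blast
    ultimately show "step \<iota> (g, Suc i) w w'" using w w' by simp
  qed
qed

definition word :: "(point \<Rightarrow> 'c) \<Rightarrow> diagram \<Rightarrow> nat \<Rightarrow> 'c list" where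
  "word F L h = map (\<lambda>p. F (h, p)) [0..<width (take h L)]"

text \<open>Level 0 is left out because it is the bottom word, which \<open>lab\<close> keeps apart
  and which is empty for a link.\<close>

definition words :: "(point \<Rightarrow> 'c) \<Rightarrow> diagram \<Rightarrow> 'c list list" where
  "words F L = map (\<lambda>h. word F L (Suc h)) [0..<length L]"

lemma length_words [simp]: "length (words F L) = length L"
  by (simp add: words_def)

lemma length_word [simp]: "length (word F L h) = width (take h L)"
  by (simp add: word_def)

lemma word_nth [simp]: "p < width (take h L) \<Longrightarrow> word F L h ! p = F (h, p)"
  by (simp add: word_def)

lemma words_nth [simp]: "h < length L \<Longrightarrow> words F L ! h = word F L (Suc h)"
  by (simp add: words_def)

lemma word_0 [simp]: "word F L 0 = []"
  by (simp add: word_def width_def)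

lemma Nil_words_nth [simp]: "h \<le> length L \<Longrightarrow> ([] # words F L) ! h = word F L h"
  by (cases h) auto

lemma width_take:
  assumes "link_diagram L" "h < length L" "L ! h = (g, i)"
  shows "i + n_in g \<le> width (take h L)" "width (take (Suc h) L) = width (take h L) - n_in g + n_out g"
proof -
  show "i + n_in g \<le> width (take h L)" using assms unfolding link_diagram_def by force
  show "width (take (Suc h) L) = width (take h L) - n_in g + n_out g"
    unfolding take_Suc_conv_app_nth[OF assms(2)] assms(3) width_eq_wd by simp
qed

lemma ascends_bound:
  assumes "ascends (g, i) p q" "i + n_in g \<le> m" "p < m"
  shows "q < m - n_in g + n_out g"
  using assms by (cases g) auto

lemma through_iff:
  "(x, y) \<in> through L \<longleftrightarrow> (\<exists>h p q. x = (h, p) \<and> y = (Suc h, q) \<and> h < length L \<and> p < width (take h L) \<and> ascends (L ! h) p q)"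
  unfolding through_def by blast

lemma turns_iff:
  "(x, y) \<in> turns L \<longleftrightarrow> (\<exists>h < length L. x = site_left L h \<and> y = site_right L h \<and> fst (L ! h) \<in> {Cup, Cap})"
  unfolding turns_def by blast

lemma sites:
  assumes "link_diagram L" "h < length L" "L ! h = (g, i)"
  shows "site_left L h \<in> points L" "site_right L h \<in> points L"
    "F (site_left L h) = (if g = Cup then word F L (Suc h) else word F L h) ! i"
    "F (site_right L h) = (if g = Cup then word F L (Suc h) else word F L h) ! Suc i"
proof -
  have b: "Suc i < width (take (if g = Cup then Suc h else h) L)"
    using width_take[OF assms] by (cases g) (auto simp del: take_Suc)
  have l: "(if g = Cup then Suc h else h) \<le> length L" using assms(2) by auto
  show "site_left L h \<in> points L" "site_right L h \<in> points L"
    using b l assms(3) by (auto simp: site_left_def site_right_def points_def split: if_splits)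
  show "F (site_left L h) = (if g = Cup then word F L (Suc h) else word F L h) ! i"
    "F (site_right L h) = (if g = Cup then word F L (Suc h) else word F L h) ! Suc i"
    using b assms(3) by (auto simp: site_left_def site_right_def split: if_splits)
qed

lemma through_points:
  assumes "link_diagram L" "(x, y) \<in> through L \<union> turns L"
  shows "x \<in> points L \<and> y \<in> points L"
proof -
  consider (through) "(x, y) \<in> through L" | (turns) "(x, y) \<in> turns L" using assms(2) by blast
  then show ?thesis
  proof cases
    case through
    then obtain h p q where d: "x = (h, p)" "y = (Suc h, q)" "h < length L" "p < width (take h L)" "ascends (L ! h) p q"
      unfolding through_iff by blast
    obtain g i where g: "L ! h = (g, i)" by force
    show ?thesis using d(1-4) ascends_bound[OF d(5)[unfolded g] width_take(1)[OF assms(1) d(3) g] d(4)]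
      width_take(2)[OF assms(1) d(3) g] by (simp add: points_def)
  next
    case turns
    then obtain h where d: "h < length L" "x = site_left L h" "y = site_right L h" unfolding turns_iff by blast
    obtain g i where g: "L ! h = (g, i)" by force
    show ?thesis unfolding d(2,3) using sites(1,2)[OF assms(1) d(1) g] by simp
  qed
qed

definition compatible :: "('c \<Rightarrow> 'c) \<Rightarrow> diagram \<Rightarrow> (point \<Rightarrow> 'c) \<Rightarrow> bool" where
  "compatible \<iota> L F \<longleftrightarrow> (\<forall>(x, y) \<in> through L. F x = F y) \<and> (\<forall>(x, y) \<in> turns L. F y = \<iota> (F x))"

lemma orientation_iff: "orientation L up \<longleftrightarrow> compatible Not L up"
  unfolding orientation_def compatible_def by auto

lemma lab_words:
  assumes L: "link_diagram L"
  shows "lab \<iota> L [] (words F L) [] \<longleftrightarrow> compatible \<iota> L F"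
proof -
  have step: "step \<iota> (L ! h) (word F L h) (word F L (Suc h)) \<longleftrightarrow>
      (\<forall>p < width (take h L). \<forall>q. ascends (L ! h) p q \<longrightarrow> F (h, p) = F (Suc h, q)) \<and>
      (fst (L ! h) \<in> {Cup, Cap} \<longrightarrow> F (site_right L h) = \<iota> (F (site_left L h)))" if h: "h < length L" for h
  proof -
    obtain g i where g: "L ! h = (g, i)" by force
    note w = width_take[OF L h g]
    have "(\<forall>p < width (take h L). \<forall>q. ascends (g, i) p q \<longrightarrow> word F L h ! p = word F L (Suc h) ! q) \<longleftrightarrow>
      (\<forall>p < width (take h L). \<forall>q. ascends (g, i) p q \<longrightarrow> F (h, p) = F (Suc h, q))"
    proof (intro all_cong imp_cong HOL.refl)
      fix p q assume "p < width (take h L)" "ascends (g, i) p q"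
      then show "(word F L h ! p = word F L (Suc h) ! q) = (F (h, p) = F (Suc h, q))"
        using ascends_bound[OF _ w(1), of p q] w(2) by simp
    qed
    then show ?thesis
      unfolding g step_iff_ascends length_word w(2) sites(3,4)[OF L h g] using w(1) by auto
  qed
  have "word F L (length L) = []" using L by (simp add: word_def link_diagram_def)
  moreover have "last ([] # words F L) = word F L (length L)"
  proof -
    have "last ([] # words F L) = ([] # words F L) ! (length ([] # words F L) - 1)" by (rule last_conv_nth) simp
    also have "length ([] # words F L) - 1 = length L" by simp
    finally show ?thesis by (simp only: Nil_words_nth order.refl)
  qed
  ultimately have "lab \<iota> L [] (words F L) [] \<longleftrightarrow> (\<forall>h < length L. step \<iota> (L ! h) (word F L h) (word F L (Suc h)))"
    unfolding lab_iff_nth by simp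
  also have "\<dots> \<longleftrightarrow> compatible \<iota> L F"
  proof
    assume st: "\<forall>h < length L. step \<iota> (L ! h) (word F L h) (word F L (Suc h))"
    show "compatible \<iota> L F"
      unfolding compatible_def
    proof (intro conjI ballI; clarify)
      fix h p h' q assume "((h, p), (h', q)) \<in> through L"
      then show "F (h, p) = F (h', q)" using st step unfolding through_iff by blast
    next
      fix h p h' q assume "((h, p), (h', q)) \<in> turns L"
      then obtain k where k: "k < length L" "(h, p) = site_left L k" "(h', q) = site_right L k" "fst (L ! k) \<in> {Cup, Cap}"
        unfolding turns_iff by blast
      show "F (h', q) = \<iota> (F (h, p))" unfolding k(2,3) using st step[OF k(1)] k(1,4) by blast
    qed
  next
    assume r: "compatible \<iota> L F"
    show "\<forall>h < length L. step \<iota> (L ! h) (word F L h) (word F L (Suc h))"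
    proof (intro allI impI)
      fix h assume h: "h < length L"
      have "F (h, p) = F (Suc h, q)" if "p < width (take h L)" "ascends (L ! h) p q" for p q
      proof -
        have "((h, p), (Suc h, q)) \<in> through L" unfolding through_iff using h that by blast
        then show ?thesis using r unfolding compatible_def by blast
      qed
      moreover have "F (site_right L h) = \<iota> (F (site_left L h))" if "fst (L ! h) \<in> {Cup, Cap}"
      proof -
        have "(site_left L h, site_right L h) \<in> turns L" unfolding turns_iff using h that by blast
        then show ?thesis using r unfolding compatible_def by blast
      qed
      ultimately show "step \<iota> (L ! h) (word F L h) (word F L (Suc h))" unfolding step[OF h] by blast
    qed
  qed
  finally show ?thesis .
qed

text \<open>\<open>F\<close> reads the label of a point off the word at its level. Together with
  \<open>lab_words\<close>, this turns the labelings of a link into compatible functions on its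
  points.\<close>

lemma lab_is_words:
  assumes L: "link_diagram L" and ws: "lab \<iota> L [] ws []"
  obtains F where "ws = words F L"
proof -
  have st: "length ws = length L" "step \<iota> (L ! h) (([] # ws) ! h) (ws ! h)" if "h < length L" for h
    using ws that unfolding lab_iff_nth by auto
  have len: "length ws = length L" using ws unfolding lab_iff_nth by simp
  have w: "length (([] # ws) ! h) = width (take h L)" if "h \<le> length L" for h
    using that
  proof (induction h)
    case (Suc h)
    obtain g i where g: "L ! h = (g, i)" by force
    show ?case using step_fits[OF st(2)[of h, unfolded g]] Suc width_take(2)[OF L _ g] by simp
  qed (simp add: width_def)
  let ?F = "\<lambda>(h, p). ([] # ws) ! h ! p"
  have "ws = words ?F L"
  proof (rule nth_equalityI)
    fix h assume "h < length ws"
    then have h: "h < length L" using len by simp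
    show "ws ! h = words ?F L ! h"
      unfolding words_nth[OF h]
      by (rule nth_equalityI) (use w[of "Suc h"] h in auto)
  qed (simp add: len)
  then show thesis by (rule that)
qed

lemma labels_words:
  assumes L: "link_diagram L"
  shows "labels [] (words F L) = F ` points L"
proof -
  have "labels [] (words F L) = (\<Union>h < length L. F ` ({Suc h} \<times> {..<width (take (Suc h) L)}))"
    by (auto simp: labels_def words_def word_def)
  also have "\<dots> = F ` points L"
  proof -
    have "(h, p) \<in> points L \<longleftrightarrow> (\<exists>h' < length L. h = Suc h' \<and> p < width (take (Suc h') L))" for h p
    proof (cases h)
      case 0
      then show ?thesis by (simp add: points_def width_def)
    qed (auto simp: points_def)
    then have "points L = (\<Union>h < length L. {Suc h} \<times> {..<width (take (Suc h) L)})" by auto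
    then show ?thesis by (simp only: image_UN)
  qed
  finally show ?thesis .
qed

lemma words_eq_iff:
  assumes L: "link_diagram L"
  shows "words F L = words G L \<longleftrightarrow> (\<forall>x \<in> points L. F x = G x)"
proof
  assume eq: "words F L = words G L"
  show "\<forall>x \<in> points L. F x = G x"
  proof
    fix x assume "x \<in> points L"
    then obtain h p where x: "x = (h, p)" "h \<le> length L" "p < width (take h L)" unfolding points_def by auto
    have "word F L h = word G L h" using Nil_words_nth[OF x(2), of F] Nil_words_nth[OF x(2), of G] eq by simp
    then show "F x = G x" using x word_nth[of p h L F] word_nth[of p h L G] by simp
  qed
next
  assume eq: "\<forall>x \<in> points L. F x = G x"
  show "words F L = words G L"
    unfolding words_def word_def using eq by (auto simp: points_def)
qed

lemma sub_words:
  assumes L: "link_diagram L"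
  shows "sub P L [] (words F L) = sublink L {x \<in> points L. P (F x)}"
  unfolding sub_eq_concat[OF length_words] sublink_def
proof (intro arg_cong[of _ _ concat] map_cong HOL.refl)
  fix h assume "h \<in> set [0..<length L]"
  then have h: "h < length L" by simp
  obtain g i where g: "L ! h = (g, i)" by force
  note w = width_take[OF L h g]
  have "{p. p < i \<and> (h, p) \<in> {x \<in> points L. P (F x)}} = {p. p < length (take i (word F L h)) \<and> P (take i (word F L h) ! p)}"
    using w(1) h by (auto simp: points_def)
  then have "card {p. p < i \<and> (h, p) \<in> {x \<in> points L. P (F x)}} = length (filter P (take i (word F L h)))"
    by (simp add: length_filter_conv_card)
  then show "sub1 P (L ! h) (([] # words F L) ! h) (words F L ! h) = restrict_slice L {x \<in> points L. P (F x)} h"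
    using h unfolding sub1_def restrict_slice_def g
    by (simp add: sites(1,2)[OF L h g] sites(3,4)[OF L h g, of F] Let_def)
qed

lemma wr1_word:
  assumes "link_diagram L" "h < length L"
  shows "wr1 \<omega> (L ! h) (word F L h) =
    (if fst (L ! h) \<in> {Pos, Neg} then \<omega> (fst (L ! h)) (F (site_left L h)) (F (site_right L h)) else 0)"
proof -
  obtain g i where g: "L ! h = (g, i)" by force
  show ?thesis unfolding sites(3,4)[OF assms g] unfolding g wr1_def by auto
qed

lemma zip_words: "map2 zip (words F L) (words G L) = words (\<lambda>x. (F x, G x)) L"
  by (rule nth_equalityI) (simp_all add: word_def zip_map_map zip_same_conv_map)

section \<open>Components and their colourings\<close>

lemma equiv_connected_points: "equiv (points L) (connected_points L)"
proof (rule equivI)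
  let ?R = "through L \<union> turns L \<union> (through L \<union> turns L)\<inverse>"
  have "sym ?R" by (auto simp: sym_def)
  then have "sym (?R\<^sup>*)" by (rule sym_rtrancl)
  then show "sym (connected_points L)" unfolding connected_points_def sym_def by blast
  show "trans (connected_points L)" unfolding connected_points_def trans_def by (blast intro: rtrancl_trans)
  show "connected_points L \<subseteq> points L \<times> points L" unfolding connected_points_def by blast
  show "refl_on (points L) (connected_points L)" unfolding connected_points_def refl_on_def by blast
qed

lemma compatible_id_iff:
  assumes L: "link_diagram L"
  shows "compatible id L F \<longleftrightarrow> (\<forall>(x, y) \<in> connected_points L. F x = F y)"
proof
  assume F: "compatible id L F"
  have "F x = F y" if "(x, y) \<in> (through L \<union> turns L \<union> (through L \<union> turns L)\<inverse>)\<^sup>*" for x y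
    using that
  proof induction
    case (step y z)
    then show ?case using F unfolding compatible_def by auto
  qed simp
  then show "\<forall>(x, y) \<in> connected_points L. F x = F y" unfolding connected_points_def by blast
next
  assume F: "\<forall>(x, y) \<in> connected_points L. F x = F y"
  have "F x = F y" if "(x, y) \<in> through L \<union> turns L" for x y
  proof -
    have "(x, y) \<in> connected_points L"
      using through_points[OF L that] that unfolding connected_points_def by (blast intro: r_into_rtrancl)
    then show ?thesis using F by blast
  qed
  then show "compatible id L F"
    unfolding compatible_def by (intro conjI ballI; clarify) (blast, metis UnI2 id_apply)
qed

definition component_of :: "diagram \<Rightarrow> point \<Rightarrow> point set" where
  "component_of L x = connected_points L `` {x}"

lemma comp_eq_iff: "x \<in> points L \<Longrightarrow> y \<in> points L \<Longrightarrow> component_of L x = component_of L y \<longleftrightarrow> (x, y) \<in> connected_points L"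
  unfolding component_of_def by (rule eq_equiv_class_iff[OF equiv_connected_points])

lemma components_eq: "components L = component_of L ` points L"
  unfolding components_def component_of_def quotient_def by auto

lemma mem_comp: "x \<in> points L \<Longrightarrow> x \<in> component_of L x"
  unfolding component_of_def by (rule equiv_class_self[OF equiv_connected_points])

lemma comp_eqI: "x \<in> points L \<Longrightarrow> y \<in> component_of L x \<Longrightarrow> y \<in> points L \<and> component_of L y = component_of L x"
  using equiv_class_eq[OF equiv_connected_points, of x y L] unfolding component_of_def connected_points_def by auto

lemma finite_components [simp]: "finite (components L)"
proof -
  have "points L = Sigma {..length L} (\<lambda>h. {..<width (take h L)})" unfolding points_def by auto
  then show ?thesis unfolding components_eq by simp
qed

lemma n_components_pos:
  assumes L: "link_diagram L"
  shows "n_components L \<ge> 1"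
proof -
  have h: "0 < length L" using L unfolding link_diagram_def by simp
  obtain g i where g: "L ! 0 = (g, i)" by force
  have "(1, 0) \<in> points L"
    using width_take[OF L h g] h unfolding points_def by (cases g) (auto simp: width_def Suc_le_eq)
  then show ?thesis unfolding n_components_def components_eq[symmetric] by (simp add: Suc_le_eq card_gt_0_iff) (auto simp: components_eq)
qed

definition comp_words :: "diagram \<Rightarrow> (point set \<Rightarrow> 'c) \<Rightarrow> 'c list list" where
  "comp_words L G = words (\<lambda>x. G (component_of L x)) L"

lemma labels_comp_words: "link_diagram L \<Longrightarrow> labels [] (comp_words L G) = G ` components L"
  unfolding comp_words_def components_eq by (simp add: labels_words image_image)

lemma compatible_comp:
  assumes "link_diagram L"
  shows "compatible id L (\<lambda>x. G (component_of L x))"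
proof -
  have "component_of L x = component_of L y" if "(x, y) \<in> connected_points L" for x y
    using that comp_eq_iff[of x L y] unfolding connected_points_def by blast
  then show ?thesis unfolding compatible_id_iff[OF assms] by auto
qed

lemma lab_comp_words: "link_diagram L \<Longrightarrow> lab id L [] (comp_words L G) []"
  unfolding comp_words_def by (simp only: lab_words compatible_comp)

text \<open>A function that respects \<open>through\<close> and \<open>turns\<close> is constant on
  components, so it factors through them. Taking the functions extensional makes the correspondence
  injective.\<close>

lemma bij_betw_comp_words:
  assumes L: "link_diagram L"
  shows "bij_betw (comp_words L) (components L \<rightarrow>\<^sub>E S) {ws. lab id L [] ws [] \<and> labels [] ws \<subseteq> S}"
proof (rule bij_betwI')
  fix G H :: "point set \<Rightarrow> 'a"
  assume GH: "G \<in> components L \<rightarrow>\<^sub>E S" "H \<in> components L \<rightarrow>\<^sub>E S"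
  show "comp_words L G = comp_words L H \<longleftrightarrow> G = H"
  proof
    assume "comp_words L G = comp_words L H"
    then have "\<forall>x \<in> points L. G (component_of L x) = H (component_of L x)" unfolding comp_words_def words_eq_iff[OF L] .
    then show "G = H" using PiE_ext[OF GH] unfolding components_eq by blast
  qed simp
next
  fix G assume "G \<in> components L \<rightarrow>\<^sub>E S"
  then show "comp_words L G \<in> {ws. lab id L [] ws [] \<and> labels [] ws \<subseteq> S}"
    using lab_comp_words[OF L, of G] labels_comp_words[OF L, of G] by auto
next
  fix ws assume ws: "ws \<in> {ws. lab id L [] ws [] \<and> labels [] ws \<subseteq> S}"
  then obtain F where F: "ws = words F L" using lab_is_words[OF L] by blast
  have cF: "\<forall>(x, y) \<in> connected_points L. F x = F y"
    using ws[unfolded F mem_Collect_eq, THEN conjunct1] unfolding lab_words[OF L] compatible_id_iff[OF L] .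
  define G where "G = (\<lambda>C \<in> components L. F (SOME x. x \<in> C))"
  have G: "G (component_of L x) = F x" if x: "x \<in> points L" for x
  proof -
    have "(SOME y. y \<in> component_of L x) \<in> component_of L x" using mem_comp[OF x] by (rule someI)
    then have "(x, SOME y. y \<in> component_of L x) \<in> connected_points L" unfolding component_of_def by simp
    then have "F (SOME y. y \<in> component_of L x) = F x" using cF by fastforce
    then show ?thesis unfolding G_def components_eq using x by simp
  qed
  have "ws = comp_words L G" unfolding F comp_words_def words_eq_iff[OF L] using G by simp
  moreover have "G \<in> components L \<rightarrow>\<^sub>E S"
  proof (rule PiE_I)
    fix C assume "C \<in> components L"
    then obtain x where x: "x \<in> points L" "C = component_of L x" unfolding components_eq by blast
    show "G C \<in> S" unfolding x(2) G[OF x(1)] using ws x(1) unfolding F by (auto simp: labels_words[OF L])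
  qed (simp add: G_def)
  ultimately show "\<exists>G \<in> components L \<rightarrow>\<^sub>E S. ws = comp_words L G" by blast
qed

lemma card_bool_labelings:
  assumes "link_diagram L"
  shows "card (bool_labelings L) = 2 ^ n_components L"
proof -
  have "card (bool_labelings L) = card (components L \<rightarrow>\<^sub>E (UNIV :: bool set))"
    using bij_betw_same_card[OF bij_betw_comp_words[OF assms, of "UNIV :: bool set"]] unfolding bool_labelings_def by simp
  then show ?thesis unfolding n_components_def by (simp add: card_PiE)
qed

lemma orientation_exists:
  assumes L: "link_diagram L"
  shows "\<exists>up. orientation L up"
proof -
  obtain os where os: "lab Not L [] os []" using orientation_labeling_exists[OF L] by blast
  obtain up where "os = words up L" using lab_is_words[OF L os] by blast
  then show ?thesis using os unfolding orientation_iff by (auto simp: lab_words[OF L])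
qed

section \<open>Surjective colourings and set partitions\<close>

definition onto :: "'c set \<Rightarrow> 't set \<Rightarrow> ('c \<Rightarrow> 't) set" where
  "onto C T = {g \<in> C \<rightarrow>\<^sub>E T. g ` C = T}"

definition fibre :: "'c set \<Rightarrow> ('c \<Rightarrow> nat) \<Rightarrow> nat \<Rightarrow> 'c set" where
  "fibre C G j = {c \<in> C. G c = j}"

lemma fibre_inj:
  assumes "G \<in> onto C {..<k}"
  shows "inj_on (fibre C G) {..<k}"
proof (rule inj_onI)
  fix i j assume "i \<in> {..<k}" "j \<in> {..<k}" and eq: "fibre C G i = fibre C G j"
  then have "i \<in> G ` C" using assms unfolding onto_def by simp
  then obtain c where "c \<in> C" "G c = i" by blast
  then have "c \<in> fibre C G i" unfolding fibre_def by simp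
  then show "i = j" using \<open>G c = i\<close> unfolding eq unfolding fibre_def by simp
qed

lemma fibres_partition:
  assumes "G \<in> onto C {..<k}"
  shows "partition_on C (fibre C G ` {..<k})" "card (fibre C G ` {..<k}) = k"
proof -
  show "card (fibre C G ` {..<k}) = k" using card_image[OF fibre_inj[OF assms]] by simp
  show "partition_on C (fibre C G ` {..<k})"
  proof (rule partition_onI)
    show "\<Union> (fibre C G ` {..<k}) = C" using assms unfolding onto_def fibre_def by auto
    show "{} \<notin> fibre C G ` {..<k}"
    proof
      assume "{} \<in> fibre C G ` {..<k}"
      then obtain j where j: "j < k" "fibre C G j = {}" by auto
      then have "j \<in> G ` C" using assms unfolding onto_def by simp
      then show False using j(2) unfolding fibre_def by blast
    qed
  qed (auto simp: fibre_def disjnt_def)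
qed

text \<open>Listing the fibres in the order of their values identifies these maps with the orderings
  of the set of parts.\<close>

lemma card_maps_with_fibres:
  assumes \<pi>: "partition_on C \<pi>" "finite C" "card \<pi> = k"
  shows "card {G \<in> onto C {..<k}. fibre C G ` {..<k} = \<pi>} = fact k"
proof -
  have fin: "finite \<pi>" using finite_elements[OF assms(2,1)] .
  have "bij_betw (\<lambda>G. map (fibre C G) [0..<k]) {G \<in> onto C {..<k}. fibre C G ` {..<k} = \<pi>} (permutations_of_set \<pi>)"
  proof (rule bij_betwI')
    fix G H assume GH: "G \<in> {G \<in> onto C {..<k}. fibre C G ` {..<k} = \<pi>}" "H \<in> {G \<in> onto C {..<k}. fibre C G ` {..<k} = \<pi>}"
    show "map (fibre C G) [0..<k] = map (fibre C H) [0..<k] \<longleftrightarrow> G = H"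
    proof
      assume "map (fibre C G) [0..<k] = map (fibre C H) [0..<k]"
      then have eq: "fibre C G j = fibre C H j" if "j < k" for j using that by simp
      show "G = H"
      proof (rule PiE_ext)
        show "G \<in> C \<rightarrow>\<^sub>E {..<k}" "H \<in> C \<rightarrow>\<^sub>E {..<k}" using GH unfolding onto_def by auto
        fix c assume c: "c \<in> C"
        then have "G c < k" using GH(1) unfolding onto_def by auto
        moreover have "c \<in> fibre C G (G c)" using c unfolding fibre_def by simp
        ultimately have "c \<in> fibre C H (G c)" using eq by simp
        then show "G c = H c" unfolding fibre_def by simp
      qed
    qed simp
  next
    fix G assume "G \<in> {G \<in> onto C {..<k}. fibre C G ` {..<k} = \<pi>}"
    then show "map (fibre C G) [0..<k] \<in> permutations_of_set \<pi>"
      using fibre_inj[of G C k] by (auto simp: permutations_of_set_def distinct_map atLeast0LessThan)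
  next
    fix xs assume "xs \<in> permutations_of_set \<pi>"
    then have xs: "set xs = \<pi>" "distinct xs" unfolding permutations_of_set_def by auto
    then have len: "length xs = k" using assms(3) distinct_card by metis
    have ex: "\<exists>!j. j < k \<and> c \<in> xs ! j" if c: "c \<in> C" for c
    proof (rule ex_ex1I)
      show "\<exists>j. j < k \<and> c \<in> xs ! j"
        using c \<pi>(1) unfolding partition_on_def xs(1)[symmetric] len[symmetric] by (auto simp: in_set_conv_nth)
      fix i j assume ij: "i < k \<and> c \<in> xs ! i" "j < k \<and> c \<in> xs ! j"
      have "xs ! i \<in> \<pi>" "xs ! j \<in> \<pi>" using ij len xs(1) by auto
      then have "xs ! i = xs ! j" using \<pi>(1) ij unfolding partition_on_def disjoint_def by blast
      then show "i = j" using ij len xs(2) nth_eq_iff_index_eq by metis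
    qed
    define G where "G = (\<lambda>c \<in> C. THE j. j < k \<and> c \<in> xs ! j)"
    have G: "G c < k \<and> c \<in> xs ! G c" if "c \<in> C" for c
      using theI'[OF ex[OF that]] that unfolding G_def by simp
    have Gj: "G c = j" if "c \<in> C" "j < k" "c \<in> xs ! j" for c j
      using ex[OF that(1)] G[OF that(1)] that(2,3) by blast
    have sub: "xs ! j \<subseteq> C" "xs ! j \<noteq> {}" if "j < k" for j
    proof -
      have "xs ! j \<in> \<pi>" using that len xs(1) by auto
      then show "xs ! j \<subseteq> C" "xs ! j \<noteq> {}" using \<pi>(1) unfolding partition_on_def by auto
    qed
    have fib: "fibre C G j = xs ! j" if "j < k" for j
      using that G Gj sub[OF that] unfolding fibre_def by blast
    have eq: "map (fibre C G) [0..<k] = xs" using fib len by (intro nth_equalityI) auto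
    have "{..<k} \<subseteq> G ` C"
    proof
      fix j assume j: "j \<in> {..<k}"
      then obtain c where "c \<in> xs ! j" using sub(2)[of j] by auto
      then have "c \<in> C" "G c = j" using sub(1)[of j] Gj[of c j] j by auto
      then show "j \<in> G ` C" by blast
    qed
    then have "G \<in> onto C {..<k}" unfolding onto_def using G by (auto simp: G_def)
    moreover have "fibre C G ` {..<k} = \<pi>"
      unfolding xs(1)[symmetric] eq[symmetric] by (simp add: atLeast0LessThan)
    ultimately show "\<exists>G \<in> {G \<in> onto C {..<k}. fibre C G ` {..<k} = \<pi>}. xs = map (fibre C G) [0..<k]"
      using eq by blast
  qed
  then show ?thesis using bij_betw_same_card card_permutations_of_set[OF fin] \<pi>(3) by fastforce
qed

lemma sum_onto:
  fixes H :: "'c set set \<Rightarrow> 'r :: comm_semiring_1"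
  assumes C: "finite C"
  shows "(\<Sum>G \<in> onto C {..<k}. H (fibre C G ` {..<k})) = of_nat (fact k) * (\<Sum>\<pi> | partition_on C \<pi> \<and> card \<pi> = k. H \<pi>)"
proof -
  let ?T = "{\<pi>. partition_on C \<pi> \<and> card \<pi> = k}"
  have finT: "finite ?T" using finitely_many_partition_on[OF C] by simp
  have finS: "finite (onto C {..<k})"
    by (rule finite_subset[OF _ finite_PiE[OF C, of "\<lambda>_. {..<k}"]]) (auto simp: onto_def)
  have "(\<Sum>G \<in> onto C {..<k}. H (fibre C G ` {..<k})) =
      (\<Sum>\<pi> \<in> ?T. \<Sum>G | G \<in> onto C {..<k} \<and> fibre C G ` {..<k} = \<pi>. H (fibre C G ` {..<k}))"
    by (rule sum.group[OF finS finT, symmetric]) (use fibres_partition[of _ C k] in auto)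
  also have "\<dots> = (\<Sum>\<pi> \<in> ?T. of_nat (fact k) * H \<pi>)"
  proof (rule sum.cong[OF HOL.refl])
    fix \<pi> assume "\<pi> \<in> ?T"
    then have c: "card {G \<in> onto C {..<k}. fibre C G ` {..<k} = \<pi>} = fact k" using card_maps_with_fibres[of C \<pi> k] C by simp
    have "(\<Sum>G | G \<in> onto C {..<k} \<and> fibre C G ` {..<k} = \<pi>. H (fibre C G ` {..<k})) =
      (\<Sum>G | G \<in> onto C {..<k} \<and> fibre C G ` {..<k} = \<pi>. H \<pi>)"
      by (rule sum.cong) auto
    then show "(\<Sum>G | G \<in> onto C {..<k} \<and> fibre C G ` {..<k} = \<pi>. H (fibre C G ` {..<k})) = of_nat (fact k) * H \<pi>"
      using c by simp
  qed
  finally show ?thesis by (simp add: sum_distrib_left)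
qed

lemma crossing_sign_eq:
  "crossing_sign L up h = turn_sign (fst (L ! h)) (up (site_left L h) = up (site_right L h))"
  unfolding crossing_sign_def Let_def by (cases "fst (L ! h)") simp_all

definition part_weight :: "(diagram \<Rightarrow> laurent) \<Rightarrow> diagram \<Rightarrow> (point \<Rightarrow> bool) \<Rightarrow> point set set set \<Rightarrow> laurent" where
  "part_weight Q L up \<pi> = const (\<i> powi (writhe L up - (\<Sum>S \<in> \<pi>. sub_writhe L up (\<Union>S)))) * (\<Prod>S \<in> \<pi>. Q (sublink L (\<Union>S)))"

lemma Union_fibre: "\<Union>(fibre (components L) G j) = {x \<in> points L. G (component_of L x) = j}"
proof (intro equalityI subsetI)
  fix x assume "x \<in> \<Union>(fibre (components L) G j)"
  then obtain y where y: "y \<in> points L" "x \<in> component_of L y" "G (component_of L y) = j" unfolding fibre_def components_eq by blast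
  then show "x \<in> {x \<in> points L. G (component_of L x) = j}" using comp_eqI[OF y(1,2)] by simp
next
  fix x assume "x \<in> {x \<in> points L. G (component_of L x) = j}"
  then show "x \<in> \<Union>(fibre (components L) G j)" using mem_comp[of x L] unfolding fibre_def components_eq by blast
qed

text \<open>A crossing of equal colours is counted in the writhe of exactly one part. Subtracting
  the writhes of all parts therefore leaves the crossings of different colours, whose signs form the
  exponent of the phase.\<close>

lemma colour_weight_comp_words:
  assumes L: "link_diagram L" and up: "orientation L up" and G: "G \<in> onto (components L) {..<k}"
  shows "colour_weight Q L k (comp_words L G) = part_weight Q L up (fibre (components L) G ` {..<k})"
proof -
  let ?fib = "fibre (components L) G"
  have "(\<Prod>j<k. Q (sub ((=) j) L [] (comp_words L G))) = (\<Prod>j<k. Q (sublink L (\<Union>(?fib j))))"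
    unfolding comp_words_def sub_words[OF L] Union_fibre by (intro prod.cong) (auto intro!: arg_cong[of _ _ Q] arg_cong[of _ _ "sublink L"])
  also have "\<dots> = (\<Prod>S \<in> ?fib ` {..<k}. Q (sublink L (\<Union>S)))"
    using prod.reindex[OF fibre_inj[OF G], of "\<lambda>S. Q (sublink L (\<Union>S))"] by simp
  finally have prod: "(\<Prod>j<k. Q (sub ((=) j) L [] (comp_words L G))) = (\<Prod>S \<in> ?fib ` {..<k}. Q (sublink L (\<Union>S)))" .
  have os: "lab Not L [] (words up L) []" using up unfolding orientation_iff lab_words[OF L] .
  have "wr mixed_sign L [] (map2 zip (comp_words L G) (words up L)) =
      (\<Sum>h < length L. crossing_sign L up h - (\<Sum>S \<in> ?fib ` {..<k}. if site_left L h \<in> \<Union>S \<and> site_right L h \<in> \<Union>S then crossing_sign L up h else 0))"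
    unfolding comp_words_def zip_words wr_eq_sum[OF length_words]
  proof (rule sum.cong[OF HOL.refl])
    fix h assume "h \<in> {..<length L}"
    then have h: "h < length L" by simp
    obtain g i where g: "L ! h = (g, i)" by force
    let ?l = "G (component_of L (site_left L h))" and ?r = "G (component_of L (site_right L h))"
    have pts: "site_left L h \<in> points L" "site_right L h \<in> points L" using sites(1,2)[OF L h g] by simp_all
    then have l: "?l < k" using G unfolding onto_def components_eq by auto
    have "(\<Sum>S \<in> ?fib ` {..<k}. if site_left L h \<in> \<Union>S \<and> site_right L h \<in> \<Union>S then crossing_sign L up h else 0) =
      (\<Sum>j<k. if site_left L h \<in> \<Union>(?fib j) \<and> site_right L h \<in> \<Union>(?fib j) then crossing_sign L up h else 0)"
      using sum.reindex[OF fibre_inj[OF G]] by simp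
    also have "\<dots> = (\<Sum>j<k. if ?l = j then (if ?l = ?r then crossing_sign L up h else 0) else 0)"
      unfolding Union_fibre using pts by (intro sum.cong) auto
    also have "\<dots> = (if ?l = ?r then crossing_sign L up h else 0)" using l by simp
    finally have sum: "(\<Sum>S \<in> ?fib ` {..<k}. if site_left L h \<in> \<Union>S \<and> site_right L h \<in> \<Union>S then crossing_sign L up h else 0) =
      (if ?l = ?r then crossing_sign L up h else 0)" .
    have nth: "([] # words (\<lambda>x. (G (component_of L x), up x)) L) ! h = word (\<lambda>x. (G (component_of L x), up x)) L h" using h by simp
    show "wr1 mixed_sign (L ! h) (([] # words (\<lambda>x. (G (component_of L x), up x)) L) ! h) = crossing_sign L up h -
        (\<Sum>S \<in> ?fib ` {..<k}. if site_left L h \<in> \<Union>S \<and> site_right L h \<in> \<Union>S then crossing_sign L up h else 0)"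
      unfolding sum nth wr1_word[OF L h] unfolding crossing_sign_eq by (cases "fst (L ! h)") simp_all
  qed
  also have "\<dots> = writhe L up - (\<Sum>S \<in> ?fib ` {..<k}. sub_writhe L up (\<Union>S))"
    unfolding writhe_def sub_writhe_def sum_subtractf by (subst sum.swap) (rule HOL.refl)
  finally have wr: "wr mixed_sign L [] (map2 zip (comp_words L G) (words up L)) = writhe L up - (\<Sum>S \<in> ?fib ` {..<k}. sub_writhe L up (\<Union>S))" .
  show ?thesis
    unfolding colour_weight_def part_weight_def prod colour_phase_eq[OF lab_comp_words[OF L] os] wr by (rule HOL.refl)
qed

lemma bij_betw_colourings:
  assumes L: "link_diagram L"
  shows "bij_betw (comp_words L) (onto (components L) {..<k}) (colourings L k)"
proof -
  let ?C = "components L"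
  note bij = bij_betw_comp_words[OF L, of "{..<k}"]
  have "comp_words L ` onto ?C {..<k} = colourings L k"
  proof (intro equalityI subsetI)
    fix cs assume cs: "cs \<in> colourings L k"
    then have "cs \<in> {ws. lab id L [] ws [] \<and> labels [] ws \<subseteq> {..<k}}" unfolding colourings_def by auto
    then obtain G where G: "G \<in> ?C \<rightarrow>\<^sub>E {..<k}" "cs = comp_words L G" using bij_betw_imp_surj_on[OF bij] by blast
    then have "G ` ?C = {..<k}" using cs labels_comp_words[OF L, of G] unfolding colourings_def by simp
    then show "cs \<in> comp_words L ` onto ?C {..<k}" using G unfolding onto_def by blast
  next
    fix cs assume "cs \<in> comp_words L ` onto ?C {..<k}"
    then obtain G where G: "G \<in> onto ?C {..<k}" "cs = comp_words L G" by blast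
    then show "cs \<in> colourings L k"
      using lab_comp_words[OF L, of G] labels_comp_words[OF L, of G] unfolding onto_def colourings_def by auto
  qed
  moreover have "inj_on (comp_words L) (onto ?C {..<k})"
    using bij_betw_imp_inj_on[OF bij] by (rule inj_on_subset) (auto simp: onto_def)
  ultimately show ?thesis unfolding bij_betw_def by blast
qed

lemma colour_sum_eq:
  assumes L: "link_diagram L" and up: "orientation L up"
  shows "colour_sum Q L k = of_nat (fact k) * (\<Sum>\<pi> | partition_on (components L) \<pi> \<and> card \<pi> = k. part_weight Q L up \<pi>)"
proof -
  let ?C = "components L"
  have "colour_sum Q L k = (\<Sum>G \<in> onto ?C {..<k}. colour_weight Q L k (comp_words L G))"
    unfolding colour_sum_def by (rule sum.reindex_bij_betw[OF bij_betw_colourings[OF L], symmetric])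
  also have "\<dots> = (\<Sum>G \<in> onto ?C {..<k}. part_weight Q L up (fibre ?C G ` {..<k}))"
    using colour_weight_comp_words[OF L up] by (intro sum.cong) auto
  also have "\<dots> = of_nat (fact k) * (\<Sum>\<pi> | partition_on ?C \<pi> \<and> card \<pi> = k. part_weight Q L up \<pi>)"
    by (rule sum_onto) simp
  finally show ?thesis .
qed

lemma const_mult: "const a * const b = const (a * b)"
  by (simp add: const_def mult_single)

lemma const_of_nat: "const (of_nat n) = of_nat n"
proof -
  have "const (of_nat n) = of_nat n \<and> True"
  proof (induction n)
    case (Suc n)
    have "const (of_nat (Suc n)) = const 1 + const (of_nat n)" unfolding const_def by (simp add: single_add)
    then show ?case using Suc by (simp add: const_def)
  qed (simp add: const_def)
  then show ?thesis by simp
qed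

text \<open>The sum over colourings counts each partition \<open>k!\<close> times; complex
  coefficients allow this factor to be divided out.\<close>

definition Psi_coeff :: "nat \<Rightarrow> laurent" where
  "Psi_coeff k = gamma ^ (k - 1) * Ehat k * const (1 / of_nat (fact k))"

lemma Psi_oriented_eq:
  assumes L: "link_diagram L" and up: "orientation L up"
  shows "Psi_oriented Q L up = (z_pow 1 * w_pow (-1)) ^ (n_components L - 1) *
    (\<Sum>k = 1..n_components L. Psi_coeff k * colour_sum Q L k)"
proof -
  let ?c = "const (\<i> powi writhe L up)"
  have part: "const (\<i> powi writhe L up) * (const (\<i> powi (- (\<Sum>S \<in> \<pi>. sub_writhe L up (\<Union>S)))) * (\<Prod>S \<in> \<pi>. Q (sublink L (\<Union>S)))) =
      part_weight Q L up \<pi>" for \<pi>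
    unfolding part_weight_def mult.assoc[symmetric] const_mult by (simp add: power_int_add[symmetric])
  have "?c * (gamma ^ (k - 1) * Ehat k * (\<Sum>\<pi> | partition_on (components L) \<pi> \<and> card \<pi> = k.
      const (\<i> powi (- (\<Sum>S \<in> \<pi>. sub_writhe L up (\<Union>S)))) * (\<Prod>S \<in> \<pi>. Q (sublink L (\<Union>S))))) =
      Psi_coeff k * colour_sum Q L k" (is "?c * (?g * ?s) = _") for k
  proof -
    have "?c * ?s = (\<Sum>\<pi> | partition_on (components L) \<pi> \<and> card \<pi> = k. part_weight Q L up \<pi>)"
      unfolding sum_distrib_left part ..
    moreover have "const (1 / of_nat (fact k)) * colour_sum Q L k = (\<Sum>\<pi> | partition_on (components L) \<pi> \<and> card \<pi> = k. part_weight Q L up \<pi>)"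
    proof -
      have "const (1 / of_nat (fact k)) * of_nat (fact k) = 1"
        unfolding const_of_nat[symmetric] const_mult by (simp add: const_def)
      then show ?thesis unfolding colour_sum_eq[OF L up] mult.assoc[symmetric] by simp
    qed
    moreover have "?c * (?g * ?s) = ?g * (?c * ?s)" by (rule mult.left_commute)
    ultimately show ?thesis unfolding Psi_coeff_def by (simp only: mult.assoc)
  qed
  note summand = this
  have "Psi_oriented Q L up = (z_pow 1 * w_pow (-1)) ^ (n_components L - 1) * (\<Sum>k = 1..n_components L.
      ?c * (gamma ^ (k - 1) * Ehat k * (\<Sum>\<pi> | partition_on (components L) \<pi> \<and> card \<pi> = k.
      const (\<i> powi (- (\<Sum>S \<in> \<pi>. sub_writhe L up (\<Union>S)))) * (\<Prod>S \<in> \<pi>. Q (sublink L (\<Union>S))))))"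
    unfolding Psi_oriented_def sum_distrib_left[symmetric] by (simp only: mult_ac)
  then show ?thesis unfolding summand .
qed

lemma Psi_eq:
  assumes "link_diagram L"
  shows "Psi Q L = (z_pow 1 * w_pow (-1)) ^ (n_components L - 1) * (\<Sum>k = 1..n_components L. Psi_coeff k * colour_sum Q L k)"
  unfolding Psi_def by (rule Psi_oriented_eq[OF assms someI_ex[OF orientation_exists[OF assms]]])

section \<open>Invariance and skein relation of the state sum\<close>

lemma n_components_isotopy:
  assumes "isotopy_move l l'" "link_diagram (u @ l @ v)" "link_diagram (u @ l' @ v)"
  shows "n_components (u @ l @ v) = n_components (u @ l' @ v)"
  using card_bool_labelings_isotopy[OF assms] unfolding card_bool_labelings[OF assms(2)] card_bool_labelings[OF assms(3)] by simp

lemma curl_link_diagram: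
  assumes "curl s l" "link_diagram (u @ l @ v)"
  shows "link_diagram (u @ v)"
  using assms by (elim curl_cases) (auto simp: link_diagram_iff)

lemma n_components_curl:
  assumes "curl s l" "link_diagram (u @ l @ v)"
  shows "n_components (u @ l @ v) = n_components (u @ v)"
  using card_bool_labelings_curl[OF assms] unfolding card_bool_labelings[OF assms(2)] card_bool_labelings[OF curl_link_diagram[OF assms]] by simp

lemma n_components_tiso:
  assumes "tiso 0 k L L'" "link_diagram L"
  shows "n_components L = n_components L'"
proof -
  have "n_components l = n_components l'" if "tiso m k l l'" "m = 0" "link_diagram l" for m l l'
    using that
  proof (induction rule: tiso.induct)
    case (move l l' m u v)
    then have "tiso 0 0 (u @ l @ v) (u @ l' @ v)" using tiso.move by blast
    then show ?case using n_components_isotopy[OF move(1)] move(5) tiso_link_diagram by blast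
  next
    case (curl s l m u v)
    then show ?case using n_components_curl[of s l u v] by simp
  next
    case (sym m k l l')
    then have "tiso 0 k l l'" by simp
    then show ?case using sym tiso_link_diagram by simp
  next
    case (trans m k l l' k' l'')
    then have "tiso 0 k l l'" by simp
    then show ?case using trans tiso_link_diagram by simp
  qed simp
  then show ?thesis using assms by blast
qed

text \<open>In the skein relation this lets the sums for diagrams with different numbers of
  components run over the same range of \<open>k\<close>.\<close>

lemma colour_sum_many:
  assumes L: "link_diagram L" and k: "n_components L < k"
  shows "colour_sum Q L k = 0"
proof -
  have "colourings L k = {}"
  proof (rule ccontr)
    assume "colourings L k \<noteq> {}"
    then obtain cs where cs: "lab id L [] cs []" "labels [] cs = {..<k}" unfolding colourings_def by blast
    then have "cs \<in> {ws. lab id L [] ws [] \<and> labels [] ws \<subseteq> {..<k}}" by simp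
    then obtain G where "cs = comp_words L G"
      unfolding bij_betw_imp_surj_on[OF bij_betw_comp_words[OF L], symmetric] by (elim imageE)
    then have "G ` components L = {..<k}" using cs(2) labels_comp_words[OF L, of G] by simp
    then have "k \<le> n_components L" using card_image_le[OF finite_components, of G L] unfolding n_components_def by simp
    then show False using k by simp
  qed
  then show ?thesis unfolding colour_sum_def by simp
qed

theorem framed_invariant_Psi:
  assumes Q: "framed_invariant Q"
  shows "framed_invariant (Psi Q)"
  unfolding framed_invariant_def
proof (intro conjI allI impI)
  fix L L' assume "local_move isotopy_move L L'"
  then obtain u v l l' where d: "isotopy_move l l'" "L = u @ l @ v" "L' = u @ l' @ v" "link_diagram L" "link_diagram L'"
    unfolding local_move_def by blast
  note l = d(4,5)[unfolded d(2,3)]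
  show "Psi Q L = Psi Q L'"
    unfolding Psi_eq[OF d(4)] Psi_eq[OF d(5)] unfolding d(2,3) n_components_isotopy[OF d(1) l] colour_sum_isotopy[OF Q d(1) l]
    by (rule HOL.refl)
next
  fix s :: int and u l v :: diagram
  assume a: "curl s l \<and> link_diagram (u @ l @ v)"
  note c = a[THEN conjunct1] a[THEN conjunct2]
  show "Psi Q (u @ l @ v) = a_pow s * Psi Q (u @ v)"
    unfolding Psi_eq[OF c(2)] Psi_eq[OF curl_link_diagram[OF c]] n_components_curl[OF c] colour_sum_curl[OF Q c]
    by (simp add: sum_distrib_left mult_ac)
qed

lemma lab_id_site:
  assumes L: "link_diagram L" and F: "compatible id L F" and h: "L = u @ (g, i) # v" "g \<in> {Pos, Neg}"
  obtains a X c c' Y b where "length X = i" "lab id u [] a (X @ [c, c'] @ Y)" "lab id v (X @ [c', c] @ Y) b []"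
    "c = F (site_left L (length u))" "c' = F (site_right L (length u))" "words F L = a @ [X @ [c', c] @ Y] @ b"
proof -
  have "lab id L [] (words F L) []" using F unfolding lab_words[OF L] .
  then obtain a X c c' Y b where d: "words F L = a @ [X @ [c', c] @ Y] @ b" "length X = i"
    "lab id u [] a (X @ [c, c'] @ Y)" "lab id v (X @ [c', c] @ Y) b []"
    unfolding h(1) lab_crossing[OF h(2)] by blast
  have n: "length u < length L" "L ! length u = (g, i)" using h(1) by simp_all
  have "length a = length u" using lab_fits[OF d(3)] by simp
  then have w: "word F L (Suc (length u)) = X @ [c', c] @ Y"
    using words_nth[OF n(1), of F] unfolding d(1) by (simp add: nth_append)
  have wid: "width (take (Suc (length u)) L) = length X + 2 + length Y" using length_word[of F L "Suc (length u)"] unfolding w by simp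
  have through: "F (length u, p) = F (Suc (length u), q)" if "p < width (take (length u) L)" "ascends (g, i) p q" for p q
  proof -
    have "((length u, p), (Suc (length u), q)) \<in> through L" unfolding through_iff using n that by metis
    then show ?thesis using F unfolding compatible_def by blast
  qed
  note wt = width_take[OF L n]
  have "c' = F (Suc (length u), i)" "c = F (Suc (length u), Suc i)"
    using word_nth[of i "Suc (length u)" L F] word_nth[of "Suc i" "Suc (length u)" L F] wid d(2) unfolding w by simp_all
  moreover have "F (length u, i) = F (Suc (length u), Suc i)" "F (length u, Suc i) = F (Suc (length u), i)"
    using through[of i "Suc i"] through[of "Suc i" i] wt(1) h(2) by auto
  moreover have "site_left L (length u) = (length u, i)" "site_right L (length u) = (length u, Suc i)"
    using h(2) n(2) by (auto simp: site_left_def site_right_def)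
  ultimately show thesis using that[OF d(2-4)] d(1) by simp
qed

lemma mixed_crossing_site:
  assumes L: "link_diagram (u @ (g, i) # v)" and g: "g \<in> {Pos, Neg}" and m: "mixed_crossing (u @ (g, i) # v) (length u)"
  shows "mixed_site u i v"
proof -
  let ?L = "u @ (g, i) # v"
  let ?l = "site_left ?L (length u)" and ?r = "site_right ?L (length u)"
  \<comment> \<open>The indicator function of the component of the left strand separates the two
    strands.\<close>
  define F where "F x = (component_of ?L x = component_of ?L ?l)" for x
  have F: "compatible id ?L F" unfolding F_def by (rule compatible_comp[OF L])
  have n: "length u < length ?L" "?L ! length u = (g, i)" by simp_all
  note pts = sites(1,2)[OF L n]
  have "(?l, ?r) \<notin> connected_points ?L" using m unfolding mixed_crossing_def .
  then have "component_of ?L ?r \<noteq> component_of ?L ?l" using comp_eq_iff[OF pts] by metis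
  then have lr: "F ?l" "\<not> F ?r" unfolding F_def by simp_all
  obtain a X c c' Y b where d: "length X = i" "lab id u [] a (X @ [c, c'] @ Y)" "lab id v (X @ [c', c] @ Y) b []"
    "c = F ?l" "c' = F ?r"
    by (rule lab_id_site[OF L F HOL.refl g])
  have ne: "c \<noteq> c'" using lr d(4,5) by simp
  show ?thesis unfolding mixed_site_def
    by (intro exI conjI, rule d(1), rule ne, rule d(2), rule d(3))
qed

lemma mixed_crossingI:
  assumes L: "link_diagram L" and F: "compatible id L F" and "F (site_left L h) \<noteq> F (site_right L h)"
  shows "mixed_crossing L h"
  using assms unfolding mixed_crossing_def compatible_id_iff[OF L] by blast

lemma n_components_site:
  assumes m: "mixed_site u i v" and L: "link_diagram (u @ (g, i) # v)" and g: "g \<in> {Pos, Neg}"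
  shows "n_components (u @ (g, i) # v) = Suc (n_components (u @ v))"
    "n_components (u @ (Cap, i) # (Cup, i) # v) = n_components (u @ v)"
    "link_diagram (u @ v)" "link_diagram (u @ (Cap, i) # (Cup, i) # v)"
proof -
  show l: "link_diagram (u @ v)" "link_diagram (u @ (Cap, i) # (Cup, i) # v)" using L g by (auto simp: link_diagram_iff)
  note c = card_bool_labelings_site[OF m L g]
  have "2 ^ n_components (u @ (g, i) # v) = (2 :: nat) ^ Suc (n_components (u @ v))"
    using c(1) unfolding card_bool_labelings[OF L] card_bool_labelings[OF l(1)] power_Suc .
  then show "n_components (u @ (g, i) # v) = Suc (n_components (u @ v))" by (rule power_inject_exp[THEN iffD1, rotated]) simp
  show "n_components (u @ (Cap, i) # (Cup, i) # v) = n_components (u @ v)"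
    using c(2) unfolding card_bool_labelings[OF l(2)] card_bool_labelings[OF l(1)] by simp
qed

lemma cancel_factor:
  fixes a b c :: "'r :: comm_monoid_mult"
  assumes "x = a * b * r" "b * c = 1"
  shows "x * (c * t) = a * (r * t)"
proof -
  have "x * (c * t) = a * ((b * c) * (r * t))" unfolding assms(1) by (simp add: mult.assoc mult.left_commute[of c r t])
  then show ?thesis unfolding assms(2) by simp
qed

theorem Psi_skein:
  assumes Q: "skein_invariant Q" and m: "mixed_site u i v" and L: "link_diagram (u @ (Pos, i) # v)"
  shows "Psi Q (u @ (Pos, i) # v) + Psi Q (u @ (Neg, i) # v) =
    z_pow 1 * (Psi Q (u @ (Cap, i) # (Cup, i) # v) + Psi Q (u @ v))"
proof -
  let ?p = "u @ (Pos, i) # v" and ?n = "u @ (Neg, i) # v" and ?o = "u @ (Cap, i) # (Cup, i) # v"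
  have L': "link_diagram ?n" using L by (auto simp: link_diagram_iff)
  note n = n_components_site[OF m L] n_components_site(1)[OF m L']
  define N where "N = n_components (u @ v)"
  have N: "n_components ?p = Suc N" "n_components ?n = Suc N" "n_components ?o = N" using n unfolding N_def by simp_all
  have l: "link_diagram (u @ v)" "link_diagram ?o" using n by simp_all
  have "N \<ge> 1" unfolding N_def by (rule n_components_pos[OF l(1)])
  let ?z = "z_pow 1 * w_pow (-1)"
  have e1: "Psi Q ?p + Psi Q ?n = ?z ^ N * (\<Sum>k = 1..Suc N. Psi_coeff k * (colour_sum Q ?p k + colour_sum Q ?n k))"
    unfolding Psi_eq[OF L] Psi_eq[OF L'] N diff_Suc_1 distrib_left sum.distrib by (rule HOL.refl)
  have nn: "n_components ?o < Suc N" "n_components (u @ v) < Suc N" unfolding N(3) N_def[symmetric] by (rule lessI)+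
  note z = colour_sum_many[OF l(2) nn(1)] colour_sum_many[OF l(1) nn(2)]
  have e2: "(\<Sum>k = 1..Suc N. Psi_coeff k * (w_pow 1 * (colour_sum Q ?o k + colour_sum Q (u @ v) k))) =
      (\<Sum>k = 1..N. Psi_coeff k * (w_pow 1 * (colour_sum Q ?o k + colour_sum Q (u @ v) k)))"
    by (simp add: z)
  have e3: "(\<Sum>k = 1..N. Psi_coeff k * (w_pow 1 * (colour_sum Q ?o k + colour_sum Q (u @ v) k))) =
      w_pow 1 * ((\<Sum>k = 1..N. Psi_coeff k * colour_sum Q ?o k) + (\<Sum>k = 1..N. Psi_coeff k * colour_sum Q (u @ v) k))"
  proof -
    have "Psi_coeff k * (w_pow 1 * (x + y)) = w_pow 1 * (Psi_coeff k * x + Psi_coeff k * y)" for k x y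
      by (simp only: distrib_left mult.left_commute)
    then show ?thesis by (simp only: sum_distrib_left[symmetric] sum.distrib)
  qed
  \<comment> \<open>One of the N factors z/w turns w into z; the other N - 1 factors are the
    prefactor of the smoothings, which have N components.\<close>
  have e4: "?z ^ N * (w_pow 1 * ((\<Sum>k = 1..N. Psi_coeff k * colour_sum Q ?o k) + (\<Sum>k = 1..N. Psi_coeff k * colour_sum Q (u @ v) k))) =
      z_pow 1 * (?z ^ (N - 1) * (\<Sum>k = 1..N. Psi_coeff k * colour_sum Q ?o k) + ?z ^ (N - 1) * (\<Sum>k = 1..N. Psi_coeff k * colour_sum Q (u @ v) k))"
  proof -
    have "?z ^ N = ?z * ?z ^ (N - 1)" using \<open>N \<ge> 1\<close> by (cases N) simp_all
    moreover have "w_pow (-1) * w_pow 1 = 1" unfolding pow_mult by simp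
    ultimately have "?z ^ N * (w_pow 1 * t) = z_pow 1 * (?z ^ (N - 1) * t)" for t by (rule cancel_factor)
    then show ?thesis by (simp only: distrib_left)
  qed
  show ?thesis
    unfolding e1 colour_sum_skein[OF Q m L] e2 e3 e4 Psi_eq[OF l(1)] Psi_eq[OF l(2)] N N_def[symmetric] by (rule HOL.refl)
qed

section \<open>Unions of unlinked knots\<close>

text \<open>Removing \<open>c\<close> leaves a map that is onto \<open>T\<close> or misses only the
  value at \<open>c\<close>. This is the recursion of the Stirling numbers of the second
  kind.\<close>

lemma card_onto:
  assumes "finite C" "finite T"
  shows "card (onto C T) = fact (card T) * Stirling (card C) (card T)"
  using assms
proof (induction C arbitrary: T rule: finite_induct)
  case empty
  show ?case
  proof (cases "T = {}")
    case False
    then obtain k where "card T = Suc k" using empty by (metis card_eq_0_iff not0_implies_Suc)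
    then show ?thesis using False by (auto simp: onto_def)
  qed (simp add: onto_def)
next
  case (insert c C)
  let ?A = "\<lambda>t. {g \<in> C \<rightarrow>\<^sub>E T. insert t (g ` C) = T}"
  have fin: "finite (C \<rightarrow>\<^sub>E T)" using insert by (intro finite_PiE) auto
  have "onto (insert c C) T = (\<lambda>(t, g). g(c := t)) ` Sigma T ?A"
  proof (intro equalityI subsetI)
    fix f assume "f \<in> onto (insert c C) T"
    then have f: "f \<in> insert c C \<rightarrow>\<^sub>E T" "f ` insert c C = T" unfolding onto_def by auto
    obtain t g where tg: "t \<in> T" "g \<in> C \<rightarrow>\<^sub>E T" "f = g(c := t)" using f(1) unfolding PiE_insert_eq by auto
    have "f ` insert c C = insert t (g ` C)" unfolding tg(3) using insert(2) by auto
    then show "f \<in> (\<lambda>(t, g). g(c := t)) ` Sigma T ?A" using tg f(2) by force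
  next
    fix f assume "f \<in> (\<lambda>(t, g). g(c := t)) ` Sigma T ?A"
    then obtain t g where tg: "t \<in> T" "g \<in> C \<rightarrow>\<^sub>E T" "insert t (g ` C) = T" "f = g(c := t)" by auto
    have "f ` insert c C = insert t (g ` C)" unfolding tg(4) using insert(2) by auto
    moreover have "f \<in> insert c C \<rightarrow>\<^sub>E T" unfolding PiE_insert_eq using tg by force
    ultimately show "f \<in> onto (insert c C) T" unfolding onto_def using tg(3) by simp
  qed
  moreover have "inj_on (\<lambda>(t, g). g(c := t)) (Sigma T ?A)"
    by (rule inj_on_subset[OF inj_combinator[OF insert(2), of "\<lambda>_. T"]]) auto
  ultimately have "card (onto (insert c C) T) = (\<Sum>t \<in> T. card (?A t))"
    using insert(4) fin by (simp add: card_image)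
  also have "\<dots> = (\<Sum>t \<in> T. card (onto C T) + card (onto C (T - {t})))"
  proof (rule sum.cong[OF HOL.refl])
    fix t assume t: "t \<in> T"
    have "?A t = onto C T \<union> onto C (T - {t})"
    proof (intro equalityI subsetI)
      fix g assume g: "g \<in> ?A t"
      then have "g ` C = T \<or> g ` C = T - {t}" by auto
      moreover have "g \<in> C \<rightarrow>\<^sub>E S" if "g ` C = S" for S using g that unfolding PiE_iff by auto
      ultimately show "g \<in> onto C T \<union> onto C (T - {t})" unfolding onto_def by blast
    next
      fix g assume "g \<in> onto C T \<union> onto C (T - {t})"
      moreover have "C \<rightarrow>\<^sub>E (T - {t}) \<subseteq> C \<rightarrow>\<^sub>E T" by (rule PiE_mono) auto
      ultimately show "g \<in> ?A t" using t unfolding onto_def by auto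
    qed
    moreover have "onto C T \<inter> onto C (T - {t}) = {}" using t unfolding onto_def by auto
    moreover have "finite (onto C T)" "finite (onto C (T - {t}))"
      using finite_PiE[OF insert(1), of "\<lambda>_. T"] finite_PiE[OF insert(1), of "\<lambda>_. T - {t}"] insert(4)
      unfolding onto_def by simp_all
    ultimately show "card (?A t) = card (onto C T) + card (onto C (T - {t}))" by (simp add: card_Un_disjoint)
  qed
  also have "\<dots> = fact (card T) * Stirling (Suc (card C)) (card T)"
  proof (cases "card T")
    case 0
    then show ?thesis using insert(4) by simp
  next
    case (Suc k)
    then have "card (onto C (T - {t})) = fact k * Stirling (card C) k" if "t \<in> T" for t
      using insert.IH[of "T - {t}"] insert(4) that by simp
    then have "(\<Sum>t \<in> T. card (onto C T) + card (onto C (T - {t}))) = (\<Sum>t \<in> T. fact (Suc k) * Stirling (card C) (Suc k) + fact k * Stirling (card C) k)"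
      using insert.IH[OF insert(4)] Suc by (intro sum.cong) simp_all
    then show ?thesis using Suc by (simp add: algebra_simps)
  qed
  finally show ?case using insert(1,2) by simp
qed

text \<open>The expansion of a power in falling factorials, divided by the variable.\<close>

lemma sum_Ehat_Stirling: "(\<Sum>k = 1..Suc r. Ehat k * of_nat (Stirling (Suc r) k)) = Ehat_inv ^ r"
proof (induction r)
  case 0
  show ?case by (simp add: Ehat_def)
next
  case (Suc r)
  let ?S = "\<lambda>k. of_nat (Stirling (Suc r) k) :: laurent"
  \<comment> \<open>Equivalently, the variable times \<open>Ehat k\<close> is
    \<open>Ehat (Suc k)\<close> plus k times \<open>Ehat k\<close>, which matches the Stirling
    recursion.\<close>
  have E: "Ehat (Suc k) = Ehat k * (Ehat_inv - of_nat k)" if "1 \<le> k" for k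
    using that unfolding Ehat_def by (simp add: prod.atLeastLessThan_Suc)
  have "(\<Sum>k = 1..Suc (Suc r). Ehat k * of_nat (Stirling (Suc (Suc r)) k)) =
      (\<Sum>k = 0..Suc r. Ehat (Suc k) * of_nat (Stirling (Suc (Suc r)) (Suc k)))"
    by (simp only: One_nat_def sum.shift_bounds_cl_Suc_ivl)
  also have "\<dots> = (\<Sum>k = 0..Suc r. Ehat (Suc k) * (of_nat (Suc k) * ?S (Suc k))) + (\<Sum>k = 0..Suc r. Ehat (Suc k) * ?S k)"
    by (simp only: Stirling.simps of_nat_add of_nat_mult distrib_left sum.distrib)
  also have "(\<Sum>k = 0..Suc r. Ehat (Suc k) * (of_nat (Suc k) * ?S (Suc k))) = (\<Sum>k = 1..Suc (Suc r). Ehat k * (of_nat k * ?S k))"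
    by (simp only: One_nat_def sum.shift_bounds_cl_Suc_ivl)
  also have "\<dots> = (\<Sum>k = 1..Suc r. Ehat k * (of_nat k * ?S k))" by simp
  also have "(\<Sum>k = 0..Suc r. Ehat (Suc k) * ?S k) = (\<Sum>k = 1..Suc r. Ehat (Suc k) * ?S k)"
    by (subst sum.atLeast_Suc_atMost) simp_all
  also have "(\<Sum>k = 1..Suc r. Ehat k * (of_nat k * ?S k)) + (\<Sum>k = 1..Suc r. Ehat (Suc k) * ?S k) =
      (\<Sum>k = 1..Suc r. Ehat_inv * (Ehat k * ?S k))"
    unfolding sum.distrib[symmetric] by (intro sum.cong) (simp_all add: E algebra_simps)
  also have "\<dots> = Ehat_inv * Ehat_inv ^ r" unfolding sum_distrib_left[symmetric] Suc.IH ..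
  finally show ?case by simp
qed

lemma sublink_points:
  assumes L: "link_diagram L"
  shows "sublink L (points L) = L"
proof -
  have "restrict_slice L (points L) h = [L ! h]" if h: "h < length L" for h
  proof -
    obtain g i where g: "L ! h = (g, i)" by force
    have "{p. p < i \<and> (h, p) \<in> points L} = {..<i}" using width_take(1)[OF L h g] h by (auto simp: points_def)
    then show ?thesis unfolding restrict_slice_def g using sites(1,2)[OF L h g] by simp
  qed
  then have "map (restrict_slice L (points L)) [0..<length L] = map (\<lambda>h. [L ! h]) [0..<length L]" by simp
  then show ?thesis unfolding sublink_def by (simp only: concat_map_singleton map_nth)
qed

lemma sublink_empty: "sublink L {} = []"
  by (auto simp: sublink_def restrict_slice_def)

lemma knot_labeling:
  assumes K: "knot_diagram K" and cs: "lab id K [] cs []"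
  obtains c where "labels [] cs = {c}" "\<And>P. sub P K [] cs = (if P c then K else [])"
    "\<And>os. lab Not K [] os [] \<Longrightarrow> wr mixed_sign K [] (map2 zip cs os) = 0"
proof -
  have L: "link_diagram K" and n: "n_components K = 1" using K unfolding knot_diagram_def by simp_all
  obtain C where C: "components K = {C}" using n unfolding n_components_def by (rule card_1_singletonE)
  have "cs \<in> {ws. lab id K [] ws [] \<and> labels [] ws \<subseteq> UNIV}" using cs by simp
  then obtain G where G: "cs = comp_words K G"
    unfolding bij_betw_imp_surj_on[OF bij_betw_comp_words[OF L], symmetric] by (elim imageE)
  have component_of: "component_of K x = C" if "x \<in> points K" for x using that C unfolding components_eq by blast
  then have cs': "cs = words (\<lambda>x. G C) K" unfolding G comp_words_def words_eq_iff[OF L] by simp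
  show thesis
  proof (rule that[of "G C"])
    show "labels [] cs = {G C}" unfolding G labels_comp_words[OF L] C by simp
    show "sub P K [] cs = (if P (G C) then K else [])" for P
      unfolding cs' sub_words[OF L] using sublink_points[OF L] sublink_empty by simp
    fix os assume os: "lab Not K [] os []"
    obtain up where up: "os = words up K" using lab_is_words[OF L os] by blast
    have "wr1 mixed_sign (K ! h) (word (\<lambda>x. (G C, up x)) K h) = 0" if "h < length K" for h
      unfolding wr1_word[OF L that] by simp
    then show "wr mixed_sign K [] (map2 zip cs os) = 0"
      unfolding cs' up zip_words wr_eq_sum[OF length_words] by (intro sum.neutral) simp
  qed
qed

lemma lab_sub_empty:
  assumes "lab \<iota> l w ws w'" "\<And>x. x \<in> labels w ws \<Longrightarrow> \<not> P x"
  shows "sub P l w ws = []"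
  using assms
proof (induction l arbitrary: w ws)
  case (Cons s l)
  obtain g i where s: "s = (g, i)" by force
  obtain x xs where x: "ws = x # xs" "step \<iota> (g, i) w x" "lab \<iota> l x xs w'"
    using Cons.prems(1) unfolding s lab.simps by blast
  have "\<not> P ((if g = Cup then x else w) ! i)"
    by (rule Cons.prems(2)) (use step_fits[OF x(2)] in \<open>cases g; auto simp: x(1) labels_def\<close>)
  moreover have "sub P l x xs = []"
    by (rule Cons.IH[OF x(3)], rule Cons.prems(2)) (auto simp: x(1) labels_def)
  ultimately show ?case unfolding x(1) s by (simp add: sub1_def Let_def)
qed simp

lemma lab_link_append:
  assumes "lab \<iota> (K @ l) [] ws []" "wd 0 K = 0"
  obtains a b where "ws = a @ b" "lab \<iota> K [] a []" "lab \<iota> l [] b []"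
proof -
  obtain x a b where "ws = a @ b" "lab \<iota> K [] a x" "lab \<iota> l x b []" using assms(1) unfolding lab_append by blast
  moreover from this have "x = []" using lab_fits[of \<iota> K "[]" a x] assms(2) by simp
  ultimately show thesis using that by blast
qed

lemma wr_union_of_knots:
  assumes "\<And>K. K \<in> set Ks \<Longrightarrow> knot_diagram K" "lab id (concat Ks) [] cs []" "lab Not (concat Ks) [] os []"
  shows "wr mixed_sign (concat Ks) [] (map2 zip cs os) = 0"
  using assms
proof (induction Ks arbitrary: cs os)
  case (Cons K Ks)
  have K: "knot_diagram K" using Cons.prems(1) by simp
  then have w: "wd 0 K = 0" unfolding knot_diagram_def link_diagram_iff by simp
  obtain a b where ab: "cs = a @ b" "lab id K [] a []" "lab id (concat Ks) [] b []"
    by (rule lab_link_append[OF Cons.prems(2)[unfolded concat.simps] w])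
  obtain p q where pq: "os = p @ q" "lab Not K [] p []" "lab Not (concat Ks) [] q []"
    by (rule lab_link_append[OF Cons.prems(3)[unfolded concat.simps] w])
  have "wr mixed_sign K [] (map2 zip a p) = 0" by (rule knot_labeling[OF K ab(2)]) (use pq(2) in blast)
  moreover have "wr mixed_sign (concat Ks) [] (map2 zip b q) = 0"
    by (rule Cons.IH[OF _ ab(3) pq(3)]) (use Cons.prems(1) in simp)
  ultimately show ?case using wr_zip_site(2)[OF ab(2) pq(2), of "concat Ks" b q] unfolding ab(1) pq(1) by simp
qed simp

text \<open>A further knot either has a new colour and contributes its value alone, or it is added
  to a nonempty sublink, which yields a factor \<open>gamma\<close>. The exponent is therefore the
  number of knots minus the number of colours.\<close>

lemma prod_union_of_knots:
  assumes Q: "kauffman_polynomial Q" and "\<And>K. K \<in> set Ks \<Longrightarrow> knot_diagram K" "lab id (concat Ks) [] cs []"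
  shows "finite (labels [] cs) \<and> card (labels [] cs) \<le> length Ks \<and>
    (\<Prod>j \<in> labels [] cs. Q (sub ((=) j) (concat Ks) [] cs)) = gamma ^ (length Ks - card (labels [] cs)) * prod_list (map Q Ks)"
  using assms(2,3)
proof (induction Ks arbitrary: cs)
  case Nil
  then show ?case by (simp add: labels_def)
next
  case (Cons K Ks)
  have K: "knot_diagram K" using Cons.prems(1) by simp
  then have w: "wd 0 K = 0" "link_diagram K" unfolding knot_diagram_def link_diagram_iff by simp_all
  obtain a b where ab: "cs = a @ b" "lab id K [] a []" "lab id (concat Ks) [] b []"
    by (rule lab_link_append[OF Cons.prems(2)[unfolded concat.simps] w(1)])
  obtain c where c: "labels [] a = {c}" "\<And>P. sub P K [] a = (if P c then K else [])"
  proof (rule knot_labeling[OF K ab(2)])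
    fix c assume "labels [] a = {c}" "\<And>P. sub P K [] a = (if P c then K else [])"
    then show thesis by (rule that)
  qed
  define T where "T = labels [] b"
  define S where "S j = sub ((=) j) (concat Ks) [] b" for j
  define P where "P = prod_list (map Q Ks)"
  have IH: "finite T" "card T \<le> length Ks" "(\<Prod>j \<in> T. Q (S j)) = gamma ^ (length Ks - card T) * P"
    using Cons.IH[OF _ ab(3)] Cons.prems(1) unfolding T_def S_def P_def by simp_all
  have lab: "labels [] cs = insert c T" unfolding ab(1) labels_append[OF ab(2)] c(1) T_def by simp
  have sub: "sub ((=) j) (concat (K # Ks)) [] cs = (if j = c then K else []) @ S j" for j
    unfolding ab(1) S_def using sub_append[OF ab(2), of "(=) j" "concat Ks" b] by (simp add: c(2))
  show ?case
  proof (cases "c \<in> T")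
    case True
    have "link_diagram (S c)" unfolding S_def by (rule used_colour_link_diagram[OF ab(3)]) (use True in \<open>simp add: T_def\<close>)
    then have Qc: "Q (K @ S c) = gamma * Q K * Q (S c)" by (rule kauffman_polynomial_union[OF Q w(2)])
    have "(\<Prod>j \<in> T. Q (sub ((=) j) (concat (K # Ks)) [] cs)) = Q (K @ S c) * (\<Prod>j \<in> T - {c}. Q (S j))"
      unfolding sub prod.remove[OF IH(1) True] by simp
    also have "\<dots> = gamma * Q K * (\<Prod>j \<in> T. Q (S j))" unfolding Qc prod.remove[OF IH(1) True] by (simp only: mult.assoc)
    also have "\<dots> = gamma ^ (Suc (length Ks) - card T) * (Q K * P)" unfolding IH(3) using IH(2) by (simp add: Suc_diff_le mult_ac)
    finally show ?thesis unfolding lab using True IH by (simp add: insert_absorb P_def)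
  next
    case False
    have "S c = []" unfolding S_def by (rule lab_sub_empty[OF ab(3)]) (use False in \<open>auto simp: T_def\<close>)
    then have "(\<Prod>j \<in> insert c T. Q (sub ((=) j) (concat (K # Ks)) [] cs)) = Q K * (\<Prod>j \<in> T. Q (sub ((=) j) (concat (K # Ks)) [] cs))"
      unfolding sub using False IH(1) by simp
    also have "(\<Prod>j \<in> T. Q (sub ((=) j) (concat (K # Ks)) [] cs)) = (\<Prod>j \<in> T. Q (S j))"
      unfolding sub using False by (intro prod.cong) auto
    finally show ?thesis unfolding lab IH(3) using False IH(1,2) by (simp add: P_def mult_ac)
  qed
qed

lemma const_1 [simp]: "const 1 = 1"
  by (simp add: const_def)

text \<open>All colourings have the same weight, so it remains to count them; they are the
  surjections from the components onto the colours.\<close>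

lemma colour_sum_union_of_knots:
  assumes Q: "kauffman_polynomial Q" and Ks: "\<And>K. K \<in> set Ks \<Longrightarrow> knot_diagram K"
    and L: "link_diagram (concat Ks)" and n: "n_components (concat Ks) = length Ks"
  shows "colour_sum Q (concat Ks) k = of_nat (fact k) * (of_nat (Stirling (length Ks) k) * (gamma ^ (length Ks - k) * prod_list (map Q Ks)))"
proof -
  have "colour_weight Q (concat Ks) k cs = gamma ^ (length Ks - k) * prod_list (map Q Ks)" if "cs \<in> colourings (concat Ks) k" for cs
  proof -
    have cs: "lab id (concat Ks) [] cs []" "labels [] cs = {..<k}" using that unfolding colourings_def by simp_all
    obtain os where os: "lab Not (concat Ks) [] os []" using orientation_labeling_exists[OF L] by blast
    have "wr mixed_sign (concat Ks) [] (map2 zip cs os) = 0" by (rule wr_union_of_knots[OF Ks cs(1) os])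
    then have "colour_phase (concat Ks) cs = 1" unfolding colour_phase_eq[OF cs(1) os] by simp
    then show ?thesis unfolding colour_weight_def using prod_union_of_knots[OF Q Ks cs(1)] unfolding cs(2) by simp
  qed
  then have "colour_sum Q (concat Ks) k = of_nat (card (colourings (concat Ks) k)) * (gamma ^ (length Ks - k) * prod_list (map Q Ks))"
    unfolding colour_sum_def by simp
  also have "card (colourings (concat Ks) k) = card (onto (components (concat Ks)) {..<k})"
    by (rule bij_betw_same_card[OF bij_betw_colourings[OF L], symmetric])
  also have "\<dots> = fact k * Stirling (length Ks) k"
    using card_onto[of "components (concat Ks)" "{..<k}"] n unfolding n_components_def by simp
  finally show ?thesis by (simp add: mult.assoc)
qed

lemma pow_power: "E_pow m ^ k = E_pow (int k * m)"
  by (induction k) (simp_all add: pow_mult algebra_simps)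

text \<open>The power of \<open>gamma\<close> in the coefficient and the one from the union of
  sublinks combine to a power independent of \<open>k\<close>. What remains is a sum of Stirling
  numbers times \<open>Ehat k\<close>, which is a power of \<open>Ehat_inv\<close>; this computation
  accounts for the coefficients in the state sum.\<close>

lemma Psi_union_of_knots:
  assumes Q: "kauffman_polynomial Q" and Ks: "\<And>K. K \<in> set Ks \<Longrightarrow> knot_diagram K" "Ks \<noteq> []"
    and n: "n_components (concat Ks) = length Ks"
  shows "Psi Q (concat Ks) = E_pow (1 - int (length Ks)) * Q (concat Ks)"
proof -
  have links: "link_diagram K" if "K \<in> set Ks" for K using Ks(1)[OF that] unfolding knot_diagram_def by simp
  have L: "link_diagram (concat Ks)" by (rule link_diagram_concat[OF Ks(2) links])
  obtain r where r: "length Ks = Suc r" using Ks(2) by (cases Ks) auto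
  define P where "P = prod_list (map Q Ks)"
  have summand: "Psi_coeff k * colour_sum Q (concat Ks) k = gamma ^ r * P * (Ehat k * of_nat (Stirling (Suc r) k))"
    if k: "k \<in> {1..Suc r}" for k
  proof -
    have f: "const (1 / of_nat (fact k)) * of_nat (fact k) = 1"
      unfolding const_of_nat[symmetric] const_mult by simp
    have g: "gamma ^ r = gamma ^ (k - 1) * gamma ^ (Suc r - k)" using k unfolding power_add[symmetric] by simp
    have "Psi_coeff k * colour_sum Q (concat Ks) k =
      gamma ^ (k - 1) * Ehat k * const (1 / of_nat (fact k)) *
        (of_nat (fact k) * (of_nat (Stirling (Suc r) k) * (gamma ^ (Suc r - k) * P)))"
      unfolding Psi_coeff_def P_def r[symmetric] by (simp only: colour_sum_union_of_knots[OF Q Ks(1) L n])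
    also have "\<dots> = gamma ^ (k - 1) * Ehat k * ((const (1 / of_nat (fact k)) * of_nat (fact k)) * (of_nat (Stirling (Suc r) k) * (gamma ^ (Suc r - k) * P)))"
      by (simp only: mult.assoc)
    also have "\<dots> = gamma ^ r * P * (Ehat k * of_nat (Stirling (Suc r) k))" unfolding f g by (simp only: mult_ac mult_1)
    finally show ?thesis .
  qed
  \<comment> \<open>Each factor z/w of the prefactor meets one factor \<open>Ehat_inv\<close>, and
    only the inverse of E is left.\<close>
  have z: "z_pow 1 * w_pow (-1) * Ehat_inv = E_pow (-1)"
  proof -
    have "z_pow 1 * w_pow (-1) * Ehat_inv = (z_pow 1 * z_pow (-1)) * (w_pow (-1) * w_pow 1) * E_pow (-1)"
      unfolding Ehat_inv_def by (simp only: mult_ac)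
    then show ?thesis unfolding pow_mult by simp
  qed
  have "Psi Q (concat Ks) = (z_pow 1 * w_pow (-1)) ^ r * (\<Sum>k = 1..Suc r. gamma ^ r * P * (Ehat k * of_nat (Stirling (Suc r) k)))"
    unfolding Psi_eq[OF L] n r diff_Suc_1 by (intro arg_cong2[of _ _ _ _ "(*)"] sum.cong HOL.refl summand)
  also have "\<dots> = (z_pow 1 * w_pow (-1)) ^ r * (gamma ^ r * P * Ehat_inv ^ r)"
    unfolding sum_distrib_left[symmetric] sum_Ehat_Stirling ..
  also have "\<dots> = (z_pow 1 * w_pow (-1) * Ehat_inv) ^ r * (gamma ^ r * P)" unfolding power_mult_distrib by (simp only: mult_ac)
  also have "\<dots> = E_pow (1 - int (length Ks)) * Q (concat Ks)"
  proof -
    have "Q (concat Ks) = gamma ^ r * P"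
      using kauffman_polynomial_concat[OF Q Ks(2) links] unfolding P_def r by simp
    then show ?thesis unfolding z pow_power r by simp
  qed
  finally show ?thesis .
qed

text \<open>Forgetting the sum of the signs of the curls turns \<open>tiso\<close> into the relation
  generated by all three Reidemeister moves.\<close>

lemma same_link_iff:
  assumes "link_diagram L"
  shows "same_link L L' \<longleftrightarrow> (\<exists>k. tiso 0 k L L')"
proof -
  let ?M = "\<lambda>l l'. planar_move l l' \<or> reidemeister2 l l' \<or> reidemeister3 l l' \<or> (\<exists>s. curl s l) \<and> l' = []"
  have eq: "same_link = equivclp (local_move ?M)" by (simp add: same_link_def)
  have step: "\<exists>k. tiso 0 k y z" if yz: "local_move ?M y z" for y z
  proof -
    obtain u v l l' where d: "?M l l'" "y = u @ l @ v" "z = u @ l' @ v" "link_diagram y" "link_diagram z"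
      using yz unfolding local_move_def by blast
    have f: "fits 0 (u @ l @ v)" "fits 0 (u @ l' @ v)" using d(2-5) unfolding link_diagram_iff by simp_all
    show ?thesis
    proof (cases "isotopy_move l l'")
      case True
      then show ?thesis unfolding d(2,3) using tiso.move[OF True f] by blast
    next
      case False
      then obtain s where "curl s l" "l' = []" using d(1) unfolding isotopy_move_def by blast
      then show ?thesis unfolding d(2,3) using tiso.curl[OF _ f(1)] by auto
    qed
  qed
  have move: "local_move ?M L L'" if "local_move isotopy_move L L'" for L L'
    using that unfolding local_move_def isotopy_move_def by blast
  have "same_link l l'" if "tiso m k l l'" "m = 0" "link_diagram l" for m k l l'
    using that
  proof (induction rule: tiso.induct)
    case (refl m l)
    then show ?case unfolding eq by simp
  next
    case (move l l' m u v)
    then have "link_diagram (u @ l' @ v)" using tiso_link_diagram[OF tiso.move[of l l' 0 u v]] by simp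
    then have "local_move ?M (u @ l @ v) (u @ l' @ v)"
      using move unfolding local_move_def isotopy_move_def by blast
    then show ?case unfolding eq by (rule r_into_equivclp)
  next
    case (curl s l m u v)
    then have "link_diagram (u @ v)" using curl_link_diagram by blast
    then have "local_move ?M (u @ l @ v) (u @ v)"
      using curl unfolding local_move_def by (metis append_Nil)
    then show ?case unfolding eq by (rule r_into_equivclp)
  next
    case (sym m k l l')
    then have "same_link l l'" using tiso_link_diagram by blast
    then show ?case unfolding eq by (rule equivclp_sym)
  next
    case (trans m j l l' k l'')
    then have "same_link l l'" "same_link l' l''" using tiso_link_diagram by blast+
    then show ?case unfolding eq by (rule equivclp_trans)
  qed
  moreover have "\<exists>k. tiso 0 k L L'" if "same_link L L'"
    using that unfolding eq
  proof (induction rule: equivclp_induct)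
    case base
    show ?case using tiso.refl assms unfolding link_diagram_iff by blast
  next
    case (step y z)
    obtain k where k: "tiso 0 k L y" using step(3) by blast
    consider "local_move ?M y z" | "local_move ?M z y" using step(2) by blast
    then obtain j where "tiso 0 j y z" using \<open>\<And>y z. local_move ?M y z \<Longrightarrow> \<exists>k. tiso 0 k y z\<close> tiso.sym by (metis (no_types, lifting))
    then show ?case using tiso.trans[OF k] by blast
  qed
  ultimately show ?thesis using assms by blast
qed

lemma union_of_unlinked_knots_tiso:
  assumes "union_of_unlinked_knots r L"
  obtains Ks k where "length Ks = r" "Ks \<noteq> []" "\<forall>K \<in> set Ks. knot_diagram K" "tiso 0 k L (concat Ks)"
    "link_diagram L" "n_components (concat Ks) = length Ks"
proof -
  have r: "r \<ge> 1" "link_diagram L" "n_components L = r" using assms unfolding union_of_unlinked_knots_def by simp_all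
  obtain Ks where Ks: "length Ks = r" "\<forall>K \<in> set Ks. knot_diagram K" "same_link L (concat Ks)"
    using assms unfolding union_of_unlinked_knots_def by blast
  obtain k where k: "tiso 0 k L (concat Ks)" using Ks(3) unfolding same_link_iff[OF r(2)] by blast
  show thesis
    by (rule that[OF Ks(1) _ _ k r(2)]) (use Ks r n_components_tiso[OF k r(2)] in auto)
qed

text \<open>\<open>Psi Q\<close> and \<open>Q\<close> are both framed invariants, so the passage to
  a disjoint union of knots multiplies both sides by the same power of a.\<close>

theorem Psi_unlinked:
  assumes Q: "kauffman_polynomial Q" and L: "union_of_unlinked_knots r L"
  shows "Psi Q L = E_pow (1 - int r) * Q L"
proof -
  have fQ: "framed_invariant Q" using Q unfolding kauffman_polynomial_iff skein_invariant_def by blast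
  obtain Ks k where d: "length Ks = r" "Ks \<noteq> []" "\<forall>K \<in> set Ks. knot_diagram K" "tiso 0 k L (concat Ks)"
    "link_diagram L" "n_components (concat Ks) = length Ks"
    by (rule union_of_unlinked_knots_tiso[OF L])
  have "Psi Q (concat Ks) = E_pow (1 - int (length Ks)) * Q (concat Ks)"
    by (rule Psi_union_of_knots[OF Q _ d(2,6)]) (use d(3) in blast)
  then have u: "Psi Q (concat Ks) = E_pow (1 - int r) * Q (concat Ks)" unfolding d(1) .
  have "Psi Q L = a_pow k * Psi Q (concat Ks)"
    by (rule framed_invariant_tiso[OF framed_invariant_Psi[OF fQ] d(4,5)])
  also have "\<dots> = E_pow (1 - int r) * (a_pow k * Q (concat Ks))"
    unfolding u by (rule mult.left_commute)
  also have "a_pow k * Q (concat Ks) = Q L"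
    by (rule framed_invariant_tiso[OF fQ d(4,5), symmetric])
  finally show ?thesis .
qed

section \<open>Layered diagrams\<close>

text \<open>Lower labels are placed in front at all crossings of different labels.\<close>

definition layer1 :: "piece \<times> nat \<Rightarrow> 'c :: linorder list \<Rightarrow> piece \<times> nat" where
  "layer1 = (\<lambda>(g, i) w. (if g \<in> {Pos, Neg} \<and> w ! i \<noteq> w ! Suc i then (if w ! i < w ! Suc i then Neg else Pos) else g, i))"

fun layer :: "diagram \<Rightarrow> 'c :: linorder list \<Rightarrow> 'c list list \<Rightarrow> diagram" where
  "layer (s # l) w (x # ws) = layer1 s w # layer l x ws"
| "layer _ w _ = []"

text \<open>Labelings do not see which strand of a crossing is on top, so a tangle and its layered
  version have the same labelings.\<close>

lemma step_layer1: "step \<iota> (layer1 s w) v v' \<longleftrightarrow> step \<iota> s v v'"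
proof -
  obtain g i where s: "s = (g, i)" by force
  obtain h where h: "layer1 s w = (h, i)" "h = g \<or> g \<in> {Pos, Neg} \<and> h \<in> {Pos, Neg}"
    unfolding s layer1_def by auto
  show ?thesis
  proof (cases "h = g")
    case False
    then have "g \<in> {Pos, Neg}" "h \<in> {Pos, Neg}" using h(2) by auto
    then show ?thesis unfolding h(1) unfolding s by (simp only: step_crossing)
  qed (use h s in simp)
qed

lemma lab_layer:
  "lab \<kappa> l w ws w' \<Longrightarrow> lab \<iota> (layer l w ws) v vs v' \<longleftrightarrow> lab \<iota> l v vs v'"
proof (induction l arbitrary: w ws v vs)
  case (Cons s l)
  obtain g i where s: "s = (g, i)" by force
  obtain x xs where x: "ws = x # xs" "lab \<kappa> l x xs w'" using Cons.prems unfolding s lab.simps by blast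
  show ?case unfolding x(1) layer.simps lab.simps step_layer1 Cons.IH[OF x(2)] ..
qed simp

lemma layer_append:
  "lab \<kappa> u w ws x \<Longrightarrow> layer (u @ v) w (ws @ ws') = layer u w ws @ layer v x ws'"
proof (induction u arbitrary: w ws)
  case (Cons s l)
  obtain g i where s: "s = (g, i)" by force
  obtain y xs where x: "ws = y # xs" "lab \<kappa> l y xs x" using Cons.prems unfolding s lab.simps by blast
  show ?case unfolding x(1) append_Cons layer.simps Cons.IH[OF x(2)] ..
qed simp

lemma length_layer: "lab \<kappa> l w ws w' \<Longrightarrow> length (layer l w ws) = length l"
proof (induction l arbitrary: w ws)
  case (Cons s l)
  obtain g i where s: "s = (g, i)" by force
  obtain y xs where x: "ws = y # xs" "lab \<kappa> l y xs w'" using Cons.prems unfolding s lab.simps by blast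
  show ?case unfolding x(1) layer.simps length_Cons Cons.IH[OF x(2)] ..
qed simp

text \<open>This is the analogue of \<open>concat\<close> for tangles with open upper ends: each
  tangle is drawn above the preceding one and to the right of its ends.\<close>

fun stack :: "diagram list \<Rightarrow> diagram" where
  "stack [] = []"
| "stack (K # Ks) = K @ shift (wd 0 K) (stack Ks)"

lemma fits_wd_stack:
  "\<forall>K \<in> set Ks. fits 0 K \<Longrightarrow> fits 0 (stack Ks) \<and> wd 0 (stack Ks) = sum_list (map (wd 0) Ks)"
proof (induction Ks)
  case (Cons K Ks)
  then have "fits 0 (stack Ks)" "wd 0 (stack Ks) = sum_list (map (wd 0) Ks)" by simp_all
  then show ?case using Cons.prems fits_wd_shift_aux[of 0 "stack Ks" "wd 0 K"] by simp
qed simp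

lemma stack_append:
  "\<forall>K \<in> set As. fits 0 K \<Longrightarrow> stack (As @ Bs) = stack As @ shift (wd 0 (stack As)) (stack Bs)"
proof (induction As)
  case (Cons K As)
  then have "fits 0 (stack As)" using fits_wd_stack[of As] by simp
  then show ?case using Cons fits_wd_shift_aux[of 0 "stack As" "wd 0 K"] by (simp add: add.commute)
qed simp

lemma stack_closed: "\<forall>K \<in> set Ks. wd 0 K = 0 \<Longrightarrow> stack Ks = concat Ks"
  by (induction Ks) auto

text \<open>A slice on the ends of \<open>K\<close> commutes with the tangles to the right of
  \<open>K\<close>, so it may be counted as part of \<open>K\<close>.\<close>

lemma stack_snoc:
  assumes A: "\<forall>K \<in> set As. fits 0 K" and K: "fits 0 K" and B: "\<forall>K \<in> set Bs. fits 0 K"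
    and i: "i + n_in g \<le> wd 0 K"
  shows "stack (As @ K # Bs) @ [(g, wd 0 (stack As) + i)] \<simeq>[0] stack (As @ (K @ [(g, i)]) # Bs)"
proof -
  let ?c = "wd 0 (stack As)" and ?k = "wd 0 K"
  have fA: "fits 0 (stack As)" using fits_wd_stack[OF A] by simp
  have fB: "fits 0 (stack Bs)" using fits_wd_stack[OF B] by simp
  have k': "wd ?k [(g, i)] = wd 0 (K @ [(g, i)])" by simp
  have "[(g, i)] @ shift (wd ?k [(g, i)]) (stack Bs) \<simeq>[?k + 0] shift ?k (stack Bs) @ [(g, i)]"
    by (rule riso_exchange) (use i fB in simp_all)
  then have "shift ?k (stack Bs) @ [(g, i)] \<simeq>[?k] [(g, i)] @ shift (wd 0 (K @ [(g, i)])) (stack Bs)"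
    unfolding k' add_0_right by (rule riso_sym)
  then have "K @ shift ?k (stack Bs) @ [(g, i)] \<simeq>[0] K @ [(g, i)] @ shift (wd 0 (K @ [(g, i)])) (stack Bs)"
    by (rule tiso_left) (use K in simp_all)
  then have "shift ?c (K @ shift ?k (stack Bs) @ [(g, i)]) \<simeq>[0 + ?c] shift ?c (K @ [(g, i)] @ shift (wd 0 (K @ [(g, i)])) (stack Bs))"
    by (rule tiso_shift)
  then have "stack As @ shift ?c (K @ shift ?k (stack Bs) @ [(g, i)]) \<simeq>[0]
      stack As @ shift ?c (K @ [(g, i)] @ shift (wd 0 (K @ [(g, i)])) (stack Bs))"
    by (intro tiso_left[OF _ fA]) simp_all
  then show ?thesis unfolding stack_append[OF A] by (simp add: add.commute)
qed

text \<open>In the stack of the sublinks of all colours, the sublink of colour \<open>a\<close>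
  begins to the right of the strands with smaller colours. The right-hand side is this offset in the
  form in which \<open>sorted_pos\<close> contains it.\<close>

lemma length_filter_less_sum: "(\<Sum>j \<leftarrow> [0..<a]. length (filter ((=) j) w)) = length (filter (\<lambda>c. c < a) w)"
proof (induction w)
  case (Cons x w)
  have "(\<Sum>j \<leftarrow> [0..<a]. length (filter ((=) j) (x # w))) =
      (\<Sum>j \<leftarrow> [0..<a]. of_bool (j = x)) + (\<Sum>j \<leftarrow> [0..<a]. length (filter ((=) j) w))"
    unfolding sum_list_addf[symmetric] by (intro arg_cong[of _ _ sum_list] map_cong) auto
  moreover have "(\<Sum>j \<leftarrow> [0..<a]. of_bool (j = x)) = (of_bool (x < a) :: nat)"
    unfolding interv_sum_list_conv_sum_set_nat by (simp add: of_bool_def)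
  ultimately show ?case using Cons by simp
qed simp

lemma lab_sub_fits:
  assumes "lab id u [] ws w"
  shows "fits 0 (sub P u [] ws)" "wd 0 (sub P u [] ws) = length (filter P w)"
  using lab_sub[OF assms, of P] by simp_all

lemma sigma_extremum_same:
  assumes "X = [] \<and> g = Cup \<and> Y = [a, a] \<or> X = [a, a] \<and> g = Cap \<and> Y = []"
  shows "sigma (A @ X @ B) @ [(g, length A)] \<simeq>[length (A @ X @ B)] (g, sorted_pos a A B) # sigma (A @ Y @ B)"
proof -
  have "adjacent_labels a a (A @ B)" by (simp add: adjacent_labels_def)
  moreover have "(X, g, Y) = ([], Cup, [a, a]) \<or> (X, g, Y) = ([a, a], Cap, [])" using assms by auto
  ultimately obtain k where "a = a \<longrightarrow> k = 0" "tiso (length (A @ X @ B)) k (sigma (A @ X @ B) @ [(g, length A)])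
      ((g, sorted_pos (min a a) A B) # sigma (A @ Y @ B))" using sigma_extremum by blast
  then show ?thesis by (simp only: HOL.simp_thms min.idem)
qed

lemma layer_cases:
  fixes y :: "'c :: linorder list"
  assumes "step id (g, i) y x"
  obtains (distinct) A a b B where "y = A @ [a, b] @ B" "x = A @ [b, a] @ B" "length A = i" "a \<noteq> b"
      "layer1 (g, i) y = (if a < b then Neg else Pos, i)" "\<forall>j. sub1 ((=) j) (g, i) y x = []"
  | (same) A X Y B a where "y = A @ X @ B" "x = A @ Y @ B" "length A = i" "length X = n_in g" "set X \<subseteq> {a}" "a \<in> set y \<union> set x"
      "layer1 (g, i) y = (g, i)" "\<forall>j. sub1 ((=) j) (g, i) y x = (if j = a then [(g, length (filter ((=) a) A))] else [])"
      "sigma (A @ X @ B) @ [(g, length A)] \<simeq>[length (A @ X @ B)] (g, sorted_pos a A B) # sigma (A @ Y @ B)"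
proof (cases "g \<in> {Pos, Neg}")
  case True
  obtain A a b B where d: "y = A @ [a, b] @ B" "x = A @ [b, a] @ B" "length A = i"
    using assms unfolding step_crossing[OF True] by blast
  have at: "y ! i = a" "y ! Suc i = b" "take i y = A" using d(1,3) by (auto simp: nth_append)
  have "g \<noteq> Cup" using True by auto
  then have sub: "sub1 ((=) j) (g, i) y x = (if j = a \<and> j = b then [(g, length (filter ((=) j) A))] else [])" for j
    unfolding sub1_def Let_def prod.case by (auto simp: at)
  show thesis
  proof (cases "a = b")
    case False
    have "layer1 (g, i) y = (if a < b then Neg else Pos, i)" unfolding layer1_def prod.case at using True False by simp
    moreover have "\<forall>j. sub1 ((=) j) (g, i) y x = []" unfolding sub using False by simp
    ultimately show thesis by (rule distinct[OF d False])
  next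
    case ab: True
    note y = d(1,2)[folded ab]
    have "length [a, a] = n_in g" using True by auto
    moreover have "set [a, a] \<subseteq> {a}" "a \<in> set y \<union> set x" unfolding y by simp_all
    moreover have "layer1 (g, i) y = (g, i)" unfolding layer1_def prod.case at ab by simp
    moreover have "\<forall>j. sub1 ((=) j) (g, i) y x = (if j = a then [(g, length (filter ((=) a) A))] else [])"
      unfolding sub ab by simp
    ultimately show thesis by (rule same[OF y d(3) _ _ _ _ _ sigma_crossing_same[OF True]])
  qed
next
  case False
  show thesis
  proof (cases g)
    case Cup
    have "i \<le> length y" using step_fits[OF assms] by simp
    then have "y = take i y @ drop i y" "length (take i y) = i" by simp_all
    then obtain A B where y: "y = A @ B" "length A = i" by blast
    obtain a where x: "x = A @ [a, a] @ B" using assms unfolding Cup y(1) step_Cup[OF y(2)] by auto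
    have at: "x ! i = a" "x ! Suc i = a" "take i y = A" using x y by (auto simp: nth_append)
    have "y = A @ [] @ B" using y(1) by simp
    moreover have "length [] = n_in g" "set [] \<subseteq> {a}" "a \<in> set y \<union> set x" unfolding Cup x by simp_all
    moreover have "layer1 (g, i) y = (g, i)" unfolding layer1_def Cup by simp
    moreover have "\<forall>j. sub1 ((=) j) (g, i) y x = (if j = a then [(g, length (filter ((=) a) A))] else [])"
      unfolding sub1_def Let_def prod.case Cup by (simp add: at)
    ultimately show thesis by (rule same[OF _ x y(2) _ _ _ _ _ sigma_extremum_same])
      (use Cup in simp)
  next
    case Cap
    obtain A a B where y: "y = A @ [a, a] @ B" "x = A @ B" "length A = i" using assms unfolding Cap step_Cap by auto
    have at: "y ! i = a" "y ! Suc i = a" "take i y = A" using y by (auto simp: nth_append)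
    have "x = A @ [] @ B" using y(2) by simp
    moreover have "length [a, a] = n_in g" "set [a, a] \<subseteq> {a}" "a \<in> set y \<union> set x" unfolding Cap y(1) by simp_all
    moreover have "layer1 (g, i) y = (g, i)" unfolding layer1_def Cap by simp
    moreover have "\<forall>j. sub1 ((=) j) (g, i) y x = (if j = a then [(g, length (filter ((=) a) A))] else [])"
      unfolding sub1_def Let_def prod.case Cap by (simp add: at)
    ultimately show thesis by (rule same[OF y(1) _ y(3) _ _ _ _ _ sigma_extremum_same])
      (use Cap in simp)
  qed (use False in auto)
qed

text \<open>The part of the diagram read so far is the stack of its monochromatic sublinks followed
  by the sorting braid. A mixed crossing has the layered type and is absorbed by
  \<open>sigma\<close>; any other slice slides through \<open>sigma\<close> and is appended to the
  sublink of its colour. The labels at an extremum are equal, so no curls arise.\<close>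

lemma layer_riso_stack:
  fixes ws :: "nat list list"
  assumes "lab id u [] ws w" "labels [] ws \<subseteq> {..<n}"
  shows "layer u [] ws \<simeq>[0] stack (map (\<lambda>j. sub ((=) j) u [] ws) [0..<n]) @ sigma w"
  using assms
proof (induction u arbitrary: ws w rule: rev_induct)
  case Nil
  have "stack (map (\<lambda>j. []) [0..<n]) = []" by (subst stack_closed) auto
  then show ?case using Nil by (simp add: tiso.refl)
next
  case (snoc s u)
  obtain g i where s: "s = (g, i)" by force
  obtain y v x where ws: "ws = v @ [x]" "lab id u [] v y" "step id (g, i) y x" "w = x"
    using snoc.prems(1) unfolding s lab_append by auto
  define K where "K j = sub ((=) j) u [] v" for j
  have K: "fits 0 (K j)" "wd 0 (K j) = length (filter ((=) j) y)" for j unfolding K_def by (rule lab_sub_fits[OF ws(2)])+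
  have lab: "labels [] v \<subseteq> {..<n}" "set y \<union> set x \<subseteq> {..<n}"
    using snoc.prems(2) labels_append[OF ws(2), of "[x]"] unfolding ws(1) by (auto simp: labels_def)
  have sub: "sub ((=) j) (u @ [s]) [] ws = K j @ sub1 ((=) j) (g, i) y x" for j
    unfolding ws(1) sub_append[OF ws(2)] s K_def by simp
  have stack: "fits 0 (stack (map K [0..<n])) \<and> wd 0 (stack (map K [0..<n])) = length y"
  proof -
    have "wd 0 (stack (map K [0..<n])) = (\<Sum>j \<leftarrow> [0..<n]. length (filter ((=) j) y))"
      using fits_wd_stack[of "map K [0..<n]"] K by (simp add: o_def)
    also have "\<dots> = length (filter (\<lambda>c. c < n) y)" by (rule length_filter_less_sum)
    also have "filter (\<lambda>c. c < n) y = y" using lab(2) by (intro filter_True) auto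
    finally show ?thesis using fits_wd_stack[of "map K [0..<n]"] K by simp
  qed
  have IH: "layer u [] v \<simeq>[0] stack (map K [0..<n]) @ sigma y"
    using snoc.IH[OF ws(2) lab(1)] unfolding K_def .
  have fl: "n_in g + i \<le> length y" "fits 0 (layer u [] v)" "wd 0 (layer u [] v) = length y"
    using step_fits[OF ws(3)] lab_fits[of id "layer u [] v" "[]" v y] lab_layer[OF ws(2), of id "[]" v y] ws(2) by auto
  obtain h where h: "layer1 s y = (h, i)" "n_in h = n_in g" unfolding s layer1_def by auto
  have "layer (u @ [s]) [] ws = layer u [] v @ [layer1 s y]"
    unfolding ws(1) layer_append[OF ws(2)] by simp
  also have "\<dots> \<simeq>[0] (stack (map K [0..<n]) @ sigma y) @ [layer1 s y]"
    by (rule tiso_right[OF IH]) (use fl h in simp)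
  finally have 1: "layer (u @ [s]) [] ws \<simeq>[0] stack (map K [0..<n]) @ (sigma y @ [layer1 s y])" by simp
  show ?case
    using ws(3)
  proof (cases rule: layer_cases)
    case (distinct A a b B)
    have "sigma y @ [layer1 s y] \<simeq>[length y] sigma x"
      unfolding s distinct(5) unfolding distinct(1,2) distinct(3)[symmetric] by (rule sigma_crossing_distinct[OF distinct(4)])
    then have "stack (map K [0..<n]) @ (sigma y @ [layer1 s y]) \<simeq>[0] stack (map K [0..<n]) @ sigma x"
      by (rule tiso_left) (use stack in simp_all)
    then have "layer (u @ [s]) [] ws \<simeq>[0] stack (map K [0..<n]) @ sigma x" by (rule riso_trans(1)[OF 1])
    moreover have "(\<lambda>j. sub ((=) j) (u @ [s]) [] ws) = K" using distinct(6) by (intro ext) (simp only: sub append_Nil2)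
    ultimately show ?thesis unfolding ws(4) by simp
  next
    case (same A X Y B a)
    define c where "c = length (filter ((=) a) A)"
    have a: "a < n" using same(6) lab(2) by auto
    let ?K' = "\<lambda>j. K j @ (if j = a then [(g, c)] else [])"
    have split: "map F [0..<n] = map F [0..<a] @ F a # map F [Suc a..<n]" for F :: "nat \<Rightarrow> diagram"
    proof -
      have "[0..<n] = [0..<a] @ [a..<n]" using upt_add_eq_append[of 0 a "n - a"] a by (simp only: le0 le_add_diff_inverse less_imp_le)
      then show ?thesis unfolding upt_conv_Cons[OF a] by (simp only: map_append list.map)
    qed
    have "wd 0 (stack (map K [0..<a])) = length (filter (\<lambda>z. z < a) y)"
      using fits_wd_stack[of "map K [0..<a]"] K by (simp add: o_def length_filter_less_sum)
    also have "filter (\<lambda>z. z < a) y = filter (\<lambda>z. z < a) (A @ B)"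
    proof -
      have "filter (\<lambda>z. z < a) X = []" using same(5) by (intro filter_False) auto
      then show ?thesis unfolding same(1) by simp
    qed
    \<comment> \<open>The position found by sorting is that of the slice within its sublink, shifted
      by the strands of smaller colours.\<close>
    finally have pos: "wd 0 (stack (map K [0..<a])) + c = sorted_pos a A B"
      unfolding sorted_pos_def c_def eq_commute[of a] by (rule arg_cong[where f = "\<lambda>z. z + _"])
    have "filter ((=) a) X = X" using same(5) by (intro filter_True) auto
    then have cw: "c + n_in g \<le> wd 0 (K a)" unfolding K(2) same(1) c_def using same(4) by simp
    have K': "map ?K' [0..<n] = map K [0..<a] @ (K a @ [(g, c)]) # map K [Suc a..<n]"
    proof -
      have "map ?K' [0..<a] = map K [0..<a]" by (rule map_cong) auto
      moreover have "map ?K' [Suc a..<n] = map K [Suc a..<n]" by (rule map_cong) auto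
      ultimately show ?thesis unfolding split[of ?K'] by (simp only: HOL.refl if_True)
    qed
    have "stack (map K [0..<n]) @ [(g, sorted_pos a A B)] \<simeq>[0] stack (map ?K' [0..<n])"
      unfolding K' split[of K] pos[symmetric] by (rule stack_snoc) (use K(1) cw in simp_all)
    then have 3: "(stack (map K [0..<n]) @ [(g, sorted_pos a A B)]) @ sigma x \<simeq>[0] stack (map ?K' [0..<n]) @ sigma x"
    proof (rule tiso_right)
      show "fits (wd 0 (stack (map K [0..<n]) @ [(g, sorted_pos a A B)])) (sigma x)"
        using stack step_fits[OF ws(3)] by simp
    qed
    have 2: "stack (map K [0..<n]) @ (sigma y @ [layer1 s y]) \<simeq>[0] stack (map K [0..<n]) @ ((g, sorted_pos a A B) # sigma x)"
    proof -
      have "layer1 s y = (g, length A)" unfolding s same(7) using same(3) by simp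
      then show ?thesis using tiso_left[OF same(9), of 0 "stack (map K [0..<n])"] stack unfolding same(1,2) by simp
    qed
    have "(\<lambda>j. sub ((=) j) (u @ [s]) [] ws) = ?K'" unfolding sub c_def using same(8) by (intro ext) simp
    moreover have "layer (u @ [s]) [] ws \<simeq>[0] stack (map ?K' [0..<n]) @ sigma x"
      by (rule riso_trans(1)[OF 1 riso_trans(1)[OF 2]]) (use 3 in simp)
    ultimately show ?thesis unfolding ws(4) by simp
  qed
qed

lemma n_components_append:
  assumes A: "link_diagram A" and B: "link_diagram B"
  shows "n_components (A @ B) = n_components A + n_components B"
proof -
  have w: "wd 0 A = 0" using A unfolding link_diagram_iff by simp
  have "bool_labelings (A @ B) = (\<lambda>(a, b). a @ b) ` (bool_labelings A \<times> bool_labelings B)"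
  proof (intro equalityI subsetI)
    fix ws assume "ws \<in> bool_labelings (A @ B)"
    then have "lab id (A @ B) [] ws []" unfolding bool_labelings_def by simp
    then obtain a b where "ws = a @ b" "lab id A [] a []" "lab id B [] b []" by (rule lab_link_append[OF _ w])
    then show "ws \<in> (\<lambda>(a, b). a @ b) ` (bool_labelings A \<times> bool_labelings B)"
      by (intro image_eqI[of _ _ "(a, b)"]) (simp_all add: bool_labelings_def)
  next
    fix ws assume "ws \<in> (\<lambda>(a, b). a @ b) ` (bool_labelings A \<times> bool_labelings B)"
    then obtain a b where "ws = a @ b" "lab id A [] a []" "lab id B [] b []" unfolding bool_labelings_def by auto
    then show "ws \<in> bool_labelings (A @ B)" using lab_appendI[of id A "[]" a "[]" B b "[]"] unfolding bool_labelings_def by simp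
  qed
  moreover have "inj_on (\<lambda>(a, b). a @ b) (bool_labelings A \<times> bool_labelings B)"
  proof (rule inj_onI)
    fix s t assume st: "s \<in> bool_labelings A \<times> bool_labelings B" "t \<in> bool_labelings A \<times> bool_labelings B"
      "(case s of (a, b) \<Rightarrow> a @ b) = (case t of (a, b) \<Rightarrow> a @ b)"
    have "length (fst s) = length (fst t)"
      using st(1,2) lab_fits[of id A "[]" "fst s" "[]"] lab_fits[of id A "[]" "fst t" "[]"] unfolding bool_labelings_def by auto
    then show "s = t" using st(3) by (simp add: case_prod_beta prod_eq_iff)
  qed
  ultimately have "card (bool_labelings (A @ B)) = card (bool_labelings A) * card (bool_labelings B)"
    by (simp add: card_image card_cartesian_product)
  then have "(2 :: nat) ^ n_components (A @ B) = 2 ^ (n_components A + n_components B)"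
    unfolding card_bool_labelings[OF A] card_bool_labelings[OF B] card_bool_labelings[OF link_diagram_append[OF A B]] power_add .
  then show ?thesis by (rule power_inject_exp[THEN iffD1, rotated]) simp
qed

lemma n_components_concat:
  assumes "Ks \<noteq> []" "\<forall>K \<in> set Ks. link_diagram K"
  shows "n_components (concat Ks) = sum_list (map n_components Ks)"
  using assms
proof (induction Ks rule: list_nonempty_induct)
  case (cons K Ks)
  have "link_diagram (concat Ks)" by (rule link_diagram_concat) (use cons in auto)
  then show ?case using cons n_components_append[of K "concat Ks"] by simp
qed simp

lemma sum_list_eq_length:
  fixes f :: "'b \<Rightarrow> nat"
  assumes "\<forall>x \<in> set xs. 1 \<le> f x" "sum_list (map f xs) = length xs"
  shows "\<forall>x \<in> set xs. f x = 1"
proof -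
  have le: "length xs \<le> sum_list (map f xs)" if "\<forall>x \<in> set xs. 1 \<le> f x" for xs
    using that by (induction xs) auto
  show ?thesis
    using assms
  proof (induction xs)
    case (Cons x xs)
    have "length xs \<le> sum_list (map f xs)" by (rule le) (use Cons.prems(1) in simp)
    moreover have "1 \<le> f x" "f x + sum_list (map f xs) = Suc (length xs)" using Cons.prems by simp_all
    ultimately have fx: "f x = 1" "sum_list (map f xs) = length xs" by linarith+
    have "\<forall>y \<in> set xs. f y = 1" by (rule Cons.IH[OF _ fx(2)]) (use Cons.prems(1) in simp)
    then show ?case using fx(1) by simp
  qed simp
qed

lemma lab_layer_append:
  assumes "lab id u [] a w"
  shows "lab \<iota> (layer u [] a @ v) [] vs [] \<longleftrightarrow> lab \<iota> (u @ v) [] vs []"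
  unfolding lab_append lab_layer[OF assms] ..

lemma layer_link:
  assumes u: "lab id u [] a w" and L: "link_diagram (u @ v)" and v: "lab id v w b []"
  shows "link_diagram (layer u [] a @ v)" "n_components (layer u [] a @ v) = n_components (u @ v)"
proof -
  have "lab id (layer u [] a @ v) [] (a @ b) []" unfolding lab_layer_append[OF u] by (rule lab_appendI[OF u v])
  then have "fits 0 (layer u [] a @ v) \<and> wd 0 (layer u [] a @ v) = 0" using lab_fits by fastforce
  moreover have "length (layer u [] a @ v) = length (u @ v)" using length_layer[OF u] by simp
  ultimately show L': "link_diagram (layer u [] a @ v)" using L unfolding link_diagram_iff by auto
  have "bool_labelings (layer u [] a @ v) = bool_labelings (u @ v)"
    unfolding bool_labelings_def lab_layer_append[OF u] ..
  then show "n_components (layer u [] a @ v) = n_components (u @ v)"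
    using card_bool_labelings[OF L'] card_bool_labelings[OF L] by simp
qed

text \<open>With one colour per component, there are as many sublinks as components in all of them
  together. None of the sublinks is empty, so each is a knot.\<close>

lemma layer_union_of_unlinked_knots:
  fixes ws :: "nat list list"
  assumes L: "link_diagram L" and ws: "lab id L [] ws []" "labels [] ws = {..<n_components L}"
  shows "union_of_unlinked_knots (n_components L) (layer L [] ws)"
proof -
  let ?n = "n_components L" and ?L = "layer L [] ws"
  define Ks where "Ks = map (\<lambda>j. sub ((=) j) L [] ws) [0..<?n]"
  have n: "?n \<ge> 1" by (rule n_components_pos[OF L])
  have l: "link_diagram ?L" "n_components ?L = ?n" using layer_link[OF ws(1), of "[]" "[]"] L by simp_all
  have links: "\<forall>K \<in> set Ks. link_diagram K"
    unfolding Ks_def using used_colour_link_diagram[OF ws(1)] ws(2) by auto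
  have ne: "Ks \<noteq> []" unfolding Ks_def using n by simp
  have "stack Ks = concat Ks" by (rule stack_closed) (use links in \<open>auto simp: link_diagram_iff\<close>)
  then have t: "tiso 0 0 ?L (concat Ks)" using layer_riso_stack[OF ws(1), of ?n] ws(2) unfolding Ks_def[symmetric] by simp
  have "sum_list (map n_components Ks) = length Ks"
    using n_components_tiso[OF t l(1)] l(2) n_components_concat[OF ne links] unfolding Ks_def by simp
  then have "\<forall>K \<in> set Ks. n_components K = 1" by (rule sum_list_eq_length[rotated]) (use links n_components_pos in blast)
  then have "\<forall>K \<in> set Ks. knot_diagram K" using links unfolding knot_diagram_def by blast
  moreover have "same_link ?L (concat Ks)" unfolding same_link_iff[OF l(1)] using t by blast
  moreover have "length Ks = ?n" unfolding Ks_def by simp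
  ultimately show ?thesis unfolding union_of_unlinked_knots_def using n l by blast
qed

section \<open>Uniqueness\<close>

lemma is_K_skein:
  assumes F: "is_K Q F" and L: "link_diagram (u @ (Pos, i) # v)" and m: "mixed_crossing (u @ (Pos, i) # v) (length u)"
  shows "F (u @ (Pos, i) # v) + F (u @ (Neg, i) # v) = z_pow 1 * (F (u @ (Cap, i) # (Cup, i) # v) + F (u @ v))"
proof -
  have "conway_quadruple (length u) (u @ (Pos, i) # v) (u @ (Neg, i) # v) (u @ (Cap, i) # (Cup, i) # v) (u @ v)"
    unfolding conway_quadruple_def using L by (intro conjI exI[of _ u] exI[of _ v]) auto
  then show ?thesis using F m unfolding is_K_def by blast
qed

lemma labels_mixed_crossing:
  assumes L: "link_diagram (u @ (g, i) # v)" and g: "g \<in> {Pos, Neg}"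
    and lab: "lab id u [] a y" "lab id ((g, i) # v) y b []" and ne: "y ! i \<noteq> y ! Suc i"
  shows "mixed_crossing (u @ (g, i) # v) (length u)"
proof -
  let ?L = "u @ (g, i) # v"
  have ws: "lab id ?L [] (a @ b) []" by (rule lab_appendI[OF lab])
  obtain F where F: "a @ b = words F ?L" by (rule lab_is_words[OF L ws])
  then have cF: "compatible id ?L F" using ws unfolding lab_words[OF L, symmetric] by simp
  obtain a' X c c' Y b' where d: "length X = i" "lab id u [] a' (X @ [c, c'] @ Y)"
    "c = F (site_left ?L (length u))" "c' = F (site_right ?L (length u))" "words F ?L = a' @ [X @ [c', c] @ Y] @ b'"
    by (rule lab_id_site[OF L cF HOL.refl g])
  have "length a = length a'" using lab_fits[OF lab(1)] lab_fits[OF d(2)] by simp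
  then have "a = a'" using F d(5) by simp
  then have "y = X @ [c, c'] @ Y" using lab_unique[OF lab(1), of "X @ [c, c'] @ Y"] d(2) by simp
  then have "c \<noteq> c'" using ne d(1) by simp
  then show ?thesis using mixed_crossingI[OF L cF, of "length u"] d(3,4) by simp
qed

text \<open>Different labels at the crossing show that it is mixed. Both smoothings have one
  component less, so \<open>F\<close> and \<open>G\<close> agree on them, and the skein relation
  transfers the agreement from one type of the crossing to the other.\<close>

lemma is_K_switch:
  assumes F: "is_K Q F" "is_K Q G"
    and IH: "\<And>L. link_diagram L \<Longrightarrow> n_components L < n_components (u @ (g, i) # v) \<Longrightarrow> F L = G L"
    and L: "link_diagram (u @ (g, i) # v)" and gh: "g \<in> {Pos, Neg}" "h \<in> {Pos, Neg}"
    and lab: "lab id u [] a y" "lab id ((g, i) # v) y b []" and ne: "y ! i \<noteq> y ! Suc i"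
    and eq: "F (u @ (h, i) # v) = G (u @ (h, i) # v)"
  shows "F (u @ (g, i) # v) = G (u @ (g, i) # v)"
proof -
  let ?p = "u @ (Pos, i) # v" and ?n = "u @ (Neg, i) # v"
  have P: "Pos \<in> {Pos, Neg}" "Neg \<in> {Pos, Neg}" by simp_all
  have L': "link_diagram ?p" "link_diagram ?n" using L gh(1) by (auto simp: link_diagram_iff)
  have "lab id ((Pos, i) # v) y b []"
    using lab(2) unfolding lab.simps step_crossing[OF gh(1)] step_crossing[OF P(1)] .
  then have m: "mixed_crossing ?p (length u)" by (rule labels_mixed_crossing[OF L'(1) P(1) lab(1) _ ne])
  note site = mixed_crossing_site[OF L'(1) P(1) m]
  note n = n_components_site[OF site L'(1) P(1)]
  have N: "n_components (u @ (g, i) # v) = Suc (n_components (u @ v))" by (rule n_components_site(1)[OF site L gh(1)])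
  have "F (u @ (Cap, i) # (Cup, i) # v) = G (u @ (Cap, i) # (Cup, i) # v)" "F (u @ v) = G (u @ v)"
    by (rule IH[OF n(4)], unfold N n(2), rule lessI, rule IH[OF n(3)], unfold N, rule lessI)
  then have "F ?p + F ?n = G ?p + G ?n"
    unfolding is_K_skein[OF F(1) L'(1) m] is_K_skein[OF F(2) L'(1) m] by simp
  then show ?thesis using gh eq by auto
qed

text \<open>The layered crossings are switched back one at a time, from the top of \<open>u\<close>
  downwards. The labeling survives every switch; it shows at each stage that the crossing is mixed
  and that the number of components is unchanged.\<close>

lemma is_K_layer:
  fixes a :: "nat list list"
  assumes F: "is_K Q F" "is_K Q G"
    and IH: "\<And>L. link_diagram L \<Longrightarrow> n_components L < n_components (u @ v) \<Longrightarrow> F L = G L"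
    and L: "link_diagram (u @ v)" and lab: "lab id u [] a w" "lab id v w b []"
    and eq: "F (layer u [] a @ v) = G (layer u [] a @ v)"
  shows "F (u @ v) = G (u @ v)"
  using IH L lab eq
proof (induction u arbitrary: v a w b rule: rev_induct)
  case (snoc s u)
  obtain g i where s: "s = (g, i)" by force
  obtain y a' x where ws: "a = a' @ [x]" "lab id u [] a' y" "step id s y x" "w = x"
    using snoc.prems(3) unfolding s lab_append by auto
  have v: "lab id (s # v) y (x # b) []" using ws(3) snoc.prems(4)[unfolded ws(4)] unfolding lab.simps by blast
  have L: "link_diagram (u @ s # v)" using snoc.prems(2) by simp
  have eq: "F (layer u [] a' @ layer1 s y # v) = G (layer u [] a' @ layer1 s y # v)"
    using snoc.prems(5) unfolding ws(1) layer_append[OF ws(2)] by simp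
  note l = layer_link[OF ws(2) L v]
  have "F (layer u [] a' @ s # v) = G (layer u [] a' @ s # v)"
  proof (cases "layer1 s y = s")
    case True
    then show ?thesis using eq by simp
  next
    case False
    then obtain h where h: "layer1 s y = (h, i)" "g \<in> {Pos, Neg}" "h \<in> {Pos, Neg}" "y ! i \<noteq> y ! Suc i"
      unfolding s layer1_def by (auto split: if_splits)
    show ?thesis
      unfolding s
    proof (rule is_K_switch[OF F])
      show "F L = G L" if "link_diagram L" "n_components L < n_components (layer u [] a' @ (g, i) # v)" for L
        using snoc.prems(1)[OF that(1)] that(2) l(2) unfolding s by simp
      show "link_diagram (layer u [] a' @ (g, i) # v)" using l(1) unfolding s .
      show "lab id (layer u [] a') [] a' y" unfolding lab_layer[OF ws(2)] by (rule ws(2))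
      show "lab id ((g, i) # v) y (x # b) []" using v unfolding s .
      show "F (layer u [] a' @ (h, i) # v) = G (layer u [] a' @ (h, i) # v)" using eq unfolding h(1) .
    qed (use h in simp_all)
  qed
  then have "F (u @ s # v) = G (u @ s # v)"
    by (intro snoc.IH[OF _ L ws(2) v]) (use snoc.prems(1) in simp_all)
  then show ?case by simp
qed simp

theorem is_K_unique:
  assumes F: "is_K Q F" "is_K Q G" and L: "link_diagram L"
  shows "F L = G L"
  using L
proof (induction "n_components L" arbitrary: L rule: less_induct)
  case less
  \<comment> \<open>Any numbering of the components serves as the order of the layers.\<close>
  obtain e where e: "bij_betw e (components L) {0..<n_components L}"
    using ex_bij_betw_finite_nat[OF finite_components] unfolding n_components_def by blast
  define ws where "ws = comp_words L e"
  have ws: "lab id L [] ws []" "labels [] ws = {..<n_components L}"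
    unfolding ws_def labels_comp_words[OF less.prems] using lab_comp_words[OF less.prems] bij_betw_imp_surj_on[OF e]
    by (simp_all add: atLeast0LessThan)
  have "F (layer L [] ws) = G (layer L [] ws)"
    using F layer_union_of_unlinked_knots[OF less.prems ws] unfolding is_K_def by metis
  then show ?case
    using is_K_layer[OF F, of L "[]" ws "[]" "[]"] less ws by simp
qed

text \<open>The characterization of K[Q] concerns link diagrams, so it passes from
  \<open>Psi Q\<close> to every function that agrees with it there.\<close>

lemma is_K_PsiI:
  assumes Q: "kauffman_polynomial Q" and F: "\<forall>L. link_diagram L \<longrightarrow> F L = Psi Q L"
  shows "is_K Q F"
  unfolding is_K_def
proof (intro conjI allI impI)
  have sQ: "skein_invariant Q" using Q unfolding kauffman_polynomial_iff by blast
  then have fQ: "framed_invariant Q" unfolding skein_invariant_def by blast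
  show "regular_isotopy_invariant F"
    unfolding regular_isotopy_invariant_iff
  proof (intro allI impI)
    fix L L' assume "local_move isotopy_move L L'"
    moreover from this have "link_diagram L" "link_diagram L'" unfolding local_move_def by blast+
    ultimately show "F L = F L'" using framed_invariant_Psi[OF fQ] F unfolding framed_invariant_def by simp
  qed
  fix h Lp Lm L0 Linf assume a: "conway_quadruple h Lp Lm L0 Linf \<and> mixed_crossing Lp h"
  then obtain u i v where d: "link_diagram Lp" "length u = h" "Lp = u @ (Pos, i) # v" "Lm = u @ (Neg, i) # v"
    "L0 = u @ (Cap, i) # (Cup, i) # v" "Linf = u @ v"
    unfolding conway_quadruple_def by auto
  have P: "Pos \<in> {Pos, Neg}" by simp
  have L: "link_diagram (u @ (Pos, i) # v)" using d by simp
  have m: "mixed_site u i v" by (rule mixed_crossing_site[OF L P]) (use a d in simp)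
  have "link_diagram (u @ (Neg, i) # v)" using L by (auto simp: link_diagram_iff)
  then show "F Lp + F Lm = z_pow 1 * (F L0 + F Linf)"
    using Psi_skein[OF sQ m L] n_components_site(3,4)[OF m L P] L F unfolding d(3-6) by simp
next
  fix r L assume "union_of_unlinked_knots r L"
  moreover from this have "link_diagram L" unfolding union_of_unlinked_knots_def by blast
  ultimately show "F L = E_pow (1 - int r) * Q L" using Psi_unlinked[OF Q] F by simp
qed

theorem theorem7:
  fixes Q :: "diagram \<Rightarrow> laurent"
  assumes "kauffman_polynomial Q"
  shows "(\<forall>L. link_diagram L \<longrightarrow>
            (\<exists>up. orientation L up) \<and>
            (\<forall>up up'. orientation L up \<and> orientation L up' \<longrightarrow>
               Psi_oriented Q L up = Psi_oriented Q L up')) \<and>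
         regular_isotopy_invariant (Psi Q) \<and>
         (\<forall>F. is_K Q F \<longleftrightarrow> (\<forall>L. link_diagram L \<longrightarrow> F L = Psi Q L))"
proof (intro conjI allI impI)
  fix L assume L: "link_diagram L"
  show "\<exists>up. orientation L up" by (rule orientation_exists[OF L])
  fix up up' assume "orientation L up \<and> orientation L up'"
  \<comment> \<open>The colour sums to which \<open>Psi_oriented_eq\<close> reduces both values do
    not involve the given orientation.\<close>
  then show "Psi_oriented Q L up = Psi_oriented Q L up'"
    using Psi_oriented_eq[OF L, of up Q] Psi_oriented_eq[OF L, of up' Q] by simp
next
  have K: "is_K Q (Psi Q)" by (rule is_K_PsiI[OF assms]) simp
  then show "regular_isotopy_invariant (Psi Q)" unfolding is_K_def by blast
  fix F show "is_K Q F \<longleftrightarrow> (\<forall>L. link_diagram L \<longrightarrow> F L = Psi Q L)"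
    using is_K_unique[OF _ K] is_K_PsiI[OF assms] by blast
qed

end
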